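(* Let $M$ be a rank set with $\#M=k$ and all intervals contained in $[n]$, and let $\kappa M=\{[a,b+1]:[a,b]\in M\}$, so $\Sigma_{\kappa M}\subseteq\operatorname{Gr}(k,n+1)$. Let $\iota:\operatorname{Gr}(k,n)\hookrightarrow\operatorname{Gr}(k,n+1)$ be the inclusion induced by an inclusion $\mathbb{C}^n\hookrightarrow\mathbb{C}^{n+1}$. Then $\iota^*[\Sigma_{\kappa M}]=[\Sigma_M]$.
   Context: A rank set is a finite set of intervals $[a_i,b_i]$ of positive integers with $a_i\le b_i$, all $a_i$ distinct and all $b_i$ distinct; for a set $S$, $S(M)$ is the set of intervals of $M$ contained in $S$. For a rank set $N$ with $\#N=k$ and intervals in $[m]$, the rank variety $\Sigma_N\subseteq\operatorname{Gr}(k,m)$ is the closure of $\{V:\dim(V\cap\langle S\cap T\rangle)=\#(S\cap T)(N)\ \forall S,T\in N\}$, where $\langle X\rangle$ is the span of the standard basis vectors $e_i$, $i\in X$, of $\mathbb{C}^m$. $[\cdot]$ denotes cohomology class and $\iota^*$ the pullback on cohomology. *)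

theory Defs
  imports
    "HOL-Analysis.Analysis"
    "HOL-Homology.Homology"
    "HOL-Library.Function_Algebras"
begin

section \<open>Coordinate spaces\<close>

definition cscale :: "complex \<Rightarrow> (nat \<Rightarrow> complex) \<Rightarrow> (nat \<Rightarrow> complex)" where
  "cscale c v = (\<lambda>i. c * v i)"

global_interpretation cvec: vector_space cscale
  defines cspan = cvec.span and csubspace = cvec.subspace and cdim = cvec.dim
    and cindependent = cvec.independent
  by unfold_locales (auto simp: cscale_def algebra_simps fun_eq_iff)

text \<open>\<open>cspace m\<close> is \<open>\<complex>\<^sup>m\<close>, with coordinates indexed by \<open>1, \<dots>, m\<close>.\<close>

definition cspace :: "nat \<Rightarrow> (nat \<Rightarrow> complex) set" where
  "cspace m = {v. \<forall>i. i \<notin> {1..m} \<longrightarrow> v i = 0}"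

definition unit_vec :: "nat \<Rightarrow> (nat \<Rightarrow> complex)" where
  "unit_vec i = (\<lambda>j. if j = i then 1 else 0)"

definition coord_span :: "nat set \<Rightarrow> (nat \<Rightarrow> complex) set" where
  "coord_span S = cspan (unit_vec ` S)"

definition linear_inclusion :: "nat \<Rightarrow> nat \<Rightarrow> ((nat \<Rightarrow> complex) \<Rightarrow> (nat \<Rightarrow> complex)) \<Rightarrow> bool" where
  "linear_inclusion n m j \<longleftrightarrow>
     j \<in> cspace n \<rightarrow> cspace m \<and> inj_on j (cspace n) \<and>
     (\<forall>v\<in>cspace n. \<forall>w\<in>cspace n. j (v + w) = j v + j w) \<and>
     (\<forall>c. \<forall>v\<in>cspace n. j (cscale c v) = cscale c (j v))"

section \<open>Grassmannians\<close>

definition Gr :: "nat \<Rightarrow> nat \<Rightarrow> (nat \<Rightarrow> complex) set set" where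
  "Gr k m = {V. csubspace V \<and> V \<subseteq> cspace m \<and> cdim V = k}"

text \<open>A \<open>k \<times> m\<close> matrix of rank \<open>k\<close> is the function \<open>A\<close> whose rows are
  \<open>A 0, \<dots>, A (k - 1)\<close>; all entries outside the matrix are \<open>0\<close>.\<close>

definition row_space :: "nat \<Rightarrow> (nat \<Rightarrow> nat \<Rightarrow> complex) \<Rightarrow> (nat \<Rightarrow> complex) set" where
  "row_space k A = cspan (A ` {..<k})"

definition frames :: "nat \<Rightarrow> nat \<Rightarrow> (nat \<Rightarrow> nat \<Rightarrow> complex) set" where
  "frames k m = {A. (\<forall>i<k. A i \<in> cspace m) \<and> (\<forall>i\<ge>k. A i = 0) \<and> cdim (row_space k A) = k}"

text \<open>The quotient topology along \<open>row_space k : frames k m \<rightarrow> Gr k m\<close>.\<close>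

definition Gr_top :: "nat \<Rightarrow> nat \<Rightarrow> (nat \<Rightarrow> complex) set topology" where
  "Gr_top k m = topology (\<lambda>U. U \<subseteq> Gr k m \<and>
     openin (top_of_set (frames k m)) {A \<in> frames k m. row_space k A \<in> U})"

lemma openin_Gr_top:
  "openin (Gr_top k m) U \<longleftrightarrow> U \<subseteq> Gr k m \<and>
     openin (top_of_set (frames k m)) {A \<in> frames k m. row_space k A \<in> U}"
proof -
  let ?P = "\<lambda>U. {A \<in> frames k m. row_space k A \<in> U}"
  have "istopology (\<lambda>U. U \<subseteq> Gr k m \<and> openin (top_of_set (frames k m)) (?P U))"
    unfolding istopology_def
  proof (intro conjI allI impI)
    fix S T
    assume "S \<subseteq> Gr k m \<and> openin (top_of_set (frames k m)) (?P S)"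
      and "T \<subseteq> Gr k m \<and> openin (top_of_set (frames k m)) (?P T)"
    moreover have "?P (S \<inter> T) = ?P S \<inter> ?P T" by auto
    ultimately show "S \<inter> T \<subseteq> Gr k m" "openin (top_of_set (frames k m)) (?P (S \<inter> T))"
      by (auto intro: openin_Int)
  next
    fix \<K>
    assume *: "\<forall>K\<in>\<K>. K \<subseteq> Gr k m \<and> openin (top_of_set (frames k m)) (?P K)"
    then show "\<Union>\<K> \<subseteq> Gr k m" by blast
    have "?P (\<Union>\<K>) = \<Union>(?P ` \<K>)" by auto
    moreover have "openin (top_of_set (frames k m)) (\<Union>(?P ` \<K>))"
      by (rule openin_Union) (use * in blast)
    ultimately show "openin (top_of_set (frames k m)) (?P (\<Union>\<K>))"
      by (simp only:)
  qed
  then show ?thesis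
    by (simp add: Gr_top_def topology_inverse')
qed

lemma cspace_subspace: "csubspace (cspace m)"
  by (auto simp: cvec.subspace_def cspace_def cscale_def)

lemma row_space_in_Gr:
  assumes "A \<in> frames k m" shows "row_space k A \<in> Gr k m"
proof -
  have "A ` {..<k} \<subseteq> cspace m"
    using assms unfolding frames_def by blast
  then have "row_space k A \<subseteq> cspace m"
    unfolding row_space_def using cspace_subspace by (rule cvec.span_minimal)
  moreover have "csubspace (row_space k A)"
    unfolding row_space_def by (rule cvec.subspace_span)
  ultimately show ?thesis
    using assms unfolding frames_def Gr_def by blast
qed

lemma topspace_Gr_top: "topspace (Gr_top k m) = Gr k m"
proof -
  have "{A \<in> frames k m. row_space k A \<in> Gr k m} = frames k m"
    using row_space_in_Gr by auto
  then have "openin (Gr_top k m) (Gr k m)"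
    by (simp add: openin_Gr_top)
  then show ?thesis
    by (meson openin_Gr_top openin_subset openin_topspace subset_antisym)
qed

section \<open>Rank varieties\<close>

text \<open>The interval \<open>[a, b]\<close> is represented by the pair \<open>(a, b)\<close>.\<close>

definition rank_set :: "(nat \<times> nat) set \<Rightarrow> bool" where
  "rank_set M \<longleftrightarrow> finite M \<and> (\<forall>(a, b)\<in>M. 1 \<le> a \<and> a \<le> b) \<and> inj_on fst M \<and> inj_on snd M"

definition intervals_in :: "nat set \<Rightarrow> (nat \<times> nat) set \<Rightarrow> (nat \<times> nat) set" where
  "intervals_in S M = {(a, b) \<in> M. {a..b} \<subseteq> S}"

definition kappa :: "(nat \<times> nat) set \<Rightarrow> (nat \<times> nat) set" where
  "kappa M = {(a, b + 1) |a b. (a, b) \<in> M}"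

text \<open>The locus below is constructible, so its closure in the classical topology
  coincides with its Zariski closure.\<close>

definition rank_variety :: "nat \<Rightarrow> (nat \<times> nat) set \<Rightarrow> (nat \<Rightarrow> complex) set set" where
  "rank_variety m N = Gr_top (card N) m closure_of
     {V \<in> Gr (card N) m. \<forall>(a, b)\<in>N. \<forall>(c, d)\<in>N.
        cdim (V \<inter> coord_span ({a..b} \<inter> {c..d})) = card (intervals_in ({a..b} \<inter> {c..d}) N)}"

section \<open>Singular cohomology with integer coefficients\<close>

type_synonym 'a cochain = "'a chain \<Rightarrow> int"

definition cochain_group :: "nat \<Rightarrow> 'a topology \<Rightarrow> 'a cochain monoid" where
  "cochain_group p X =
    \<lparr>carrier = hom (chain_group p X) integer_group \<inter> extensional (carrier (chain_group p X)),
     monoid.mult = (\<lambda>\<phi> \<psi>. \<lambda>c\<in>carrier (chain_group p X). \<phi> c + \<psi> c),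
     one = (\<lambda>c\<in>carrier (chain_group p X). 0)\<rparr>"

definition coboundary_map :: "nat \<Rightarrow> 'a topology \<Rightarrow> 'a cochain \<Rightarrow> 'a cochain" where
  "coboundary_map p X \<phi> = (\<lambda>c\<in>carrier (chain_group (Suc p) X). \<phi> (chain_boundary (Suc p) c))"

definition cocycles :: "nat \<Rightarrow> 'a topology \<Rightarrow> 'a cochain set" where
  "cocycles p X =
     {\<phi> \<in> carrier (cochain_group p X). coboundary_map p X \<phi> = \<one>\<^bsub>cochain_group (Suc p) X\<^esub>}"

definition coboundaries :: "nat \<Rightarrow> 'a topology \<Rightarrow> 'a cochain set" where
  "coboundaries p X = (case p of
       0 \<Rightarrow> {\<one>\<^bsub>cochain_group 0 X\<^esub>}
     | Suc q \<Rightarrow> coboundary_map q X ` carrier (cochain_group q X))"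

definition cocycle_group :: "nat \<Rightarrow> 'a topology \<Rightarrow> 'a cochain monoid" where
  "cocycle_group p X = subgroup_generated (cochain_group p X) (cocycles p X)"

definition cohomology_group :: "nat \<Rightarrow> 'a topology \<Rightarrow> 'a cochain set monoid" where
  "cohomology_group p X = cocycle_group p X Mod coboundaries p X"

definition cohom_class :: "nat \<Rightarrow> 'a topology \<Rightarrow> 'a cochain \<Rightarrow> 'a cochain set" where
  "cohom_class p X \<phi> = coboundaries p X #>\<^bsub>cocycle_group p X\<^esub> \<phi>"

definition cochain_pullback ::
    "nat \<Rightarrow> 'a topology \<Rightarrow> ('a \<Rightarrow> 'b) \<Rightarrow> 'b cochain \<Rightarrow> 'a cochain" where
  "cochain_pullback p X f \<phi> = (\<lambda>c\<in>carrier (chain_group p X). \<phi> (chain_map p f c))"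

text \<open>An element of \<open>H\<^sup>*(X) = \<Oplus>\<^sub>p H\<^sup>p(X)\<close> is the family of its homogeneous components.
  For a continuous \<open>f : X \<rightarrow> Y\<close>, the pullbacks of all the cocycles in one class of \<open>Y\<close>
  differ by coboundaries of \<open>X\<close>, so multiplying by \<open>coboundaries p X\<close> gives a single coset.\<close>

definition cohom_pullback ::
    "'a topology \<Rightarrow> ('a \<Rightarrow> 'b) \<Rightarrow> (nat \<Rightarrow> 'b cochain set) \<Rightarrow> (nat \<Rightarrow> 'a cochain set)" where
  "cohom_pullback X f \<xi> =
     (\<lambda>p. coboundaries p X <#>\<^bsub>cocycle_group p X\<^esub> (cochain_pullback p X f ` \<xi> p))"

lemma cochain_group_carrier_iff:
  "\<phi> \<in> carrier (cochain_group p X) \<longleftrightarrow>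
     (\<forall>c d. singular_chain p X c \<longrightarrow> singular_chain p X d \<longrightarrow> \<phi> (c + d) = \<phi> c + \<phi> d) \<and>
     \<phi> \<in> extensional (singular_chain_set p X)"
  by (auto simp: cochain_group_def hom_def)

lemma cochain_group_mult:
  "\<phi> \<otimes>\<^bsub>cochain_group p X\<^esub> \<psi> = (\<lambda>c\<in>singular_chain_set p X. \<phi> c + \<psi> c)"
  by (simp add: cochain_group_def)

lemma cochain_group_one: "\<one>\<^bsub>cochain_group p X\<^esub> = (\<lambda>c\<in>singular_chain_set p X. 0)"
  by (simp add: cochain_group_def)

lemma comm_group_cochain_group: "comm_group (cochain_group p X)"
proof (rule comm_groupI)
  fix \<phi> assume \<phi>: "\<phi> \<in> carrier (cochain_group p X)"
  show "\<exists>\<psi>\<in>carrier (cochain_group p X). \<psi> \<otimes>\<^bsub>cochain_group p X\<^esub> \<phi> = \<one>\<^bsub>cochain_group p X\<^esub>"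
  proof (rule bexI[of _ "\<lambda>c\<in>singular_chain_set p X. - \<phi> c"])
    show "(\<lambda>c\<in>singular_chain_set p X. - \<phi> c) \<in> carrier (cochain_group p X)"
      using \<phi> by (simp add: cochain_group_carrier_iff singular_chain_add)
  qed (simp add: cochain_group_mult cochain_group_one cong: restrict_cong)
  show "\<one>\<^bsub>cochain_group p X\<^esub> \<otimes>\<^bsub>cochain_group p X\<^esub> \<phi> = \<phi>"
    using \<phi> by (simp add: cochain_group_carrier_iff cochain_group_mult cochain_group_one
        extensional_restrict cong: restrict_cong)
qed (simp_all add: cochain_group_carrier_iff cochain_group_mult cochain_group_one
      singular_chain_add algebra_simps cong: restrict_cong)

lemma coboundary_map_hom:
  "coboundary_map p X \<in> hom (cochain_group p X) (cochain_group (Suc p) X)"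
proof (rule homI)
  fix \<phi> \<psi>
  assume "\<phi> \<in> carrier (cochain_group p X)" "\<psi> \<in> carrier (cochain_group p X)"
  show "coboundary_map p X (\<phi> \<otimes>\<^bsub>cochain_group p X\<^esub> \<psi>)
      = coboundary_map p X \<phi> \<otimes>\<^bsub>cochain_group (Suc p) X\<^esub> coboundary_map p X \<psi>"
    by (rule ext) (simp add: coboundary_map_def cochain_group_mult restrict_def
        singular_chain_boundary_alt)
qed (simp add: cochain_group_carrier_iff coboundary_map_def chain_boundary_add
      singular_chain_add singular_chain_boundary_alt)

lemma coboundary_map_coboundary_map:
  assumes "\<phi> \<in> carrier (cochain_group p X)"
  shows "coboundary_map (Suc p) X (coboundary_map p X \<phi>) = \<one>\<^bsub>cochain_group (Suc (Suc p)) X\<^esub>"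
proof -
  have "\<phi> 0 = 0"
  proof -
    have "\<phi> (0 + 0) = \<phi> 0 + \<phi> 0"
      using assms by (auto simp: cochain_group_def hom_def simp del: add_0 add_0_right)
    then show ?thesis by simp
  qed
  then show ?thesis
    by (intro ext) (simp add: coboundary_map_def cochain_group_one restrict_def
        singular_chain_boundary_alt chain_boundary_boundary_alt)
qed

lemma subgroup_cocycles: "subgroup (cocycles p X) (cochain_group p X)"
proof -
  interpret group_hom "cochain_group p X" "cochain_group (Suc p) X" "coboundary_map p X"
    by (intro group_hom.intro group_hom_axioms.intro coboundary_map_hom
        comm_group.axioms(2) comm_group_cochain_group)
  show ?thesis
    using subgroup_kernel unfolding kernel_def cocycles_def .
qed

lemma coboundaries_subset_cocycles: "coboundaries p X \<subseteq> cocycles p X"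
proof (cases p)
  case 0
  then show ?thesis
    using subgroup.one_closed[OF subgroup_cocycles[of 0 X]] by (simp add: coboundaries_def)
next
  case (Suc q)
  then show ?thesis
    using hom_in_carrier[OF coboundary_map_hom[of q X]]
    by (auto simp: coboundaries_def cocycles_def coboundary_map_coboundary_map)
qed

lemma subgroup_coboundaries: "subgroup (coboundaries p X) (cochain_group p X)"
proof (cases p)
  case 0
  then show ?thesis
    using group.triv_subgroup[OF comm_group.axioms(2)[OF comm_group_cochain_group[of 0 X]]]
    by (simp add: coboundaries_def)
next
  case (Suc q)
  interpret group_hom "cochain_group q X" "cochain_group (Suc q) X" "coboundary_map q X"
    by (intro group_hom.intro group_hom_axioms.intro coboundary_map_hom
        comm_group.axioms(2) comm_group_cochain_group)
  show ?thesis
    using Suc img_is_subgroup by (simp add: coboundaries_def)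
qed

lemma carrier_cocycle_group: "carrier (cocycle_group p X) = cocycles p X"
  unfolding cocycle_group_def
  by (rule subgroup.carrier_subgroup_generated_subgroup[OF subgroup_cocycles])

lemma comm_group_cohomology_group: "comm_group (cohomology_group p X)"
proof -
  have g: "group (cochain_group p X)"
    by (rule comm_group.axioms(2)[OF comm_group_cochain_group])
  have cg: "comm_group (cocycle_group p X)"
    unfolding cocycle_group_def
    by (intro group.abelian_subgroup_generated g comm_group_cochain_group)
  have "subgroup (coboundaries p X) (cocycle_group p X)"
    unfolding cocycle_group_def
    by (intro group.subgroup_of_subgroup_generated g coboundaries_subset_cocycles
        subgroup_coboundaries)
  then show ?thesis
    unfolding cohomology_group_def by (rule comm_group.abelian_FactGroup[OF cg])
qed

section \<open>The cohomology class of a subvariety of a Grassmannian\<close>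

text \<open>Since \<open>row_space k\<close> is a holomorphic submersion from the open set \<open>frames k m\<close> of
  \<open>k \<times> m\<close> matrices onto \<open>Gr k m\<close>, a function on an open subset of \<open>Gr k m\<close> is holomorphic,
  respectively a submersion, iff its composition with \<open>row_space k\<close> is. Holomorphy in several
  variables is continuity together with holomorphy in every single matrix entry.\<close>

definition entry_slice ::
    "((nat \<Rightarrow> nat \<Rightarrow> complex) \<Rightarrow> complex) \<Rightarrow> (nat \<Rightarrow> nat \<Rightarrow> complex) \<Rightarrow> nat \<Rightarrow> nat \<Rightarrow> complex \<Rightarrow> complex"
  where "entry_slice g A i j = (\<lambda>z. g (A(i := (A i)(j := z))))"

definition Gr_holomorphic_on ::
    "nat \<Rightarrow> nat \<Rightarrow> ((nat \<Rightarrow> complex) set \<Rightarrow> complex) \<Rightarrow> (nat \<Rightarrow> complex) set set \<Rightarrow> bool" where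
  "Gr_holomorphic_on k m f U \<longleftrightarrow>
     continuous_on {A \<in> frames k m. row_space k A \<in> U} (f \<circ> row_space k) \<and>
     (\<forall>A\<in>frames k m. row_space k A \<in> U \<longrightarrow> (\<forall>i<k. \<forall>j\<in>{1..m}.
        entry_slice (f \<circ> row_space k) A i j field_differentiable at (A i j)))"

definition Gr_partial ::
    "nat \<Rightarrow> ((nat \<Rightarrow> complex) set \<Rightarrow> complex) \<Rightarrow> (nat \<Rightarrow> nat \<Rightarrow> complex) \<Rightarrow> nat \<Rightarrow> nat \<Rightarrow> complex" where
  "Gr_partial k f A i j = deriv (entry_slice (f \<circ> row_space k) A i j) (A i j)"

text \<open>\<open>(f 0, \<dots>, f (c - 1)) : U \<rightarrow> \<complex>\<^sup>c\<close> is a holomorphic submersion with zero set \<open>Z \<inter> U\<close>.\<close>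

definition local_equations ::
    "nat \<Rightarrow> nat \<Rightarrow> nat \<Rightarrow> (nat \<Rightarrow> complex) set set \<Rightarrow> (nat \<Rightarrow> complex) set set
      \<Rightarrow> (nat \<Rightarrow> (nat \<Rightarrow> complex) set \<Rightarrow> complex) \<Rightarrow> bool" where
  "local_equations k m c Z U f \<longleftrightarrow>
     openin (Gr_top k m) U \<and>
     (\<forall>s<c. Gr_holomorphic_on k m (f s) U) \<and>
     (\<forall>A\<in>frames k m. row_space k A \<in> U \<longrightarrow>
        (\<forall>t. (\<forall>i<k. \<forall>j\<in>{1..m}. (\<Sum>s<c. t s * Gr_partial k (f s) A i j) = 0)
              \<longrightarrow> (\<forall>s<c. t s = 0))) \<and>
     Z \<inter> U = {V \<in> U. \<forall>s<c. f s V = 0}"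

definition regular_points ::
    "nat \<Rightarrow> nat \<Rightarrow> nat \<Rightarrow> (nat \<Rightarrow> complex) set set \<Rightarrow> (nat \<Rightarrow> complex) set set" where
  "regular_points k m c Z = {V \<in> Z. \<exists>U f. V \<in> U \<and> local_equations k m c Z U f}"

text \<open>The complex codimension of a nonempty closed subvariety of pure dimension, i.e. the
  codimension at its smooth points, which are dense.\<close>

definition Gr_codim :: "nat \<Rightarrow> nat \<Rightarrow> (nat \<Rightarrow> complex) set set \<Rightarrow> nat" where
  "Gr_codim k m Z = (THE c. Z \<subseteq> Gr_top k m closure_of regular_points k m c Z)"

text \<open>A small simplex normal to \<open>Z\<close>: in terms of local equations \<open>f\<close> it is the affine simplex
  in \<open>\<complex>\<^sup>c\<close> with vertices
  \<open>- r (\<epsilon>\<^sub>1 + i \<epsilon>\<^sub>1 + \<dots> + \<epsilon>\<^sub>c + i \<epsilon>\<^sub>c), r \<epsilon>\<^sub>1, r i \<epsilon>\<^sub>1, \<dots>, r \<epsilon>\<^sub>c, r i \<epsilon>\<^sub>c\<close>, where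
  \<open>\<epsilon>\<^sub>1, \<dots>, \<epsilon>\<^sub>c\<close> is the standard basis. It is positively oriented for the complex orientation and
  contains the origin in its interior, so the canonical generator of
  \<open>H\<^sup>2\<^sup>c(\<complex>\<^sup>c, \<complex>\<^sup>c - 0)\<close> takes the value \<open>1\<close> on it.\<close>

definition normal_simplex ::
    "nat \<Rightarrow> nat \<Rightarrow> nat \<Rightarrow> (nat \<Rightarrow> complex) set set
      \<Rightarrow> ((nat \<Rightarrow> real) \<Rightarrow> (nat \<Rightarrow> complex) set) \<Rightarrow> bool" where
  "normal_simplex k m c Z \<sigma> \<longleftrightarrow>
     (\<exists>U f r. local_equations k m c Z U f \<and> r > 0 \<and>
        singular_simplex (2 * c) (subtopology (Gr_top k m) U) \<sigma> \<and>
        (\<forall>x\<in>standard_simplex (2 * c). \<forall>s<c.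
           f s (\<sigma> x) = of_real r * Complex (x (2 * s + 1) - x 0) (x (2 * s + 2) - x 0)))"

text \<open>A cocycle representing the canonical class of \<open>Z\<close> in \<open>H\<^sup>2\<^sup>c(X, X - Z)\<close>, where
  \<open>X = Gr k m\<close>: it vanishes on \<open>X - Z\<close> and restricts to the Thom class of the normal
  bundle, with its complex orientation, at the smooth points of \<open>Z\<close>.\<close>

definition fundamental_cocycle ::
    "nat \<Rightarrow> nat \<Rightarrow> nat \<Rightarrow> (nat \<Rightarrow> complex) set set \<Rightarrow> (nat \<Rightarrow> complex) set cochain \<Rightarrow> bool" where
  "fundamental_cocycle k m c Z \<phi> \<longleftrightarrow>
     \<phi> \<in> cocycles (2 * c) (Gr_top k m) \<and>
     (\<forall>d. singular_chain (2 * c) (subtopology (Gr_top k m) (- Z)) d \<longrightarrow> \<phi> d = 0) \<and>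
     (\<forall>\<sigma>. normal_simplex k m c Z \<sigma> \<longrightarrow> \<phi> (frag_of \<sigma>) = 1)"

text \<open>The class \<open>[Z] \<in> H\<^sup>*(Gr k m)\<close>, homogeneous of degree twice the codimension of \<open>Z\<close>: the
  image under \<open>H\<^sup>2\<^sup>c(X, X - Z) \<rightarrow> H\<^sup>2\<^sup>c(X)\<close> of the canonical class, as in Fulton, Young Tableaux,
  Appendix B.\<close>

definition subvariety_class ::
    "nat \<Rightarrow> nat \<Rightarrow> (nat \<Rightarrow> complex) set set \<Rightarrow> (nat \<Rightarrow> (nat \<Rightarrow> complex) set cochain set)" where
  "subvariety_class k m Z =
     (let c = Gr_codim k m Z in
      (\<lambda>p. \<one>\<^bsub>cohomology_group p (Gr_top k m)\<^esub>)
        (2 * c := (THE \<xi>. \<exists>\<phi>. fundamental_cocycle k m c Z \<phi> \<and>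
                               \<xi> = cohom_class (2 * c) (Gr_top k m) \<phi>)))"

end

theory Submission
 imports Defs "Jordan_Normal_Form.Determinant" "HOL-Complex_Analysis.Cauchy_Integral_Formula"
begin

text \<open>
 A rank set \<open>N\<close> with \<open>k\<close> intervals in \<open>[m]\<close> determines a cell of \<open>Gr k m\<close>: the row spaces of the
 matrices whose \<open>i\<close>-th row is supported on the \<open>i\<close>-th interval and nonzero at both of its ends. The
 cells partition \<open>Gr k m\<close>, on the cell of \<open>N\<close> the dimension of \<open>V \<inter> \<langle>[p, q]\<rangle>\<close> is the number
 \<open>rk N p q\<close> of intervals inside \<open>[p, q]\<close>, and the rank variety is the closure of the cell. It lies in the closed set
 \<open>R\<^sub>N\<close> where all these dimensions are at least \<open>rk N p q\<close>, whose other strata have larger codimension.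
 In an explicit chart the cell is a coordinate subspace. Therefore, for every closed \<open>Z\<close> between the cell
 and \<open>R\<^sub>N\<close>, the homology of \<open>(Gr k m, Gr k m - Z)\<close> vanishes below degree \<open>2c\<close> and is generated in
 degree \<open>2c\<close> by small simplices normal to the cell, where \<open>c\<close> is the codimension. Hence a cocycle of
 degree \<open>2c\<close> that vanishes off \<open>Z\<close> is determined up to coboundaries by its values on these simplices,
 and the fundamental cocycle exists.

 Any two linear inclusions of \<open>\<complex>\<^sup>n\<close> into \<open>\<complex>\<^sup>n\<^sup>+\<^sup>1\<close> induce homotopic maps. For the
 inclusion \<open>e\<^sub>p \<mapsto> e\<^sub>p - e\<^sub>p\<^sub>+\<^sub>1\<close> a vector lies in \<open>\<langle>[p, q]\<rangle>\<close> iff its image lies in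
 \<open>\<langle>[p, q + 1]\<rangle>\<close>, so the preimage of \<open>R\<^sub>N\<close> for \<open>N = kappa M\<close> is \<open>R\<^sub>M\<close>, and simplices normal to the cell of \<open>M\<close> are
 mapped to simplices on which the local equations for \<open>kappa M\<close> have degree \<open>1\<close>.
\<close>

text \<open>The coordinate inclusion, sending each unit vector to itself, does not suit the problem:
  it turns the condition on \<open>[p, q + 1]\<close> into one on the same interval of the smaller
  space, which is in general weaker than the condition on \<open>[p, q]\<close>. The image of the
  inclusion used instead is the hyperplane of vectors with coordinate sum 0, which contains no
  coordinate vector and is transverse to all the strata that matter. The preimage of the rank
  variety itself is only known to lie in the set of larger ranks. This is why the homology is
  computed for every closed set in between, and why the two cocycles are compared relative to the
  complement of the larger set. The definition of the fundamental cocycle admits normal simplices at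
  any smooth point and for any local equations. As the remaining strata have real codimension at
  least \<open>2c + 2\<close>, such a simplex can be moved, inside the domain of its equations, to
  small simplices at points of the cell. There the degree is 1 because invertible complex matrices
  are path connected.\<close>

abbreviation (input) relcycle where "relcycle \<equiv> singular_relcycle"
abbreviation (input) relboundary where "relboundary \<equiv> singular_relboundary"
abbreviation (input) bdry where "bdry \<equiv> chain_boundary"
abbreviation (input) sub where "sub \<equiv> subtopology"
abbreviation (input) schain where "schain \<equiv> singular_chain"
abbreviation (input) rel_hom where "rel_hom \<equiv> relative_homology_group"
abbreviation (input) stdx where "stdx \<equiv> standard_simplex"
abbreviation (input) ssimp where "ssimp \<equiv> singular_simplex"
abbreviation (input) homrel where "homrel \<equiv> homologous_rel"
abbreviation (input) Euc where "Euc \<equiv> Euclidean_space"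
abbreviation (input) uvec where "uvec \<equiv> Defs.unit_vec"

section \<open>Relative homology on the level of chains\<close>

definition hvanish :: "nat => 'a topology => 'a set => bool" where
 "hvanish p X S \<longleftrightarrow> (\<forall>z. relcycle p X S z --> relboundary p X S z)"

text \<open>The chain \<open>c\<close> is a relative cycle as a whole and not simplex by simplex, so
  \<open>G\<close> may be any geometric condition on simplices.\<close>

definition hgen :: "nat => 'a topology => 'a set => ((nat => real) => 'a) set => bool" where
 "hgen p X S G \<longleftrightarrow> (\<forall>z. relcycle p X S z -->
   (\<exists>c. Poly_Mapping.keys c <= G & homrel p X S z c))"

text \<open>The homology of the pair in degree \<open>p\<close> is infinite cyclic, generated by the
  class of \<open>w\<close>. It is stated for chains because the generator has to be followed
  through explicit maps.\<close>

definition hfree :: "nat => 'a topology => 'a set => 'a chain => bool" where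
 "hfree p X S w \<longleftrightarrow> relcycle p X S w &
  (\<forall>z. relcycle p X S z --> (\<exists>a. homrel p X S z (frag_cmul a w))) &
  (\<forall>a. relboundary p X S (frag_cmul a w) --> a = 0)"

lemma hvanish_restrict: "hvanish p X (topspace X Int S) = hvanish p X S"
 by (simp add: hvanish_def)

lemma hvanish_iff_trivial_group:
 "hvanish p X S \<longleftrightarrow> trivial_group (rel_hom (int p) X S)"
proof
 assume h: "hvanish p X S"
 have "carrier (rel_hom (int p) X S) = {singular_relboundary_set p X S}"
 proof -
  have "homologous_rel_set p X S z = singular_relboundary_set p X S" if "relcycle p X S z" for z
   using that h homologous_rel_set_eq_relboundary unfolding hvanish_def by blast
  moreover have "relcycle p X S 0" by simp
  ultimately show ?thesis
   unfolding carrier_relative_homology_group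
   by (intro equalityI subsetI) (auto intro!: rev_image_eqI[of 0])
 qed
 then show "trivial_group (rel_hom (int p) X S)"
  by (simp add: trivial_group_def)
next
 assume t: "trivial_group (rel_hom (int p) X S)"
 show "hvanish p X S"
  unfolding hvanish_def
 proof (intro allI impI)
  fix z assume "relcycle p X S z"
  then have "homologous_rel_set p X S z : carrier (rel_hom (int p) X S)"
   by (simp add: carrier_relative_homology_group)
  then have "homologous_rel_set p X S z = singular_relboundary_set p X S"
   using t by (simp add: trivial_group_def)
  then show "relboundary p X S z"
   using homologous_rel_set_eq_relboundary by blast
 qed
qed

lemma singular_relcycle_mono:
 assumes "relcycle p (sub X V) S z" "V <= W" "V Int S <= T"
 shows "relcycle p (sub X W) T z"
 using assms
 by (fastforce simp: singular_relcycle subtopology_subtopology singular_chain_subtopology)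

lemma singular_relboundary_mono:
 assumes "relboundary p (sub X V) S z" "V <= W" "V Int S <= T"
 shows "relboundary p (sub X W) T z"
proof -
 obtain d e where "schain (Suc p) (sub X V) d"
  "schain p (sub (sub X V) S) e" "bdry (Suc p) d + e = z"
  using assms(1) singular_relboundary by blast
 moreover have "schain (Suc p) (sub X W) d"
  using calculation assms(2) singular_chain_mono by blast
 moreover have "schain p (sub (sub X W) T) e"
  using calculation(2) assms by (fastforce simp: subtopology_subtopology singular_chain_subtopology)
 ultimately show ?thesis
  using singular_relboundary by blast
qed

lemma homologous_rel_mono:
 assumes "homrel p (sub X V) S z z'" "V <= W" "V Int S <= T"
 shows "homrel p (sub X W) T z z'"
 using assms singular_relboundary_mono unfolding homologous_rel_def by blast

lemma singular_relcycle_mono':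
 assumes "relcycle p X S z" "S <= T"
 shows "relcycle p X T z"
 using singular_relcycle_mono[of p X "topspace X" S z "topspace X" T] assms by auto

lemma singular_relboundary_mono':
 assumes "relboundary p X S z" "S <= T"
 shows "relboundary p X T z"
 using singular_relboundary_mono[of p X "topspace X" S z "topspace X" T] assms by auto

lemma frag_cmul_right_diff: "frag_cmul c (a - b) = frag_cmul c a - frag_cmul c b"
 by (rule poly_mapping_eqI) (simp add: lookup_minus right_diff_distrib)

lemma homologous_rel_cmul:
 "homrel p X S a b ==> homrel p X S (frag_cmul c a) (frag_cmul c b)"
 unfolding homologous_rel_def using singular_relboundary_cmul[of p X S "a - b" c]
 by (simp add: frag_cmul_right_diff)

lemma homologous_rel_relboundary:
 "homrel p X S a b ==> relboundary p X S a \<longleftrightarrow> relboundary p X S b"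
 by (metis homologous_rel_eq homologous_rel_eq_relboundary)

lemma homologous_rel_chain_map:
 assumes "homrel p X S a b" "continuous_map X X' g" "g : topspace X Int S \<rightarrow> T"
 shows "homrel p X' T (chain_map p g a) (chain_map p g b)"
proof -
 have "relboundary p X (topspace X Int S) (a - b)"
  using assms(1) by (simp add: homologous_rel_def)
 then have "relboundary p X' T (chain_map p g (a - b))"
  by (rule singular_relboundary_chain_map) (use assms in auto)
 then show ?thesis
  by (simp add: homologous_rel_def chain_map_diff)
qed

lemma singular_relcycle_chain_map':
 assumes "relcycle p X S c" "continuous_map X X' g" "g : topspace X Int S \<rightarrow> T"
 shows "relcycle p X' T (chain_map p g c)"
 using singular_relcycle_chain_map[of p X "topspace X Int S" c X' g T] assms by auto

text \<open>Isomorphisms of homology groups are turned into statements about single chains; this is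
  the injective half, \<open>hom_induced_iso_surj\<close> the surjective one.\<close>

lemma hom_induced_iso_inj:
 assumes iso: "hom_induced (int p) X S Y T f : iso (rel_hom (int p) X S) (rel_hom (int p) Y T)"
  and f: "continuous_map X Y f" "f : topspace X Int S \<rightarrow> T"
  and z: "relcycle p X S z" and b: "relboundary p Y T (chain_map p f z)"
 shows "relboundary p X S z"
proof -
 let ?h = "hom_induced (int p) X S Y T f"
 have inj: "inj_on ?h (carrier (rel_hom (int p) X S))"
  using iso by (simp add: iso_def bij_betw_def)
 have 1: "?h (homologous_rel_set p X S z) = homologous_rel_set p Y T (chain_map p f z)"
  using hom_induced_chain_map_gen[OF f z] .
 have 2: "?h (homologous_rel_set p X S 0) = homologous_rel_set p Y T 0"
  using hom_induced_chain_map_gen[OF f, of p 0] by simp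
 have "homologous_rel_set p Y T (chain_map p f z) = homologous_rel_set p Y T 0"
  unfolding homologous_rel_set_eq using b by (simp add: homologous_rel_def)
 then have "homologous_rel_set p X S z = homologous_rel_set p X S 0"
  using inj_onD[OF inj, of "homologous_rel_set p X S z" "homologous_rel_set p X S 0"] z 1 2
  by (simp add: carrier_relative_homology_group)
 then show ?thesis
  unfolding homologous_rel_set_eq by (simp add: homologous_rel_def)
qed

lemma hom_induced_iso_surj:
 assumes iso: "hom_induced (int p) X S Y T f : iso (rel_hom (int p) X S) (rel_hom (int p) Y T)"
  and f: "continuous_map X Y f" "f : topspace X Int S \<rightarrow> T"
  and w: "relcycle p Y T w"
 obtains z where "relcycle p X S z" "homrel p Y T w (chain_map p f z)"
proof -
 let ?h = "hom_induced (int p) X S Y T f"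
 have "homologous_rel_set p Y T w : ?h ` carrier (rel_hom (int p) X S)"
  using iso w by (simp add: iso_def bij_betw_def carrier_relative_homology_group)
 then obtain z where z: "relcycle p X S z" "homologous_rel_set p Y T w = ?h (homologous_rel_set p X S z)"
  by (auto simp: carrier_relative_homology_group)
 then have "homrel p Y T w (chain_map p f z)"
  using hom_induced_chain_map_gen[OF f z(1)] homologous_rel_set_eq by metis
 with z that show ?thesis by blast
qed

lemma hfree_transfer:
 assumes iso: "hom_induced (int p) X S Y T f : iso (rel_hom (int p) X S) (rel_hom (int p) Y T)"
  and f: "continuous_map X Y f" "f : topspace X Int S \<rightarrow> T"
  and w: "relcycle p X S w"
 shows "hfree p X S w \<longleftrightarrow> hfree p Y T (chain_map p f w)"
proof
 assume h: "hfree p X S w"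
 show "hfree p Y T (chain_map p f w)"
  unfolding hfree_def
 proof (intro conjI allI impI)
  show "relcycle p Y T (chain_map p f w)"
   using singular_relcycle_chain_map' f w by blast
 next
  fix y assume "relcycle p Y T y"
  then obtain z where z: "relcycle p X S z" "homrel p Y T y (chain_map p f z)"
   using hom_induced_iso_surj[OF iso f] by blast
  then obtain a where "homrel p X S z (frag_cmul a w)"
   using h unfolding hfree_def by blast
  then have "homrel p Y T (chain_map p f z) (chain_map p f (frag_cmul a w))"
   using homologous_rel_chain_map f by blast
  then show "\<exists>a. homrel p Y T y (frag_cmul a (chain_map p f w))"
   using z(2) by (metis chain_map_cmul homologous_rel_trans)
 next
  fix a assume "relboundary p Y T (frag_cmul a (chain_map p f w))"
  then have "relboundary p Y T (chain_map p f (frag_cmul a w))"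
   by simp
  then have "relboundary p X S (frag_cmul a w)"
   by (rule hom_induced_iso_inj[OF iso f singular_relcycle_cmul[OF w]])
  then show "a = 0"
   using h unfolding hfree_def by blast
 qed
next
 assume h: "hfree p Y T (chain_map p f w)"
 show "hfree p X S w"
  unfolding hfree_def
 proof (intro conjI allI impI)
  fix z assume z: "relcycle p X S z"
  then obtain a where "homrel p Y T (chain_map p f z) (frag_cmul a (chain_map p f w))"
   using h singular_relcycle_chain_map'[OF z f] unfolding hfree_def by blast
  then have "relboundary p Y T (chain_map p f (z - frag_cmul a w))"
   by (simp add: homologous_rel_def chain_map_diff)
  then have "relboundary p X S (z - frag_cmul a w)"
   by (rule hom_induced_iso_inj[OF iso f singular_relcycle_diff[OF z singular_relcycle_cmul[OF w]]])
  then show "\<exists>a. homrel p X S z (frag_cmul a w)"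
   by (auto simp: homologous_rel_def)
 next
  fix a assume "relboundary p X S (frag_cmul a w)"
  then have "relboundary p Y T (chain_map p f (frag_cmul a w))"
   using singular_relboundary_chain_map[of p X "topspace X Int S" "frag_cmul a w" Y f T] f
   by (auto simp del: chain_map_cmul)
  then show "a = 0"
   using h unfolding hfree_def by simp
 qed (use w in simp)
qed

lemma hvanish_transfer:
 assumes iso: "hom_induced (int p) X S Y T f : iso (rel_hom (int p) X S) (rel_hom (int p) Y T)"
 shows "hvanish p X S \<longleftrightarrow> hvanish p Y T"
 unfolding hvanish_iff_trivial_group
 by (meson group_relative_homology_group iso is_isoI isomorphic_group_triviality)

lemma hfree_cong:
 assumes "hfree p X S w" "homrel p X S w w'"
 shows "hfree p X S w'"
 unfolding hfree_def
proof (intro conjI allI impI)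
 show "relcycle p X S w'"
  using assms homologous_rel_singular_relcycle_1 unfolding hfree_def by blast
 have c: "homrel p X S (frag_cmul a w) (frag_cmul a w')" for a
  by (rule homologous_rel_cmul[OF assms(2)])
 show "\<exists>a. homrel p X S z (frag_cmul a w')" if "relcycle p X S z" for z
  using that assms(1) c unfolding hfree_def by (meson homologous_rel_trans)
 show "a = 0" if "relboundary p X S (frag_cmul a w')" for a
  using that assms(1) c[of a] homologous_rel_relboundary unfolding hfree_def by blast
qed

lemma hfree_minus:
 assumes "hfree p X S w" shows "hfree p X S (- w)"
 unfolding hfree_def
proof (intro conjI allI impI)
 have eq: "frag_cmul a (- w) = frag_cmul (- a) w" for a
  by (rule poly_mapping_eqI) simp
 show "relcycle p X S (- w)"
  using assms by (simp add: hfree_def singular_relcycle_minus)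
 show "\<exists>a. homrel p X S z (frag_cmul a (- w))" if z: "relcycle p X S z" for z
 proof -
  obtain a where "homrel p X S z (frag_cmul a w)"
   using assms z unfolding hfree_def by blast
  then have "homrel p X S z (frag_cmul (- a) (- w))"
   by (simp add: eq)
  then show ?thesis by blast
 qed
 show "a = 0" if "relboundary p X S (frag_cmul a (- w))" for a
 proof -
  have "relboundary p X S (frag_cmul (- a) w)"
   using that by (simp only: eq)
  then show ?thesis
   using assms unfolding hfree_def by (metis neg_equal_0_iff_equal)
 qed
qed

text \<open>Exactness of \<open>H_p(S, T) -> H_p(X, T) -> H_p(X, S)\<close> at the middle
  term.\<close>

lemma hvanish_triple:
 assumes "T <= S" "hvanish p (sub X S) T" "hvanish p X S"
 shows "hvanish p X T"
 unfolding hvanish_def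
proof (intro allI impI)
 fix z assume z: "relcycle p X T z"
 have "relboundary p X S z"
  using assms singular_relcycle_mono'[OF z] unfolding hvanish_def by blast
 then obtain d e where d: "schain (Suc p) X d" and e: "schain p (sub X S) e"
  and eq: "bdry (Suc p) d + e = z"
  using singular_relboundary by blast
 have "relboundary p X T (bdry (Suc p) d)"
  using d singular_relboundary by (metis add.right_neutral singular_chain_0)
 then have 1: "relcycle p X T (bdry (Suc p) d)"
  by (rule singular_relboundary_imp_relcycle)
 have "relcycle p X T (z - bdry (Suc p) d)"
  by (rule singular_relcycle_diff[OF z 1])
 moreover have "z - bdry (Suc p) d = e"
  using eq by auto
 ultimately have "relcycle p (sub X S) T e"
  using e assms(1) by (simp add: singular_relcycle subtopology_subtopology Int_absorb1)
 then have "relboundary p (sub X S) T e"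
  using assms unfolding hvanish_def by blast
 then have "relboundary p (sub X (topspace X)) T e"
  by (metis (no_types) singular_relboundary_mono Int_lower2 inf_le1 subtopology_restrict)
 then have "relboundary p X T e"
  by simp
 then show "relboundary p X T z"
  using singular_relboundary_add[OF \<open>singular_relboundary p X T (chain_boundary (Suc p) d)\<close>] eq by blast
qed

text \<open>Exactness of \<open>H_p(X, T) -> H_p(X, S) -> H_(p-1)(S, T)\<close>. In degree 0 the
  last term is absent, and every 0-chain is a relative cycle.\<close>

lemma hvanish_triple':
 assumes "T <= S" "hvanish p X T" "p = 0 | hvanish (p - 1) (sub X S) T"
 shows "hvanish p X S"
 unfolding hvanish_def
proof (intro allI impI)
 fix z assume z: "relcycle p X S z"
 show "relboundary p X S z"
 proof (cases p)
  case 0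
  then have "relcycle p X T z"
   using z by (simp add: singular_relcycle chain_boundary_def)
  then have "relboundary p X T z"
   using assms unfolding hvanish_def by blast
  then show ?thesis
   using assms singular_relboundary_mono' by blast
 next
  case (Suc q)
  then have zc: "schain (Suc q) X z" "schain q (sub X S) (bdry (Suc q) z)"
   using z by (auto simp: singular_relcycle)
  have "relcycle q (sub X S) {} (bdry (Suc q) z)"
   using zc chain_boundary_boundary_alt singular_cycle by blast
  then have "relcycle q (sub X S) T (bdry (Suc q) z)"
   by (rule singular_relcycle_mono') simp
  then have "relboundary q (sub X S) T (bdry (Suc q) z)"
   using assms Suc unfolding hvanish_def by simp
  then obtain d e where d: "schain (Suc q) (sub X S) d"
   and e: "schain q (sub X T) e"
   and eq: "bdry (Suc q) d + e = bdry (Suc q) z"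
   using assms(1) unfolding singular_relboundary subtopology_subtopology by (metis Int_absorb1)
  have dX: "schain (Suc q) X d"
   using d by (simp add: singular_chain_subtopology)
  have "bdry (Suc q) (z - d) = e"
   using eq by (metis add_diff_cancel_left' chain_boundary_diff)
  then have "relcycle p X T (z - d)"
   using e Suc zc dX by (simp add: singular_relcycle singular_chain_diff)
  then have "relboundary p X T (z - d)"
   using assms unfolding hvanish_def by blast
  then have "relboundary p X S (z - d)"
   using assms singular_relboundary_mono' by blast
  moreover have "relboundary p X S d"
   using d Suc by (simp add: singular_chain_imp_relboundary)
  ultimately show ?thesis
   using singular_relboundary_add by fastforce
 qed
qed

text \<open>The connecting map \<open>H_(p+1)(X, S) -> H_p(S, T)\<close> has trivial kernel because
  \<open>H_(p+1)(X, T)\<close> vanishes: subtracting a chain \<open>d\<close> in \<open>S\<close>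
  that has the same boundary modulo \<open>T\<close> makes \<open>z\<close> a cycle relative to
  \<open>T\<close>.\<close>

lemma connecting_inj:
 assumes "T <= S" "hvanish (Suc p) X T"
  and z: "relcycle (Suc p) X S z"
  and b: "relboundary p (sub X S) T (bdry (Suc p) z)"
 shows "relboundary (Suc p) X S z"
proof -
 have zc: "schain (Suc p) X z"
  using z by (auto simp: singular_relcycle)
 obtain d e where d: "schain (Suc p) (sub X S) d"
  and e: "schain p (sub X T) e"
  and eq: "bdry (Suc p) d + e = bdry (Suc p) z"
  using b assms(1) unfolding singular_relboundary subtopology_subtopology by (metis Int_absorb1)
 have dX: "schain (Suc p) X d"
  using d by (simp add: singular_chain_subtopology)
 have "bdry (Suc p) (z - d) = e"
  using eq by (metis add_diff_cancel_left' chain_boundary_diff)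
 then have "relcycle (Suc p) X T (z - d)"
  using e zc dX by (simp add: singular_relcycle singular_chain_diff)
 then have "relboundary (Suc p) X S (z - d)"
  using assms singular_relboundary_mono' unfolding hvanish_def by blast
 moreover have "relboundary (Suc p) X S d"
  using d by (simp add: singular_chain_imp_relboundary)
 ultimately show ?thesis
  using singular_relboundary_add by fastforce
qed

text \<open>A generator is recognised by its boundary. Injectivity of the connecting map gives
  generation; and if \<open>a\<close> times \<open>w\<close> bounds modulo \<open>S\<close>, then
  \<open>a\<close> times the boundary of \<open>w\<close> bounds in \<open>S\<close> modulo
  \<open>T\<close>, so \<open>a = 0\<close>.\<close>

lemma hfree_connecting:
 assumes TS: "T <= S" and van: "hvanish p X T" "hvanish (Suc p) X T"
  and w: "relcycle (Suc p) X S w"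
  and f: "hfree p (sub X S) T (bdry (Suc p) w)"
 shows "hfree (Suc p) X S w"
 unfolding hfree_def
proof (intro conjI allI impI)
 fix z assume z: "relcycle (Suc p) X S z"
 have zc: "schain (Suc p) X z" "schain p (sub X S) (bdry (Suc p) z)"
  using z by (auto simp: singular_relcycle)
 have "relcycle p (sub X S) {} (bdry (Suc p) z)"
  using zc chain_boundary_boundary_alt singular_cycle by blast
 then have "relcycle p (sub X S) T (bdry (Suc p) z)"
  by (rule singular_relcycle_mono') simp
 then obtain a where "homrel p (sub X S) T (bdry (Suc p) z) (frag_cmul a (bdry (Suc p) w))"
  using f unfolding hfree_def by blast
 then have "relboundary p (sub X S) T (bdry (Suc p) (z - frag_cmul a w))"
  by (simp add: homologous_rel_def chain_boundary_diff chain_boundary_cmul)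
 then have "relboundary (Suc p) X S (z - frag_cmul a w)"
  using connecting_inj[OF TS van(2)] z w singular_relcycle_diff singular_relcycle_cmul by blast
 then show "\<exists>a. homrel (Suc p) X S z (frag_cmul a w)"
  unfolding homologous_rel_def by blast
next
 fix a assume "relboundary (Suc p) X S (frag_cmul a w)"
 then obtain d e where d: "schain (Suc (Suc p)) X d"
  and e: "schain (Suc p) (sub X S) e"
  and eq: "bdry (Suc (Suc p)) d + e = frag_cmul a w"
  using singular_relboundary by blast
 have "frag_cmul a (bdry (Suc p) w) = bdry (Suc p) e"
  by (metis add_0 chain_boundary_add chain_boundary_boundary_alt chain_boundary_cmul d eq)
 moreover have "relboundary p (sub X S) T (bdry (Suc p) e)"
  using e singular_relboundary by (metis add.right_neutral singular_chain_0)
 ultimately show "a = 0"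
  using f unfolding hfree_def by metis
qed (use w in simp)

lemma hvanish_connecting:
 assumes TS: "T <= S" and van: "hvanish (Suc p) X T"
  and f: "hvanish p (sub X S) T"
 shows "hvanish (Suc p) X S"
 unfolding hvanish_def
proof (intro allI impI)
 fix z assume z: "relcycle (Suc p) X S z"
 have zc: "schain (Suc p) X z" "schain p (sub X S) (bdry (Suc p) z)"
  using z by (auto simp: singular_relcycle)
 have "relcycle p (sub X S) {} (bdry (Suc p) z)"
  using zc chain_boundary_boundary_alt singular_cycle by blast
 then have "relcycle p (sub X S) T (bdry (Suc p) z)"
  by (rule singular_relcycle_mono') simp
 then show "relboundary (Suc p) X S z"
  using connecting_inj[OF TS van z] f unfolding hvanish_def by blast
qed

text \<open>The surjectivity part of the Mayer-Vietoris sequence. After subdivision \<open>z\<close>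
  splits as a chain, and the obstruction to splitting it into relative cycles is a class of degree
  \<open>p - 1\<close> on \<open>U1 Int U2\<close>, which vanishes.\<close>

lemma relcycle_split:
 assumes U: "openin X U1" "openin X U2" "topspace X <= U1 Un U2"
  and van: "p = 0 | hvanish (p - 1) (sub X (U1 Int U2)) S"
  and z: "relcycle p X S z"
 obtains z1 z2 where "relcycle p (sub X U1) S z1"
  "relcycle p (sub X U2) S z2" "homrel p X S z (z1 + z2)"
proof -
 have o: "!!U. U : {U1, U2} ==> openin X U" "topspace X <= \<Union>{U1, U2}"
  using U by auto
 obtain z' where z': "relcycle p X S z'" "homrel p X S z z'"
  and small: "!!f. f : Poly_Mapping.keys z' ==> \<exists>V \<in> {U1,U2}. f : (stdx p) \<rightarrow> V"
  by (rule small_homologous_rel_relcycle_exists[OF o z]) blast+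
 have z'c: "schain p X z'"
  using z' by (simp add: singular_relcycle)
 have "Poly_Mapping.keys z' <= {f. ssimp p (sub X U1) f} Un {f. ssimp p (sub X U2) f}"
 proof
  fix f assume f: "f : Poly_Mapping.keys z'"
  then have "ssimp p X f"
   using z'c by (auto simp: singular_chain_def)
  with small[OF f] show "f : {f. ssimp p (sub X U1) f} Un {f. ssimp p (sub X U2) f}"
   by (auto simp: singular_simplex_subtopology)
 qed
 then obtain z1 z2 where zz: "schain p (sub X U1) z1" "schain p (sub X U2) z2"
  "z1 + z2 = z'"
  using frag_split unfolding singular_chain_def by metis
 show ?thesis
 proof (cases p)
  case 0
  have "relcycle p (sub X U1) S z1" "relcycle p (sub X U2) S z2"
   using zz 0 by (simp_all add: singular_relcycle chain_boundary_def)
  moreover have "homrel p X S z (z1 + z2)"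
   using zz z' by simp
  ultimately show ?thesis
   by (rule that)
 next
  case (Suc q)
  let ?b = "bdry (Suc q)"
  let ?w = "?b z1 + ?b z2"
  have bz1: "schain q (sub X U1) (?b z1)" and bz2: "schain q (sub X U2) (?b z2)"
   using zz(1,2) Suc singular_chain_boundary_alt by simp_all
  have wS: "schain q (sub X S) ?w"
   using z'(1) Suc unfolding singular_relcycle zz(3)[symmetric] by (simp add: chain_boundary_add)
  have "Poly_Mapping.keys ?w <= {f. ssimp q (sub X (S Int U1)) f} Un {f. ssimp q (sub X (S Int U2)) f}"
  proof
   fix f assume f: "f : Poly_Mapping.keys ?w"
   then have "f : Poly_Mapping.keys (?b z1) | f : Poly_Mapping.keys (?b z2)"
    using subsetD[OF Poly_Mapping.keys_add[of "?b z1" "?b z2"] f] by simp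
   then have "ssimp q (sub X U1) f | ssimp q (sub X U2) f"
    using bz1 bz2 by (auto simp: singular_chain_def)
   moreover have "ssimp q (sub X S) f"
    using wS f by (auto simp: singular_chain_def)
   ultimately show "f : {f. ssimp q (sub X (S Int U1)) f} Un {f. ssimp q (sub X (S Int U2)) f}"
    by (auto simp: singular_simplex_subtopology)
  qed
  then obtain w1 w2 where ww: "schain q (sub X (S Int U1)) w1" "schain q (sub X (S Int U2)) w2"
   "w1 + w2 = ?w"
   using frag_split unfolding singular_chain_def by metis
  \<comment> \<open>\<open>y\<close> represents the Mayer-Vietoris boundary, the part of the
    boundary of \<open>z1\<close> that is not absorbed by \<open>S\<close>. Its two expressions put
    it into \<open>U1\<close> and into \<open>U2\<close>.\<close>
  define y where "y = ?b z1 - w1"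
  have y': "y = w2 - ?b z2"
   unfolding y_def using ww(3) by (simp add: algebra_simps)
  have w1U: "schain q (sub X U1) w1" and w2U: "schain q (sub X U2) w2"
   using ww singular_chain_mono by blast+
  have yU: "schain q (sub X (U1 Int U2)) y"
  proof -
   have "schain q (sub X U1) y"
    unfolding y_def using bz1 w1U singular_chain_diff by blast
   moreover have "schain q (sub X U2) y"
    unfolding y' using bz2 w2U singular_chain_diff by blast
   ultimately show ?thesis
    by (simp add: singular_chain_subtopology)
  qed
  have "schain (q - 1) (sub X (U1 Int U2 Int S)) (bdry q y)"
  proof -
   have "bdry q y = - bdry q w1"
    unfolding y_def using zz Suc chain_boundary_boundary_alt by (metis chain_boundary_diff diff_0)
   then have "schain (q - 1) (sub X (S Int U1)) (bdry q y)"
    using ww singular_chain_boundary by (metis One_nat_def singular_chain_minus)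
   moreover have "bdry q y = bdry q w2"
    unfolding y' using zz Suc chain_boundary_boundary_alt by (metis chain_boundary_diff diff_zero)
   then have "schain (q - 1) (sub X (S Int U2)) (bdry q y)"
    using ww singular_chain_boundary by (metis One_nat_def)
   ultimately show ?thesis
    by (simp add: singular_chain_subtopology)
  qed
  then have "relcycle q (sub X (U1 Int U2)) S y"
   using yU by (simp add: singular_relcycle subtopology_subtopology)
  then have "relboundary q (sub X (U1 Int U2)) S y"
   using van Suc unfolding hvanish_def by simp
  then obtain u v where u: "schain (Suc q) (sub X (U1 Int U2)) u"
   and v: "schain q (sub X (U1 Int U2 Int S)) v" and uv: "?b u + v = y"
   unfolding singular_relboundary subtopology_subtopology by blast
  have "?b (z1 - u) = w1 + v"
  proof -
   have "?b z1 = y + w1" by (simp add: y_def)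
   then have "?b z1 = (?b u + v) + w1" using uv by simp
   then show ?thesis by (simp add: chain_boundary_diff)
  qed
  moreover have "schain q (sub X (U1 Int S)) (w1 + v)"
   by (rule singular_chain_add; rule singular_chain_mono[OF ww(1)] singular_chain_mono[OF v]) auto
  moreover have "schain (Suc q) (sub X U1) (z1 - u)"
   using zz Suc singular_chain_mono[OF u, of U1] by (intro singular_chain_diff) auto
  ultimately have 1: "relcycle p (sub X U1) S (z1 - u)"
   using Suc by (simp add: singular_relcycle subtopology_subtopology)
  have "?b (z2 + u) = w2 - v"
  proof -
   have "?b z2 = w2 - y" by (simp add: y')
   then have "?b z2 = w2 - (?b u + v)" using uv by simp
   then show ?thesis by (simp add: chain_boundary_add)
  qed
  moreover have "schain q (sub X (U2 Int S)) (w2 - v)"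
   by (rule singular_chain_diff; rule singular_chain_mono[OF ww(2)] singular_chain_mono[OF v]) auto
  moreover have "schain (Suc q) (sub X U2) (z2 + u)"
   using zz Suc singular_chain_mono[OF u, of U2] by (intro singular_chain_add) auto
  ultimately have 2: "relcycle p (sub X U2) S (z2 + u)"
   using Suc by (simp add: singular_relcycle subtopology_subtopology)
  have "homrel p X S z ((z1 - u) + (z2 + u))"
   using z'(2) zz(3) by simp
  with 1 2 show ?thesis by (rule that)
 qed
qed

section \<open>Excision to a neighbourhood of a closed set\<close>

lemma excision_iso:
 assumes "openin X U" "closedin X Z" "Z <= U"
 shows "hom_induced p (sub X U) (-Z) X (-Z) id
  : iso (rel_hom p (sub X U) (-Z)) (rel_hom p X (-Z))"
proof -
 let ?A = "topspace X - U" let ?T = "topspace X - Z"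
 have UX: "U <= topspace X" using assms openin_subset by blast
 have "X closure_of ?A <= X interior_of ?T"
 proof -
  have "closedin X ?A" "openin X ?T" using assms by auto
  then show ?thesis
   using assms(3) by (auto simp: closure_of_closedin interior_of_openin)
 qed
 then have *: "hom_induced p (sub X (topspace X - ?A)) (?T - ?A) (sub X (topspace X)) ?T id
   : iso (rel_hom p (sub X (topspace X - ?A)) (?T - ?A))
      (rel_hom p (sub X (topspace X)) ?T)"
  by (rule homology_excision_axiom) auto
 have 1: "topspace X - ?A = U" "topspace (sub X U) Int -Z = ?T - ?A" "topspace X Int -Z = ?T"
  using UX by auto
 have "hom_induced p (sub X U) (-Z) X (-Z) id = hom_induced p (sub X U) (?T - ?A) X ?T id"
  using hom_induced_restrict[of p "sub X U" "-Z" X "-Z"] by (simp only: 1)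
 moreover have "rel_hom p (sub X U) (-Z) = rel_hom p (sub X U) (?T - ?A)"
  using relative_homology_group_restrict[of p "sub X U" "-Z"] by (simp only: 1)
 moreover have "rel_hom p X (-Z) = rel_hom p X ?T"
  using relative_homology_group_restrict[of p X "-Z"] by (simp only: 1)
 moreover note *[unfolded 1(1) subtopology_topspace]
 ultimately show ?thesis
  by simp
qed

lemma excision_surj:
 assumes "openin X U" "closedin X Z" "Z <= U" and z: "relcycle p X (-Z) z"
 obtains z' where "relcycle p (sub X U) (-Z) z'" "homrel p X (-Z) z z'"
proof -
 have "continuous_map (sub X U) X id"
  by (simp add: continuous_map_from_subtopology)
 then obtain z' where z': "relcycle p (sub X U) (-Z) z'" "homrel p X (-Z) z (chain_map p id z')"
  using hom_induced_iso_surj[OF excision_iso[OF assms(1-3)] _ _ z] by auto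
 moreover have "chain_map p id z' = z'"
  using z' chain_map_ident by (metis singular_relcycle)
 ultimately show ?thesis using that by simp
qed

lemma excision_inj:
 assumes "openin X U" "closedin X Z" "Z <= U" and z: "relcycle p (sub X U) (-Z) z"
  and b: "relboundary p X (-Z) z"
 shows "relboundary p (sub X U) (-Z) z"
proof -
 have "continuous_map (sub X U) X id"
  by (simp add: continuous_map_from_subtopology)
 moreover have "chain_map p id z = z"
  using z chain_map_ident by (metis singular_relcycle)
 ultimately show ?thesis
  using hom_induced_iso_inj[OF excision_iso[OF assms(1-3)] _ _ z] b by auto
qed

lemma hvanish_excision:
 assumes "openin X U" "closedin X Z" "Z <= U"
 shows "hvanish p (sub X U) (-Z) = hvanish p X (-Z)"
 using hvanish_transfer[OF excision_iso[OF assms]] .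

lemma linear_homotopic_with:
 assumes f: "continuous_map X (powertop_real UNIV) f" and g: "continuous_map X (powertop_real UNIV) g"
  and T: "!!t x. [|0 <= t; t <= 1; x : topspace X|] ==> (%i. (1 - t) * f x i + t * g x i) : T"
  and P: "!!t. [|0 <= t; t <= 1|] ==> P (%x i. (1 - t) * f x i + t * g x i)"
 shows "homotopic_with P X (sub (powertop_real UNIV) T) f g"
 unfolding homotopic_with_def
proof (intro exI conjI ballI allI)
 let ?h = "%(t, x). %i. (1 - t) * f x i + t * g x i"
 have "continuous_map (prod_topology (top_of_set {0..1::real}) X) euclideanreal (%y. (1 - fst y) * f (snd y) i + fst y * g (snd y) i)" for i
 proof -
  have a: "continuous_map (prod_topology (top_of_set {0..1::real}) X) euclideanreal fst"
   using continuous_map_fst continuous_map_into_fulltopology by blast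
  have b: "continuous_map (prod_topology (top_of_set {0..1::real}) X) euclideanreal (%y. f (snd y) i)"
   using continuous_map_compose[OF continuous_map_snd, of X euclideanreal "%x. f x i" "top_of_set {0..1::real}"] f
   by (simp add: continuous_map_componentwise_UNIV o_def)
  have c: "continuous_map (prod_topology (top_of_set {0..1::real}) X) euclideanreal (%y. g (snd y) i)"
   using continuous_map_compose[OF continuous_map_snd, of X euclideanreal "%x. g x i" "top_of_set {0..1::real}"] g
   by (simp add: continuous_map_componentwise_UNIV o_def)
  show ?thesis
   by (intro continuous_map_add continuous_map_real_mult continuous_map_diff a b c) simp
 qed
 then show "continuous_map (prod_topology (top_of_set {0..1}) X) (sub (powertop_real UNIV) T) ?h"
  using T by (auto simp: continuous_map_in_subtopology continuous_map_componentwise_UNIV case_prod_unfold Pi_iff)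
 show "?h (0, x) = f x" "?h (1, x) = g x" for x
  by auto
 show "P (%x. ?h (t, x))" if "t : {0..1}" for t
  using P that by simp
qed

lemma excision_iso':
 assumes "openin X (topspace X Int U)" "closedin X (topspace X Int Z)" "topspace X Int Z <= U"
 shows "hom_induced p (sub X U) (-Z) X (-Z) id
  : iso (rel_hom p (sub X U) (-Z)) (rel_hom p X (-Z))"
proof -
 let ?U = "topspace X Int U" let ?Z = "topspace X Int Z"
 have *: "hom_induced p (sub X ?U) (-?Z) X (-?Z) id
  : iso (rel_hom p (sub X ?U) (-?Z)) (rel_hom p X (-?Z))"
  using assms by (intro excision_iso) auto
 have 1: "topspace (sub X U) Int - ?Z = topspace (sub X U) Int - Z" "topspace X Int - ?Z = topspace X Int - Z"
  by auto
 have "rel_hom p (sub X U) (-?Z) = rel_hom p (sub X U) (-Z)"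
  by (metis relative_homology_group_restrict 1)
 moreover have "rel_hom p X (-?Z) = rel_hom p X (-Z)"
  by (metis relative_homology_group_restrict 1)
 moreover have "hom_induced p (sub X U) (-?Z) X (-?Z) id = hom_induced p (sub X U) (-Z) X (-Z) id"
  by (metis hom_induced_restrict 1)
 ultimately show ?thesis
  using * by (simp flip: subtopology_restrict[of X U])
qed

lemma hfree_restrict: "hfree p X (topspace X Int S) w = hfree p X S w"
 by (simp add: hfree_def)

text \<open>The faces of a simplex are the points with a vanishing barycentric coordinate, so its
  boundary lies in \<open>S\<close>.\<close>

lemma singular_relcycle_of_simplex:
 assumes f: "ssimp p X f"
  and S: "!!x k. [|x : stdx p; k <= p; x k = 0|] ==> f x : S"
 shows "relcycle p X S (frag_of f)"
proof -
 have "schain (p - 1) (sub X S) (bdry p (frag_of f))"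
 proof (cases "p = 0")
  case False
  have "ssimp (p - 1) (sub X S) (singular_face p k f)" if "k <= p" for k
  proof -
   have "f (simplical_face k x) : S" if "x : stdx (p - Suc 0)" for x
    using S[OF simplical_face_in_standard_simplex[OF _ \<open>k \<le> p\<close> that] \<open>k \<le> p\<close>] False
    by (simp add: simplical_face_def)
   then show ?thesis
    using singular_simplex_singular_face[OF f _ that] False
    by (auto simp: singular_simplex_subtopology singular_face_def)
  qed
  then show ?thesis
   using False by (auto simp: chain_boundary_of intro!: singular_chain_sum singular_chain_cmul simp: singular_chain_of)
 qed (simp add: chain_boundary_def)
 then show ?thesis
  using f by (simp add: singular_relcycle singular_chain_of)
qed

section \<open>The local homology of Euclidean space\<close>

definition Es :: "nat => (nat => real) set" where
 "Es n = {x. \<forall>i\<ge>n. x i = 0}"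

lemma Euclidean_space_eq: "Euc n = top_of_set (Es n)"
 by (simp add: Euclidean_space_def Es_def euclidean_product_topology)

lemma powertop_real_eq: "powertop_real UNIV = (euclidean :: (nat => real) topology)"
 by (simp add: euclidean_product_topology)

text \<open>The affine simplex with vertices \<open>-(e_0 + ... + e_(n-1))\<close>,
  \<open>e_0\<close>, ..., \<open>e_(n-1)\<close>. For \<open>n = 2c\<close> it is the simplex
  prescribed by \<open>normal_simplex\<close>, up to scaling and with real and imaginary parts
  interleaved.\<close>

definition std_simp :: "nat => (nat => real) => (nat => real)" where
 "std_simp n = (\<lambda>x\<in>stdx n. (%j. if j < n then x (Suc j) - x 0 else 0))"

lemma continuous_on_std_simp: "continuous_on (stdx n) (std_simp n)"
proof -
 have "continuous_on (stdx n) (%x. %j. if j < n then x (Suc j) - x 0 else 0)"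
 proof (rule continuous_on_coordinatewise_then_product)
  show "continuous_on (stdx n) (%x. if j < n then x (Suc j) - x 0 else 0)" for j
   by (cases "j < n") (auto intro!: continuous_intros continuous_on_product_coordinates intro: continuous_on_subset)
 qed
 then show ?thesis
  by (rule continuous_on_eq) (simp add: std_simp_def)
qed

lemma std_simp_simplex: "ssimp n (Euc n) (std_simp n)"
 unfolding singular_simplex_def Euclidean_space_eq powertop_real_eq
 using continuous_on_std_simp
 by (auto simp: std_simp_def Es_def)

text \<open>Only the barycentre is mapped to the origin, and it lies on no face.\<close>

lemma std_simp_zero:
 assumes "x : stdx n" "!!j. j < n ==> x (Suc j) = x 0" "k <= n" "x k = 0"
 shows False
proof -
 have "x i = x 0" if "i <= n" for i
  using that assms(2) by (cases i) auto
 then have "x i = 0" if "i <= n" for i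
  using that assms(3,4) by metis
 then have "(\<Sum>i\<le>n. x i) = 0" by simp
 then show False using assms(1) by (simp add: standard_simplex_def)
qed

lemma std_simp_nonzero:
 assumes "x : stdx n" "k <= n" "x k = 0"
 shows "std_simp n x ~= 0"
proof
 assume 0: "std_simp n x = 0"
 have "x (Suc j) = x 0" if "j < n" for j
  using fun_cong[OF 0, of j] that assms by (simp add: std_simp_def)
 then show False using std_simp_zero assms by blast
qed

lemma std_simp_relcycle: "relcycle n (Euc n) (-{0}) (frag_of (std_simp n))"
 by (rule singular_relcycle_of_simplex[OF std_simp_simplex]) (use std_simp_nonzero in auto)

lemma contractible_starlike:
 assumes "a : T" "!!x t. [|x : T; 0 <= t; t <= 1|] ==> (%i. (1 - t) * x i + t * a i) : T"
 shows "contractible_space (sub (powertop_real UNIV) T)"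
 unfolding contractible_space_def
proof
 show "homotopic_with (%x. True) (sub (powertop_real UNIV) T) (sub (powertop_real UNIV) T) id (%x. a)"
  by (rule linear_homotopic_with) (use assms in \<open>auto intro: continuous_map_from_subtopology\<close>)
qed

lemma open_coord_less: "open {y :: nat => real. y n < a}"
 by (intro open_Collect_less continuous_on_product_coordinates continuous_intros)

lemma open_coord_neq: "open {y :: nat => real. y n ~= a}"
 by (intro open_Collect_neq continuous_on_product_coordinates continuous_intros)

lemma closed_coord_eq: "closed {y :: nat => real. y n = a}"
 by (intro closed_Collect_eq continuous_on_product_coordinates continuous_intros)

lemma closed_coord_le: "closed {y :: nat => real. y n <= a}"
 by (intro closed_Collect_le continuous_on_product_coordinates continuous_intros)

context
 fixes n :: nat
begin

text \<open>The closed lower half of the last axis. Its complement is contractible, so the step from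
  dimension \<open>n\<close> to \<open>n + 1\<close> is the connecting map for the triple of the
  whole space, the complement of the origin and the complement of \<open>ray\<close>.\<close>

definition ray :: "(nat => real) set" where
 "ray = {y. (\<forall>j<n. y j = 0) & y n <= 0}"

text \<open>The complement of the opposite closed half-axis: an open neighbourhood of
  \<open>ray\<close> without the origin that contracts to a copy of \<open>n\<close>-space at height
  -1.\<close>

definition offray :: "(nat => real) set" where
 "offray = {y. y n < 0 | (\<exists>j<n. y j ~= 0)}"

lemma closed_ray: "closed ray"
proof -
 have "ray = (\<Inter>j\<in>{..<n}. {y. y j = 0}) Int {y. y n <= 0}"
  by (auto simp: ray_def)
 then show ?thesis
  using closed_coord_eq closed_coord_le by (metis closed_INT closed_Int)
qed

lemma open_offray: "open offray"
proof -
 have "offray = {y. y n < 0} Un (\<Union>j\<in>{..<n}. {y. y j ~= 0})"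
  by (auto simp: offray_def)
 then show ?thesis
  using open_coord_less open_coord_neq by (metis open_UN open_Un)
qed

text \<open>The complement of \<open>ray\<close> is starlike about the last basis vector
  \<open>?a\<close>, and a pair of nonempty contractible spaces has no relative homology.\<close>

lemma hvanish_off_ray: "hvanish p (Euc (Suc n)) (- ray)"
 unfolding hvanish_iff_trivial_group
proof (rule trivial_relative_homology_group_contractible_spaces)
 show "contractible_space (Euc (Suc n))" by simp
 let ?a = "(%i. if i = n then 1 else 0) :: nat => real"
 have a: "?a : Es (Suc n) Int - ray"
  by (auto simp: Es_def ray_def)
 then show "topspace (Euc (Suc n)) Int - ray ~= {}"
  by (auto simp: Euclidean_space_eq)
 have "contractible_space (sub (powertop_real UNIV) (Es (Suc n) Int - ray))"
 proof (rule contractible_starlike[OF a])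
  fix x :: "nat => real" and t :: real assume x: "x : Es (Suc n) Int - ray" and t: "0 <= t" "t <= 1"
  have "(%i. (1 - t) * x i + t * ?a i) ~: ray"
  proof (cases "t = 1")
   case True then show ?thesis by (auto simp: ray_def)
  next
   case False
   show ?thesis
   proof
    assume r: "(%i. (1 - t) * x i + t * ?a i) : ray"
    then have 1: "x j = 0" if "j < n" for j
     using that False by (auto simp: ray_def)
    have 2: "(1 - t) * x n + t <= 0" using r by (simp add: ray_def)
    have "x n > 0" using 1 x by (auto simp: ray_def)
    then have "(1 - t) * x n > 0" using False t by simp
    then show False using 2 t by linarith
   qed
  qed
  then show "(%i. (1 - t) * x i + t * ?a i) : Es (Suc n) Int - ray"
   using x by (auto simp: Es_def)
 qed
 then show "contractible_space (sub (Euc (Suc n)) (- ray))"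
  by (simp add: Euclidean_space_eq powertop_real_eq subtopology_subtopology)
qed

definition trunc :: "(nat => real) => nat => real" where
 "trunc y = (%j. if j < n then y j else 0)"

definition add_last :: "(nat => real) => nat => real" where
 "add_last y = (%j. if j < n then y j else if j = n then -1 else 0)"

lemma continuous_trunc: "continuous_on A trunc"
proof -
 have "continuous_on A (%y j. if j < n then y j else 0 :: real)"
 proof (rule continuous_on_coordinatewise_then_product)
  show "continuous_on A (%y. if j < n then y j else 0 :: real)" for j
   by (cases "j < n") (auto intro: continuous_on_product_coordinates continuous_on_subset)
 qed
 then show ?thesis by (simp add: trunc_def[abs_def])
qed

lemma continuous_add_last: "continuous_on A add_last"
proof -
 have "continuous_on A (%y j. if j < n then y j else if j = n then -1 else 0 :: real)"
 proof (rule continuous_on_coordinatewise_then_product)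
  show "continuous_on A (%y. if j < n then y j else if j = n then -1 else 0 :: real)" for j
   by (cases "j < n") (auto intro: continuous_on_product_coordinates continuous_on_subset)
 qed
 then show ?thesis by (simp add: add_last_def[abs_def])
qed

lemma trunc_in_Es: "trunc y : Es n"
 by (simp add: trunc_def Es_def)

lemma trunc_eq_0_iff: "trunc y = 0 \<longleftrightarrow> (\<forall>j<n. y j = 0)"
 unfolding trunc_def fun_eq_iff by (metis zero_fun_apply)

text \<open>The homotopy inverse is \<open>add_last\<close>. Its last coordinate -1 keeps points
  with vanishing first coordinates inside \<open>offray\<close>; and within \<open>offray\<close> a
  point is off \<open>ray\<close> exactly when one of its first \<open>n\<close> coordinates is
  nonzero, which the homotopies preserve.\<close>

lemma trunc_iso:
 "hom_induced p (sub (Euc (Suc n)) offray) (- ray) (Euc n) (- {0}) trunc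
 : iso (rel_hom p (sub (Euc (Suc n)) offray) (- ray))
    (rel_hom p (Euc n) (- {0}))"
proof -
 define Q where "Q = Es (Suc n) Int offray"
 have H: "sub (Euc (Suc n)) offray = top_of_set Q"
  by (simp add: Q_def Euclidean_space_eq subtopology_subtopology)
 have tH: "top_of_set Q = sub (powertop_real UNIV) Q" "top_of_set (Es n) = sub (powertop_real UNIV) (Es n)"
  by (simp_all add: powertop_real_eq)
 let ?S = "Q Int - ray" and ?T = "Es n Int - {0}"
 have S: "y : ?S \<longleftrightarrow> y : Es (Suc n) & (\<exists>j<n. y j ~= 0)" for y
  by (auto simp: Q_def offray_def ray_def)
 have T: "y : ?T \<longleftrightarrow> y : Es n & (\<exists>j<n. y j ~= 0)" for y
  unfolding Es_def by (auto simp: fun_eq_iff) (metis not_less)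
 have add_Q: "add_last y : Q" for y
  by (auto simp: Es_def add_last_def Q_def offray_def)
 have c1: "continuous_map (top_of_set Q) (top_of_set (Es n)) trunc"
  using continuous_trunc trunc_in_Es by auto
 have c2: "continuous_map (top_of_set (Es n)) (top_of_set Q) add_last"
  using continuous_add_last[of "Es n"] add_Q by auto
 have i1: "trunc : ?S \<rightarrow> ?T"
  unfolding Pi_iff Ball_def S T using trunc_in_Es by (auto simp: trunc_def)
 have i2: "add_last : ?T \<rightarrow> ?S"
  unfolding Pi_iff Ball_def S T by (auto simp: add_last_def Es_def)
 have h1: "homotopic_with (%h. h : ?S \<rightarrow> ?S) (top_of_set Q) (sub (powertop_real UNIV) Q) (add_last \<circ> trunc) id"
 proof (rule linear_homotopic_with)
  show "continuous_map (top_of_set Q) (powertop_real UNIV) (add_last \<circ> trunc)"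
   unfolding powertop_real_eq
   by (rule continuous_map_compose[OF continuous_map_into_fulltopology[OF c1]]) (simp add: continuous_add_last)
  have nz: "(1 - t) * (add_last \<circ> trunc) x j + t * id x j = x j" if "j < n" for t x j
   using that by (simp add: add_last_def trunc_def algebra_simps)
  have es: "(%i. (1 - t) * (add_last \<circ> trunc) x i + t * id x i) : Es (Suc n)" if "x : Es (Suc n)" for t x
   using that by (auto simp: Es_def add_last_def trunc_def)
  show "(%i. (1 - t) * (add_last \<circ> trunc) x i + t * id x i) : Q"
   if t: "0 <= t" "t <= 1" and x: "x : topspace (top_of_set Q)" for t x
  proof (cases "\<exists>j<n. x j ~= 0")
   case True
   then show ?thesis
    using es[of x t] x nz[of _ t x] by (auto simp: Q_def offray_def)
  next
   case False
   then have "x n < 0" using x by (auto simp: Q_def offray_def)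
   moreover have "(1 - t) * (add_last \<circ> trunc) x n + t * id x n = - (1 - t) + t * x n"
    by (simp add: add_last_def)
   moreover have "- (1 - t) + t * x n < 0"
   proof (cases "t = 1")
    case True then show ?thesis using \<open>x n < 0\<close> by simp
   next
    case False
    have "t * x n <= 0" using t \<open>x n < 0\<close> by (simp add: mult_nonneg_nonpos)
    then show ?thesis using False t by linarith
   qed
   ultimately have "(1 - t) * (add_last \<circ> trunc) x n + t * id x n < 0" by simp
   then show ?thesis
    using es[of x t] x unfolding Q_def offray_def by (simp del: o_apply)
  qed
  show "(%x i. (1 - t) * (add_last \<circ> trunc) x i + t * id x i) : ?S \<rightarrow> ?S"
   if t: "0 <= t" "t <= 1" for t
  proof
   fix x assume x: "x : ?S"
   then show "(%i. (1 - t) * (add_last \<circ> trunc) x i + t * id x i) : ?S"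
    using es[of x t] nz[of _ t x] unfolding S by auto
  qed
 qed (simp add: powertop_real_eq)
 have h2: "homotopic_with (%h. h : ?T \<rightarrow> ?T) (top_of_set (Es n)) (top_of_set (Es n)) (trunc \<circ> add_last) id"
 proof -
  have a: "(trunc \<circ> add_last) x = id x" if "x : topspace (top_of_set (Es n))" for x
   using that by (auto simp: Es_def trunc_def add_last_def fun_eq_iff)
  have b: "homotopic_with (%h. h : ?T \<rightarrow> ?T) (top_of_set (Es n)) (top_of_set (Es n)) id id"
   by auto
  show ?thesis
   by (rule homotopic_with_eq[OF b]) (use a in \<open>auto simp: Pi_iff\<close>)
 qed
 have iso: "hom_induced p (top_of_set Q) ?S (top_of_set (Es n)) ?T trunc
  : iso (rel_hom p (top_of_set Q) ?S) (rel_hom p (top_of_set (Es n)) ?T)"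
  by (rule homotopy_equivalence_relative_homology_group_isomorphism[OF c1 i1 c2 i2 _ h2])
   (use h1 in \<open>simp add: tH\<close>)
 then show ?thesis
  using hom_induced_restrict[of p "top_of_set Q" "-ray" "top_of_set (Es n)" "-{0}"]
   relative_homology_group_restrict[of p "top_of_set Q" "-ray"]
   relative_homology_group_restrict[of p "top_of_set (Es n)" "-{0}"]
  unfolding H Euclidean_space_eq[of n] by simp
qed

lemma excise_offray:
 "hom_induced p (sub (Euc (Suc n)) offray) (- ray)
   (sub (Euc (Suc n)) (- {0})) (- ray) id
 : iso (rel_hom p (sub (Euc (Suc n)) offray) (- ray))
   (rel_hom p (sub (Euc (Suc n)) (- {0})) (- ray))"
proof -
 let ?Y = "sub (Euc (Suc n)) (- {0})"
 have "0 ~: offray" by (simp add: offray_def)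
 then have "sub ?Y offray = sub (Euc (Suc n)) offray"
  unfolding subtopology_subtopology by (metis Int_absorb1 Compl_iff singletonD subsetI)
 moreover have "hom_induced p (sub ?Y offray) (- ray) ?Y (- ray) id
 : iso (rel_hom p (sub ?Y offray) (- ray)) (rel_hom p ?Y (- ray))"
 proof (rule excision_iso')
  have Y: "?Y = top_of_set (Es (Suc n) Int - {0})"
   by (simp add: Euclidean_space_eq subtopology_subtopology)
  show "openin ?Y (topspace ?Y Int offray)"
   unfolding Y using open_offray by (simp add: openin_open_Int)
  show "closedin ?Y (topspace ?Y Int ray)"
   unfolding Y using closed_ray by (simp add: closedin_closed_Int)
  show "topspace ?Y Int ray <= offray"
  proof
   fix y assume y: "y : topspace ?Y Int ray"
   then have "y j = 0" if "j ~= n" for j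
    using that by (cases "j < n") (auto simp: Y Es_def ray_def)
   moreover have "y ~= 0" using y by simp
   ultimately have "y n ~= 0" by (metis ext zero_fun_def)
   then show "y : offray" using y by (auto simp: ray_def offray_def)
  qed
 qed
 ultimately show ?thesis by simp
qed

end

text \<open>The connecting map, excision to \<open>offray\<close> and \<open>trunc\<close> identify
  degree \<open>p + 1\<close> in dimension \<open>n + 1\<close> with degree \<open>p\<close> in
  dimension \<open>n\<close>. Of the faces of the simplex only the last one meets
  \<open>ray\<close>, and \<open>trunc\<close> maps it to the simplex one dimension below.\<close>

theorem euclidean_local_homology:
 "(\<forall>p. p ~= n --> hvanish p (Euc n) (-{0})) &
 hfree n (Euc n) (-{0}) (frag_of (std_simp n))"
proof (induction n)
 case 0
 have t: "topspace (Euc 0) = {0}"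
  by (auto simp: Euclidean_space_eq Es_def fun_eq_iff)
 then have e: "topspace (Euc 0) Int - {0} = {}" by auto
 have "hvanish p (Euc 0) (-{0})" if "p ~= 0" for p
 proof -
  have "hvanish p (Euc 0) {}"
   unfolding hvanish_iff_trivial_group using homology_dimension_axiom[OF t] that by simp
  then show ?thesis by (metis e hvanish_restrict)
 qed
 moreover have "hfree 0 (Euc 0) (-{0}) (frag_of (std_simp 0))"
 proof -
  have s: "std_simp 0 = restrict (%x. 0) (stdx 0)"
   by (auto simp: std_simp_def fun_eq_iff restrict_def)
  have "hfree 0 (Euc 0) {} (frag_of (std_simp 0))"
   unfolding hfree_def
  proof (intro conjI allI impI)
   show "relcycle 0 (Euc 0) {} (frag_of (std_simp 0))"
    using std_simp_relcycle[of 0] by (metis e singular_relcycle_restrict)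
   show "\<exists>a. homrel 0 (Euc 0) {} z (frag_cmul a (frag_of (std_simp 0)))"
    if "relcycle 0 (Euc 0) {} z" for z
    using that unfolding singular_cycle_singleton[OF t] singular_chain_singleton[OF t] s
    by (metis homologous_rel_refl)
   show "a = 0" if "relboundary 0 (Euc 0) {} (frag_cmul a (frag_of (std_simp 0)))" for a
    using that unfolding singular_boundary_singleton[OF t] by simp
  qed
  then show ?thesis by (metis e hfree_restrict)
 qed
 ultimately show ?case by blast
next
 case (Suc n)
 let ?X = "Euc (Suc n)" and ?H = "sub (Euc (Suc n)) (offray n)"
 let ?Y = "sub (Euc (Suc n)) (- {0})"
 let ?T = "- ray n" and ?S = "- {0} :: (nat => real) set"
 have TS: "?T <= ?S" by (auto simp: ray_def)
 have step: "hvanish p ?Y ?T \<longleftrightarrow> hvanish p (Euc n) (-{0})" for p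
  using hvanish_transfer[OF excise_offray[of "int p" n]] hvanish_transfer[OF trunc_iso[of "int p" n]] by blast
 have "hvanish p ?X ?S" if "p ~= Suc n" for p
 proof (cases p)
  case 0
  then show ?thesis
   using hvanish_triple'[OF TS hvanish_off_ray] by blast
 next
  case (Suc q)
  then have "q ~= n" using that by blast
  then have "hvanish q ?Y ?T" using step Suc.IH by blast
  then show ?thesis
   using hvanish_connecting[OF TS hvanish_off_ray] Suc by blast
 qed
 moreover have "hfree (Suc n) ?X ?S (frag_of (std_simp (Suc n)))"
 proof (rule hfree_connecting[OF TS hvanish_off_ray hvanish_off_ray std_simp_relcycle])
  let ?f = "%k. singular_face (Suc n) k (std_simp (Suc n))"
  let ?F = "?f (Suc n)"
  have face: "?f k x = std_simp (Suc n) (simplical_face k x)" "simplical_face k x : stdx (Suc n)"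
   if "x : stdx n" "k <= Suc n" for k x
   using that simplical_face_in_standard_simplex[of "Suc n" k x] by (auto simp: singular_face_def)
  have fs: "ssimp n ?X (?f k)" if "k <= Suc n" for k
   using singular_simplex_singular_face[OF std_simp_simplex, of "Suc n" k] that by simp
  have off: "?f k x ~: ray n" if x: "x : stdx n" and k: "k <= n" for k x
  proof
   let ?x = "simplical_face k x"
   assume r: "?f k x : ray n"
   have k': "k <= Suc n" using k by simp
   have 1: "?x (Suc j) = ?x 0" if "j < n" for j
    using r face[OF x k'] that by (auto simp: ray_def std_simp_def)
   have 2: "?x (Suc n) <= ?x 0"
    using r face[OF x k'] by (auto simp: ray_def std_simp_def)
   have kz: "?x k = 0" by (simp add: simplical_face_def)
   have "?x i = ?x 0" if "i <= n" for i
    using 1 that by (cases i) auto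
   then have z: "?x i = 0" if "i <= n" for i
    using that kz k by metis
   then have "?x (Suc n) <= 0" using 2 by simp
   then have "(\<Sum>i\<le>Suc n. ?x i) <= 0"
    using z by (simp add: sum_nonpos)
   then show False
    using face(2)[OF x k'] by (simp add: standard_simplex_def)
  qed
  have FH: "ssimp n ?H ?F"
  proof -
   have "?F x : offray n" if x: "x : stdx n" for x
   proof (rule ccontr)
    assume c: "?F x ~: offray n"
    have F: "?F x j = x (Suc j) - x 0" if "j < n" for j
     using that face[OF x, of "Suc n"] by (simp add: std_simp_def simplical_face_def)
    have Fn: "?F x n = - x 0"
     using face[OF x, of "Suc n"] by (simp add: std_simp_def simplical_face_def)
    have "x (Suc j) = x 0" if "j < n" for j
     using c F[OF that] that by (auto simp: offray_def)
    moreover have "x 0 = 0"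
     using c Fn x by (auto simp: offray_def standard_simplex_def intro: antisym)
    ultimately show False using std_simp_zero[OF x] by blast
   qed
   then show ?thesis using fs by (auto simp: singular_simplex_subtopology)
  qed
  have dF: "simplex_map n (trunc n) ?F = std_simp n"
  proof
   fix x
   show "simplex_map n (trunc n) ?F x = std_simp n x"
    using face[of x "Suc n"]
    by (auto simp: simplex_map_def trunc_def std_simp_def simplical_face_def restrict_def fun_eq_iff)
  qed
  have nz: "?F x ~: ray n" if "x : stdx n" "k <= n" "x k = 0" for x k
  proof
   assume r: "?F x : ray n"
   have "x (Suc j) = x 0" if "j < n" for j
    using r face[OF \<open>x \<in> standard_simplex n\<close>, of "Suc n"] that by (auto simp: ray_def std_simp_def simplical_face_def)
   then show False using std_simp_zero that by blast
  qed
  have Fc: "relcycle n ?H ?T (frag_of ?F)"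
   by (rule singular_relcycle_of_simplex[OF FH]) (use nz in auto)
  have contd: "continuous_map ?H (Euc n) (trunc n)" "trunc n : topspace ?H Int ?T \<rightarrow> - {0}"
   using continuous_trunc[of _ n] trunc_in_Es[of n]
   by (auto simp: Euclidean_space_eq subtopology_subtopology trunc_eq_0_iff ray_def offray_def)
  have "hfree n (Euc n) (-{0}) (chain_map n (trunc n) (frag_of ?F))"
   unfolding chain_map_of dF using Suc.IH by blast
  then have "hfree n ?H ?T (frag_of ?F)"
   using hfree_transfer[OF trunc_iso contd Fc] by blast
  moreover have contid: "continuous_map ?H ?Y id"
   by (auto simp: Euclidean_space_eq subtopology_subtopology offray_def)
  ultimately have "hfree n ?Y ?T (chain_map n id (frag_of ?F))"
   using hfree_transfer[OF excise_offray _ _ Fc] by auto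
  then have hF: "hfree n ?Y ?T (frag_of ?F)"
   using chain_map_ident[of n ?H "frag_of ?F"] FH by (simp add: singular_chain_of)
  \<comment> \<open>The last face enters the boundary with the sign \<open>(-1) ^ Suc n\<close>, and
    a generator remains one under a change of sign.\<close>
  then have hF': "hfree n ?Y ?T (frag_cmul ((-1) ^ Suc n) (frag_of ?F))"
   using hfree_minus[OF hF] by (cases "even n") auto
  have "bdry (Suc n) (frag_of (std_simp (Suc n)))
    = (\<Sum>k\<le>n. frag_cmul ((-1) ^ k) (frag_of (?f k))) + frag_cmul ((-1) ^ Suc n) (frag_of ?F)"
   by (simp only: chain_boundary_of) simp
  moreover have "schain n (sub ?Y ?T) (\<Sum>k\<le>n. frag_cmul ((-1) ^ k) (frag_of (?f k)))"
  proof (intro singular_chain_sum singular_chain_cmul)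
   fix k assume "k : {..n}"
   then show "schain n (sub ?Y ?T) (frag_of (?f k))"
    using fs[of k] off[of _ k] TS
    by (auto simp: singular_chain_of subtopology_subtopology singular_simplex_subtopology Int_absorb1)
  qed
  ultimately have "homrel n ?Y ?T (frag_cmul ((-1) ^ Suc n) (frag_of ?F)) (bdry (Suc n) (frag_of (std_simp (Suc n))))"
   by (subst homologous_rel_sym) (simp add: homologous_rel_def singular_chain_imp_relboundary)
  with hF' show "hfree n ?Y ?T (bdry (Suc n) (frag_of (std_simp (Suc n))))"
   using hfree_cong by blast
 qed
 ultimately show ?case by blast
qed

section \<open>Coordinate subspaces of open subsets of Euclidean space\<close>

lemma homotopic_pair_homologous:
 assumes h: "homotopic_with (%h. h : topspace X Int S \<rightarrow> T) X Y f g" and c: "relcycle p X S c"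
 shows "homrel p Y T (chain_map p f c) (chain_map p g c)"
 using homotopic_imp_homologous_rel_chain_maps[OF h] c by simp

lemma scaled_std_simp_homologous:
 assumes "r > 0"
 shows "homrel n (Euc n) (-{0}) (frag_of (std_simp n))
  (frag_of (\<lambda>x\<in>stdx n. %j. if j < n then r * (x (Suc j) - x 0) else 0))"
proof -
 let ?s = "%(y :: nat => real) j. r * y j"
 let ?E = "Euc n"
 have E: "?E = sub (powertop_real UNIV) (Es n)"
  by (simp add: Euclidean_space_eq powertop_real_eq)
 have pos: "(1 - t) * 1 + t * r > 0" if "0 <= t" "t <= 1" for t
 proof (cases "t = 0")
  case False
  then have "t * r > 0" using assms that by simp
  then show ?thesis using that by (simp add: add_nonneg_pos)
 qed simp
 have ev: "(1 - t) * id x i + t * (r * x i) = ((1 - t) * 1 + t * r) * x i" for t i and x :: "nat => real"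
  by (simp add: algebra_simps)
 have "homotopic_with (%h. h : topspace ?E Int -{0} \<rightarrow> -{0}) ?E (sub (powertop_real UNIV) (Es n)) id ?s"
 proof (rule linear_homotopic_with)
  show "continuous_map ?E (powertop_real UNIV) ?s"
   unfolding Euclidean_space_eq powertop_real_eq
   by (auto intro!: continuous_on_coordinatewise_then_product continuous_intros continuous_on_product_coordinates intro: continuous_on_subset)
  show "(%i. (1 - t) * id x i + t * (r * x i)) : Es n" if "0 <= t" "t <= 1" "x : topspace ?E" for t x
   using that by (simp add: Euclidean_space_eq Es_def)
  show "(%x i. (1 - t) * id x i + t * (r * x i)) : topspace ?E Int -{0} \<rightarrow> -{0}" if t: "0 <= t" "t <= 1" for t
  proof
   fix x assume x: "x : topspace ?E Int - {0}"
   then obtain i where "x i ~= 0" by (auto simp: fun_eq_iff)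
   then have "(1 - t) * id x i + t * (r * x i) ~= 0"
    unfolding ev using pos[OF t] by simp
   then show "(%i. (1 - t) * id x i + t * (r * x i)) : - {0}"
    by (auto simp: fun_eq_iff)
  qed
 qed (simp add: Euclidean_space_eq powertop_real_eq)
 then have "homrel n ?E (-{0}) (chain_map n id (frag_of (std_simp n))) (chain_map n ?s (frag_of (std_simp n)))"
  using homotopic_pair_homologous std_simp_relcycle E by metis
 moreover have "chain_map n id (frag_of (std_simp n)) = frag_of (std_simp n)"
  using chain_map_ident std_simp_simplex singular_chain_of by blast
 moreover have "simplex_map n ?s (std_simp n) = (\<lambda>x\<in>stdx n. %j. if j < n then r * (x (Suc j) - x 0) else 0)"
  by (auto simp: simplex_map_def std_simp_def fun_eq_iff restrict_def)
 ultimately show ?thesis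
  by (metis chain_map_of)
qed

lemma scaled_std_simp_free:
 assumes "r > 0"
 shows "hfree n (Euc n) (-{0})
  (frag_of (\<lambda>x\<in>stdx n. %j. if j < n then r * (x (Suc j) - x 0) else 0))"
 using hfree_cong[OF conjunct2[OF euclidean_local_homology] scaled_std_simp_homologous[OF assms]] .

section \<open>Open sets relative to the complement of a coordinate subspace\<close>

definition Lsub :: "nat => (nat => real) set" where
 "Lsub n = {y. \<forall>j<n. y j = 0}"

text \<open>\<open>std_simp\<close> scaled by \<open>r\<close> in the first \<open>n\<close>
  coordinates, the others being fixed as in \<open>p\<close>. For \<open>p\<close> in
  \<open>Lsub n\<close> this is a simplex through \<open>p\<close> normal to
  \<open>Lsub n\<close>.\<close>

definition nsm :: "nat => (nat => real) => real => (nat => real) => (nat => real)" where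
 "nsm n p r = (\<lambda>x\<in>stdx n. %j. if j < n then r * (x (Suc j) - x 0) else p j)"

text \<open>Boxes with separate bounds for each coordinate are closed under intersection, as the
  Mayer-Vietoris induction requires.\<close>

definition box :: "nat => (nat => real) => (nat => real) => (nat => real) set" where
 "box N lo hi = {y : Es N. \<forall>j<N. lo j < y j & y j < hi j}"

lemma box_Int: "box N lo hi Int box N lo' hi' = box N (%j. max (lo j) (lo' j)) (%j. min (hi j) (hi' j))"
 by (auto simp: box_def)

lemma openin_box: "openin (Euc N) (box N lo hi)"
proof -
 have "box N lo hi = Es N Int (\<Inter>j\<in>{..<N}. {y. lo j < y j} Int {y. y j < hi j})"
  by (auto simp: box_def)
 moreover have "open (\<Inter>j\<in>{..<N}. {y. lo j < y j} Int {y. y j < hi j})"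
  by (intro open_INT ballI open_Int open_Collect_less continuous_on_product_coordinates continuous_intros) auto
 ultimately show ?thesis
  unfolding Euclidean_space_eq by (simp only: openin_open_Int)
qed

lemma box_neighbourhood:
 assumes O: "openin (Euc N) O'" and y: "y : O'"
 obtains lo hi where "y : box N lo hi" "box N lo hi <= O'"
proof -
 obtain T where T: "open T" "O' = Es N Int T"
  using O unfolding Euclidean_space_eq openin_open by blast
 have "openin (powertop_real UNIV) T" "y : T"
  using T y by (auto simp: powertop_real_eq)
 then obtain X where X: "y : (\<Pi>\<^sub>E i\<in>UNIV. X i)" "!!i. open (X i)" "(\<Pi>\<^sub>E i\<in>UNIV. X i) <= T"
  using product_topology_open_contains_basis[of "%_. euclideanreal" UNIV T y] by auto
 have "\<exists>e>0. \<forall>s. \<bar>s - y i\<bar> < e --> s : X i" for i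
 proof -
  have "y i : X i" using X(1) by auto
  then show ?thesis using X(2)[of i] unfolding open_dist by (auto simp: dist_real_def)
 qed
 then obtain e where e: "!!i. e i > 0" "!!i s. \<bar>s - y i\<bar> < e i ==> s : X i"
  by metis
 let ?lo = "%i. y i - e i" and ?hi = "%i. y i + e i"
 have "y : box N ?lo ?hi"
  using y T e by (auto simp: box_def)
 moreover have "box N ?lo ?hi <= O'"
 proof
  fix w assume w: "w : box N ?lo ?hi"
  have "w i : X i" for i
  proof (cases "i < N")
   case True
   then have "y i - e i < w i & w i < y i + e i" using w by (simp add: box_def)
   then have "\<bar>w i - y i\<bar> < e i" by linarith
   then show ?thesis using e by blast
  next
   case False
   then have "w i = y i" using w y T by (auto simp: box_def Es_def)
   then show ?thesis using e(1)[of i] e(2)[of "y i" i] by simp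
  qed
  then have "w : (\<Pi>\<^sub>E i\<in>UNIV. X i)" by auto
  then show "w : O'" using X(3) w T by (auto simp: box_def)
 qed
 ultimately show ?thesis using that by blast
qed

lemma box_convex:
 assumes "x : box N lo hi" "y : box N lo hi" "0 <= t" "t <= 1"
 shows "(%i. (1 - t) * x i + t * y i) : box N lo hi"
proof -
 have "lo j < (1 - t) * x j + t * y j & (1 - t) * x j + t * y j < hi j" if "j < N" for j
 proof -
  have "convex {lo j<..<hi j}" by simp
  then show ?thesis
   using convexD_alt[of "{lo j<..<hi j}" "x j" "y j" t] assms that by (simp add: box_def)
 qed
 then show ?thesis using assms by (simp add: box_def Es_def)
qed

text \<open>The projection to the first \<open>n\<close> coordinates has a homotopy inverse of pairs
  \<open>g\<close>, which shrinks \<open>n\<close>-space into the box and takes the remaining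
  coordinates from \<open>q\<close>. Convexity of the box provides the homotopies.\<close>

lemma box_iso:
 assumes nN: "n <= N" and q: "q : box N lo hi Int Lsub n"
 shows "hom_induced p (top_of_set (box N lo hi)) (- Lsub n) (Euc n) (- {0}) (trunc n)
 : iso (rel_hom p (top_of_set (box N lo hi)) (- Lsub n))
    (rel_hom p (Euc n) (- {0}))"
proof -
 define B where "B = box N lo hi"
 have qb: "lo j < 0" "0 < hi j" "q j = 0" if "j < n" for j
  using q that nN by (auto simp: box_def Lsub_def) (metis order_less_le_trans)+
 \<comment> \<open>The least distance from 0 to the sides in the first \<open>n\<close> directions.
   The inserted 1 keeps the set nonempty for \<open>n = 0\<close>.\<close>
 define d where "d = Min (insert 1 ((%j. min (- lo j) (hi j)) ` {..<n}))"
 have d0: "d > 0" unfolding d_def using qb by (subst Min_gr_iff) auto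
 have dl: "d <= - lo j" "d <= hi j" if "j < n" for j
 proof -
  have "d <= min (- lo j) (hi j)" unfolding d_def using that by (intro Min_le) auto
  then show "d <= - lo j" "d <= hi j" by auto
 qed
 \<comment> \<open>A positive continuous factor that brings all coordinates of \<open>v\<close>
   below \<open>d\<close>.\<close>
 define \<rho> where "\<rho> = (%v :: nat => real. d / (1 + (\<Sum>j<n. \<bar>v j\<bar>)))"
 have den: "1 + (\<Sum>j<n. \<bar>v j\<bar>) > 0" for v :: "nat => real"
  by (smt (verit) sum_nonneg abs_ge_zero)
 have \<rho>0: "\<rho> v > 0" for v
  unfolding \<rho>_def using den d0 by simp
 have \<rho>l: "\<bar>\<rho> v * v j\<bar> < d" if "j < n" for v j
 proof -
  have "\<bar>v j\<bar> <= (\<Sum>j<n. \<bar>v j\<bar>)" using that by (intro member_le_sum) auto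
  then have "\<bar>v j\<bar> < 1 + (\<Sum>j<n. \<bar>v j\<bar>)" by simp
  then have "d * \<bar>v j\<bar> < d * (1 + (\<Sum>j<n. \<bar>v j\<bar>))" using d0 by simp
  then have "d * \<bar>v j\<bar> / (1 + (\<Sum>j<n. \<bar>v j\<bar>)) < d" using den[of v] by (simp add: pos_divide_less_eq)
  moreover have "\<bar>\<rho> v * v j\<bar> = d * \<bar>v j\<bar> / (1 + (\<Sum>j<n. \<bar>v j\<bar>))"
   unfolding \<rho>_def using d0 den[of v] by (simp add: abs_mult)
  ultimately show ?thesis by simp
 qed
 have \<rho>c: "continuous_on A \<rho>" for A
  unfolding \<rho>_def
  using den by (intro continuous_intros continuous_on_subset[OF continuous_on_product_coordinates]) (auto simp: less_imp_neq[THEN not_sym])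
 define g where "g = (%v j. if j < n then \<rho> v * v j else q j)"
 have gB: "g v : B" for v
 proof -
  have "lo j < g v j & g v j < hi j" if "j < N" for j
   using that \<rho>l[of j v] dl[of j] q by (cases "j < n") (auto simp: g_def box_def abs_less_iff)
  moreover have "g v : Es N"
   using q nN by (auto simp: g_def Es_def box_def)
  ultimately show ?thesis by (simp add: B_def box_def)
 qed
 have gc: "continuous_on A g" for A
 proof -
  have "continuous_on A (%v j. if j < n then \<rho> v * v j else q j)"
  proof (rule continuous_on_coordinatewise_then_product)
   show "continuous_on A (%v. if j < n then \<rho> v * v j else q j)" for j
    by (cases "j < n") (auto intro!: continuous_intros \<rho>c continuous_on_subset[OF continuous_on_product_coordinates])
  qed
  then show ?thesis by (simp add: g_def[abs_def])
 qed
 let ?S = "B Int - Lsub n" and ?T = "Es n Int - {0}"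
 have S: "y : ?S \<longleftrightarrow> y : B & (\<exists>j<n. y j ~= 0)" for y
  by (auto simp: Lsub_def)
 have T: "y : ?T \<longleftrightarrow> y : Es n & (\<exists>j<n. y j ~= 0)" for y
  unfolding Es_def by (auto simp: fun_eq_iff) (metis not_less)
 have c1: "continuous_map (top_of_set B) (top_of_set (Es n)) (trunc n)"
  using continuous_trunc[of _ n] trunc_in_Es[of n] by auto
 have c2: "continuous_map (top_of_set (Es n)) (top_of_set B) g"
  using gc gB by auto
 have i1: "trunc n : ?S \<rightarrow> ?T"
  unfolding Pi_iff Ball_def S T using trunc_in_Es[of n] by (auto simp: trunc_def)
 have i2: "g : ?T \<rightarrow> ?S"
  unfolding Pi_iff Ball_def S T using gB \<rho>0 by (auto simp: g_def less_imp_neq[THEN not_sym])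
 have pos: "(1 - t) * \<rho> v + t * 1 > 0" if "0 <= t" "t <= 1" for t v
 proof (cases "t = 1")
  case False
  then have "(1 - t) * \<rho> v > 0" using \<rho>0 that by simp
  then show ?thesis using that by (simp add: add_pos_nonneg)
 qed simp
 have h1: "homotopic_with (%h. h : ?S \<rightarrow> ?S) (top_of_set B) (sub (powertop_real UNIV) B) (g \<circ> trunc n) id"
 proof (rule linear_homotopic_with)
  show "continuous_map (top_of_set B) (powertop_real UNIV) (g \<circ> trunc n)"
   unfolding powertop_real_eq
   using continuous_map_compose[OF c1 c2] continuous_map_into_fulltopology by blast
  show cv: "(%i. (1 - t) * (g \<circ> trunc n) x i + t * id x i) : B"
   if t: "0 <= t" "t <= 1" and x: "x : topspace (top_of_set B)" for t x
   using box_convex[of "g (trunc n x)" N lo hi x t] that gB[of "trunc n x"] by (simp add: B_def)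
  show "(%x i. (1 - t) * (g \<circ> trunc n) x i + t * id x i) : ?S \<rightarrow> ?S"
   if t: "0 <= t" "t <= 1" for t
  proof
   fix x assume x: "x : ?S"
   then obtain j where j: "j < n" "x j ~= 0" unfolding S by blast
   have "(1 - t) * (g \<circ> trunc n) x j + t * id x j = ((1 - t) * \<rho> (trunc n x) + t * 1) * x j"
    using j by (simp add: g_def trunc_def algebra_simps)
   also have "... ~= 0" using pos[OF t, of "trunc n x"] j by simp
   finally show "(%i. (1 - t) * (g \<circ> trunc n) x i + t * id x i) : ?S"
    unfolding S using cv[OF t, of x] x j(1) by (auto simp del: o_apply)
  qed
 qed (simp add: powertop_real_eq)
 have h2: "homotopic_with (%h. h : ?T \<rightarrow> ?T) (top_of_set (Es n)) (sub (powertop_real UNIV) (Es n)) (trunc n \<circ> g) id"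
 proof (rule linear_homotopic_with)
  show "continuous_map (top_of_set (Es n)) (powertop_real UNIV) (trunc n \<circ> g)"
   unfolding powertop_real_eq
   using continuous_map_compose[OF c2 c1] continuous_map_into_fulltopology by blast
  show cv: "(%i. (1 - t) * (trunc n \<circ> g) x i + t * id x i) : Es n"
   if t: "0 <= t" "t <= 1" and x: "x : topspace (top_of_set (Es n))" for t x
   using x by (auto simp: Es_def trunc_def)
  show "(%x i. (1 - t) * (trunc n \<circ> g) x i + t * id x i) : ?T \<rightarrow> ?T"
   if t: "0 <= t" "t <= 1" for t
  proof
   fix x assume x: "x : ?T"
   then obtain j where j: "j < n" "x j ~= 0" unfolding T by blast
   have "(1 - t) * (trunc n \<circ> g) x j + t * id x j = ((1 - t) * \<rho> x + t * 1) * x j"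
    using j by (simp add: g_def trunc_def algebra_simps)
   also have "... ~= 0" using pos[OF t, of x] j by simp
   finally show "(%i. (1 - t) * (trunc n \<circ> g) x i + t * id x i) : ?T"
    unfolding T using cv[OF t, of x] x j(1) by (auto simp del: o_apply)
  qed
 qed (simp add: powertop_real_eq)
 have iso: "hom_induced p (top_of_set B) ?S (top_of_set (Es n)) ?T (trunc n)
  : iso (rel_hom p (top_of_set B) ?S) (rel_hom p (top_of_set (Es n)) ?T)"
  by (rule homotopy_equivalence_relative_homology_group_isomorphism[OF c1 i1 c2 i2])
   (use h1 h2 in \<open>simp_all add: powertop_real_eq\<close>)
 then show ?thesis
  using hom_induced_restrict[of p "top_of_set B" "- Lsub n" "top_of_set (Es n)" "-{0}"]
   relative_homology_group_restrict[of p "top_of_set B" "- Lsub n"]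
   relative_homology_group_restrict[of p "top_of_set (Es n)" "-{0}"]
  by (simp add: B_def Euclidean_space_eq)
qed

lemma nsm_simplex:
 assumes "n <= N" "q : Es N"
 shows "ssimp n (Euc N) (nsm n q r)"
proof -
 have "continuous_on (stdx n) (%x. %j. if j < n then r * (x (Suc j) - x 0) else q j)"
 proof (rule continuous_on_coordinatewise_then_product)
  show "continuous_on (stdx n) (%x. if j < n then r * (x (Suc j) - x 0) else q j)" for j
   by (cases "j < n") (auto intro!: continuous_intros continuous_on_product_coordinates intro: continuous_on_subset)
 qed
 then have "continuous_on (stdx n) (nsm n q r)"
  by (rule continuous_on_eq) (simp add: nsm_def)
 then show ?thesis
  unfolding singular_simplex_def Euclidean_space_eq powertop_real_eq
  using assms by (auto simp: nsm_def Es_def)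
qed

lemma nsm_off:
 assumes "x : stdx n" "k <= n" "x k = 0" "r > 0"
 shows "nsm n q r x ~: Lsub n"
proof
 assume 0: "nsm n q r x : Lsub n"
 have "x (Suc j) = x 0" if "j < n" for j
  using 0 that assms by (auto simp: nsm_def Lsub_def)
 then show False using std_simp_zero assms by blast
qed

lemma nsm_free_box:
 assumes nN: "n <= N" and q: "q : box N lo hi Int Lsub n" and r: "r > 0"
  and im: "nsm n q r ` stdx n <= box N lo hi"
 shows "hfree n (top_of_set (box N lo hi)) (- Lsub n) (frag_of (nsm n q r))"
proof -
 let ?B = "box N lo hi"
 have tB: "top_of_set ?B = sub (Euc N) ?B"
  by (auto simp: Euclidean_space_eq subtopology_subtopology box_def intro: arg_cong[where f=top_of_set])
 have ns: "ssimp n (top_of_set ?B) (nsm n q r)"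
  unfolding tB singular_simplex_subtopology
  using nsm_simplex[OF nN, of q r] q im by (simp add: box_def)
 have rc: "relcycle n (top_of_set ?B) (- Lsub n) (frag_of (nsm n q r))"
  by (rule singular_relcycle_of_simplex[OF ns]) (use nsm_off r in auto)
 have c: "continuous_map (top_of_set ?B) (Euc n) (trunc n)"
  "trunc n : topspace (top_of_set ?B) Int - Lsub n \<rightarrow> - {0}"
  using continuous_trunc[of _ n] trunc_in_Es[of n]
  by (auto simp: Euclidean_space_eq trunc_eq_0_iff Lsub_def)
 have "simplex_map n (trunc n) (nsm n q r) = (\<lambda>x\<in>stdx n. %j. if j < n then r * (x (Suc j) - x 0) else 0)"
  by (auto simp: simplex_map_def nsm_def trunc_def fun_eq_iff restrict_def)
 then have "hfree n (Euc n) (-{0}) (chain_map n (trunc n) (frag_of (nsm n q r)))"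
  using scaled_std_simp_free[OF r, of n] by simp
 then show ?thesis
  using hfree_transfer[OF box_iso[OF nN q] c rc] by blast
qed

text \<open>Arbitrarily small radii are demanded because the simplices have to fit into arbitrarily
  small boxes.\<close>

definition normal_rich :: "nat => (nat => real) set => ((nat => real) => (nat => real)) set => bool" where
 "normal_rich n A G \<longleftrightarrow> (\<forall>q\<in>A Int Lsub n. \<forall>\<delta>>0. \<exists>r. 0 < r & r < \<delta> & nsm n q r : G)"

text \<open>The property carried through the Mayer-Vietoris induction. It asks for generators and
  not for a basis: an open set may meet \<open>Lsub n\<close> in many components, and generation is
  what passes to unions.\<close>

definition local_model :: "nat => (nat => real) set => ((nat => real) => (nat => real)) set => bool" where
 "local_model n A G \<longleftrightarrow> (\<forall>p<n. hvanish p (top_of_set A) (- Lsub n)) & hgen n (top_of_set A) (- Lsub n) G"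

lemma local_model_box:
 assumes nN: "n <= N" and G: "normal_rich n (box N lo hi) G"
 shows "local_model n (box N lo hi) G"
proof (cases "box N lo hi Int Lsub n = {}")
 case True
 then have "topspace (top_of_set (box N lo hi)) Int - Lsub n = topspace (top_of_set (box N lo hi))"
  by auto
 then have "hvanish p (top_of_set (box N lo hi)) (- Lsub n)" for p
  unfolding hvanish_iff_trivial_group
  by (metis relative_homology_group_restrict trivial_relative_homology_group_topspace)
 then show ?thesis
  unfolding local_model_def hgen_def hvanish_def homologous_rel_def
  by (metis diff_zero empty_subsetI keys_zero)
next
 case False
 then obtain q where q: "q : box N lo hi Int Lsub n" by blast
 have qb: "lo j < 0" "0 < hi j" if "j < n" for j
  using q that nN by (auto simp: box_def Lsub_def) (metis order_less_le_trans)+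
 define d where "d = Min (insert 1 ((%j. min (- lo j) (hi j)) ` {..<n}))"
 have d0: "d > 0" unfolding d_def using qb by (subst Min_gr_iff) auto
 have dl: "d <= - lo j" "d <= hi j" if "j < n" for j
 proof -
  have "d <= min (- lo j) (hi j)" unfolding d_def using that by (intro Min_le) auto
  then show "d <= - lo j" "d <= hi j" by auto
 qed
 obtain r where r: "0 < r" "r < d" "nsm n q r : G"
  using G q d0 unfolding normal_rich_def by blast
 have im: "nsm n q r ` stdx n <= box N lo hi"
 proof
  fix y assume "y : nsm n q r ` stdx n"
  then obtain x where x: "x : stdx n" "y = nsm n q r x" by blast
  have "\<bar>x i - x 0\<bar> <= 1" for i
   using x(1) unfolding standard_simplex_def by (smt (verit) mem_Collect_eq)
  then have "\<bar>r * (x i - x 0)\<bar> <= r" for i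
   using r by (simp add: abs_mult mult_left_le)
  then have s: "\<bar>r * (x i - x 0)\<bar> < d" for i
   using r by (meson order_le_less_trans)
  have "lo j < y j & y j < hi j" if "j < N" for j
  proof (cases "j < n")
   case True
   then show ?thesis using s[of "Suc j"] dl[OF True] x by (auto simp: nsm_def abs_less_iff)
  next
   case False
   then show ?thesis using x q that by (auto simp: nsm_def box_def)
  qed
  moreover have "y : Es N"
   using x q nN by (auto simp: nsm_def box_def Es_def)
  ultimately show "y : box N lo hi" by (simp add: box_def)
 qed
 have "hfree n (top_of_set (box N lo hi)) (- Lsub n) (frag_of (nsm n q r))"
  by (rule nsm_free_box[OF nN q r(1) im])
 then have "hgen n (top_of_set (box N lo hi)) (- Lsub n) G"
  unfolding hgen_def hfree_def using r(3)
  by (metis keys_cmul keys_frag_of empty_subsetI insert_subset subset_trans)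
 moreover have "hvanish p (top_of_set (box N lo hi)) (- Lsub n)" if "p < n" for p
 proof -
  have "hvanish p (Euc n) (-{0})"
   using conjunct1[OF euclidean_local_homology, rule_format, of p n] that by linarith
  then show ?thesis
   by (simp only: hvanish_transfer[OF box_iso[OF nN q]])
 qed
 ultimately show ?thesis
  unfolding local_model_def by blast
qed

text \<open>A cycle of degree at most \<open>n\<close> splits between \<open>A\<close> and
  \<open>B\<close> because the intersection has no homology below degree \<open>n\<close>; the two
  summands are then treated separately.\<close>

lemma local_model_Un:
 assumes op: "openin (Euc N) A" "openin (Euc N) B"
  and AB: "local_model n A G" "local_model n B G" "local_model n (A Int B) G"
 shows "local_model n (A Un B) G"
proof -
 let ?X = "top_of_set (A Un B)"
 have sub: "sub ?X A = top_of_set A" "sub ?X B = top_of_set B"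
  "sub ?X (A Int B) = top_of_set (A Int B)"
  by (auto simp: subtopology_subtopology intro: arg_cong[where f=top_of_set])
 have opX: "openin ?X A" "openin ?X B"
  using op unfolding Euclidean_space_eq
  by (metis openin_subset openin_subset_trans topspace_euclidean_subtopology Un_upper1 Un_upper2 Un_least)+
 have split: "\<exists>z1 z2. relcycle p (top_of_set A) (- Lsub n) z1 & relcycle p (top_of_set B) (- Lsub n) z2
   & homrel p ?X (- Lsub n) z (z1 + z2)"
  if pn: "p <= n" and zc: "relcycle p ?X (- Lsub n) z" for p z
 proof -
  have v: "p = 0 | hvanish (p - 1) (sub ?X (A Int B)) (- Lsub n)"
   using AB(3) pn unfolding local_model_def sub by (cases p) auto
  obtain z1 z2 where "relcycle p (sub ?X A) (- Lsub n) z1"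
    "relcycle p (sub ?X B) (- Lsub n) z2" "homrel p ?X (- Lsub n) z (z1 + z2)"
   by (rule relcycle_split[OF opX _ v zc]) auto
  then show ?thesis unfolding sub by blast
 qed
 have mA: "homrel p ?X (- Lsub n) z c" if "homrel p (top_of_set A) (- Lsub n) z c" for p z c
  by (rule homologous_rel_mono[OF that]) auto
 have mB: "homrel p ?X (- Lsub n) z c" if "homrel p (top_of_set B) (- Lsub n) z c" for p z c
  by (rule homologous_rel_mono[OF that]) auto
 show ?thesis
  unfolding local_model_def
 proof (intro conjI allI impI)
  fix p assume p: "p < n"
  show "hvanish p ?X (- Lsub n)"
   unfolding hvanish_def
  proof (intro allI impI)
   fix z assume "relcycle p ?X (- Lsub n) z"
   then obtain z1 z2 where z: "relcycle p (top_of_set A) (- Lsub n) z1" "relcycle p (top_of_set B) (- Lsub n) z2"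
    "homrel p ?X (- Lsub n) z (z1 + z2)"
    using split p by (meson less_imp_le)
   then have "homrel p (top_of_set A) (- Lsub n) z1 0" "homrel p (top_of_set B) (- Lsub n) z2 0"
    using AB p unfolding local_model_def hvanish_def homologous_rel_def by auto
   then have "homrel p ?X (- Lsub n) (z1 + z2) (0 + 0)"
    using mA mB homologous_rel_add by blast
   then have "relboundary p ?X (- Lsub n) (z1 + z2)"
    by (simp add: homologous_rel_def)
   then show "relboundary p ?X (- Lsub n) z"
    using z(3) homologous_rel_relboundary by blast
  qed
 next
  show "hgen n ?X (- Lsub n) G"
   unfolding hgen_def
  proof (intro allI impI)
   fix z assume "relcycle n ?X (- Lsub n) z"
   then obtain z1 z2 where z: "relcycle n (top_of_set A) (- Lsub n) z1" "relcycle n (top_of_set B) (- Lsub n) z2"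
    "homrel n ?X (- Lsub n) z (z1 + z2)"
    using split by blast
   then obtain c1 c2 where c: "Poly_Mapping.keys c1 <= G" "homrel n (top_of_set A) (- Lsub n) z1 c1"
     "Poly_Mapping.keys c2 <= G" "homrel n (top_of_set B) (- Lsub n) z2 c2"
    using AB unfolding local_model_def hgen_def by meson
   then have "homrel n ?X (- Lsub n) (z1 + z2) (c1 + c2)"
    using mA mB homologous_rel_add by blast
   then have "homrel n ?X (- Lsub n) z (c1 + c2)"
    using z(3) homologous_rel_trans by blast
   moreover have "Poly_Mapping.keys (c1 + c2) <= G"
    using c Poly_Mapping.keys_add[of c1 c2] by blast
   ultimately show "\<exists>c. Poly_Mapping.keys c <= G & homrel n ?X (- Lsub n) z c"
    by blast
  qed
 qed
qed

text \<open>Induction on a bound for the number of boxes: the intersection of one box with the union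
  of the others is again a union of at most \<open>m\<close> boxes.\<close>

lemma local_model_finite:
 assumes nN: "n <= N" and G: "normal_rich n (\<Union>\<B>) G" and "finite \<B>" "card \<B> <= m"
  and \<B>: "!!B. B : \<B> ==> \<exists>lo hi. B = box N lo hi"
 shows "local_model n (\<Union>\<B>) G"
 using assms(2-)
proof (induction m arbitrary: \<B>)
 case 0
 then have "\<Union>\<B> = box N (%_. 1) (%_. 0) | N = 0 & \<B> = {}"
  by (auto simp: box_def)
 moreover have "local_model n {} G"
 proof -
  \<comment> \<open>The empty set is presented as an empty box in dimension \<open>Suc N\<close>,
    since in dimension 0 every box is a point.\<close>
  have "local_model n (box (Suc N) (%_. 1) (%_. 0)) G"
   by (rule local_model_box) (use nN in \<open>auto simp: normal_rich_def box_def\<close>)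
  moreover have "box (Suc N) (%_. 1) (%_. 0) = {}"
   by (auto simp: box_def)
  ultimately show ?thesis by simp
 qed
 ultimately show ?case using 0 by auto
next
 case (Suc m)
 show ?case
 proof (cases "\<B> = {}")
  case True
  then show ?thesis using Suc.IH[of "{}"] Suc.prems by simp
 next
  case False
  then obtain B \<C> where B: "\<B> = insert B \<C>" "B ~: \<C>" by (meson mk_disjoint_insert ex_in_conv)
  then have C: "finite \<C>" "card \<C> <= m"
   using Suc.prems by auto
  obtain lo hi where lh: "B = box N lo hi" using Suc.prems(4) B by blast
  have op: "openin (Euc N) B'" if "B' : \<B>" for B'
   using Suc.prems(4)[OF that] openin_box by metis
  have rich: "normal_rich n A G" if "A <= \<Union>\<B>" for A
   using Suc.prems(1) that unfolding normal_rich_def by blast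
  have 1: "local_model n (\<Union>\<C>) G"
   by (rule Suc.IH[OF rich C]) (use B Suc.prems(4) in auto)
  have 2: "local_model n B G"
   unfolding lh by (rule local_model_box[OF nN rich]) (use lh B in auto)
  have 3: "local_model n (\<Union>((%B'. B Int B') ` \<C>)) G"
  proof (rule Suc.IH[OF rich])
   show "card ((Int) B ` \<C>) <= m"
    using C card_image_le[OF C(1), of "(Int) B"] by linarith
   show "\<exists>lo hi. B' = box N lo hi" if "B' : (Int) B ` \<C>" for B'
    using that Suc.prems(4) B lh box_Int by (metis (no_types, lifting) image_iff insertCI)
  qed (use C B in auto)
  have "local_model n (B Un \<Union>\<C>) G"
  proof (rule local_model_Un[of N])
   show "openin (Euc N) B" "openin (Euc N) (\<Union>\<C>)"
    using op B by auto
   show "local_model n (B Int \<Union>\<C>) G"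
   proof -
    have "B Int \<Union>\<C> = \<Union>((Int) B ` \<C>)" by blast
    then show ?thesis using 3 by simp
   qed
  qed (use 1 2 in auto)
  then show ?thesis using B by simp
 qed
qed

lemma singular_chain_compact_support:
 assumes "schain p X c"
 obtains K where "compactin X K" "schain p (sub X K) c"
proof
 let ?K = "\<Union>f\<in>Poly_Mapping.keys c. f ` stdx p"
 have f: "ssimp p X f" if "f : Poly_Mapping.keys c" for f
  using assms that by (auto simp: singular_chain_def)
 show "compactin X ?K"
 proof (rule compactin_Union)
  show "compactin X K" if K': "K : (%f. f ` stdx p) ` Poly_Mapping.keys c" for K
  proof -
   obtain f where "f : Poly_Mapping.keys c" and K: "K = f ` stdx p" using K' by blast
   then have "continuous_map (sub (powertop_real UNIV) (stdx p)) X f"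
    using f by (simp add: singular_simplex_def)
   moreover have "compactin (sub (powertop_real UNIV) (stdx p)) (stdx p)"
    using compactin_standard_simplex by (simp add: compactin_subtopology)
   ultimately show ?thesis
    using image_compactin K by blast
  qed
 qed simp
 show "schain p (sub X ?K) c"
  using assms by (auto simp: singular_chain_subtopology)
qed

text \<open>A chain has compact support, so it lives in a finite union of boxes contained in
  \<open>A\<close>.\<close>

theorem local_model_open:
 assumes nN: "n <= N" and A: "openin (Euc N) A" and G: "normal_rich n A G"
 shows "local_model n A G"
proof -
 have tA: "top_of_set A = sub (Euc N) A"
  using openin_subset[OF A] by (simp add: Euclidean_space_eq subtopology_subtopology Int_absorb1)
 have key: "\<exists>B\<subseteq>A. local_model n B G & relcycle p (top_of_set B) (- Lsub n) z"
  if z: "relcycle p (top_of_set A) (- Lsub n) z" for p z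
 proof -
  have zc: "schain p (top_of_set A) z"
   using z by (simp add: singular_relcycle)
  then obtain K where K: "compactin (top_of_set A) K" "schain p (sub (top_of_set A) K) z"
   using singular_chain_compact_support by blast
  have KA: "K <= A" using K compactin_subset_topspace by fastforce
  have KE: "compactin (Euc N) K"
   using K(1) unfolding tA by (simp add: compactin_subtopology)
  define \<C> where "\<C> = {B. B <= A & (\<exists>lo hi. B = box N lo hi)}"
  have "K <= \<Union>\<C>"
  proof
   fix y assume "y : K"
   then have "y : A" using KA by blast
   then obtain lo hi where "y : box N lo hi" "box N lo hi <= A"
    using box_neighbourhood[OF A] by blast
   then show "y : \<Union>\<C>" unfolding \<C>_def by blast
  qed
  moreover have "openin (Euc N) B" if "B : \<C>" for B
   using that openin_box unfolding \<C>_def by blast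
  ultimately obtain \<F> where \<F>: "finite \<F>" "\<F> <= \<C>" "K <= \<Union>\<F>"
   using KE unfolding compactin_def by (meson subset_iff)
  have sub: "\<Union>\<F> <= A" using \<F> unfolding \<C>_def by blast
  have "local_model n (\<Union>\<F>) G"
  proof (rule local_model_finite[OF nN _ \<F>(1) order_refl])
   show "normal_rich n (\<Union>\<F>) G" using G sub unfolding normal_rich_def by blast
   show "\<exists>lo hi. B = box N lo hi" if "B : \<F>" for B
    using that \<F> unfolding \<C>_def by blast
  qed
  moreover have "relcycle p (top_of_set (\<Union>\<F>)) (- Lsub n) z"
  proof -
   have 1: "schain p (top_of_set (\<Union>\<F>)) z"
    using K(2) \<F>(3) unfolding subtopology_subtopology singular_chain_subtopology by blast
   have "schain (p - 1) (top_of_set (\<Union>\<F>)) (bdry p z)"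
    using singular_chain_boundary[OF 1] by simp
   moreover have "schain (p - 1) (sub (top_of_set A) (- Lsub n)) (bdry p z)"
    using z by (simp add: singular_relcycle)
   ultimately show ?thesis
    using 1 by (auto simp: singular_relcycle subtopology_subtopology singular_chain_subtopology)
  qed
  ultimately show ?thesis using sub by blast
 qed
 show ?thesis
  unfolding local_model_def hvanish_def hgen_def
 proof (intro conjI allI impI)
  fix p z assume p: "p < n" and z: "relcycle p (top_of_set A) (- Lsub n) z"
  then obtain B where B: "B <= A" "local_model n B G" "relcycle p (top_of_set B) (- Lsub n) z"
   using key by blast
  then have "relboundary p (top_of_set B) (- Lsub n) z"
   using p unfolding local_model_def hvanish_def by blast
  then show "relboundary p (top_of_set A) (- Lsub n) z"
   by (rule singular_relboundary_mono) (use B(1) in auto)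
 next
  fix z assume z: "relcycle n (top_of_set A) (- Lsub n) z"
  then obtain B where B: "B <= A" "local_model n B G" "relcycle n (top_of_set B) (- Lsub n) z"
   using key by blast
  then obtain c where c: "Poly_Mapping.keys c <= G" "homrel n (top_of_set B) (- Lsub n) z c"
   unfolding local_model_def hgen_def by blast
  have "homrel n (top_of_set A) (- Lsub n) z c"
   by (rule homologous_rel_mono[OF c(2)]) (use B(1) in auto)
  then show "\<exists>c. Poly_Mapping.keys c <= G & homrel n (top_of_set A) (- Lsub n) z c"
   using c(1) by blast
 qed
qed

section \<open>Cocycles from homomorphisms on relative homology\<close>

text \<open>A contraction of the relative chain complex below degree \<open>n\<close>:
  \<open>1 - bdry s - s bdry\<close> takes values in the chains of \<open>S\<close>. It is built
  degree by degree. For a simplex \<open>f\<close> the error \<open>f - s (bdry f)\<close> is a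
  relative cycle by the identity one degree below, hence a relative boundary, and a chain that
  bounds it becomes the value of \<open>s\<close>.\<close>

lemma relative_contraction:
 assumes "!!i. i < n ==> hvanish i X S"
 obtains s :: "nat => 'a chain => 'a chain" where
  "!!i a b. s i (a - b) = s i a - s i b" "!!i. s i 0 = 0"
  "!!i c. [|i < n; schain i X c|] ==> schain (Suc i) X (s i c)"
  "!!i c. [|i < n; schain i (sub X S) c|] ==> s i c = 0"
  "!!i c. [|i < n; schain i X c|] ==>
    schain i (sub X S) (c - bdry (Suc i) (s i c) - s (i - 1) (bdry i c))"
proof -
 let ?P = "%n (g :: nat => ((nat => real) => 'a) => 'a chain). \<forall>i<n. \<forall>f. ssimp i X f -->
   schain (Suc i) X (g i f) & (ssimp i (sub X S) f --> g i f = 0) &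
   schain i (sub X S) (frag_of f - bdry (Suc i) (g i f)
     - frag_extend (g (i - 1)) (bdry i (frag_of f)))"
 have ext: "schain (Suc i) X (frag_extend (g i) c)" "schain i (sub X S) c ==> frag_extend (g i) c = 0"
  "schain i (sub X S) (c - bdry (Suc i) (frag_extend (g i) c) - frag_extend (g (i - 1)) (bdry i c))"
  if P: "?P m g" and i: "i < m" and c: "schain i X c" for m g i c
 proof -
  have k: "f : Poly_Mapping.keys c ==> ssimp i X f" for f
   using c by (auto simp: singular_chain_def)
  show "schain (Suc i) X (frag_extend (g i) c)"
   using P i k by (intro singular_chain_extend) blast
  show "frag_extend (g i) c = 0" if "schain i (sub X S) c"
   using that P i k unfolding singular_chain_def by (intro frag_extend_eq_0) blast
  show "schain i (sub X S) (c - bdry (Suc i) (frag_extend (g i) c) - frag_extend (g (i - 1)) (bdry i c))"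
   using c unfolding singular_chain_def[of i X]
  proof (induction c rule: frag_induction)
   case (one f)
   then show ?case using P i by simp
  next
   case (diff a b)
   let ?F = "%c. c - bdry (Suc i) (frag_extend (g i) c) - frag_extend (g (i - 1)) (bdry i c)"
   have F: "?F (a - b) = ?F a - ?F b"
    by (simp add: frag_extend_diff chain_boundary_diff)
   show ?case
    unfolding F by (rule singular_chain_diff[OF diff])
  qed simp
 qed
 have "\<exists>g. ?P n g"
  using assms
 proof (induction n)
  case (Suc n)
  then obtain g where g: "?P n g" by (metis less_Suc_eq)
  have van: "hvanish n X S" using Suc.prems by simp
  have ex: "\<exists>d. schain (Suc n) X d & schain n (sub X S) (frag_of f - bdry (Suc n) d
     - frag_extend (g (n - 1)) (bdry n (frag_of f)))"
   if f: "ssimp n X f" for f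
  proof -
   let ?y = "frag_of f - frag_extend (g (n - 1)) (bdry n (frag_of f))"
   have fc: "schain n X (frag_of f)" using f by (simp add: singular_chain_of)
   have "relcycle n X S ?y"
   proof (cases n)
    case 0
    then show ?thesis using fc by (simp add: singular_relcycle chain_boundary_def)
   next
    case (Suc m)
    let ?c = "bdry n (frag_of f)"
    have c: "schain m X ?c" using fc Suc singular_chain_boundary_alt by blast
    have m: "m < n" using Suc by simp
    have 1: "schain n X (frag_extend (g m) ?c)"
     using ext(1)[OF g m c] Suc by simp
    have "bdry m ?c = 0"
     using fc Suc chain_boundary_boundary_alt by blast
    then have "schain m (sub X S) (?c - bdry (Suc m) (frag_extend (g m) ?c))"
     using ext(3)[OF g m c] by simp
    then have "schain m (sub X S) (bdry n ?y)"
     using Suc by (simp add: chain_boundary_diff)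
    then show ?thesis
     using 1 fc Suc by (simp add: singular_relcycle singular_chain_diff)
   qed
   then have "relboundary n X S ?y"
    using van unfolding hvanish_def by blast
   then obtain d e where "schain (Suc n) X d" "schain n (sub X S) e" "bdry (Suc n) d + e = ?y"
    using singular_relboundary by blast
   moreover have "frag_of f - bdry (Suc n) d - frag_extend (g (n - 1)) (bdry n (frag_of f)) = e"
    using calculation(3) by (simp add: algebra_simps)
   ultimately show ?thesis by metis
  qed
  \<comment> \<open>The value 0 on simplices of \<open>S\<close> is consistent with the identity,
    since the contraction already vanishes on their boundaries.\<close>
  define gn where "gn = (%f. if ssimp n (sub X S) f then 0 else
   SOME d. schain (Suc n) X d & schain n (sub X S) (frag_of f - bdry (Suc n) d
     - frag_extend (g (n - 1)) (bdry n (frag_of f))))"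
  have gn: "schain (Suc n) X (gn f)" "ssimp n (sub X S) f ==> gn f = 0"
   "schain n (sub X S) (frag_of f - bdry (Suc n) (gn f)
     - frag_extend (g (n - 1)) (bdry n (frag_of f)))"
   if f: "ssimp n X f" for f
  proof -
   show "gn f = 0" if "ssimp n (sub X S) f"
    using that by (simp add: gn_def)
   have "schain (Suc n) X (gn f) & schain n (sub X S) (frag_of f - bdry (Suc n) (gn f)
     - frag_extend (g (n - 1)) (bdry n (frag_of f)))"
   proof (cases "ssimp n (sub X S) f")
    case True
    have "frag_extend (g (n - 1)) (bdry n (frag_of f)) = 0"
    proof (cases n)
     case 0 then show ?thesis by (simp add: chain_boundary_def)
    next
     case (Suc m)
     have 1: "schain m (sub X S) (bdry n (frag_of f))"
      using True Suc singular_chain_boundary_alt by (metis singular_chain_of)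
     then have "schain m X (bdry n (frag_of f))"
      by (simp add: singular_chain_subtopology)
     then show ?thesis using ext(2)[OF g _ _ 1] Suc by simp
    qed
    then show ?thesis using True by (simp add: gn_def singular_chain_of)
   next
    case False
    then show ?thesis unfolding gn_def using someI_ex[OF ex[OF f]] by simp
   qed
   then show "schain (Suc n) X (gn f)"
    "schain n (sub X S) (frag_of f - bdry (Suc n) (gn f)
     - frag_extend (g (n - 1)) (bdry n (frag_of f)))"
    by blast+
  qed
  have low: "i - 1 < n" if "i <= n" "i ~= 0" for i using that by linarith
  \<comment> \<open>For \<open>i = 0\<close> truncated subtraction gives \<open>i - 1 = 0\<close>,
    but there the boundary is 0, so changing \<open>g\<close> at \<open>n\<close> has no
    effect.\<close>
  have eq: "frag_extend ((g(n := gn)) (i - 1)) (bdry i c) = frag_extend (g (i - 1)) (bdry i c)" if "i <= n" for i c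
  proof (cases "i = 0")
   case True then show ?thesis by (simp add: chain_boundary_def)
  next
   case False then show ?thesis using low[OF that] by simp
  qed
  have "?P (Suc n) (g(n := gn))"
  proof (intro allI impI)
   fix i f assume i: "i < Suc n" and f: "ssimp i X f"
   show "schain (Suc i) X ((g(n := gn)) i f) & (ssimp i (sub X S) f --> (g(n := gn)) i f = 0) &
    schain i (sub X S) (frag_of f - bdry (Suc i) ((g(n := gn)) i f)
     - frag_extend ((g(n := gn)) (i - 1)) (bdry i (frag_of f)))"
   proof (cases "i = n")
    case True
    then show ?thesis using gn[of f] f eq[of i "frag_of f"] by simp
   next
    case False
    then have "i < n" using i by simp
    then show ?thesis using g f eq[of i "frag_of f"] by simp
   qed
  qed
  then show ?case by blast
 qed simp
 then obtain g where g: "?P n g" by blast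
 show ?thesis
 proof (rule that[of "%i. frag_extend (g i)"])
  show "frag_extend (g i) c = 0" if "i < n" "schain i (sub X S) c" for i c
   using ext(2)[OF g that(1) _ that(2)] that(2) by (simp add: singular_chain_subtopology)
 qed (use ext[OF g] in \<open>auto simp: frag_extend_diff\<close>)
qed

text \<open>In degree \<open>n\<close> itself there is no contraction, but
  \<open>c - s (bdry c)\<close> turns \<open>n\<close>-chains into relative cycles; its boundary is
  controlled by the identity in degree \<open>n - 1\<close>.\<close>

lemma contraction_relcycle:
 assumes "!!i. s i (0 :: 'a chain) = 0"
  and "!!i c. [|i < n; schain i X c|] ==> schain (Suc i) X (s i c)"
  and "!!i c. [|i < n; schain i X c|] ==>
    schain i (sub X S) (c - bdry (Suc i) (s i c) - s (i - 1) (bdry i c))"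
  and c: "schain n X c"
 shows "relcycle n X S (c - s (n - 1) (bdry n c))"
proof (cases n)
 case 0
 then show ?thesis using c by (simp add: singular_relcycle chain_boundary_def assms(1))
next
 case (Suc m)
 let ?c = "bdry n c"
 have b: "schain m X ?c" "bdry m ?c = 0"
  using c Suc singular_chain_boundary_alt chain_boundary_boundary_alt by blast+
 have "schain m (sub X S) (?c - bdry (Suc m) (s m ?c))"
  using assms(3)[of m ?c] b Suc assms(1) by simp
 then show ?thesis
  using assms(2)[of m ?c] b c Suc by (simp add: singular_relcycle chain_boundary_diff singular_chain_diff)
qed

lemma relboundary_of_boundary:
 "schain (Suc n) X e ==> relboundary n X S (bdry (Suc n) e)"
 using singular_relboundary by (metis add.right_neutral singular_chain_0)

text \<open>One half of the universal coefficient theorem when the lower homology vanishes: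
  \<open>h\<close> is composed with \<open>c - s (bdry c)\<close>. This map fixes relative cycles
  because \<open>s\<close> is 0 on chains of \<open>S\<close>.\<close>

theorem cocycle_of_relative_hom:
 fixes h :: "'a chain => int"
 assumes van: "!!i. i < n ==> hvanish i X S"
  and add: "!!a b. [|relcycle n X S a; relcycle n X S b|] ==> h (a + b) = h a + h b"
  and zero: "!!a. relboundary n X S a ==> h a = 0"
 obtains \<phi> where "\<phi> : cocycles n X" "!!d. schain n (sub X S) d ==> \<phi> d = 0"
  "!!z. relcycle n X S z ==> \<phi> z = h z"
proof -
 obtain s :: "nat => 'a chain => 'a chain" where s: "!!i a b. s i (a - b) = s i a - s i b" "!!i. s i 0 = 0"
  "!!i c. [|i < n; schain i X c|] ==> schain (Suc i) X (s i c)"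
  "!!i c. [|i < n; schain i (sub X S) c|] ==> s i c = 0"
  "!!i c. [|i < n; schain i X c|] ==>
    schain i (sub X S) (c - bdry (Suc i) (s i c) - s (i - 1) (bdry i c))"
  using relative_contraction[OF van] by blast
 have sadd: "s i (a + b) = s i a + s i b" for i a b
  using s(1)[of i a "- b"] s(1)[of i 0 b] s(2) by simp
 define \<phi> where "\<phi> = (\<lambda>c\<in>singular_chain_set n X. h (c - s (n - 1) (bdry n c)))"
 have rc: "relcycle n X S (c - s (n - 1) (bdry n c))" if "schain n X c" for c
  by (rule contraction_relcycle[OF s(2,3,5) that])
 have bz: "s (n - 1) (bdry n c) = 0" if "schain (n - 1) (sub X S) (bdry n c)" for c
  using that s(4)[of "n - 1" "bdry n c"] s(2) by (cases "n = 0") (auto simp: chain_boundary_def)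
 have "\<phi> : cocycles n X"
 proof -
  have "\<phi> (c + d) = \<phi> c + \<phi> d" if "schain n X c" "schain n X d" for c d
   using that add[OF rc rc, of c d]
   by (simp add: \<phi>_def singular_chain_add chain_boundary_add sadd algebra_simps)
  then have "\<phi> : carrier (cochain_group n X)"
   by (simp add: cochain_group_carrier_iff \<phi>_def)
  moreover have "\<phi> (bdry (Suc n) e) = 0" if e: "schain (Suc n) X e" for e
   using singular_chain_boundary_alt[OF e] chain_boundary_boundary_alt[OF e] zero[OF relboundary_of_boundary[OF e]] s(2)
   by (simp add: \<phi>_def)
  then have "coboundary_map n X \<phi> = \<one>\<^bsub>cochain_group (Suc n) X\<^esub>"
   by (auto simp: coboundary_map_def cochain_group_one fun_eq_iff restrict_def)
  ultimately show ?thesis by (simp add: cocycles_def)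
 qed
 moreover have "\<phi> z = h z" if z: "relcycle n X S z" for z
  using z bz[of z] by (simp add: \<phi>_def singular_relcycle)
 moreover have "\<phi> d = 0" if d: "schain n (sub X S) d" for d
 proof -
  have "relboundary n X S d" using d by (rule singular_chain_imp_relboundary)
  then show ?thesis
   using zero \<open>\<And>z. singular_relcycle n X S z \<Longrightarrow> \<phi> z = h z\<close> singular_relboundary_imp_relcycle by metis
 qed
 ultimately show ?thesis using that by blast
qed

text \<open>The other half: as \<open>c - s (bdry c)\<close> is a relative cycle,
  \<open>\<delta> c = \<delta> (s (bdry c))\<close>, so \<open>\<delta>\<close> is the coboundary of
  \<open>\<delta>\<close> composed with \<open>s\<close>.\<close>

theorem relative_cocycle_coboundary:
 assumes van: "!!i. i < n ==> hvanish i X S"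
  and \<delta>: "\<delta> : cocycles n X" and dz: "!!z. relcycle n X S z ==> \<delta> z = 0"
 shows "\<delta> : coboundaries n X"
proof -
 have \<delta>c: "\<delta> : carrier (cochain_group n X)" using \<delta> by (simp add: cocycles_def)
 then have \<delta>add: "\<delta> (c + d) = \<delta> c + \<delta> d" if "schain n X c" "schain n X d" for c d
  using that by (simp add: cochain_group_carrier_iff)
 have \<delta>ext: "\<delta> : extensional (singular_chain_set n X)"
  using \<delta>c by (simp add: cochain_group_carrier_iff)
 show ?thesis
 proof (cases n)
  case 0
  have "\<delta> c = 0" if "schain 0 X c" for c
   using dz[of c] that 0 by (simp add: singular_relcycle chain_boundary_def)
  then have "\<delta> = \<one>\<^bsub>cochain_group 0 X\<^esub>"
   using \<delta>ext 0 by (auto simp: cochain_group_one fun_eq_iff restrict_def extensional_def)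
  then show ?thesis using 0 by (simp add: coboundaries_def)
 next
  case (Suc m)
  obtain s :: "nat => 'a chain => 'a chain" where s: "!!i a b. s i (a - b) = s i a - s i b" "!!i. s i 0 = 0"
   "!!i c. [|i < n; schain i X c|] ==> schain (Suc i) X (s i c)"
   "!!i c. [|i < n; schain i (sub X S) c|] ==> s i c = 0"
   "!!i c. [|i < n; schain i X c|] ==>
     schain i (sub X S) (c - bdry (Suc i) (s i c) - s (i - 1) (bdry i c))"
   using relative_contraction[OF van] by blast
  have sadd: "s i (a + b) = s i a + s i b" for i a b
   using s(1)[of i a "- b"] s(1)[of i 0 b] s(2) by simp
  define \<eta> where "\<eta> = (\<lambda>c\<in>singular_chain_set m X. \<delta> (s m c))"
  have sm: "schain n X (s m c)" if "schain m X c" for c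
   using s(3)[of m c] that Suc by simp
  have "\<eta> : carrier (cochain_group m X)"
   using \<delta>add sm by (auto simp: cochain_group_carrier_iff \<eta>_def singular_chain_add sadd)
  moreover have "coboundary_map m X \<eta> = \<delta>"
  proof
   fix c
   show "coboundary_map m X \<eta> c = \<delta> c"
   proof (cases "schain n X c")
    case True
    let ?b = "bdry n c"
    have b: "schain m X ?b" using True Suc singular_chain_boundary_alt by blast
    have rc: "relcycle n X S (c - s m ?b)"
     using contraction_relcycle[OF s(2,3,5) True] Suc by simp
    have "\<delta> c = \<delta> (c - s m ?b) + \<delta> (s m ?b)"
     using \<delta>add[of "c - s m ?b" "s m ?b"] sm[OF b] rc by (simp add: singular_relcycle)
    then have "\<delta> c = \<delta> (s m ?b)" using dz[OF rc] by simp
    then show ?thesis using True b Suc by (simp add: coboundary_map_def \<eta>_def)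
   next
    case False
    then show ?thesis using Suc \<delta>ext by (simp add: coboundary_map_def extensional_def)
   qed
  qed
  ultimately show ?thesis using Suc by (auto simp: coboundaries_def)
 qed
qed

abbreviation Dtop :: "nat => (nat => real) topology" where
 "Dtop q \<equiv> sub (powertop_real UNIV) (stdx q)"

abbreviation cyl :: "'a topology => (real \<times> 'a) topology" where
 "cyl X \<equiv> prod_topology (top_of_set {0..1}) X"

section \<open>The degree of a relative cycle\<close>

text \<open>The multiple of the generator that \<open>z\<close> represents; meaningful for relative
  cycles only.\<close>

definition hdeg :: "nat => (nat => real) chain => int" where
 "hdeg n z = (THE a. homrel n (Euc n) (-{0}) z (frag_cmul a (frag_of (std_simp n))))"

lemma hfree_unique:
 assumes "hfree p X S w" "homrel p X S z (frag_cmul a w)" "homrel p X S z (frag_cmul b w)"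
 shows "a = b"
proof -
 have "homrel p X S (frag_cmul a w) (frag_cmul b w)"
  using assms(2,3) by (metis homologous_rel_eq)
 then have "relboundary p X S (frag_cmul (a - b) w)"
  by (simp add: homologous_rel_def frag_cmul_diff_distrib)
 then have "a - b = 0" using assms(1) unfolding hfree_def by blast
 then show ?thesis by simp
qed

lemma hdeg_eqI:
 assumes "homrel n (Euc n) (-{0}) z (frag_cmul a (frag_of (std_simp n)))"
 shows "hdeg n z = a"
 unfolding hdeg_def
 using assms hfree_unique[OF conjunct2[OF euclidean_local_homology]] by blast

lemma hdeg_homologous:
 assumes "relcycle n (Euc n) (-{0}) z"
 shows "homrel n (Euc n) (-{0}) z (frag_cmul (hdeg n z) (frag_of (std_simp n)))"
proof -
 obtain a where "homrel n (Euc n) (-{0}) z (frag_cmul a (frag_of (std_simp n)))"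
  using assms conjunct2[OF euclidean_local_homology[of n]] unfolding hfree_def by blast
 then show ?thesis using hdeg_eqI by blast
qed

lemma hdeg_cong:
 assumes "homrel n (Euc n) (-{0}) z w" "relcycle n (Euc n) (-{0}) w"
 shows "hdeg n z = hdeg n w"
 by (rule hdeg_eqI, rule homologous_rel_trans[OF hdeg_homologous[OF assms(2)] assms(1)])

lemma hdeg_add:
 assumes "relcycle n (Euc n) (-{0}) z" "relcycle n (Euc n) (-{0}) w"
 shows "hdeg n (z + w) = hdeg n z + hdeg n w"
 by (rule hdeg_eqI) (simp add: frag_cmul_distrib homologous_rel_add[OF hdeg_homologous[OF assms(1)] hdeg_homologous[OF assms(2)]])

lemma hdeg_relboundary:
 assumes "relboundary n (Euc n) (-{0}) z"
 shows "hdeg n z = 0"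
 by (rule hdeg_eqI) (use assms in \<open>simp add: homologous_rel_def\<close>)

lemma hdeg_std_simp: "hdeg n (frag_of (std_simp n)) = 1"
 by (rule hdeg_eqI) simp

lemma relcycle_push:
 assumes "relcycle p X (-Z) z" "continuous_map X Y f" "!!x. x : topspace X ==> x ~: Z ==> f x ~: L"
 shows "relcycle p Y (-L) (chain_map p f z)"
 by (rule singular_relcycle_chain_map'[OF assms(1,2)]) (use assms(3) in auto)

lemma homologous_push:
 assumes "homrel p X (-Z) z w" "continuous_map X Y f" "!!x. x : topspace X ==> x ~: Z ==> f x ~: L"
 shows "homrel p Y (-L) (chain_map p f z) (chain_map p f w)"
 by (rule homologous_rel_chain_map[OF assms(1,2)]) (use assms(3) in auto)

section \<open>Closed subsets with a linear chart away from a small set\<close>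

locale chart =
 fixes X :: "'a topology" and N n :: nat and U :: "'a set" and A :: "(nat => real) set"
  and \<theta> :: "'a => (nat => real)" and \<psi> :: "(nat => real) => 'a"
 assumes nN: "n <= N" and openU: "openin X U" and openA: "openin (Euc N) A"
  and homeo: "homeomorphic_maps (sub X U) (top_of_set A) \<theta> \<psi>"
begin

definition rich :: "'a set => ((nat => real) => 'a) set => bool" where
 "rich C G \<longleftrightarrow> (\<forall>x\<in>U Int C. \<theta> x : Lsub n --> (\<forall>\<delta>>0. \<exists>r. 0 < r & r < \<delta> & simplex_map n \<psi> (nsm n (\<theta> x) r) : G))"

lemma UX: "U <= topspace X"
 using openU openin_subset by blast

lemma theta_psi: "x : U ==> \<psi> (\<theta> x) = x" "y : A ==> \<theta> (\<psi> y) = y" "x : U ==> \<theta> x : A" "y : A ==> \<psi> y : U"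
 using homeo UX unfolding homeomorphic_maps_def continuous_map_def by auto

lemma chart_open:
 assumes W: "openin X W" "W <= U" and Z: "!!x. x : U ==> x : Z \<longleftrightarrow> \<theta> x : Lsub n"
 shows "p < n ==> hvanish p (sub X W) (-Z)"
  and "rich W G ==> hgen n (sub X W) (-Z) G"
proof -
 define B where "B = \<theta> ` W"
 have WX: "W <= topspace X" using W openin_subset by blast
 have BA: "B <= A" using W theta_psi(3) B_def by blast
 have opB: "openin (Euc N) B"
 proof -
  have "homeomorphic_map (sub X U) (top_of_set A) \<theta>"
   using homeo homeomorphic_map_maps by blast
  moreover have "openin (sub X U) W"
   using W openU openin_open_subtopology by blast
  ultimately have "openin (top_of_set A) B"
   unfolding B_def using homeomorphic_map_openness_eq by blast
  moreover have "top_of_set A = sub (Euc N) A"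
   using openin_subset[OF openA] by (simp add: Euclidean_space_eq subtopology_subtopology Int_absorb1)
  ultimately show ?thesis
   using openA openin_open_subtopology by (metis)
 qed
 have sub: "sub (sub X U) W = sub X W" "sub (top_of_set A) B = top_of_set B"
  using W BA by (simp_all add: subtopology_subtopology Int_absorb1)
 have c\<theta>: "continuous_map (sub X W) (top_of_set B) \<theta>"
 proof -
  have "continuous_map (sub X U) (top_of_set A) \<theta>"
   using homeo by (simp add: homeomorphic_maps_def)
  then have "continuous_map (sub (sub X U) W) (top_of_set A) \<theta>"
   by (rule continuous_map_from_subtopology)
  then have "continuous_map (sub X W) (sub (top_of_set A) B) \<theta>"
   unfolding sub by (simp add: continuous_map_in_subtopology B_def)
  then show ?thesis by (simp only: sub)
 qed
 have c\<psi>: "continuous_map (top_of_set B) (sub X W) \<psi>"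
 proof -
  have "continuous_map (top_of_set A) (sub X U) \<psi>"
   using homeo by (simp add: homeomorphic_maps_def)
  then have "continuous_map (sub (top_of_set A) B) (sub X U) \<psi>"
   by (rule continuous_map_from_subtopology)
  moreover have "\<psi> ` B <= W"
   unfolding B_def using theta_psi(1) W by auto
  ultimately have "continuous_map (top_of_set B) (sub (sub X U) W) \<psi>"
   unfolding sub(2) by (subst continuous_map_in_subtopology) auto
  then show ?thesis by (simp only: sub)
 qed
 have off1: "\<theta> x ~: Lsub n" if "x : topspace (sub X W)" "x ~: Z" for x
  using that Z W by auto
 have off2: "\<psi> y ~: Z" if "y : topspace (top_of_set B)" "y ~: Lsub n" for y
  using that Z theta_psi BA by auto
 have undo: "chain_map p \<psi> (chain_map p \<theta> z) = z" if "schain p (sub X W) z" for p z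
 proof -
  have "chain_map p \<psi> (chain_map p \<theta> z) = chain_map p (\<psi> \<circ> \<theta>) z" by (simp add: chain_map_compose)
  also have "... = z" by (rule chain_map_id_gen[OF that]) (use theta_psi(1) W in auto)
  finally show ?thesis .
 qed
 \<comment> \<open>For the vanishing statement any family of simplices will do.\<close>
 have norich: "normal_rich n B UNIV"
  unfolding normal_rich_def by (meson dense UNIV_I)
 show "hvanish p (sub X W) (-Z)" if p: "p < n"
  unfolding hvanish_def
 proof (intro allI impI)
  fix z assume z: "relcycle p (sub X W) (-Z) z"
  have "relcycle p (top_of_set B) (- Lsub n) (chain_map p \<theta> z)"
   by (rule relcycle_push[OF z c\<theta> off1])
  then have "relboundary p (top_of_set B) (- Lsub n) (chain_map p \<theta> z)"
   using local_model_open[OF nN opB norich] p unfolding local_model_def hvanish_def by blast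
  then have "homrel p (top_of_set B) (- Lsub n) (chain_map p \<theta> z) 0"
   by (simp add: homologous_rel_def)
  then have "homrel p (sub X W) (-Z) (chain_map p \<psi> (chain_map p \<theta> z)) (chain_map p \<psi> 0)"
   by (rule homologous_push[OF _ c\<psi> off2])
  then show "relboundary p (sub X W) (-Z) z"
   using undo z by (simp add: singular_relcycle homologous_rel_def)
 qed
 show "hgen n (sub X W) (-Z) G" if G: "rich W G"
  unfolding hgen_def
 proof (intro allI impI)
  fix z assume z: "relcycle n (sub X W) (-Z) z"
  define G' where "G' = {f. simplex_map n \<psi> f : G}"
  have rich': "normal_rich n B G'"
   unfolding normal_rich_def
  proof
   fix q assume q: "q : B Int Lsub n"
   then obtain x where x: "x : W" "q = \<theta> x" unfolding B_def by blast
   then show "\<forall>\<delta>>0. \<exists>r. 0 < r & r < \<delta> & nsm n q r : G'"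
    using G W q unfolding rich_def G'_def by blast
  qed
  have "relcycle n (top_of_set B) (- Lsub n) (chain_map n \<theta> z)"
   by (rule relcycle_push[OF z c\<theta> off1])
  then obtain c where c: "Poly_Mapping.keys c <= G'" "homrel n (top_of_set B) (- Lsub n) (chain_map n \<theta> z) c"
   using local_model_open[OF nN opB rich'] unfolding local_model_def hgen_def by blast
  have "homrel n (sub X W) (-Z) (chain_map n \<psi> (chain_map n \<theta> z)) (chain_map n \<psi> c)"
   by (rule homologous_push[OF c(2) c\<psi> off2])
  then have "homrel n (sub X W) (-Z) z (chain_map n \<psi> c)"
   using undo z by (simp add: singular_relcycle)
  moreover have "Poly_Mapping.keys (chain_map n \<psi> c) <= G"
  proof -
   have "Poly_Mapping.keys (chain_map n \<psi> c) <= (\<Union>f\<in>Poly_Mapping.keys c. Poly_Mapping.keys ((frag_of \<circ> simplex_map n \<psi>) f))"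
    unfolding chain_map_def by (rule keys_frag_extend)
   then show ?thesis using c(1) unfolding G'_def by auto
  qed
  ultimately show "\<exists>c. Poly_Mapping.keys c <= G & homrel n (sub X W) (-Z) z c"
   by blast
 qed
qed

end

text \<open>\<open>S\<close> is the part of \<open>Z\<close> that the chart does not see. It is
  small: degree \<open>n\<close> of \<open>small\<close> lets cycles be moved into the chart, degree
  \<open>Suc n\<close> does the same for the chains that bound them. All open \<open>W\<close> occur
  because local equations live on arbitrary open sets.\<close>

locale chart_pair = chart +
 fixes Z S :: "'a set"
 assumes closedZ: "closedin X Z" and closedS: "closedin X S" and SZ: "S <= Z"
  and US: "U Int S = {}" and ZU: "Z - S <= U" and Zlin: "!!x. x : U ==> x : Z \<longleftrightarrow> \<theta> x : Lsub n"
  and small: "!!p W. [|p <= Suc n; openin X W|] ==> hvanish p (sub X W) (-S)"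
begin

context
 fixes W assumes W: "openin X W"
begin

lemma Y_facts:
 "openin (sub X (W Int -S)) (W Int U)" "closedin (sub X (W Int -S)) (W Int (Z - S))"
 "sub (sub X (W Int -S)) (W Int U) = sub X (W Int U)"
proof -
 have "W Int U <= W Int -S" using US by auto
 then show "sub (sub X (W Int -S)) (W Int U) = sub X (W Int U)"
  by (simp add: subtopology_subtopology Int_absorb1)
 show "openin (sub X (W Int -S)) (W Int U)"
  using W openU \<open>W \<inter> U \<subseteq> W \<inter> -S\<close> by (auto simp: openin_subtopology intro: exI[of _ "W Int U"])
 have "W Int (Z - S) = Z Int (W Int -S)" by auto
 then show "closedin (sub X (W Int -S)) (W Int (Z - S))"
  using closedZ by (auto simp: closedin_subtopology)
qed

lemma pair_eq:
 "relcycle p (sub X (W Int -S)) (- (W Int (Z - S))) = relcycle p (sub X (W Int -S)) (-Z)"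
 "homrel p (sub X (W Int -S)) (- (W Int (Z - S))) = homrel p (sub X (W Int -S)) (-Z)"
 "relboundary p (sub X (W Int -S)) (- (W Int (Z - S))) = relboundary p (sub X (W Int -S)) (-Z)"
 "relcycle p (sub X (W Int U)) (- (W Int (Z - S))) = relcycle p (sub X (W Int U)) (-Z)"
 "relboundary p (sub X (W Int U)) (- (W Int (Z - S))) = relboundary p (sub X (W Int U)) (-Z)"
 "hvanish p (sub X (W Int -S)) (- (W Int (Z - S))) = hvanish p (sub X (W Int -S)) (-Z)"
 "hvanish p (sub X (W Int U)) (- (W Int (Z - S))) = hvanish p (sub X (W Int U)) (-Z)"
proof -
 have 1: "topspace (sub X (W Int -S)) Int - (W Int (Z - S)) = topspace (sub X (W Int -S)) Int -Z"
  by auto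
 have 2: "topspace (sub X (W Int U)) Int - (W Int (Z - S)) = topspace (sub X (W Int U)) Int -Z"
  using US by auto
 show "relcycle p (sub X (W Int -S)) (- (W Int (Z - S))) = relcycle p (sub X (W Int -S)) (-Z)"
  by (metis 1 singular_relcycle_restrict)
 show "homrel p (sub X (W Int -S)) (- (W Int (Z - S))) = homrel p (sub X (W Int -S)) (-Z)"
  by (metis 1 homologous_rel_restrict)
 show "relboundary p (sub X (W Int -S)) (- (W Int (Z - S))) = relboundary p (sub X (W Int -S)) (-Z)"
  by (metis 1 singular_relboundary_restrict)
 show "relcycle p (sub X (W Int U)) (- (W Int (Z - S))) = relcycle p (sub X (W Int U)) (-Z)"
  by (metis 2 singular_relcycle_restrict)
 show "relboundary p (sub X (W Int U)) (- (W Int (Z - S))) = relboundary p (sub X (W Int U)) (-Z)"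
  by (metis 2 singular_relboundary_restrict)
 show "hvanish p (sub X (W Int -S)) (- (W Int (Z - S))) = hvanish p (sub X (W Int -S)) (-Z)"
  by (metis 1 hvanish_restrict)
 show "hvanish p (sub X (W Int U)) (- (W Int (Z - S))) = hvanish p (sub X (W Int U)) (-Z)"
  by (metis 2 hvanish_restrict)
qed

lemma subW: "sub (sub X W) (-S) = sub X (W Int -S)"
 by (simp add: subtopology_subtopology)

lemma ZWU: "W Int (Z - S) <= W Int U"
 using ZU by auto

text \<open>In the triple of \<open>W\<close>, \<open>W - S\<close> and \<open>W - Z\<close>, the
  first pair has no homology by \<open>small\<close>, and the second is excised into the
  chart.\<close>

theorem pair_vanish:
 assumes p: "p < n"
 shows "hvanish p (sub X W) (-Z)"
proof (rule hvanish_triple[of "-Z" "-S"])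
 show "-Z <= -S" using SZ by auto
 show "hvanish p (sub X W) (-S)" using small W p by simp
 have "openin X (W Int U)" using W openU by blast
 then have "hvanish p (sub X (W Int U)) (-Z)"
  using chart_open(1)[OF _ _ Zlin p] by blast
 then have "hvanish p (sub X (W Int -S)) (-Z)"
  using hvanish_excision[OF Y_facts(1,2) ZWU, of p] unfolding Y_facts(3) pair_eq by blast
 then show "hvanish p (sub (sub X W) (-S)) (-Z)"
  by (simp only: subW)
qed

text \<open>\<open>small\<close> in degree \<open>n\<close> replaces \<open>z\<close> by a chain off
  \<open>S\<close>. What is left of \<open>Z\<close> there lies in \<open>U\<close>, so excision
  brings the chain into the chart.\<close>

lemma pair_reduce:
 assumes z: "relcycle n (sub X W) (-Z) z"
 obtains e where "relcycle n (sub X (W Int U)) (-Z) e" "homrel n (sub X W) (-Z) z e"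
proof -
 have sub: "-Z <= -S" using SZ by auto
 have "relcycle n (sub X W) (-S) z"
  by (rule singular_relcycle_mono'[OF z sub])
 then have "relboundary n (sub X W) (-S) z"
  using small[OF _ W, of n] unfolding hvanish_def by simp
 then obtain d e where d: "schain (Suc n) (sub X W) d"
  and e: "schain n (sub X (W Int -S)) e" and eq: "bdry (Suc n) d + e = z"
  unfolding singular_relboundary subW by blast
 have b: "relboundary n (sub X W) (-Z) (bdry (Suc n) d)"
  by (rule relboundary_of_boundary[OF d])
 have ze: "homrel n (sub X W) (-Z) z e"
  unfolding homologous_rel_def using b eq by (metis add_diff_cancel_right')
 have "relcycle n (sub X W) (-Z) e"
  using ze z homologous_rel_singular_relcycle by blast
 then have ec: "relcycle n (sub X (W Int -S)) (- (W Int (Z - S))) e"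
  using e SZ unfolding pair_eq by (fastforce simp: singular_relcycle singular_chain_subtopology subtopology_subtopology)
 obtain e' where e': "relcycle n (sub X (W Int U)) (-Z) e'"
  "homrel n (sub X (W Int -S)) (-Z) e e'"
  using excision_surj[OF Y_facts(1,2) ZWU ec] unfolding Y_facts(3) pair_eq by blast
 have "homrel n (sub X W) (-Z) e e'"
  by (rule homologous_rel_mono[OF e'(2)]) auto
 then show ?thesis
  using that[OF e'(1)] ze homologous_rel_trans by blast
qed

theorem pair_generate:
 assumes G: "rich W G"
 shows "hgen n (sub X W) (-Z) G"
 unfolding hgen_def
proof (intro allI impI)
 fix z assume "relcycle n (sub X W) (-Z) z"
 then obtain e where e: "relcycle n (sub X (W Int U)) (-Z) e" "homrel n (sub X W) (-Z) z e"
  using pair_reduce by blast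
 have "rich (W Int U) G" using G unfolding rich_def by blast
 then have "hgen n (sub X (W Int U)) (-Z) G"
  using chart_open(2)[OF _ _ Zlin] W openU by blast
 then obtain c where c: "Poly_Mapping.keys c <= G" "homrel n (sub X (W Int U)) (-Z) e c"
  using e(1) unfolding hgen_def by blast
 have "homrel n (sub X W) (-Z) e c"
  by (rule homologous_rel_mono[OF c(2)]) auto
 then show "\<exists>c. Poly_Mapping.keys c <= G & homrel n (sub X W) (-Z) z c"
  using c(1) e(2) homologous_rel_trans by blast
qed

text \<open>A chain \<open>d\<close> that bounds \<open>y\<close> modulo the complement of
  \<open>Z\<close> has its boundary off \<open>S\<close>, so \<open>small\<close> in degree
  \<open>Suc n\<close> moves \<open>d\<close> off \<open>S\<close>; excision then moves it into the
  chart.\<close>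

lemma pair_inj:
 assumes y: "relcycle n (sub X (W Int U)) (-Z) y"
  and b: "relboundary n (sub X W) (-Z) y"
 shows "relboundary n (sub X (W Int U)) (-Z) y"
proof -
 obtain d w where d: "schain (Suc n) (sub X W) d" and w: "schain n (sub X (W Int -Z)) w"
  and eq: "bdry (Suc n) d + w = y"
  using b unfolding singular_relboundary subtopology_subtopology by blast
 have wS: "schain n (sub X (W Int -S)) w"
  by (rule singular_chain_mono[OF w]) (use SZ in auto)
 have yS: "schain n (sub X (W Int -S)) y"
  using y singular_chain_mono[of n X "W Int U" y "W Int -S"] US by (auto simp: singular_relcycle)
 have "bdry (Suc n) d = y - w" using eq by (metis add_diff_cancel_right')
 then have "relcycle (Suc n) (sub X W) (-S) d"
  using d singular_chain_diff[OF yS wS] by (simp add: singular_relcycle subW)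
 then have "relboundary (Suc n) (sub X W) (-S) d"
  using small[OF _ W, of "Suc n"] unfolding hvanish_def by simp
 then obtain u v where u: "schain (Suc (Suc n)) (sub X W) u"
  and v: "schain (Suc n) (sub X (W Int -S)) v" and eq': "bdry (Suc (Suc n)) u + v = d"
  unfolding singular_relboundary subW by blast
 have "bdry (Suc n) d = bdry (Suc n) v"
  using chain_boundary_boundary_alt[OF u] by (simp add: chain_boundary_add flip: eq')
 then have "bdry (Suc n) v + w = y" using eq by simp
 moreover have "schain n (sub (sub X (W Int -S)) (-Z)) w"
  using w wS by (auto simp: singular_chain_subtopology)
 ultimately have "relboundary n (sub X (W Int -S)) (- (W Int (Z - S))) y"
  using v unfolding pair_eq singular_relboundary by blast
 moreover have "relcycle n (sub (sub X (W Int -S)) (W Int U)) (- (W Int (Z - S))) y"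
  unfolding Y_facts(3) pair_eq by (rule y)
 ultimately show ?thesis
  using excision_inj[OF Y_facts(1,2) ZWU] unfolding Y_facts(3) pair_eq by blast
qed

end

definition coordn :: "'a => nat => real" where
 "coordn x = trunc n (\<theta> x)"

lemma coordn_continuous: "W <= U ==> continuous_map (sub X W) (Euc n) coordn"
proof -
 assume W: "W <= U"
 have "continuous_map (sub X U) (top_of_set A) \<theta>"
  using homeo by (simp add: homeomorphic_maps_def)
 moreover have "continuous_map (top_of_set A) (Euc n) (trunc n)"
  unfolding Euclidean_space_eq using continuous_trunc[of A n] trunc_in_Es[of n] by auto
 ultimately have "continuous_map (sub X U) (Euc n) coordn"
  unfolding coordn_def[abs_def] using continuous_map_compose[unfolded o_def] by blast
 then show ?thesis
  using W continuous_map_from_subtopology_mono by blast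
qed

lemma coordn_off: "x : U ==> x ~: Z ==> coordn x ~: {0}"
 using Zlin unfolding coordn_def singleton_iff trunc_eq_0_iff Lsub_def by blast

text \<open>\<open>h\<close> moves a cycle into the chart and takes the degree of its normal
  coordinates. By \<open>pair_inj\<close> the value does not depend on the representative picked by
  \<open>SOME\<close>.\<close>

theorem pair_hom:
 obtains h :: "'a chain => int" where
  "!!a b. [|relcycle n X (-Z) a; relcycle n X (-Z) b|] ==> h (a + b) = h a + h b"
  "!!a. relboundary n X (-Z) a ==> h a = 0"
  "!!e. relcycle n (sub X U) (-Z) e ==> h e = hdeg n (chain_map n coordn e)"
proof -
 let ?T = "topspace X"
 have oT: "openin X ?T" by simp
 have s: "sub X ?T = X" "?T Int U = U" using UX by auto
 define R where "R = (%z e. relcycle n (sub X U) (-Z) e & homrel n X (-Z) z e)"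
 have ex: "\<exists>e. R z e" if "relcycle n X (-Z) z" for z
  using pair_reduce[OF oT, unfolded s, OF that] unfolding R_def by blast
 have push: "relcycle n (Euc n) (-{0}) (chain_map n coordn e)"
  if "relcycle n (sub X U) (-Z) e" for e
  by (rule relcycle_push[OF that coordn_continuous]) (use coordn_off in auto)
 have uniq: "hdeg n (chain_map n coordn e) = hdeg n (chain_map n coordn e')"
  if e: "relcycle n (sub X U) (-Z) e" and e': "relcycle n (sub X U) (-Z) e'"
   and h: "homrel n X (-Z) e e'" for e e'
 proof -
  have "relboundary n (sub X U) (-Z) (e - e')"
   using pair_inj[OF oT, unfolded s] singular_relcycle_diff[OF e e'] h unfolding homologous_rel_def by blast
  then have "homrel n (sub X U) (-Z) e e'" by (simp add: homologous_rel_def)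
  then have "homrel n (Euc n) (-{0}) (chain_map n coordn e) (chain_map n coordn e')"
   by (rule homologous_push[OF _ coordn_continuous]) (use coordn_off in auto)
  then show ?thesis using hdeg_cong push[OF e'] by blast
 qed
 define h where "h = (%z. hdeg n (chain_map n coordn (SOME e. R z e)))"
 have heq: "h z = hdeg n (chain_map n coordn e)" if "R z e" for z e
 proof -
  have "R z (SOME e. R z e)" using that by (rule someI)
  then show ?thesis
   unfolding h_def using uniq that unfolding R_def by (meson homologous_rel_sym homologous_rel_trans)
 qed
 show ?thesis
 proof (rule that[of h])
  fix a b assume a: "relcycle n X (-Z) a" and b: "relcycle n X (-Z) b"
  obtain e f where e: "R a e" and f: "R b f" using ex a b by blast
  have "R (a + b) (e + f)"
   using e f unfolding R_def by (simp add: singular_relcycle_add homologous_rel_add)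
  then have "h (a + b) = hdeg n (chain_map n coordn (e + f))" by (rule heq)
  also have "... = hdeg n (chain_map n coordn e) + hdeg n (chain_map n coordn f)"
   using e f push unfolding R_def by (simp add: chain_map_add hdeg_add)
  finally show "h (a + b) = h a + h b" using heq e f by simp
 next
  fix a assume "relboundary n X (-Z) a"
  then have "R a 0" unfolding R_def by (simp add: homologous_rel_def)
  then have "h a = hdeg n (chain_map n coordn 0)" by (rule heq)
  also have "... = 0" by (rule hdeg_relboundary) simp
  finally show "h a = 0" .
 next
  fix e assume e: "relcycle n (sub X U) (-Z) e"
  then have "R e e" unfolding R_def by simp
  then show "h e = hdeg n (chain_map n coordn e)" by (rule heq)
 qed
qed

end

section \<open>Rank sets and their ranks\<close>

definition rk :: "(nat \<times> nat) set => nat => nat => nat" where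
 "rk M p q = card {x : M. p <= fst x & snd x <= q}"

text \<open>The complex dimension of the cell: an interval contributes its length, less one for
  every interval inside it, itself included.\<close>

definition rdim :: "(nat \<times> nat) set => int" where
 "rdim M = (\<Sum>x\<in>M. int (Suc (snd x) - fst x) - int (rk M (fst x) (snd x)))"

lemma intervals_in_rk:
 assumes "rank_set M" shows "card (intervals_in {p..q} M) = rk M p q"
proof -
 have "{a..b} <= {p..q} \<longleftrightarrow> p <= a & b <= q" if "(a, b) : M" for a b
  using assms that unfolding rank_set_def by auto
 then have "intervals_in {p..q} M = {x : M. p <= fst x & snd x <= q}"
  unfolding intervals_in_def by (auto simp del: atLeastatMost_subset_iff)
 then show ?thesis by (simp add: rk_def)
qed

lemma rk_eq_sum: "finite M ==> int (rk M p q) = (\<Sum>x\<in>M. of_bool (p <= fst x & snd x <= q))"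
 by (simp add: rk_def Int_def)

text \<open>The second difference of the rank function: inclusion-exclusion leaves exactly the
  interval with these two ends.\<close>

lemma rk_point:
 assumes "finite M"
 shows "of_bool ((p, Suc q) : M) = int (rk M p (Suc q)) - int (rk M (Suc p) (Suc q)) - int (rk M p q) + int (rk M (Suc p) q)"
proof -
 have "int (rk M p (Suc q)) - int (rk M (Suc p) (Suc q)) - int (rk M p q) + int (rk M (Suc p) q)
  = (\<Sum>x\<in>M. if x = (p, Suc q) then 1 else 0)"
  unfolding rk_eq_sum[OF assms] sum_subtractf[symmetric] sum.distrib[symmetric]
  by (intro sum.cong refl) (auto simp: of_bool_def)
 then show ?thesis using assms by simp
qed

lemma rank_setD:
 assumes "rank_set M"
 shows "finite M" "x : M ==> 1 <= fst x & fst x <= snd x" "inj_on fst M" "inj_on snd M" "rk M p 0 = 0"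
proof -
 show "finite M" "inj_on fst M" "inj_on snd M" and d: "x : M ==> 1 <= fst x & fst x <= snd x" for x
  using assms unfolding rank_set_def by auto
 have "{x : M. p <= fst x & snd x <= 0} = {}" using d by fastforce
 then show "rk M p 0 = 0" unfolding rk_def by (simp only: card.empty)
qed

lemma rk_determines:
 assumes N: "rank_set N" "rank_set N'" and eq: "!!p q. rk N p q = rk N' p q"
 shows "N = N'"
proof -
 have "x : N \<longleftrightarrow> x : N'" for x
 proof (cases "snd x")
  case 0
  then show ?thesis using rank_setD(2)[OF N(1), of x] rank_setD(2)[OF N(2), of x] by auto
 next
  case (Suc q)
  then have x: "x = (fst x, Suc q)" by (simp add: prod_eq_iff)
  have "(of_bool ((fst x, Suc q) : N) :: int) = of_bool ((fst x, Suc q) : N')"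
   unfolding rk_point[OF rank_setD(1)[OF N(1)]] rk_point[OF rank_setD(1)[OF N(2)]] eq ..
  then show ?thesis using x by (metis of_bool_eq_iff)
 qed
 then show ?thesis by blast
qed

text \<open>Take the largest \<open>p\<close>, and for it the least \<open>q\<close>, at which the
  rank functions differ. Three of the four terms of \<open>rk_point\<close> agree there, so the
  second difference is larger for \<open>N'\<close>, and \<open>(p, q)\<close> belongs to
  \<open>N'\<close>.\<close>

lemma rk_differs:
 assumes N: "rank_set N" "rank_set N'" and le: "!!p q. rk N p q <= rk N' p q" and ne: "N ~= N'"
 obtains x where "x : N'" "rk N (fst x) (snd x) < rk N' (fst x) (snd x)"
proof -
 let ?P = "{p. \<exists>q. rk N p q < rk N' p q}"
 have "?P ~= {}" using rk_determines[OF N] ne le by (metis (mono_tags, lifting) empty_iff le_neq_implies_less mem_Collect_eq)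
 moreover have "?P <= (\<Union>x\<in>N'. {..fst x})"
 proof
  fix p assume "p : ?P"
  then obtain q where "rk N p q < rk N' p q" by auto
  then have "rk N' p q ~= 0" by simp
  then have "{x : N'. p <= fst x & snd x <= q} ~= {}" unfolding rk_def by (metis card.empty)
  then show "p : (\<Union>x\<in>N'. {..fst x})" unfolding UN_iff atMost_iff by blast
 qed
 then have fin: "finite ?P" by (rule finite_subset) (use rank_setD(1)[OF N(2)] in auto)
 define p where "p = Max ?P"
 have p: "p : ?P" unfolding p_def using calculation fin by (rule Max_in[rotated])
 have "Suc p ~: ?P" using Max_ge[OF fin, of "Suc p"] unfolding p_def[symmetric] by auto
 then have top: "rk N (Suc p) q = rk N' (Suc p) q" for q using le[of "Suc p" q] by (auto simp: not_less intro: antisym)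
 define q where "q = (LEAST q. rk N p q < rk N' p q)"
 have q: "rk N p q < rk N' p q" unfolding q_def by (rule LeastI_ex) (use p in auto)
 then obtain q' where q': "q = Suc q'" using rank_setD(5)[OF N(2), of p] by (cases q) auto
 have "~ rk N p q' < rk N' p q'" unfolding q_def[symmetric] using not_less_Least[of q' "%q. rk N p q < rk N' p q"] q' unfolding q_def by simp
 then have "rk N p q' = rk N' p q'" using le[of p q'] by simp
 then have "of_bool ((p, q) : N') > (of_bool ((p, q) : N) :: int)"
  unfolding q' rk_point[OF rank_setD(1)[OF N(1)]] rk_point[OF rank_setD(1)[OF N(2)]] top using q q' by simp
 then have "(p, q) : N'" by (auto simp: of_bool_def split: if_splits)
 then show ?thesis using that[of "(p, q)"] q by simp
qed

text \<open>The lengths are rewritten through ranks, so that two rank sets can be compared by their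
  rank functions; the last sum counts nested pairs.\<close>

lemma rdim_formula:
 assumes M: "rank_set M" and D: "\<forall>x\<in>M. snd x <= D"
 shows "rdim M = int (card M) * (int D + 1) - (\<Sum>d<D. int (rk M 0 d)) - (\<Sum>c\<le>D. int (rk M (Suc c) D))
  - (\<Sum>x\<in>M. int (rk M (fst x) (snd x)))"
proof -
 note f = rank_setD(1)[OF M]
 \<comment> \<open>Among \<open>d < D\<close> there are \<open>D - snd x\<close> with
   \<open>snd x <= d\<close>, and among \<open>c <= D\<close> there are \<open>fst x\<close> with
   \<open>c < fst x\<close>.\<close>
 have len: "int (Suc (snd x) - fst x) = (int D + 1) - (\<Sum>d<D. of_bool (0 <= fst x & snd x <= d)) - (\<Sum>c\<le>D. of_bool (Suc c <= fst x & snd x <= D))"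
  if x: "x : M" for x
 proof -
  have b: "1 <= fst x" "fst x <= snd x" "snd x <= D" using rank_setD(2)[OF M x] D x by auto
  have "{..<D} Int {d. snd x <= d} = {snd x..<D}" "{..D} Int {c. Suc c <= fst x} = {..<fst x}" using b by auto
  then show ?thesis using b by (simp add: of_nat_diff)
 qed
 have "rdim M = (\<Sum>x\<in>M. int (Suc (snd x) - fst x)) - (\<Sum>x\<in>M. int (rk M (fst x) (snd x)))"
  unfolding rdim_def by (rule sum_subtractf)
 also have "(\<Sum>x\<in>M. int (Suc (snd x) - fst x)) = (\<Sum>x\<in>M. (int D + 1) - (\<Sum>d<D. of_bool (0 <= fst x & snd x <= d)) - (\<Sum>c\<le>D. of_bool (Suc c <= fst x & snd x <= D)))"
  by (intro sum.cong refl len)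
 also have "... = int (card M) * (int D + 1) - (\<Sum>d<D. int (rk M 0 d)) - (\<Sum>c\<le>D. int (rk M (Suc c) D))"
  unfolding sum_subtractf rk_eq_sum[OF f] sum.swap[of _ M] by simp
 finally show ?thesis .
qed

text \<open>Nested pairs are counted from the inner interval \<open>y\<close>: from all
  \<open>x\<close> remove those with larger left end and those with smaller right end, and add back
  those with both. Only ranks of \<open>M\<close> remain.\<close>

lemma rk_cross_sum:
 assumes M: "rank_set M" and L: "rank_set L" and D: "\<forall>x\<in>M. snd x <= D"
 shows "(\<Sum>x\<in>M. int (rk L (fst x) (snd x))) = (\<Sum>y\<in>L. int (card M) - int (rk M (Suc (fst y)) D)
  - int (rk M 0 (snd y - 1)) + int (rk M (Suc (fst y)) (snd y - 1)))"
proof -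
 note f = rank_setD(1)[OF M]
 have "(\<Sum>x\<in>M. int (rk L (fst x) (snd x))) = (\<Sum>y\<in>L. \<Sum>x\<in>M. of_bool (fst x <= fst y & snd y <= snd x))"
  unfolding rk_eq_sum[OF rank_setD(1)[OF L]] by (rule sum.swap)
 also have "... = (\<Sum>y\<in>L. \<Sum>x\<in>M. 1 - of_bool (Suc (fst y) <= fst x & snd x <= D)
  - of_bool (0 <= fst x & snd x <= snd y - 1) + of_bool (Suc (fst y) <= fst x & snd x <= snd y - 1))"
 proof (intro sum.cong refl)
  fix x y assume "y : L" "x : M"
  then have "1 <= snd y" "snd x <= D" using rank_setD(2)[OF L, of y] D by auto
  then show "(of_bool (fst x <= fst y & snd y <= snd x) :: int) = 1 - of_bool (Suc (fst y) <= fst x & snd x <= D)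
  - of_bool (0 <= fst x & snd x <= snd y - 1) + of_bool (Suc (fst y) <= fst x & snd x <= snd y - 1)"
   by (auto simp: of_bool_def)
 qed
 finally show ?thesis unfolding sum.distrib sum_subtractf rk_eq_sum[OF f] by simp
qed

text \<open>With \<open>f = rk N' - rk N \<ge> 0\<close>, expanding both numbers of nested pairs through the mixed one
 \<open>(\<Sum>x\<in>N'. rk N x)\<close> shows that \<open>rdim N - rdim N'\<close> is the sum of \<open>f\<close> over \<open>N'\<close> plus nonnegative terms.\<close>

theorem rdim_strict_mono:
 assumes N: "rank_set N" "rank_set N'" "card N = card N'" and le: "!!p q. rk N p q <= rk N' p q" and ne: "N ~= N'"
 shows "rdim N' < rdim N"
proof -
 note fin = rank_setD(1)[OF N(1)] rank_setD(1)[OF N(2)]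
 obtain D where "snd ` (N Un N') <= {..D}" using fin finite_nat_iff_bounded_le[of "snd ` (N Un N')"] by auto
 then have D: "\<forall>x\<in>N. snd x <= D" "\<forall>x\<in>N'. snd x <= D" by auto
 define f where "f p q = int (rk N' p q) - int (rk N p q)" for p q
 have f0: "f p q >= 0" for p q using le unfolding f_def by simp
 have cross: "(\<Sum>x\<in>N'. int (rk N (fst x) (snd x))) - (\<Sum>x\<in>N. int (rk N (fst x) (snd x)))
   = (\<Sum>y\<in>N. f (Suc (fst y)) (snd y - 1)) - (\<Sum>y\<in>N. f (Suc (fst y)) D) - (\<Sum>y\<in>N. f 0 (snd y - 1))"
  unfolding rk_cross_sum[OF N(2,1) D(2)] rk_cross_sum[OF N(1,1) D(1)] N(3) sum_subtractf[symmetric] f_def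
  by (intro sum.cong refl) simp
 have "rdim N - rdim N' = (\<Sum>d<D. f 0 d) + (\<Sum>c\<le>D. f (Suc c) D) + (\<Sum>x\<in>N'. f (fst x) (snd x))
   + ((\<Sum>x\<in>N'. int (rk N (fst x) (snd x))) - (\<Sum>x\<in>N. int (rk N (fst x) (snd x))))"
  unfolding rdim_formula[OF N(1) D(1)] rdim_formula[OF N(2) D(2)] N(3) f_def sum_subtractf by simp
 moreover have "(\<Sum>y\<in>N. f (Suc (fst y)) D) <= (\<Sum>c\<le>D. f (Suc c) D)"
 proof -
  have "(\<Sum>y\<in>N. f (Suc (fst y)) D) = (\<Sum>c\<in>fst ` N. f (Suc c) D)" by (simp add: sum.reindex[OF rank_setD(3)[OF N(1)]])
  also have "... <= (\<Sum>c\<le>D. f (Suc c) D)"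
  proof (rule sum_mono2)
   show "fst ` N <= {..D}"
   proof
    fix c assume "c : fst ` N"
    then obtain y where y: "y : N" "c = fst y" by blast
    then show "c : {..D}" using rank_setD(2)[OF N(1) y(1)] bspec[OF D(1) y(1)] by auto
   qed
  qed (use f0 in auto)
  finally show ?thesis .
 qed
 moreover have "(\<Sum>y\<in>N. f 0 (snd y - 1)) <= (\<Sum>d<D. f 0 d)"
 proof -
  have "inj_on (%y. snd y - 1) N"
  proof (rule inj_onI)
   fix x y assume xy: "x : N" "y : N" "snd x - 1 = snd y - 1"
   then have "snd x = snd y" using rank_setD(2)[OF N(1), of x] rank_setD(2)[OF N(1), of y] by auto
   then show "x = y" using xy rank_setD(4)[OF N(1)] by (auto dest: inj_onD)
  qed
  then have "(\<Sum>y\<in>N. f 0 (snd y - 1)) = (\<Sum>d\<in>(%y. snd y - 1) ` N. f 0 d)" by (simp add: sum.reindex)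
  also have "... <= (\<Sum>d<D. f 0 d)"
  proof (rule sum_mono2)
   show "(%y. snd y - 1) ` N <= {..<D}"
   proof
    fix d assume "d : (%y. snd y - 1) ` N"
    then obtain y where y: "y : N" "d = snd y - 1" by blast
    then show "d : {..<D}" using rank_setD(2)[OF N(1) y(1)] bspec[OF D(1) y(1)] by auto
   qed
  qed (use f0 in auto)
  finally show ?thesis .
 qed
 moreover have "(\<Sum>y\<in>N. f (Suc (fst y)) (snd y - 1)) >= 0" using f0 by (intro sum_nonneg)
 moreover have "(\<Sum>x\<in>N'. f (fst x) (snd x)) > 0"
 proof -
  obtain x where x: "x : N'" "rk N (fst x) (snd x) < rk N' (fst x) (snd x)" using rk_differs[OF N(1,2) le ne] by blast
  then show ?thesis using f0 fin(2) by (intro sum_pos2[of _ x]) (auto simp: f_def)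
 qed
 ultimately show ?thesis using cross by linarith
qed

section \<open>Linear algebra with families of coordinate vectors\<close>

lemma sum_fun_apply: "(\<Sum>i\<in>T. f i) p = (\<Sum>i\<in>T. f i p :: 'b :: comm_monoid_add)"
 by (induction T rule: infinite_finite_induct) auto

definition comb :: "nat set => (nat => complex) => (nat => nat => complex) => nat => complex" where
 "comb T c v = (%p. \<Sum>l\<in>T. c l * v l p)"

text \<open>Independence of an indexed family. A repeated vector makes it dependent, which
  independence of the set of values would not detect.\<close>

definition findep :: "nat set => (nat => nat => complex) => bool" where
 "findep T v \<longleftrightarrow> (\<forall>c. comb T c v = 0 --> (\<forall>l\<in>T. c l = 0))"

lemma findepD: "findep T v ==> comb T c v = 0 ==> l : T ==> c l = 0"
 unfolding findep_def by blast

lemma comb_eq_sum: "comb T c v = (\<Sum>l\<in>T. cscale (c l) (v l))"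
 by (simp add: comb_def fun_eq_iff sum_fun_apply cscale_def)

lemma comb_in_subspace:
 assumes "csubspace W" "v ` T <= W" shows "comb T c v : W"
 unfolding comb_eq_sum using assms by (intro cvec.subspace_sum cvec.subspace_scale) auto

lemma comb_in_span: "comb T c v : cspan (v ` T)"
 by (rule comb_in_subspace[OF cvec.subspace_span cvec.span_superset])

lemma comb_cong: "(!!l. l : T ==> c l = c' l) ==> (!!l. l : T ==> v l = v' l) ==> comb T c v = comb T c' v'"
 unfolding comb_def by (intro ext sum.cong) auto

lemma comb_diff: "comb T c v - comb T d v = comb T (%l. c l - d l) v"
 by (simp add: comb_def fun_eq_iff sum_subtractf algebra_simps)

lemma findep_iff:
 assumes T: "finite T"
 shows "findep T v \<longleftrightarrow> inj_on v T & cvec.independent (v ` T)"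
proof
 assume f: "findep T v"
 have inj: "inj_on v T"
 proof (rule inj_onI, rule ccontr)
  fix i j assume ij: "i : T" "j : T" "v i = v j" "i ~= j"
  let ?c = "%l. if l = i then 1 else if l = j then -1 else 0"
  have "comb T ?c v p = 0" for p
  proof -
   have "comb T ?c v p = (\<Sum>l\<in>T. (if l = i then v i p else 0) + (if l = j then - v j p else 0))"
    unfolding comb_def by (intro sum.cong) (use ij in auto)
   also have "... = v i p - v j p" using T ij by (simp add: sum.distrib)
   finally show ?thesis using ij by simp
  qed
  then have "comb T ?c v = 0" by auto
  from findepD[OF f this ij(1)] show False by simp
 qed
 moreover have "cvec.independent (v ` T)"
 proof
  assume "cvec.dependent (v ` T)"
  then obtain u where u: "\<exists>w\<in>v ` T. u w ~= 0" "(\<Sum>w\<in>v ` T. cscale (u w) w) = 0"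
   using cvec.dependent_finite[of "v ` T"] T by auto
  have "comb T (%l. u (v l)) v = 0"
   unfolding comb_eq_sum using u(2) by (simp add: sum.reindex[OF inj])
  from findepD[OF f this] u(1) show False by auto
 qed
 ultimately show "inj_on v T & cvec.independent (v ` T)" by blast
next
 assume h: "inj_on v T & cvec.independent (v ` T)"
 show "findep T v"
  unfolding findep_def
 proof (intro allI impI ballI, rule ccontr)
  fix c l assume c: "comb T c v = 0" "l : T" "c l ~= 0"
  let ?u = "%w. c (inv_into T v w)"
  have u: "?u (v i) = c i" if "i : T" for i using h that by simp
  have "(\<Sum>w\<in>v ` T. cscale (?u w) w) = comb T c v"
   unfolding comb_eq_sum using h by (simp add: sum.reindex)
  moreover have "\<exists>w\<in>v ` T. ?u w ~= 0" using u c by (metis imageI)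
  ultimately have "cvec.dependent (v ` T)"
   using cvec.dependent_finite[of "v ` T"] T c(1) by auto
  then show False using h by blast
 qed
qed

lemma cspace_span: "cspace m = cspan (uvec ` {1..m})"
proof
 show "cspan (uvec ` {1..m}) <= cspace m"
  by (rule cvec.span_minimal[OF _ cspace_subspace]) (auto simp: cspace_def Defs.unit_vec_def)
 show "cspace m <= cspan (uvec ` {1..m})"
 proof
  fix v assume v: "v : cspace m"
  have "v = (\<Sum>i\<in>{1..m}. cscale (v i) (uvec i))"
  proof
   fix p
   have "(\<Sum>i\<in>{1..m}. cscale (v i) (uvec i)) p = (\<Sum>i\<in>{1..m}. if i = p then v p else 0)"
    unfolding sum_fun_apply by (intro sum.cong) (auto simp: cscale_def Defs.unit_vec_def)
   also have "... = v p" using v by (auto simp: cspace_def)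
   finally show "v p = (\<Sum>i\<in>{1..m}. cscale (v i) (uvec i)) p" by simp
  qed
  then show "v : cspan (uvec ` {1..m})"
   by (metis (no_types, lifting) cvec.span_base cvec.span_scale cvec.span_sum imageI)
 qed
qed

lemma coord_span_eq:
 assumes "finite S" shows "coord_span S = {v. \<forall>i. i ~: S --> v i = 0}"
proof
 have "csubspace {v :: nat => complex. \<forall>i. i ~: S --> v i = 0}"
  by (auto simp: cvec.subspace_def cscale_def)
 then show "coord_span S <= {v. \<forall>i. i ~: S --> v i = 0}"
  unfolding coord_span_def by (intro cvec.span_minimal) (auto simp: Defs.unit_vec_def)
 show "{v. \<forall>i. i ~: S --> v i = 0} <= coord_span S"
 proof
  fix v :: "nat => complex" assume v: "v : {v. \<forall>i. i ~: S --> v i = 0}"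
  have "v = (\<Sum>i\<in>S. cscale (v i) (uvec i))"
  proof
   fix p
   have "(\<Sum>i\<in>S. cscale (v i) (uvec i)) p = (\<Sum>i\<in>S. if i = p then v p else 0)"
    unfolding sum_fun_apply by (intro sum.cong) (auto simp: cscale_def Defs.unit_vec_def)
   also have "... = v p" using v assms by auto
   finally show "v p = (\<Sum>i\<in>S. cscale (v i) (uvec i)) p" by simp
  qed
  then show "v : coord_span S"
   unfolding coord_span_def
   by (metis (no_types, lifting) cvec.span_base cvec.span_scale cvec.span_sum imageI)
 qed
qed

lemma independent_in_cspace_finite:
 assumes "cvec.independent B" "B <= cspace m" shows "finite B"
 using cvec.independent_span_bound[of "uvec ` {1..m}" B] assms cspace_span by auto

lemma subspace_family_basis:
 assumes "csubspace W" "W <= cspace m"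
 obtains v where "findep {..<cdim W} v" "!!i. v i : W" "!!w. w : W ==> \<exists>c. w = comb {..<cdim W} c v"
proof -
 obtain B where B: "B <= W" "cvec.independent B" "W <= cspan B" "card B = cdim W"
  using cvec.basis_exists by blast
 have fB: "finite B" using independent_in_cspace_finite B assms by blast
 then obtain f where f: "bij_betw f {..<cdim W} B"
  using ex_bij_betw_nat_finite[OF fB] B by (metis atLeast0LessThan)
 define v where "v = (%i. if i < cdim W then f i else 0)"
 have im: "v ` {..<cdim W} = B" "inj_on v {..<cdim W}"
  using f unfolding bij_betw_def v_def inj_on_def by auto
 have fi: "findep {..<cdim W} v" using findep_iff[of "{..<cdim W}" v] im B by simp
 have inW: "v i : W" for i
  using B(1) im(1) cvec.subspace_0[OF assms(1)] by (cases "i < cdim W") (auto simp: v_def)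
 have ex: "\<exists>c. w = comb {..<cdim W} c v" if "w : W" for w
 proof -
  have "w : cspan B" using B that by blast
  then obtain u where "w = (\<Sum>x\<in>B. cscale (u x) x)"
   using cvec.span_finite[OF fB] by auto
  then have "w = comb {..<cdim W} (%l. u (v l)) v"
   unfolding comb_eq_sum using sum.reindex[OF im(2), of "%x. cscale (u x) x"] im(1) by simp
  then show ?thesis by blast
 qed
 show ?thesis using that[OF fi inW ex] .
qed

lemma findep_card_le:
 assumes "finite T" "findep T v" "v ` T <= W" "csubspace W" "W <= cspace m"
 shows "card T <= cdim W"
proof -
 obtain B where B: "B <= W" "cvec.independent B" "W <= cspan B" "card B = cdim W"
  using cvec.basis_exists by blast
 have fB: "finite B" using independent_in_cspace_finite B assms by blast
 have "inj_on v T" "cvec.independent (v ` T)" using findep_iff assms by auto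
 then show ?thesis
  using cvec.independent_span_bound[OF fB, of "v ` T"] assms B by (auto simp: card_image)
qed

lemma findep_spans:
 assumes "finite T" "findep T v" "v ` T <= W" "csubspace W" "W <= cspace m" "card T = cdim W" "w : W"
 shows "\<exists>c. w = comb T c v"
proof -
 have iv: "inj_on v T" "cvec.independent (v ` T)" using findep_iff assms by auto
 have "w : cspan (v ` T)"
 proof (rule ccontr)
  assume w: "w ~: cspan (v ` T)"
  then have "cvec.independent (insert w (v ` T))"
   using iv cvec.independent_insert cvec.span_base by metis
  moreover obtain B where B: "B <= W" "cvec.independent B" "W <= cspan B" "card B = cdim W"
   using cvec.basis_exists by blast
  moreover have "finite B" using independent_in_cspace_finite B assms by blast
  ultimately have "card (insert w (v ` T)) <= card B"
   using cvec.independent_span_bound[of B "insert w (v ` T)"] assms by auto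
  moreover have "w ~: v ` T" using w cvec.span_base by blast
  ultimately show False using B assms iv by (simp add: card_image)
 qed
 then obtain u where "w = (\<Sum>x\<in>v ` T. cscale (u x) x)"
  using cvec.span_finite[of "v ` T"] assms(1) by auto
 then have "w = comb T (%l. u (v l)) v"
  unfolding comb_eq_sum using iv by (simp add: sum.reindex)
 then show ?thesis by blast
qed

lemma cdim_eqI:
 assumes "finite T" "findep T v" "v ` T <= W" "!!w. w : W ==> \<exists>c. w = comb T c v"
 shows "cdim W = card T"
proof (rule cvec.dim_unique[of "v ` T"])
 have iv: "inj_on v T" "cvec.independent (v ` T)" using findep_iff assms by auto
 show "cvec.independent (v ` T)" "card (v ` T) = card T" using iv by (auto simp: card_image)
 show "v ` T <= W" by fact
 show "W <= cspan (v ` T)"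
 proof
  fix w assume "w : W"
  then obtain c where "w = comb T c v" using assms(4) by blast
  then show "w : cspan (v ` T)" by (simp add: comb_in_span)
 qed
qed

lemma row_space_iff: "v : row_space k A \<longleftrightarrow> (\<exists>c. v = comb {..<k} c A)"
proof
 let ?W = "{v. \<exists>c. v = comb {..<k} c A}"
 have "csubspace ?W"
  unfolding cvec.subspace_def
 proof (intro conjI ballI allI)
  show "0 : ?W" by (auto simp: comb_def fun_eq_iff intro!: exI[of _ "%_. 0"])
  show "x + y : ?W" if xy: "x : ?W" "y : ?W" for x y
  proof -
   obtain c d where "x = comb {..<k} c A" "y = comb {..<k} d A" using xy by blast
   then have "x + y = comb {..<k} (%l. c l + d l) A"
    by (simp add: comb_def fun_eq_iff sum.distrib algebra_simps)
   then show ?thesis by blast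
  qed
  show "cscale t x : ?W" if x: "x : ?W" for t x
  proof -
   obtain c where "x = comb {..<k} c A" using x by blast
   then have "cscale t x = comb {..<k} (%l. t * c l) A"
    by (simp add: comb_def fun_eq_iff cscale_def sum_distrib_left algebra_simps)
   then show ?thesis by blast
  qed
 qed
 moreover have "A ` {..<k} <= ?W"
 proof
  fix w assume "w : A ` {..<k}"
  then obtain i where i: "i < k" "w = A i" by blast
  have "comb {..<k} (%l. if l = i then 1 else 0) A = A i"
  proof
   fix p
   have "comb {..<k} (%l. if l = i then 1 else 0) A p = (\<Sum>l<k. if l = i then A i p else 0)"
    unfolding comb_def by (intro sum.cong) auto
   then show "comb {..<k} (%l. if l = i then 1 else 0) A p = A i p" using i by simp
  qed
  then show "w : ?W" using i by (metis (mono_tags, lifting) mem_Collect_eq)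
 qed
 ultimately have "row_space k A <= ?W"
  unfolding row_space_def by (intro cvec.span_minimal)
 then show "v : row_space k A ==> \<exists>c. v = comb {..<k} c A" by blast
 show "\<exists>c. v = comb {..<k} c A ==> v : row_space k A"
  unfolding row_space_def using comb_in_span by auto
qed

lemma row_in_row_space: "i < k ==> A i : row_space k A"
 unfolding row_space_def by (intro cvec.span_base) auto

lemma cdim_row_space_iff: "cdim (row_space k A) = k \<longleftrightarrow> findep {..<k} A"
proof
 assume "findep {..<k} A"
 then have "cdim (row_space k A) = card {..<k}"
  by (intro cdim_eqI) (auto simp: row_space_iff[symmetric] intro: row_in_row_space)
 then show "cdim (row_space k A) = k" by simp
next
 assume d: "cdim (row_space k A) = k"
 obtain B where B: "B <= A ` {..<k}" "cvec.independent B" "A ` {..<k} <= cspan B"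
  using cvec.maximal_independent_subset by blast
 have "card B = k"
  using cvec.dim_unique[OF B(1,3,2) refl] d cvec.dim_span unfolding row_space_def by metis
 moreover have "card (A ` {..<k}) <= k" using card_image_le[of "{..<k}" A] by simp
 ultimately have eq: "B = A ` {..<k}" using B(1) card_seteq[of "A ` {..<k}" B] by simp
 then have "card (A ` {..<k}) = card {..<k}" using \<open>card B = k\<close> by simp
 then have "inj_on A {..<k}" by (intro eq_card_imp_inj_on) auto
 then show "findep {..<k} A" using findep_iff[of "{..<k}" A] B eq by simp
qed

lemma frames_iff: "A : frames k m \<longleftrightarrow> (\<forall>i<k. A i : cspace m) & (\<forall>i\<ge>k. A i = 0) & findep {..<k} A"
 unfolding frames_def by (simp add: cdim_row_space_iff)

lemma Gr_frame:
 assumes "V : Gr k m" obtains A where "A : frames k m" "row_space k A = V"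
proof -
 have V: "csubspace V" "V <= cspace m" "cdim V = k" using assms by (auto simp: Gr_def)
 obtain v where v: "findep {..<k} v" "!!i. v i : V" "!!w. w : V ==> \<exists>c. w = comb {..<k} c v"
  using subspace_family_basis[OF V(1,2)] V(3) by metis
 define A where "A = (%i. if i < k then v i else 0)"
 have c: "comb {..<k} c A = comb {..<k} c v" for c by (intro comb_cong) (auto simp: A_def)
 have "A : frames k m"
  unfolding frames_iff using v V(2) by (auto simp: A_def[THEN fun_cong] findep_def c)
 moreover have "row_space k A = V"
 proof
  show "row_space k A <= V"
   unfolding row_space_iff subset_iff c using comb_in_subspace[OF V(1)] v(2) by blast
  show "V <= row_space k A" unfolding row_space_iff subset_iff c using v(3) by blast
 qed
 ultimately show ?thesis using that by blast
qed

lemma frame_in_subspace: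
 assumes A: "findep {..<k} A" "!!i. i < k ==> A i : V" and V: "V : Gr k m"
 shows "row_space k A = V"
proof
 have V': "csubspace V" "V <= cspace m" "cdim V = k" using V by (auto simp: Gr_def)
 have "A ` {..<k} <= V" using A by auto
 then show "row_space k A <= V" unfolding row_space_def using V'(1) by (rule cvec.span_minimal)
 show "V <= row_space k A"
  unfolding row_space_iff subset_iff using findep_spans[OF _ A(1) \<open>A ` {..<k} \<subseteq> V\<close> V'(1,2)] V'(3) by simp
qed

section \<open>Cells\<close>

definition rkV :: "(nat => complex) set => nat => nat => nat" where
 "rkV V p q = cdim (V Int coord_span {p..q})"

lemma in_coord_span_interval: "v : coord_span {p..q} \<longleftrightarrow> (\<forall>i. v i ~= 0 --> p <= i & i <= q)"
 by (subst coord_span_eq) auto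

lemma coord_span_interval_mono:
 "w : coord_span {p..q} ==> p' <= p ==> q <= q' ==> w : coord_span {p'..q'}"
 unfolding in_coord_span_interval by (meson le_trans)

lemma csubspace_coord_span: "csubspace (coord_span S)"
 unfolding coord_span_def by (rule cvec.subspace_span)

text \<open>A rank set listed by the rows of a matrix, row \<open>i\<close> belonging to the
  interval \<open>[a i, b i]\<close>.\<close>

locale spans =
 fixes k m :: nat and a b :: "nat => nat"
 assumes inj_a: "inj_on a {..<k}" and inj_b: "inj_on b {..<k}"
  and ab: "!!i. i < k ==> 1 <= a i & a i <= b i & b i <= m"
begin

definition rset :: "(nat \<times> nat) set" where
 "rset = (%i. (a i, b i)) ` {..<k}"

lemma inj_pair: "inj_on (%i. (a i, b i)) {..<k}"
 using inj_a unfolding inj_on_def by auto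

lemma rank_set_rset: "rank_set rset"
 unfolding rank_set_def
proof (intro conjI)
 show "inj_on fst rset" "inj_on snd rset"
  using inj_a inj_b unfolding rset_def inj_on_def by auto
 show "\<forall>(a, b)\<in>rset. 1 <= a & a <= b" using ab unfolding rset_def by auto
qed (simp add: rset_def)

lemma card_rset: "card rset = k"
 unfolding rset_def by (simp add: card_image[OF inj_pair])

lemma rk_rset: "rk rset p q = card {i. i < k & p <= a i & b i <= q}"
proof -
 have "{x : rset. p <= fst x & snd x <= q} = (%i. (a i, b i)) ` {i. i < k & p <= a i & b i <= q}"
  unfolding rset_def by auto
 moreover have "inj_on (%i. (a i, b i)) {i. i < k & p <= a i & b i <= q}"
  using inj_pair by (rule inj_on_subset) auto
 ultimately show ?thesis unfolding rk_def by (simp add: card_image)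
qed

definition spanned :: "(nat => nat => complex) => bool" where
 "spanned B \<longleftrightarrow> (\<forall>i<k. (\<forall>p. B i p ~= 0 --> a i <= p & p <= b i) & B i (a i) ~= 0 & B i (b i) ~= 0) & (\<forall>i\<ge>k. B i = 0)"

definition cell :: "(nat => complex) set set" where
 "cell = row_space k ` Collect spanned"

text \<open>Left ends are distinct, so at the least left end of the contributing rows every other
  contributing row still vanishes.\<close>

lemma spanned_leading:
 assumes B: "spanned B" and T: "T <= {..<k}" "finite T" and i: "i : T" "!!l. l : T ==> c l ~= 0 ==> a i <= a l"
 shows "comb T c B (a i) = c i * B i (a i)"
proof -
 have "c l * B l (a i) = 0" if "l : T" "l ~= i" for l
 proof (cases "c l = 0")
  case False
  then have "a i <= a l" using i that by blast
  moreover have "a i ~= a l" using inj_a that i(1) T unfolding inj_on_def by blast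
  ultimately have "~ a l <= a i" by simp
  then have "B l (a i) = 0" using B T that unfolding spanned_def by blast
  then show ?thesis by simp
 qed simp
 then have "comb T c B (a i) = (\<Sum>l\<in>T. if l = i then c i * B i (a i) else 0)"
  unfolding comb_def by (intro sum.cong) auto
 then show ?thesis using T i by simp
qed

lemma spanned_trailing:
 assumes B: "spanned B" and T: "T <= {..<k}" "finite T" and i: "i : T" "!!l. l : T ==> c l ~= 0 ==> b l <= b i"
 shows "comb T c B (b i) = c i * B i (b i)"
proof -
 have "c l * B l (b i) = 0" if "l : T" "l ~= i" for l
 proof (cases "c l = 0")
  case False
  then have "b l <= b i" using i that by blast
  moreover have "b i ~= b l" using inj_b that i(1) T unfolding inj_on_def by blast
  ultimately have "~ b i <= b l" by simp
  then have "B l (b i) = 0" using B T that unfolding spanned_def by blast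
  then show ?thesis by simp
 qed simp
 then have "comb T c B (b i) = (\<Sum>l\<in>T. if l = i then c i * B i (b i) else 0)"
  unfolding comb_def by (intro sum.cong) auto
 then show ?thesis using T i by simp
qed

text \<open>The entries at the least left end and at the greatest right end of the contributing rows
  cannot cancel, so these two ends lie in \<open>[p, q]\<close>, and all contributing intervals lie
  between them.\<close>

lemma spanned_support:
 assumes B: "spanned B" and v: "!!x. comb {..<k} c B x ~= 0 ==> p <= x & x <= q" and i: "i < k" "c i ~= 0"
 shows "p <= a i & b i <= q"
proof -
 let ?T = "{l. l < k & c l ~= 0}"
 have T: "finite ?T" "i : ?T" using i by auto
 obtain j where j: "j : ?T" "!!l. l : ?T ==> a j <= a l"
 proof -
  have "Min (a ` ?T) : a ` ?T" using T by (intro Min_in) auto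
  then obtain j where "j : ?T" "a j = Min (a ` ?T)" by auto
  then show ?thesis using that[of j] T by auto
 qed
 obtain j' where j': "j' : ?T" "!!l. l : ?T ==> b l <= b j'"
 proof -
  have "Max (b ` ?T) : b ` ?T" using T by (intro Max_in) auto
  then obtain j' where "j' : ?T" "b j' = Max (b ` ?T)" by auto
  then show ?thesis using that[of j'] T by auto
 qed
 have "comb {..<k} c B (a j) = c j * B j (a j)"
  by (rule spanned_leading[OF B]) (use j in auto)
 then have "p <= a j" using v[of "a j"] j B unfolding spanned_def by auto
 have "comb {..<k} c B (b j') = c j' * B j' (b j')"
  by (rule spanned_trailing[OF B]) (use j' in auto)
 then have "b j' <= q" using v[of "b j'"] j' B unfolding spanned_def by auto
 then show ?thesis using \<open>p \<le> a j\<close> j(2)[OF T(2)] j'(2)[OF T(2)] by linarith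
qed

lemma spanned_findep: "spanned B ==> findep {..<k} B"
 unfolding findep_def
proof (intro allI impI ballI, rule ccontr)
 fix c l assume B: "spanned B" and c: "comb {..<k} c B = 0" and l: "l : {..<k}" "c l ~= 0"
 \<comment> \<open>The zero vector is supported in the empty interval
   \<open>[Suc m, 0]\<close>.\<close>
 have "Suc m <= a l & b l <= 0"
  using spanned_support[of B c "Suc m" 0 l] B c l by simp
 then show False using ab[of l] l by simp
qed

lemma spanned_frame: "spanned B ==> B : frames k m"
 unfolding frames_iff
proof (intro conjI)
 assume B: "spanned B"
 show "findep {..<k} B" by (rule spanned_findep[OF B])
 show "\<forall>i\<ge>k. B i = 0" using B by (simp add: spanned_def)
 show "\<forall>i<k. B i : cspace m"
  unfolding cspace_def
 proof (intro allI impI CollectI)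
  fix i p assume "i < k" "p ~: {1..m}"
  moreover from this have "~ (a i <= p & p <= b i)" using ab[of i] by auto
  ultimately show "B i p = 0" using B unfolding spanned_def by blast
 qed
qed

lemma cell_Gr: "cell <= Gr k m"
 unfolding cell_def using spanned_frame row_space_in_Gr by auto

text \<open>By \<open>spanned_support\<close> the rows whose intervals lie in \<open>[p, q]\<close>
  form a basis of the intersection.\<close>

lemma rkV_cell:
 assumes "V : cell" shows "rkV V p q = rk rset p q"
proof -
 obtain B where B: "spanned B" "V = row_space k B" using assms unfolding cell_def by blast
 let ?T = "{i. i < k & p <= a i & b i <= q}"
 have ext: "comb {..<k} (%l. if l : ?T then c l else 0) B = comb ?T c B" for c
 proof
  fix x
  have "comb ?T c B x = (\<Sum>l<k. if l : ?T then c l * B l x else 0)"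
   unfolding comb_def by (subst sum.inter_filter[symmetric]) (auto intro: sum.cong)
  then show "comb {..<k} (%l. if l : ?T then c l else 0) B x = comb ?T c B x"
   unfolding comb_def by (auto intro!: sum.cong)
 qed
 have "cdim (V Int coord_span {p..q}) = card ?T"
 proof (rule cdim_eqI[of ?T B])
  show "findep ?T B"
   unfolding findep_def
  proof (intro allI impI ballI)
   fix c l assume h: "comb ?T c B = 0" "l : ?T"
   have "comb {..<k} (%l. if l : ?T then c l else 0) B = 0" using ext[of c] h by simp
   from findepD[OF spanned_findep[OF B(1)] this, of l] h show "c l = 0" by simp
  qed
  show "B ` ?T <= V Int coord_span {p..q}"
  proof
   fix w assume "w : B ` ?T"
   then obtain i where i: "i : ?T" "w = B i" by blast
   have "w : V" using i B row_in_row_space by simp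
   moreover have "w : coord_span {p..q}"
    unfolding in_coord_span_interval
   proof (intro allI impI)
    fix x assume "w x ~= 0"
    then have "a i <= x & x <= b i" using B(1) i unfolding spanned_def by blast
    then show "p <= x & x <= q" using i by simp
   qed
   ultimately show "w : V Int coord_span {p..q}" by simp
  qed
  show "\<exists>c. w = comb ?T c B" if w: "w : V Int coord_span {p..q}" for w
  proof -
   obtain c where c: "w = comb {..<k} c B" using w B row_space_iff by auto
   have sup: "!!x. comb {..<k} c B x ~= 0 ==> p <= x & x <= q"
    using w in_coord_span_interval unfolding c by blast
   have "c i = 0" if "i < k" "i ~: ?T" for i
    using spanned_support[of B c p q i] B(1) sup that by blast
   then have "w = comb {..<k} (%l. if l : ?T then c l else 0) B"
    unfolding c by (intro comb_cong) auto
   then show ?thesis unfolding ext by blast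
  qed
 qed auto
 then show ?thesis unfolding rkV_def rk_rset .
qed

end

section \<open>Every subspace lies in a cell\<close>

definition vlo :: "(nat => complex) => nat" where "vlo v = Min {p. v p ~= 0}"
definition vhi :: "(nat => complex) => nat" where "vhi v = Max {p. v p ~= 0}"

lemma vlo_vhi:
 assumes "v : cspace m" "v ~= 0"
 shows "v (vlo v) ~= 0" "v (vhi v) ~= 0" "v p ~= 0 ==> vlo v <= p & p <= vhi v" "1 <= vlo v" "vlo v <= vhi v" "vhi v <= m"
proof -
 let ?S = "{p. v p ~= 0}"
 have S: "?S <= {1..m}" using assms(1) unfolding cspace_def by blast
 then have fS: "finite ?S" by (rule finite_subset) simp
 have ne: "?S ~= {}" using assms(2) by (auto simp: fun_eq_iff)
 have M: "Min ?S : ?S" "Max ?S : ?S" using Min_in[OF fS ne] Max_in[OF fS ne] by blast+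
 then show "v (vlo v) ~= 0" "v (vhi v) ~= 0" by (auto simp: vlo_def vhi_def)
 show "v p ~= 0 ==> vlo v <= p & p <= vhi v" using fS by (auto simp: vlo_def vhi_def)
 show "1 <= vlo v" "vhi v <= m" using M S by (auto simp: vlo_def vhi_def)
 show "vlo v <= vhi v" using M fS by (auto simp: vlo_def vhi_def)
qed

lemma row_operation:
 assumes A: "A : frames k m" and il: "i < k" "l < k" "i ~= l"
 shows "A(l := A l - cscale t (A i)) : frames k m" "row_space k (A(l := A l - cscale t (A i))) = row_space k A"
proof -
 let ?A = "A(l := A l - cscale t (A i))"
 have cs: "!!i. i < k ==> A i : cspace m" and ind: "findep {..<k} A" and z: "!!i. i >= k ==> A i = 0"
  using A frames_iff by auto
 have eq: "comb {..<k} c ?A = comb {..<k} (c(i := c i - t * c l)) A" for c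
 proof
  fix p
  have "comb {..<k} c ?A p = (\<Sum>j<k. c j * A j p - (if j = l then t * c l * A i p else 0))"
   unfolding comb_def by (intro sum.cong) (auto simp: cscale_def algebra_simps)
  also have "... = (\<Sum>j<k. c j * A j p) - t * c l * A i p" using il by (simp add: sum_subtractf)
  also have "... = (\<Sum>j<k. c j * A j p - (if j = i then t * c l * A i p else 0))" using il by (simp add: sum_subtractf)
  also have "... = comb {..<k} (c(i := c i - t * c l)) A p"
   unfolding comb_def by (intro sum.cong) (auto simp: algebra_simps)
  finally show "comb {..<k} c ?A p = comb {..<k} (c(i := c i - t * c l)) A p" .
 qed
 have "findep {..<k} ?A"
  unfolding findep_def
 proof (intro allI impI)
  fix c assume "comb {..<k} c ?A = 0"
  then have h: "\<forall>j\<in>{..<k}. (c(i := c i - t * c l)) j = 0"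
   using findepD[OF ind] unfolding eq by blast
  then have "c l = 0" using il by (metis fun_upd_other lessThan_iff)
  then show "\<forall>j\<in>{..<k}. c j = 0" using h by (metis diff_zero fun_upd_apply mult_zero_right)
 qed
 moreover have "A l - cscale t (A i) : cspace m"
  using cs il cspace_subspace by (intro cvec.subspace_diff cvec.subspace_scale) auto
 ultimately show fr: "?A : frames k m" unfolding frames_iff using cs z il by auto
 have V: "row_space k A : Gr k m" by (rule row_space_in_Gr[OF A])
 then have "csubspace (row_space k A)" by (simp add: Gr_def)
 then have "?A j : row_space k A" if "j < k" for j
  using that row_in_row_space[of j k A] row_in_row_space[OF il(1), of A] row_in_row_space[OF il(2), of A]
  by (auto intro!: cvec.subspace_diff cvec.subspace_scale)
 then show "row_space k ?A = row_space k A"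
  using frame_in_subspace[OF _ _ V] fr frames_iff by blast
qed

text \<open>Among the frames of \<open>V\<close> one of least total row length is chosen. If two
  rows had a left or a right end in common, subtracting a multiple of the row with the smaller range
  from the other one would shorten the latter.\<close>

theorem cell_exists:
 assumes V: "V : Gr k m"
 obtains a b where "spans k m a b" "V : spans.cell k a b"
proof -
 define \<mu> where "\<mu> = (%A :: nat => nat => complex. \<Sum>i<k. vhi (A i) - vlo (A i))"
 obtain A0 where A0: "A0 : frames k m & row_space k A0 = V" using Gr_frame[OF V] by blast
 obtain A where A: "A : frames k m & row_space k A = V"
   and min: "!!A'. A' : frames k m & row_space k A' = V ==> \<mu> A <= \<mu> A'"
  using ex_has_least_nat[of "%A. A : frames k m & row_space k A = V" A0 \<mu>] A0 by blast
 have cs: "!!i. i < k ==> A i : cspace m" and ind: "findep {..<k} A" and z: "!!i. i >= k ==> A i = 0"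
  using A frames_iff by auto
 have nz': "A' i ~= 0" if "A' : frames k m" "i < k" for A' i
 proof
  assume "A' i = 0"
  then have "comb {..<k} (%l. if l = i then 1 else 0) A' = 0"
   by (auto simp: comb_def fun_eq_iff intro!: sum.neutral)
  from findepD[OF _ this, of i] that show False unfolding frames_iff by simp
 qed
 note nz = nz'[of A, OF conjunct1[OF A]]
 note vv = vlo_vhi[OF cs nz]
 \<comment> \<open>\<open>ends\<close> says that the range of row \<open>i\<close> lies within that
   of row \<open>l\<close> and shares its end \<open>x\<close>. The new row \<open>?w\<close>
   vanishes at \<open>x\<close> and stays within the old range, so it is strictly shorter.\<close>
 have red: False if il: "i < k" "l < k" "i ~= l" and x: "A i x ~= 0"
  and ends: "x = vlo (A l) & x = vlo (A i) & vhi (A i) <= vhi (A l) | x = vhi (A l) & x = vhi (A i) & vlo (A l) <= vlo (A i)" for i l x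
 proof -
  let ?w = "A l - cscale (A l x / A i x) (A i)"
  let ?A = "A(l := ?w)"
  have fr: "?A : frames k m & row_space k ?A = V"
   using row_operation[OF conjunct1[OF A] il] A by simp
  have w0: "?w x = 0" using x by (simp add: cscale_def)
  have wcs: "?w : cspace m" "?w ~= 0"
   using fr nz'[of ?A l] il frames_iff by (metis fun_upd_same)+
  note w = vlo_vhi[OF wcs]
  have sup: "vlo (A l) <= p & p <= vhi (A l)" if "?w p ~= 0" for p
  proof -
   have "A l p ~= 0 | A i p ~= 0" using that by (auto simp: cscale_def)
   then show ?thesis
   proof
    assume "A l p ~= 0" then show ?thesis using vv(3)[of l p] il by blast
   next
    assume "A i p ~= 0"
    then have "vlo (A i) <= p & p <= vhi (A i)" using vv(3)[of i p] il by blast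
    then show ?thesis using ends by auto
   qed
  qed
  have "vlo ?w ~= x" "vhi ?w ~= x" using w(1,2) w0 by metis+
  then have lt: "vhi ?w - vlo ?w < vhi (A l) - vlo (A l)"
   using sup[OF w(1)] sup[OF w(2)] w(5) ends by (auto simp: diff_less_mono)
  have "\<mu> ?A < \<mu> A"
   unfolding \<mu>_def by (rule sum_strict_mono_ex1) (use lt il in \<open>auto intro!: bexI[of _ l]\<close>)
  then show False using min[OF fr] by simp
 qed
 let ?a = "%i. vlo (A i)" and ?b = "%i. vhi (A i)"
 have sp: "spans k m ?a ?b"
 proof
  show "inj_on ?a {..<k}"
  proof (rule inj_onI, rule ccontr)
   fix i l assume h: "i : {..<k}" "l : {..<k}" "vlo (A i) = vlo (A l)" "i ~= l"
   show False
   proof (cases "vhi (A i) <= vhi (A l)")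
    case True
    then show False using red[of i l "vlo (A i)"] h vv(1)[of i] by auto
   next
    case False
    then show False using red[of l i "vlo (A l)"] h vv(1)[of l] by auto
   qed
  qed
  show "inj_on ?b {..<k}"
  proof (rule inj_onI, rule ccontr)
   fix i l assume h: "i : {..<k}" "l : {..<k}" "vhi (A i) = vhi (A l)" "i ~= l"
   show False
   proof (cases "vlo (A l) <= vlo (A i)")
    case True
    then show False using red[of i l "vhi (A i)"] h vv(2)[of i] by auto
   next
    case False
    then show False using red[of l i "vhi (A l)"] h vv(2)[of l] by auto
   qed
  qed
  show "1 <= vlo (A i) & vlo (A i) <= vhi (A i) & vhi (A i) <= m" if "i < k" for i
   using vv(4-6) that by blast
 qed
 moreover have "V : spans.cell k ?a ?b"
 proof -
  have "spans.spanned k ?a ?b A"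
   unfolding spans.spanned_def[OF sp] using vv(1-3) z by blast
  then show ?thesis unfolding spans.cell_def[OF sp] using A by blast
 qed
 ultimately show ?thesis using that by blast
qed

context spans
begin

text \<open>The rows are found in the order of decreasing left ends. The rank conditions only
  concern intersections of two intervals, and these suffice: for the next interval
  \<open>[a i, b i]\<close> and an earlier row \<open>l0\<close> that sticks out to the right, the
  intersection is \<open>[a l0, b i]\<close>.\<close>

theorem intersection_basis:
 assumes V: "V : Gr k m"
  and dims: "!!i l. [|i < k; l < k|] ==> cdim (V Int coord_span ({a i..b i} Int {a l..b l})) = card (intervals_in ({a i..b i} Int {a l..b l}) rset)"
 obtains A where "A : frames k m" "row_space k A = V" "!!i. i < k ==> A i : coord_span {a i..b i}"
proof -
 have V': "csubspace V" "V <= cspace m" "cdim V = k" using V by (auto simp: Gr_def)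
 have rkI: "rkV V (max (a i) (a l)) (min (b i) (b l)) = card {j. j < k & max (a i) (a l) <= a j & b j <= min (b i) (b l)}"
  if "i < k" "l < k" for i l
  using dims[OF that] intervals_in_rk[OF rank_set_rset] rk_rset by (simp add: rkV_def)
 have sub: "csubspace (V Int coord_span S)" "V Int coord_span S <= cspace m" for S
  using V' csubspace_coord_span cvec.subspace_inter by auto
 \<comment> \<open>Downward induction on \<open>s\<close>: the rows with left end at least
   \<open>s\<close> have been chosen.\<close>
 have "\<exists>v. (\<forall>l. l < k & s <= a l --> v l : V Int coord_span {a l..b l}) & findep {l. l < k & s <= a l} v" if "s <= Suc m" for s
  using that
 proof (induction rule: inc_induct)
  case base
  have "{l. l < k & Suc m <= a l} = {}" using ab by fastforce
  then show ?case by (auto simp: findep_def dest: ab)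
 next
  case (step s)
  let ?T = "{l. l < k & Suc s <= a l}"
  obtain v where v: "!!l. l : ?T ==> v l : V Int coord_span {a l..b l}" and ind: "findep ?T v"
   using step.IH by auto
  show ?case
  proof (cases "\<exists>i<k. a i = s")
   case False
   then have "{l. l < k & s <= a l} = ?T" using Suc_leI le_neq_implies_less by fastforce
   then show ?thesis using v ind by (intro exI[of _ v]) auto
  next
   case True
   then obtain i where i: "i < k" "a i = s" by blast
   have iT: "i ~: ?T" using i by simp
   have Teq: "{l. l < k & s <= a l} = insert i ?T"
   proof -
    have u: "l = i" if "l < k" "a l = s" for l using inj_a that i unfolding inj_on_def by auto
    have "l < k & s <= a l \<longleftrightarrow> l = i | l < k & Suc s <= a l" for l
     using i u[of l] by (cases "a l = s") auto
    then show ?thesis by blast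
   qed
   let ?K = "{l : ?T. b l <= b i}"
   \<comment> \<open>A combination of the chosen rows that lies in the new interval uses no row with
     right end beyond \<open>b i\<close>. Let \<open>l0\<close> have the least left end among the
     offending rows \<open>?C\<close>. Their part of the sum lies in \<open>[a l0, b i]\<close>,
     whose intersection with \<open>V\<close> has the rows of \<open>?K'\<close> as a basis by the
     dimension condition; this contradicts independence.\<close>
   have zero: "c j = 0" if x: "comb ?T c v : coord_span {a i..b i}" and j: "j : ?T" "b i < b j" for c j
   proof (rule ccontr)
    assume cj: "c j ~= 0"
    let ?C = "{l : ?T. b i < b l & c l ~= 0}"
    have C: "finite ?C" "j : ?C" using j cj by auto
    obtain l0 where l0: "l0 : ?C" "!!l. l : ?C ==> a l0 <= a l"
    proof -
     have "Min (a ` ?C) : a ` ?C" using C by (intro Min_in) auto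
     then obtain l0 where "l0 : ?C" "a l0 = Min (a ` ?C)" by auto
     then show ?thesis using that[of l0] C by auto
    qed
    have split: "comb ?T c v = comb ?K c v + comb ?C c v"
    proof
     fix p
     have "comb ?T c v p = (\<Sum>l\<in>?T. (if b l <= b i then c l * v l p else 0) + (if b i < b l & c l ~= 0 then c l * v l p else 0))"
      unfolding comb_def by (intro sum.cong) auto
     also have "... = (comb ?K c v + comb ?C c v) p"
     proof -
      have "comb ?K c v p = (\<Sum>l\<in>?T. if b l <= b i then c l * v l p else 0)"
       unfolding comb_def by (rule sum.mono_neutral_cong_left) auto
      moreover have "comb ?C c v p = (\<Sum>l\<in>?T. if b i < b l & c l ~= 0 then c l * v l p else 0)"
       unfolding comb_def by (rule sum.mono_neutral_cong_left) auto
      ultimately show ?thesis by (simp only: sum.distrib plus_fun_apply)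
     qed
     finally show "comb ?T c v p = (comb ?K c v + comb ?C c v) p" .
    qed
    have vK: "v ` ?K <= coord_span {a i..b i}"
    proof
     fix w assume "w : v ` ?K"
     then obtain l where l: "l : ?K" "w = v l" by blast
     then have "w : coord_span {a l..b l}" using v by auto
     then show "w : coord_span {a i..b i}" using l i by (auto intro: coord_span_interval_mono)
    qed
    have "comb ?K c v : coord_span {a i..b i}"
     by (rule comb_in_subspace[OF csubspace_coord_span vK])
    then have "comb ?T c v - comb ?K c v : coord_span {a i..b i}"
     using x csubspace_coord_span cvec.subspace_diff by blast
    then have y1: "comb ?C c v : coord_span {a i..b i}" using split by simp
    have y2: "a l0 <= p" if yp: "comb ?C c v p ~= 0" for p
    proof -
     obtain l where "l : ?C" "c l * v l p ~= 0"
      using sum.not_neutral_contains_not_neutral[OF yp[unfolded comb_def]] by blast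
     then have l: "l : ?C" "v l p ~= 0" by auto
     then have "a l <= p" using v[of l] in_coord_span_interval by auto
     then show ?thesis using l0(2)[OF l(1)] by simp
    qed
    have vCV: "v ` ?C <= V" using v by auto
    have yW: "comb ?C c v : V Int coord_span {a l0..b i}"
    proof
     show "comb ?C c v : V" by (rule comb_in_subspace[OF V'(1) vCV])
     show "comb ?C c v : coord_span {a l0..b i}"
      unfolding in_coord_span_interval using y1[unfolded in_coord_span_interval] y2 by blast
    qed
    let ?K' = "{j. j < k & a l0 <= a j & b j <= b i}"
    have l0T: "l0 < k" "s < a l0" "b i < b l0" using l0(1) by auto
    have "max (a i) (a l0) = a l0" "min (b i) (b l0) = b i" using l0T i by auto
    then have dimW: "cdim (V Int coord_span {a l0..b i}) = card ?K'"
     using rkI[OF i(1) l0T(1)] unfolding rkV_def by simp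
    have K'T: "?K' <= ?T" using l0T by auto
    have ind': "findep ?K' v"
     unfolding findep_def
    proof (intro allI impI ballI)
     fix d l assume d: "comb ?K' d v = 0" "l : ?K'"
     have "comb ?T (%l. if l : ?K' then d l else 0) v = comb ?K' d v"
      unfolding comb_def by (intro ext sum.mono_neutral_cong_right) (use K'T in auto)
     then have "comb ?T (%l. if l : ?K' then d l else 0) v = 0" using d by simp
     from findepD[OF ind this, of l] d(2) K'T show "d l = 0" by auto
    qed
    have vK': "v ` ?K' <= V Int coord_span {a l0..b i}"
    proof
     fix w assume "w : v ` ?K'"
     then obtain l where l: "l : ?K'" "w = v l" by blast
     then have "w : V Int coord_span {a l..b l}" using v K'T by blast
     then show "w : V Int coord_span {a l0..b i}" using l by (auto intro: coord_span_interval_mono)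
    qed
    obtain d where d: "comb ?C c v = comb ?K' d v"
     using findep_spans[OF _ ind' vK' sub dimW[symmetric] yW] by auto
    let ?e = "%l. (if l : ?C then c l else 0) - (if l : ?K' then d l else 0)"
    have "comb ?T ?e v = comb ?T (%l. if l : ?C then c l else 0) v - comb ?T (%l. if l : ?K' then d l else 0) v"
     by (simp only: comb_diff)
    also have "comb ?T (%l. if l : ?C then c l else 0) v = comb ?C c v"
     unfolding comb_def by (intro ext sum.mono_neutral_cong_right) auto
    also have "comb ?T (%l. if l : ?K' then d l else 0) v = comb ?K' d v"
     unfolding comb_def by (intro ext sum.mono_neutral_cong_right) (use K'T in auto)
    finally have "comb ?T ?e v = 0" by (simp only: d diff_self)
    from findepD[OF ind this j(1)] have "?e j = 0" .
    moreover have "j ~: ?K'" using j by auto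
    ultimately show False using cj C(2) by simp
   qed
   \<comment> \<open>The prescribed dimension exceeds the number of chosen rows inside
     \<open>[a i, b i]\<close> by one, for the interval itself; this leaves room for a new vector
     \<open>u\<close>.\<close>
   have "cdim (V Int coord_span {a i..b i}) = card {j. j < k & a i <= a j & b j <= b i}"
    using rkI[OF i(1) i(1)] unfolding rkV_def by simp
   also have "{j. j < k & a i <= a j & b j <= b i} = insert i ?K"
   proof -
    have "x < k & s <= a x \<longleftrightarrow> x = i | x : ?T" for x using Teq by blast
    then show ?thesis using i by auto
   qed
   finally have dimI: "cdim (V Int coord_span {a i..b i}) = Suc (card ?K)" using i by (simp add: card_insert_if)
   obtain u where u: "u : V Int coord_span {a i..b i}" "!!c. u ~= comb ?K c v"
   proof (rule ccontr)
    note u_intro = that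
    assume "~ thesis"
    then have all: "\<exists>c. w = comb ?K c v" if "w : V Int coord_span {a i..b i}" for w using that u_intro by blast
    have "V Int coord_span {a i..b i} <= cspan (v ` ?K)"
    proof
     fix w assume "w : V Int coord_span {a i..b i}"
     then obtain c where "w = comb ?K c v" using all by blast
     then show "w : cspan (v ` ?K)" by (simp add: comb_in_span)
    qed
    then have "cdim (V Int coord_span {a i..b i}) <= card (v ` ?K)"
     by (intro cvec.dim_le_card) auto
    also have "... <= card ?K" by (rule card_image_le) simp
    finally show False using dimI by simp
   qed
   let ?v = "v(i := u)"
   have vT: "comb ?T c ?v = comb ?T c v" for c by (intro comb_cong) (use iT in auto)
   have ins: "comb (insert i ?T) c ?v = cscale (c i) u + comb ?T c v" for c
   proof -
    have "comb (insert i ?T) c ?v = cscale (c i) (?v i) + comb ?T c ?v"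
     unfolding comb_eq_sum using iT by (intro sum.insert) auto
    then show ?thesis by (simp only: vT fun_upd_same)
   qed
   have "findep (insert i ?T) ?v"
    unfolding findep_def
   proof (intro allI impI)
    fix c assume c: "comb (insert i ?T) c ?v = 0"
    have ci: "c i = 0"
    proof (rule ccontr)
     assume ci: "c i ~= 0"
     let ?d = "%l. - c l / c i"
     have ud: "u = comb ?T ?d v"
     proof
      fix p
      have "(cscale (c i) u + comb ?T c v) p = 0" using c unfolding ins by simp
      then have "c i * u p + comb ?T c v p = 0" by (simp add: cscale_def)
      then have "u p = - comb ?T c v p / c i" using ci by (simp add: field_simps eq_neg_iff_add_eq_0)
      also have "... = comb ?T ?d v p"
       unfolding comb_def by (simp add: sum_negf sum_divide_distrib)
      finally show "u p = comb ?T ?d v p" .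
     qed
     have "?d l = 0" if "l : ?T" "~ b l <= b i" for l
      using zero[of ?d l] u(1) ud that by auto
     then have "comb ?T ?d v = comb ?K ?d v"
      unfolding comb_def by (intro ext sum.mono_neutral_right) auto
     then show False using u(2) ud by metis
    qed
    then have "cscale (c i) u = 0" by (simp add: cscale_def fun_eq_iff)
    then have "comb ?T c v = 0" using c unfolding ins by (metis add_0)
    then show "\<forall>l\<in>insert i ?T. c l = 0" using ind ci unfolding findep_def by blast
   qed
   moreover have "\<forall>l. l < k & s <= a l --> ?v l : V Int coord_span {a l..b l}"
   proof (intro allI impI)
    fix l assume "l < k & s <= a l"
    then have "l : insert i ?T" using Teq by blast
    then show "?v l : V Int coord_span {a l..b l}" using v u(1) i by (cases "l = i") auto
   qed
   ultimately show ?thesis unfolding Teq by blast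
  qed
 qed
 from this[of 0] obtain v where v: "!!l. l < k ==> v l : V Int coord_span {a l..b l}" and ind: "findep {l. l < k & 0 <= a l} v"
  by auto
 define A where "A = (%i. if i < k then v i else 0)"
 have "comb {..<k} c A = comb {l. l < k & 0 <= a l} c v" for c
  unfolding comb_def A_def by (intro ext sum.cong) auto
 then have indA: "findep {..<k} A" using findepD[OF ind] unfolding findep_def by auto
 have "A : frames k m"
  unfolding frames_iff using indA v V'(2) by (auto simp: A_def)
 moreover have "row_space k A = V"
  by (rule frame_in_subspace[OF indA _ V]) (use v in \<open>auto simp: A_def\<close>)
 ultimately show ?thesis using that[of A] v by (auto simp: A_def)
qed

end

section \<open>Determinants of square arrays\<close>

text \<open>Frames are functions of two natural numbers, so determinants are taken of the initial
  \<open>k\<close> by \<open>k\<close> block of such a function.\<close>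

definition cmat :: "nat => (nat => nat => complex) => complex Matrix.mat" where
 "cmat k T = Matrix.mat k k (%(i, j). T i j)"

definition cdet :: "nat => (nat => nat => complex) => complex" where
 "cdet k T = Determinant.det (cmat k T)"

definition cadj :: "nat => (nat => nat => complex) => nat => nat => complex" where
 "cadj k T i j = adj_mat (cmat k T) $$ (i, j)"

lemma cmat_carrier: "cmat k T : carrier_mat k k"
 by (simp add: cmat_def)

lemma cmat_index: "i < k ==> j < k ==> cmat k T $$ (i, j) = T i j"
 by (simp add: cmat_def)

lemma cdet_sum: "cdet k T = (\<Sum>p\<in>{p. p permutes {0..<k}}. signof p * (\<Prod>i=0..<k. T i (p i)))"
 unfolding cdet_def det_def'[OF cmat_carrier]
proof (intro sum.cong refl arg_cong2[where f = "(*)"] prod.cong)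
 fix p i assume "p : {p. p permutes {0..<k}}" "i : {0..<k}"
 then have "p i < k" "i < k" using permutes_in_image[of p "{0..<k}" i] by auto
 then show "cmat k T $$ (i, p i) = T i (p i)" by (simp add: cmat_index)
qed

lemma cadj_mult:
 assumes "i < k" "l < k"
 shows "(\<Sum>j<k. cadj k T i j * T j l) = (if i = l then cdet k T else 0)"
  and "(\<Sum>j<k. T i j * cadj k T j l) = (if i = l then cdet k T else 0)"
proof -
 note A = adj_mat[OF cmat_carrier[of k T]]
 have "(adj_mat (cmat k T) * cmat k T) $$ (i, l) = (\<Sum>j\<in>{0..<k}. cadj k T i j * T j l)"
  using assms A(1) cmat_carrier[of k T] by (simp add: scalar_prod_def cadj_def cmat_index)
 then show "(\<Sum>j<k. cadj k T i j * T j l) = (if i = l then cdet k T else 0)"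
  using assms unfolding A(3) by (cases "i = l") (simp_all add: cdet_def atLeast0LessThan)
 have "(cmat k T * adj_mat (cmat k T)) $$ (i, l) = (\<Sum>j\<in>{0..<k}. T i j * cadj k T j l)"
  using assms A(1) cmat_carrier[of k T] by (simp add: scalar_prod_def cadj_def cmat_index)
 then show "(\<Sum>j<k. T i j * cadj k T j l) = (if i = l then cdet k T else 0)"
  using assms unfolding A(2) by (cases "i = l") (simp_all add: cdet_def atLeast0LessThan)
qed

text \<open>Reduces continuity and differentiability of inverse matrices to those of
  determinants.\<close>

lemma cadj_cdet:
 assumes "i < k" "j < k"
 shows "cadj k T i j = (-1) ^ (j + i) * cdet (k - 1) (%i' j'. T (if i' < j then i' else Suc i') (if j' < i then j' else Suc j'))"
proof -
 have "mat_delete (cmat k T) j i = cmat (k - 1) (%i' j'. T (if i' < j then i' else Suc i') (if j' < i then j' else Suc j'))"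
  using assms by (intro eq_matI) (auto simp: mat_delete_def cmat_def)
 then show ?thesis
  using assms by (simp add: cadj_def adj_mat_def cofactor_def cdet_def cmat_def[of k T])
qed

lemma cdet_nonzero_iff:
 "cdet k T ~= 0 \<longleftrightarrow> (\<forall>g. (\<forall>l<k. (\<Sum>j<k. g j * T j l) = 0) --> (\<forall>j<k. g j = 0))"
proof
 assume d: "cdet k T ~= 0"
 show "\<forall>g. (\<forall>l<k. (\<Sum>j<k. g j * T j l) = 0) --> (\<forall>j<k. g j = 0)"
 proof (intro allI impI)
  fix g i assume g: "\<forall>l<k. (\<Sum>j<k. g j * T j l) = 0" and i: "i < k"
  have "0 = (\<Sum>l<k. (\<Sum>j<k. g j * T j l) * cadj k T l i)" using g by simp
  also have "... = (\<Sum>l<k. \<Sum>j<k. g j * (T j l * cadj k T l i))" by (simp add: sum_distrib_right mult.assoc)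
  also have "... = (\<Sum>j<k. \<Sum>l<k. g j * (T j l * cadj k T l i))" by (rule sum.swap)
  also have "... = (\<Sum>j<k. g j * (\<Sum>l<k. T j l * cadj k T l i))" by (simp add: sum_distrib_left)
  also have "... = (\<Sum>j<k. if j = i then g i * cdet k T else 0)"
   by (intro sum.cong refl) (use i cadj_mult(2)[of _ k i T] in auto)
  also have "... = g i * cdet k T" using i by simp
  finally show "g i = 0" using d by simp
 qed
next
 assume h: "\<forall>g. (\<forall>l<k. (\<Sum>j<k. g j * T j l) = 0) --> (\<forall>j<k. g j = 0)"
 show "cdet k T ~= 0"
 proof
  assume "cdet k T = 0"
  then have "Determinant.det (transpose_mat (cmat k T)) = 0"
   unfolding cdet_def using det_transpose[OF cmat_carrier] by metis
  moreover have tc: "transpose_mat (cmat k T) : carrier_mat k k" using cmat_carrier by simp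
  ultimately obtain v where v: "v : carrier_vec k" "v ~= 0\<^sub>v k" "transpose_mat (cmat k T) *\<^sub>v v = 0\<^sub>v k"
   using det_0_iff_vec_prod_zero[OF tc] by blast
  have "(\<Sum>j<k. vec_index v j * T j l) = 0" if "l < k" for l
  proof -
   have "vec_index (transpose_mat (cmat k T) *\<^sub>v v) l = (\<Sum>j\<in>{0..<k}. T j l * vec_index v j)"
    using that v(1) cmat_carrier[of k T] by (simp add: scalar_prod_def cmat_index)
   then have "(\<Sum>j\<in>{0..<k}. T j l * vec_index v j) = 0" using v(3) that by simp
   then show ?thesis by (simp add: atLeast0LessThan mult.commute)
  qed
  then have "\<forall>j<k. vec_index v j = 0" using h by blast
  then have "v = 0\<^sub>v k" using v(1) by (intro eq_vecI) auto
  then show False using v by simp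
 qed
qed

lemma continuous_on_cdet:
 assumes "!!i j. i < k ==> j < k ==> continuous_on S (%x. F x i j)"
 shows "continuous_on S (%x. cdet k (F x))"
 unfolding cdet_sum
proof (intro continuous_on_sum continuous_on_mult continuous_on_const continuous_on_prod)
 fix p i assume "p : {p. p permutes {0..<k}}" "i : {0..<k}"
 then have "p i < k" "i < k" using permutes_in_image[of p "{0..<k}" i] by auto
 then show "continuous_on S (%x. F x i (p i))" using assms by blast
qed

lemma field_differentiable_prod':
 fixes F :: "complex => 'i => complex"
 assumes "!!i. i : I ==> (%z. F z i) field_differentiable at w"
 shows "(%z. \<Prod>i\<in>I. F z i) field_differentiable at w"
 using assms
proof (induction I rule: infinite_finite_induct)
 case (insert x I)
 then have "(%z. F z x * (\<Prod>i\<in>I. F z i)) field_differentiable at w"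
  by (intro field_differentiable_mult) auto
 then show ?case using insert by simp
qed auto

lemma field_differentiable_cdet:
 assumes "!!i j. i < k ==> j < k ==> (%z. F z i j) field_differentiable at (w :: complex)"
 shows "(%z. cdet k (F z)) field_differentiable at w"
 unfolding cdet_sum
proof (intro field_differentiable_sum field_differentiable_mult field_differentiable_const field_differentiable_prod')
 fix p i assume "p : {p. p permutes {0..<k}}" "i : {0..<k}"
 then have "p i < k" "i < k" using permutes_in_image[of p "{0..<k}" i] by auto
 then show "(%z. F z i (p i)) field_differentiable at w" using assms by blast
qed

lemma continuous_on_cadj:
 assumes "!!i j. i < k ==> j < k ==> continuous_on S (%x. F x i j)" "i < k" "j < k"
 shows "continuous_on S (%x. cadj k (F x) i j)"
 unfolding cadj_cdet[OF assms(2,3)]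
 by (intro continuous_on_mult continuous_on_const continuous_on_cdet assms(1)) auto

lemma field_differentiable_cadj:
 assumes "!!i j. i < k ==> j < k ==> (%z. F z i j) field_differentiable at (w :: complex)" "i < k" "j < k"
 shows "(%z. cadj k (F z) i j) field_differentiable at w"
 unfolding cadj_cdet[OF assms(2,3)]
 by (intro field_differentiable_mult field_differentiable_const field_differentiable_cdet assms(1)) auto

section \<open>Continuous separately holomorphic functions are differentiable\<close>

text \<open>Only the first \<open>n\<close> coordinates vary on \<open>P\<close>, so a basic
  neighbourhood in the product topology contains a cube in these coordinates.\<close>

lemma continuous_on_coordinates_bound:
 fixes g :: "(nat => 'a :: metric_space) => 'b :: metric_space"
 assumes g: "continuous_on P g" and x: "x : P" and e: "e > 0"
  and P: "!!y i. y : P ==> i >= n ==> y i = x i"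
 obtains d where "d > 0" "!!y. y : P ==> (!!i. i < n ==> dist (y i) (x i) < d) ==> dist (g y) (g x) < e"
proof -
 obtain T where T: "open T" "P Int g -` ball (g x) e = P Int T"
  using g[unfolded continuous_on_open_invariant, rule_format, of "ball (g x) e"] by (auto simp: Int_commute)
 have "x : T" using T x e by auto
 moreover have "openin (product_topology (%i. euclidean) UNIV) T"
  using T(1) by (simp add: euclidean_product_topology)
 ultimately obtain X where X: "x : (\<Pi>\<^sub>E i\<in>UNIV. X i)" "!!i. open (X i)" "(\<Pi>\<^sub>E i\<in>UNIV. X i) <= T"
  using product_topology_open_contains_basis[of "%_. euclidean" UNIV T x] by auto
 have "\<exists>d>0. \<forall>s. dist s (x i) < d --> s : X i" for i
  using X(1,2) unfolding open_dist by auto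
 then obtain d where d: "!!i. d i > 0" "!!i s. dist s (x i) < d i ==> s : X i" by metis
 define \<delta> where "\<delta> = Min (insert 1 (d ` {..<n}))"
 have \<delta>: "\<delta> > 0" unfolding \<delta>_def using d by (subst Min_gr_iff) auto
 have \<delta>l: "\<delta> <= d i" if "i < n" for i unfolding \<delta>_def using that by (intro Min_le) auto
 show ?thesis
 proof (rule that[OF \<delta>])
  fix y assume y: "y : P" "!!i. i < n ==> dist (y i) (x i) < \<delta>"
  have "y i : X i" for i
  proof (cases "i < n")
   case True
   then have "dist (y i) (x i) < d i" using y(2)[OF True] \<delta>l[OF True] by simp
   then show ?thesis using d by blast
  next
   case False
   then have "y i = x i" using P y by simp
   then show ?thesis using d(1)[of i] d(2)[of "x i" i] by simp
  qed
  then have "y : T" using X(3) by auto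
  then have "y : P Int g -` ball (g x) e" using y T by blast
  then show "dist (g y) (g x) < e" by (simp add: dist_commute)
 qed
qed

definition polydisc :: "nat => real => (nat => complex) set" where
 "polydisc n \<rho> = {x. (\<forall>i<n. cmod (x i) <= \<rho>) & (\<forall>i\<ge>n. x i = 0)}"

text \<open>Compactness of the disc for variable \<open>i\<close> makes the continuity in the other
  variables at 0 uniform.\<close>

lemma osgood_uniform:
 assumes g: "continuous_on (polydisc n \<rho>) g" and \<rho>: "\<rho> > 0" and \<omega>: "\<omega> > 0" and i: "i < n"
 obtains d where "d > 0" "!!x z. x : polydisc n \<rho> ==> (!!j. j < n ==> cmod (x j) < d) ==> cmod z <= \<rho> ==>
  cmod (g (x(i := z)) - g ((%_. 0)(i := z))) < (\<omega> :: real)"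
proof -
 let ?K = "cball (0 :: complex) \<rho>" and ?o = "%z. (%_. 0 :: complex)(i := z)"
 have oP: "?o z : polydisc n \<rho>" if "z : ?K" for z
  using that i \<rho> by (auto simp: polydisc_def)
 have "\<exists>d>0. \<forall>y\<in>polydisc n \<rho>. (\<forall>j<n. dist (y j) (?o z j) < d) --> dist (g y) (g (?o z)) < \<omega> / 2" if z: "z : ?K" for z
 proof -
  obtain d where "d > 0" "!!y. y : polydisc n \<rho> ==> (!!j. j < n ==> dist (y j) (?o z j) < d) ==> dist (g y) (g (?o z)) < \<omega> / 2"
  proof (rule continuous_on_coordinates_bound[OF g oP[OF z], of "\<omega> / 2" n])
   show "y j = ?o z j" if "y : polydisc n \<rho>" "j >= n" for y j using that i by (auto simp: polydisc_def)
  qed (use \<omega> in auto)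
  then show ?thesis by blast
 qed
 then obtain D where D: "!!z. z : ?K ==> D z > 0"
  "!!z y. z : ?K ==> y : polydisc n \<rho> ==> (\<forall>j<n. dist (y j) (?o z j) < D z) ==> dist (g y) (g (?o z)) < \<omega> / 2"
  by metis
 have "?K <= (\<Union>z\<in>?K. ball z (D z))" using D(1) by auto
 then obtain F where F: "F <= ?K" "finite F" "?K <= (\<Union>z\<in>F. ball z (D z))"
  using compactE_image[OF compact_cball, of ?K "%z. ball z (D z)" 0 \<rho>] by auto
 define d where "d = Min (insert 1 (D ` F))"
 have d: "d > 0" unfolding d_def using F D(1) by (subst Min_gr_iff) auto
 have dl: "d <= D z" if "z : F" for z unfolding d_def using that F by (intro Min_le) auto
 show ?thesis
 proof (rule that[OF d])
  fix x z assume x: "x : polydisc n \<rho>" "!!j. j < n ==> cmod (x j) < d" and z: "cmod z <= \<rho>"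
  then obtain w where w: "w : F" "z : ball w (D w)" using F(3) by force
  then have wK: "w : ?K" using F by blast
  have "x(i := z) : polydisc n \<rho>" using x z i by (auto simp: polydisc_def)
  moreover have "dist ((x(i := z)) j) (?o w j) < D w" if "j < n" for j
   using w x(2)[OF that] dl[OF w(1)] by (auto simp: dist_commute)
  ultimately have 1: "dist (g (x(i := z))) (g (?o w)) < \<omega> / 2" using D(2)[OF wK] by blast
  have "dist (?o z j) (?o w j) < D w" for j
   using w D(1)[OF wK] by (auto simp: dist_commute)
  moreover have "?o z : polydisc n \<rho>" using oP z by simp
  ultimately have "dist (g (?o z)) (g (?o w)) < \<omega> / 2" using D(2)[OF wK] by blast
  then have "dist (g (x(i := z))) (g (?o z)) < \<omega>"
   using 1 dist_triangle_half_l by blast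
  then show "cmod (g (x(i := z)) - g (?o z)) < \<omega>" by (simp add: dist_norm)
 qed
qed

text \<open>Cauchy's inequality on discs of radius \<open>\<rho> / 4\<close> about the points of the
  half disc bounds the derivative by \<open>4 * \<omega> / \<rho>\<close>.\<close>

lemma holomorphic_small_increment:
 assumes w: "w holomorphic_on ball 0 \<rho>" and b: "!!z. z : ball 0 \<rho> ==> cmod (w z) <= \<omega>" and \<rho>: "\<rho> > 0"
  and h: "cmod h < \<rho> / 2"
 shows "cmod (w h - w 0) <= 4 * \<omega> / \<rho> * cmod h"
proof -
 have d: "cmod (deriv w z) <= 4 * \<omega> / \<rho>" if z: "z : ball 0 (\<rho> / 2)" for z
 proof -
  have sub: "cball z (\<rho> / 4) <= ball 0 \<rho>"
  proof
   fix y assume "y : cball z (\<rho> / 4)"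
   then have "cmod y <= cmod z + \<rho> / 4" by (metis dist_commute dist_norm mem_cball norm_triangle_sub order_trans add_left_mono)
   then show "y : ball 0 \<rho>" using z \<rho> by simp
  qed
  have "cmod ((deriv ^^ 1) w z) <= fact 1 * \<omega> / (\<rho> / 4) ^ 1"
  proof (rule Cauchy_inequality)
   show "w holomorphic_on ball z (\<rho> / 4)"
    by (rule holomorphic_on_subset[OF w]) (use sub ball_subset_cball in blast)
   show "continuous_on (cball z (\<rho> / 4)) w"
    by (rule holomorphic_on_imp_continuous_on, rule holomorphic_on_subset[OF w sub])
   show "cmod (w x) <= \<omega>" if "cmod (z - x) = \<rho> / 4" for x
    using b[of x] sub that by (auto simp: dist_norm)
  qed (use \<rho> in simp)
  then show ?thesis by (simp add: field_simps)
 qed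
 have "cmod (w h - w 0) <= 4 * \<omega> / \<rho> * cmod (h - 0)"
 proof (rule field_differentiable_bound[of "ball 0 (\<rho> / 2)" w "deriv w"])
  show "(w has_field_derivative deriv w z) (at z within ball 0 (\<rho> / 2))" if "z : ball 0 (\<rho> / 2)" for z
  proof -
   have "z : ball 0 \<rho>" using that \<rho> by simp
   then have "(w has_field_derivative deriv w z) (at z)"
    using holomorphic_derivI[OF w open_ball] by blast
   then show ?thesis by (rule has_field_derivative_at_within)
  qed
 qed (use d h \<rho> in auto)
 then show ?thesis by simp
qed

lemma differentiable_first_order:
 fixes u :: "complex => complex"
 assumes "u field_differentiable at 0" "e > 0"
 obtains d where "d > 0" "!!h. cmod h < d ==> cmod (u h - u 0 - h * deriv u 0) <= e * cmod h"
proof -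
 have "(u has_field_derivative deriv u 0) (at 0)" using assms by (simp add: DERIV_deriv_iff_field_differentiable)
 then have "(u has_derivative (*) (deriv u 0)) (at 0)" by (simp add: has_field_derivative_def)
 then obtain d where "d > 0" "!!y. norm (y - 0) < d ==> norm (u y - u 0 - deriv u 0 * (y - 0)) <= e * norm (y - 0)"
  unfolding has_derivative_at_alt using assms(2) by blast
 then show ?thesis using that[of d] by (simp add: mult.commute)
qed

text \<open>The coordinates of \<open>x\<close> are switched on one at a time. The increment in
  coordinate \<open>t\<close> differs from the one along the axis through the origin by the
  increment of a function \<open>w\<close> that is holomorphic and uniformly small; by the Cauchy
  estimate this difference is small compared with \<open>cmod (x t)\<close>.\<close>

theorem osgood:
 fixes g :: "(nat => complex) => complex"
 assumes g: "continuous_on (polydisc n \<rho>) g" and \<rho>: "\<rho> > 0"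
  and sep: "!!x i. x : polydisc n \<rho> ==> i < n ==> cmod (x i) < \<rho> ==> (%z. g (x(i := z))) field_differentiable at (x i)"
  and e: "e > 0"
 obtains d where "d > 0" "d <= \<rho>" "!!x. x : polydisc n \<rho> ==> (!!j. j < n ==> cmod (x j) < d) ==>
  cmod (g x - g (%_. 0) - (\<Sum>i<n. x i * deriv (%z. g ((%_. 0)(i := z))) 0)) <= e * (\<Sum>i<n. cmod (x i))"
proof -
 let ?o = "%_ :: nat. 0 :: complex"
 let ?D = "%i. deriv (%z. g (?o(i := z))) 0"
 \<comment> \<open>Chosen so that \<open>4 * \<omega> / \<rho>\<close> is \<open>e / 2\<close>; the
   other half of \<open>e\<close> goes to the expansion along the axis.\<close>
 define \<omega> where "\<omega> = e * \<rho> / 8"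
 have \<omega>: "\<omega> > 0" using e \<rho> by (simp add: \<omega>_def)
 have "\<exists>d>0. \<forall>x z. x : polydisc n \<rho> --> (\<forall>j<n. cmod (x j) < d) --> cmod z <= \<rho> --> cmod (g (x(i := z)) - g (?o(i := z))) < \<omega>" if i: "i < n" for i
 proof -
  obtain d where "d > 0" "!!x z. x : polydisc n \<rho> ==> (!!j. j < n ==> cmod (x j) < d) ==> cmod z <= \<rho> ==>
  cmod (g (x(i := z)) - g (?o(i := z))) < \<omega>"
   using osgood_uniform[OF g \<rho> \<omega> i] by blast
  then show ?thesis by blast
 qed
 then obtain d1 where d1: "!!i. i < n ==> d1 i > 0"
  "!!i x z. i < n ==> x : polydisc n \<rho> ==> (\<forall>j<n. cmod (x j) < d1 i) ==> cmod z <= \<rho> ==> cmod (g (x(i := z)) - g (?o(i := z))) < \<omega>"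
  by metis
 have oP: "?o : polydisc n \<rho>" using \<rho> by (simp add: polydisc_def)
 have "\<exists>d>0. \<forall>h. cmod h < d --> cmod (g (?o(i := h)) - g ?o - h * ?D i) <= e / 2 * cmod h" if i: "i < n" for i
 proof -
  have "(%z. g (?o(i := z))) field_differentiable at 0" using sep[OF oP i] \<rho> by simp
  then obtain d where "d > 0" "!!h. cmod h < d ==> cmod (g (?o(i := h)) - g (?o(i := 0)) - h * ?D i) <= e / 2 * cmod h"
   using differentiable_first_order[of "%z. g (?o(i := z))" "e / 2"] e by auto
  moreover have "?o(i := 0) = ?o" by auto
  ultimately show ?thesis by auto
 qed
 then obtain d2 where d2: "!!i. i < n ==> d2 i > 0"
  "!!i h. i < n ==> cmod h < d2 i ==> cmod (g (?o(i := h)) - g ?o - h * ?D i) <= e / 2 * cmod h"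
  by metis
 define d where "d = Min (insert (\<rho> / 2) (d1 ` {..<n} Un d2 ` {..<n}))"
 have d: "d > 0" unfolding d_def using d1(1) d2(1) \<rho> by (subst Min_gr_iff) auto
 have dl: "d <= d1 i" "d <= d2 i" if "i < n" for i unfolding d_def using that by (auto intro!: Min_le)
 have d\<rho>: "d <= \<rho> / 2" unfolding d_def by (intro Min_le) auto
 show ?thesis
 proof (rule that[OF d])
  show "d <= \<rho>" using d\<rho> \<rho> by linarith
  fix x assume x: "x : polydisc n \<rho>" "!!j. j < n ==> cmod (x j) < d"
  define y where "y = (%t j. if j < t then x j else 0 :: complex)"
  have yP: "y t : polydisc n \<rho>" for t using x \<rho> by (auto simp: y_def polydisc_def)
  have ys: "y (Suc t) = (y t)(t := x t)" for t by (auto simp: y_def fun_eq_iff less_Suc_eq)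
  have yn: "y n = x" using x by (auto simp: y_def fun_eq_iff polydisc_def)
  have y0: "y 0 = ?o" by (simp add: y_def)
  have yt: "(y t)(t := 0) = y t" for t by (auto simp: y_def)
  have step: "cmod (g (y (Suc t)) - g (y t) - x t * ?D t) <= e * cmod (x t)" if t: "t < n" for t
  proof -
   define w where "w = (%z. g ((y t)(t := z)) - g (?o(t := z)))"
   have yP': "(y t)(t := z) : polydisc n \<rho>" "?o(t := z) : polydisc n \<rho>" if "cmod z <= \<rho>" for z
    using yP[of t] that t \<rho> by (auto simp: polydisc_def)
   have "w holomorphic_on ball 0 \<rho>"
    unfolding holomorphic_on_def
   proof
    fix z :: complex assume z: "z : ball 0 \<rho>"
    then have zl: "cmod z <= \<rho>" "cmod z < \<rho>" by auto
    have "(%u. g (((y t)(t := z))(t := u))) field_differentiable at (((y t)(t := z)) t)"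
     using sep[OF yP'(1)[OF zl(1)] t] zl by simp
    moreover have "(%u. g ((?o(t := z))(t := u))) field_differentiable at ((?o(t := z)) t)"
     using sep[OF yP'(2)[OF zl(1)] t] zl by simp
    ultimately have "w field_differentiable at z"
     unfolding w_def by (intro field_differentiable_diff) simp_all
    then show "w field_differentiable at z within ball 0 \<rho>" by (rule field_differentiable_at_within)
   qed
   moreover have "cmod (w z) <= \<omega>" if "z : ball 0 \<rho>" for z
   proof -
    have "cmod (y t j) < d1 t" if "j < n" for j
     using x(2)[OF that] dl(1)[OF t] d1(1)[OF t] by (auto simp: y_def)
    then show ?thesis
     unfolding w_def using d1(2)[OF t yP] that by (intro less_imp_le) auto
   qed
   ultimately have "cmod (w (x t) - w 0) <= 4 * \<omega> / \<rho> * cmod (x t)"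
    by (rule holomorphic_small_increment) (use \<rho> x(2)[OF t] d\<rho> in auto)
   also have "4 * \<omega> / \<rho> = e / 2" using \<rho> by (simp add: \<omega>_def)
   finally have 1: "cmod (w (x t) - w 0) <= e / 2 * cmod (x t)" .
   have 2: "cmod (g (?o(t := x t)) - g ?o - x t * ?D t) <= e / 2 * cmod (x t)"
    by (rule d2(2)[OF t]) (use x(2)[OF t] dl(2)[OF t] in simp)
   have "g (y (Suc t)) - g (y t) - x t * ?D t = (w (x t) - w 0) + (g (?o(t := x t)) - g ?o - x t * ?D t)"
   proof -
    have "?o(t := 0) = ?o" by auto
    then show ?thesis unfolding w_def ys yt by simp
   qed
   then have "cmod (g (y (Suc t)) - g (y t) - x t * ?D t) <= cmod (w (x t) - w 0) + cmod (g (?o(t := x t)) - g ?o - x t * ?D t)"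
    using norm_triangle_ineq by metis
   then show ?thesis using 1 2 by simp
  qed
  have "g x - g ?o = (\<Sum>t<n. g (y (Suc t)) - g (y t))"
   using sum_lessThan_telescope[of "%t. g (y t)" n] by (simp only: yn y0)
  then have "g x - g ?o - (\<Sum>i<n. x i * ?D i) = (\<Sum>t<n. g (y (Suc t)) - g (y t) - x t * ?D t)"
   by (simp add: sum_subtractf)
  then have "cmod (g x - g ?o - (\<Sum>i<n. x i * ?D i)) <= (\<Sum>t<n. cmod (g (y (Suc t)) - g (y t) - x t * ?D t))"
   by (simp only: norm_sum)
  also have "... <= (\<Sum>t<n. e * cmod (x t))" by (intro sum_mono step) simp
  finally show "cmod (g x - g ?o - (\<Sum>i<n. x i * ?D i)) <= e * (\<Sum>i<n. cmod (x i))"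
   by (simp add: sum_distrib_left)
 qed
qed

section \<open>The degree of a perturbed complex linear map\<close>

text \<open>Real and imaginary parts are interleaved, which gives the real space its complex
  orientation.\<close>

definition c2r :: "nat => (nat => complex) => nat => real" where
 "c2r c y = (%j. if j < 2 * c then (if even j then Re (y (j div 2)) else Im (y (j div 2))) else 0)"

text \<open>The values that \<open>normal_simplex\<close> prescribes for the local equations; in
  real coordinates they form \<open>std_simp\<close> scaled by \<open>r\<close>.\<close>

definition ylin :: "real => (nat => real) => nat => complex" where
 "ylin r x t = of_real r * Complex (x (2 * t + 1) - x 0) (x (2 * t + 2) - x 0)"

lemma c2r_ylin:
 "c2r c (ylin r x) = (%j. if j < 2 * c then r * (x (Suc j) - x 0) else 0)"
proof
 fix j
 show "c2r c (ylin r x) j = (if j < 2 * c then r * (x (Suc j) - x 0) else 0)"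
 proof (cases "even j")
  case True
  then obtain t where "j = 2 * t" by blast
  then show ?thesis by (simp add: c2r_def ylin_def)
 next
  case False
  then obtain t where "j = 2 * t + 1" using oddE by blast
  then show ?thesis by (simp add: c2r_def ylin_def)
 qed
qed

lemma c2r_eq_0_iff: "c2r c y = 0 \<longleftrightarrow> (\<forall>s<c. y s = 0)"
proof
 assume h: "c2r c y = 0"
 show "\<forall>s<c. y s = 0"
 proof (intro allI impI)
  fix s assume s: "s < c"
  have "c2r c y (2 * s) = 0" "c2r c y (2 * s + 1) = 0" using h by auto
  then show "y s = 0" using s by (simp add: c2r_def complex_eq_iff)
 qed
next
 assume h: "\<forall>s<c. y s = 0"
 show "c2r c y = 0"
 proof
  fix j
  have "j div 2 < c" if "j < 2 * c" using that by simp
  then show "c2r c y j = 0 j" using h by (auto simp: c2r_def)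
 qed
qed

lemma c2r_in_Es: "c2r c y : Es (2 * c)"
 by (simp add: c2r_def Es_def)

lemma continuous_on_c2r:
 assumes "!!s. s < c ==> continuous_on S (%x. f x s)"
 shows "continuous_on S (%x. c2r c (f x))"
proof -
 have "continuous_on S (%x. c2r c (f x) j)" for j
 proof (cases "j < 2 * c")
  case True
  then have "j div 2 < c" by simp
  then show ?thesis using assms True by (cases "even j") (auto simp: c2r_def intro!: continuous_intros)
 qed (simp add: c2r_def)
 then show ?thesis by (rule continuous_on_coordinatewise_then_product)
qed

lemma c2r_line: "(%i. (1 - t) * c2r c u i + t * c2r c v i) = c2r c (%s. of_real (1 - t) * u s + of_real t * v s)"
 by (auto simp: c2r_def fun_eq_iff)

lemma continuous_on_ylin: "continuous_on S (%x. ylin r x t)"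
proof -
 have c: "continuous_on S (%x :: nat => real. x i)" for i
  by (rule continuous_on_subset[OF continuous_on_product_coordinates]) auto
 have "continuous_on S (%x. of_real r * (of_real (x (2 * t + 1) - x 0) + \<i> * of_real (x (2 * t + 2) - x 0)))"
  by (intro continuous_intros c)
 moreover have "ylin r x t = of_real r * (of_real (x (2 * t + 1) - x 0) + \<i> * of_real (x (2 * t + 2) - x 0))" for x
  by (simp add: ylin_def complex_eq_iff)
 ultimately show ?thesis by simp
qed

lemma ylin_boundary_nonzero:
 assumes "x : stdx (2 * c)" "k <= 2 * c" "x k = 0" "r > 0"
 shows "\<exists>s<c. ylin r x s ~= 0"
proof (rule ccontr)
 assume "~ ?thesis"
 then have "c2r c (ylin r x) = 0" by (simp add: c2r_eq_0_iff)
 then have "r * (x (Suc j) - x 0) = 0" if "j < 2 * c" for j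
  using that fun_cong[of _ _ j] unfolding c2r_ylin by (metis (mono_tags, lifting) zero_fun_apply)
 then have "x (Suc j) = x 0" if "j < 2 * c" for j using that assms(4) by fastforce
 then show False using std_simp_zero[OF assms(1)] assms by blast
qed

definition lmap :: "nat => (nat => nat => complex) => (nat => complex) => nat => complex" where
 "lmap c D y = (%s. \<Sum>t<c. D s t * y t)"

definition linj :: "nat => (nat => nat => complex) => bool" where
 "linj c D \<longleftrightarrow> (\<forall>y. (\<forall>s<c. lmap c D y s = 0) --> (\<forall>t<c. y t = 0))"

lemma linj_iff_cdet: "linj c D \<longleftrightarrow> cdet c (%i j. D j i) ~= 0"
 unfolding linj_def lmap_def cdet_nonzero_iff by (simp add: mult.commute)

lemma linj_bound:
 assumes "linj c D"
 obtains \<mu> where "\<mu> > 0" "!!y. (\<Sum>s<c. cmod (lmap c D y s)) >= \<mu> * (\<Sum>t<c. cmod (y t))"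
proof -
 let ?T = "%i j. D j i"
 let ?d = "cdet c ?T"
 have d: "?d ~= 0" using assms linj_iff_cdet by blast
 define K where "K = 1 + (\<Sum>t<c. \<Sum>s<c. cmod (cadj c ?T s t / ?d))"
 have nn: "0 <= (\<Sum>t<c. \<Sum>s<c. cmod (cadj c ?T s t / ?d))" by (intro sum_nonneg) auto
 have K: "K > 0" using nn unfolding K_def by linarith
 have main: "(\<Sum>t<c. cmod (y t)) <= K * (\<Sum>s<c. cmod (lmap c D y s))" for y
 proof -
  let ?S = "\<Sum>s<c. cmod (lmap c D y s)"
  have "cmod (y t) <= (\<Sum>s<c. cmod (cadj c ?T s t / ?d)) * ?S" if t: "t < c" for t
  proof -
   have "(\<Sum>s<c. lmap c D y s * cadj c ?T s t) = (\<Sum>s<c. \<Sum>l<c. y l * (?T l s * cadj c ?T s t))"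
    unfolding lmap_def by (simp add: sum_distrib_right sum_distrib_left mult_ac)
   also have "... = (\<Sum>l<c. \<Sum>s<c. y l * (?T l s * cadj c ?T s t))" by (rule sum.swap)
   also have "... = (\<Sum>l<c. y l * (\<Sum>s<c. ?T l s * cadj c ?T s t))" by (simp add: sum_distrib_left)
   also have "... = (\<Sum>l<c. if l = t then y t * ?d else 0)"
    by (intro sum.cong refl) (use t cadj_mult(2)[of _ c t ?T] in auto)
   finally have "y t * ?d = (\<Sum>s<c. lmap c D y s * cadj c ?T s t)" using t by simp
   then have "y t = (\<Sum>s<c. lmap c D y s * cadj c ?T s t) / ?d" using d by (metis nonzero_mult_div_cancel_right)
   then have "y t = (\<Sum>s<c. lmap c D y s * (cadj c ?T s t / ?d))" by (simp only: sum_divide_distrib times_divide_eq_right)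
   then have "cmod (y t) <= (\<Sum>s<c. cmod (lmap c D y s * (cadj c ?T s t / ?d)))" by (simp only: norm_sum)
   also have "... <= (\<Sum>s<c. ?S * cmod (cadj c ?T s t / ?d))"
   proof (intro sum_mono)
    fix s assume "s : {..<c}"
    then have "cmod (lmap c D y s) <= ?S" by (intro member_le_sum) auto
    then show "cmod (lmap c D y s * (cadj c ?T s t / ?d)) <= ?S * cmod (cadj c ?T s t / ?d)"
     unfolding norm_mult by (intro mult_right_mono) auto
   qed
   also have "... = (\<Sum>s<c. cmod (cadj c ?T s t / ?d)) * ?S" by (simp add: sum_distrib_left mult.commute)
   finally show ?thesis .
  qed
  then have "(\<Sum>t<c. cmod (y t)) <= (\<Sum>t<c. (\<Sum>s<c. cmod (cadj c ?T s t / ?d)) * ?S)" by (intro sum_mono) auto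
  also have "... = (\<Sum>t<c. \<Sum>s<c. cmod (cadj c ?T s t / ?d)) * ?S" by (simp add: sum_distrib_right)
  also have "... <= K * ?S" unfolding K_def by (intro mult_right_mono sum_nonneg) auto
  finally show ?thesis .
 qed
 show ?thesis
 proof (rule that[of "1 / K"])
  show "1 / K * (\<Sum>t<c. cmod (y t)) <= (\<Sum>s<c. cmod (lmap c D y s))" for y
   using main[of y] K by (simp add: field_simps)
 qed (use K in simp)
qed

text \<open>Along the complex line through \<open>D\<close> and the identity matrix the determinant
  is a polynomial that is nonzero at 0 and at 1. Its finitely many zeros do not disconnect the
  complex plane. Over the reals this would fail; here the complex orientation enters.\<close>

lemma linj_path:
 assumes D: "linj c D"
 obtains \<gamma> :: "real => nat => nat => complex" where
  "!!s t. continuous_on {0..1} (%\<tau>. \<gamma> \<tau> s t)" "!!s t. \<gamma> 0 s t = D s t" "!!s t. \<gamma> 1 s t = (if s = t then 1 else 0)"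
  "!!\<tau>. \<tau> : {0..1} ==> linj c (\<gamma> \<tau>)"
proof -
 let ?M = "%z s t. D s t + z * ((if s = t then 1 else 0) - D s t)"
 define P where "P = (\<Sum>p\<in>{p. p permutes {0..<c}}. [:signof p:] * (\<Prod>i=0..<c. [:D (p i) i, (if p i = i then 1 else 0) - D (p i) i:]))"
 have P: "poly P z = cdet c (%i j. ?M z j i)" for z
  unfolding P_def cdet_sum by (simp add: poly_sum poly_prod)
 have "poly P 0 ~= 0" using D unfolding P linj_iff_cdet by simp
 then have "P ~= 0" by auto
 then have fin: "finite {z. poly P z = 0}" by (rule poly_roots_finite)
 have "poly P 1 ~= 0"
 proof -
  have "linj c (?M 1)"
   unfolding linj_def lmap_def
  proof (intro allI impI)
   fix y t assume h: "\<forall>s<c. (\<Sum>t<c. ?M 1 s t * y t) = 0" and t: "t < c"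
   have "(\<Sum>j<c. ?M 1 t j * y j) = (\<Sum>j<c. if j = t then y t else 0)"
    by (intro sum.cong) auto
   then show "y t = 0" using h t by simp
  qed
  then show ?thesis unfolding P linj_iff_cdet .
 qed
 have "path_connected (- {z. poly P z = 0})"
  by (rule path_connected_complement_countable) (use fin in \<open>auto intro: countable_finite\<close>)
 then obtain \<zeta> where \<zeta>: "path \<zeta>" "path_image \<zeta> <= - {z. poly P z = 0}" "pathstart \<zeta> = 0" "pathfinish \<zeta> = 1"
  using path_connected_def[THEN iffD1, rule_format, of "- {z. poly P z = 0}" 0 1] \<open>poly P 0 \<noteq> 0\<close> \<open>poly P 1 \<noteq> 0\<close> by auto
 show ?thesis
 proof (rule that[of "%\<tau>. ?M (\<zeta> \<tau>)"])
  have z01: "\<zeta> 0 = 0" "\<zeta> 1 = 1" using \<zeta> by (simp_all add: pathstart_def pathfinish_def)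
  show "continuous_on {0..1} (%\<tau>. ?M (\<zeta> \<tau>) s t)" for s t
   using \<zeta>(1) unfolding path_def by (intro continuous_on_add continuous_on_mult continuous_on_const)
  show "?M (\<zeta> 0) s t = D s t" "?M (\<zeta> 1) s t = (if s = t then 1 else 0)" for s t using z01 by simp_all
  show "linj c (?M (\<zeta> \<tau>))" if "\<tau> : {0..1}" for \<tau>
  proof -
   have "\<zeta> \<tau> : path_image \<zeta>" using that by (auto simp: path_image_def)
   then have "poly P (\<zeta> \<tau>) ~= 0" using \<zeta>(2) by blast
   then show ?thesis unfolding P linj_iff_cdet .
  qed
 qed
qed

lemma Dtop_eq: "Dtop q = top_of_set (stdx q)"
 by (simp add: powertop_real_eq)

lemma iota_relcycle:
 "relcycle q (Dtop q) {x. \<exists>k\<le>q. x k = 0} (frag_of (restrict id (stdx q)))"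
proof (rule singular_relcycle_of_simplex)
 show "ssimp q (Dtop q) (restrict id (stdx q))"
  using simplicial_imp_singular_simplex[of q "stdx q"] by simp
qed auto

lemma cyl_Dtop: "cyl (Dtop q) = top_of_set ({0..1} \<times> stdx q)"
 unfolding Dtop_eq by (simp add: prod_topology_subtopology subtopology_subtopology Times_Int_Times flip: prod_topology_euclidean)

lemma hdeg_scaled:
 assumes "r > 0"
 shows "hdeg n (frag_of (\<lambda>x\<in>stdx n. %j. if j < n then r * (x (Suc j) - x 0) else 0)) = 1"
proof -
 have h: "homrel n (Euc n) (-{0}) (frag_of (std_simp n))
  (frag_of (\<lambda>x\<in>stdx n. %j. if j < n then r * (x (Suc j) - x 0) else 0))"
  by (rule scaled_std_simp_homologous[OF assms])
 then have "relcycle n (Euc n) (-{0})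
  (frag_of (\<lambda>x\<in>stdx n. %j. if j < n then r * (x (Suc j) - x 0) else 0))"
  using std_simp_relcycle homologous_rel_singular_relcycle by blast
 then show ?thesis
  using hdeg_cong[OF h] hdeg_std_simp by simp
qed

text \<open>Two homotopies avoid 0 on the boundary of the simplex: the straight line from
  \<open>f\<close> to its linear part, and the path from \<open>D\<close> to the identity given by
  \<open>linj_path\<close>. They end in the scaled standard simplex, of degree 1.\<close>

theorem degree_perturbed:
 assumes D: "linj c D"
 obtains \<mu> where "\<mu> > 0"
  "!!r f. [|r > 0; !!s. s < c ==> continuous_on (stdx (2 * c)) (%x. f x s);
    !!x. x : stdx (2 * c) ==>
     (\<Sum>s<c. cmod (f x s - lmap c D (ylin r x) s)) <= \<mu> * (\<Sum>t<c. cmod (ylin r x t))|] ==>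
   relcycle (2 * c) (Euc (2 * c)) (-{0}) (frag_of (\<lambda>x\<in>stdx (2 * c). c2r c (f x))) &
   hdeg (2 * c) (frag_of (\<lambda>x\<in>stdx (2 * c). c2r c (f x))) = 1"
proof -
 obtain \<mu> where \<mu>: "\<mu> > 0" "!!y. (\<Sum>s<c. cmod (lmap c D y s)) >= \<mu> * (\<Sum>t<c. cmod (y t))"
  using linj_bound[OF D] by blast
 obtain \<gamma> :: "real => nat => nat => complex" where \<gamma>:
  "!!s t. continuous_on {0..1} (%\<tau>. \<gamma> \<tau> s t)" "!!s t. \<gamma> 0 s t = D s t" "!!s t. \<gamma> 1 s t = (if s = t then 1 else 0)"
  "!!\<tau>. \<tau> : {0..1} ==> linj c (\<gamma> \<tau>)"
  using linj_path[OF D] by blast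
 let ?\<Delta> = "stdx (2 * c)" and ?E = "Euc (2 * c)"
 let ?bd = "{x. \<exists>k\<le>2 * c. x k = (0 :: real)}"
 let ?P = "%h :: (nat => real) => nat => real. h : topspace (Dtop (2 * c)) Int ?bd \<rightarrow> -{0}"
 \<comment> \<open>All simplices involved are images of the identity simplex, a cycle modulo the
   boundary \<open>?bd\<close>, so homotopies of maps on the simplex are enough.\<close>
 let ?i = "frag_of (restrict id ?\<Delta>) :: (nat => real) chain"
 have E: "?E = sub (powertop_real UNIV) (Es (2 * c))"
  by (simp add: Euclidean_space_eq powertop_real_eq)
 have im: "chain_map (2 * c) g ?i = frag_of (restrict g ?\<Delta>)" for g :: "(nat => real) => nat => real"
  unfolding chain_map_of by (rule arg_cong[where f = frag_of]) (auto simp: simplex_map_def fun_eq_iff restrict_def)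
 show ?thesis
 \<comment> \<open>Half of the lower bound for \<open>lmap c D\<close> keeps the segment from
   \<open>f\<close> to the linear part away from 0.\<close>
 proof (rule that[of "\<mu> / 2"])
  show "\<mu> / 2 > 0" using \<mu> by simp
  fix r :: real and f :: "(nat => real) => nat => complex"
  assume r: "r > 0" and fc: "!!s. s < c ==> continuous_on ?\<Delta> (%x. f x s)"
   and fb: "!!x. x : ?\<Delta> ==> (\<Sum>s<c. cmod (f x s - lmap c D (ylin r x) s)) <= \<mu> / 2 * (\<Sum>t<c. cmod (ylin r x t))"
  let ?y = "%x. ylin r x"
  have nz: "\<exists>s<c. ?y x s ~= 0" if "x : topspace (Dtop (2 * c)) Int ?bd" for x
   using ylin_boundary_nonzero[of x c _ r] that r by auto
  have h1: "homotopic_with ?P (Dtop (2 * c)) (sub (powertop_real UNIV) (Es (2 * c))) (%x. c2r c (f x)) (%x. c2r c (lmap c D (?y x)))"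
  proof (rule linear_homotopic_with)
   show "continuous_map (Dtop (2 * c)) (powertop_real UNIV) (%x. c2r c (f x))"
    unfolding powertop_real_eq using continuous_on_c2r[OF fc] by simp
   show "continuous_map (Dtop (2 * c)) (powertop_real UNIV) (%x. c2r c (lmap c D (?y x)))"
    unfolding powertop_real_eq lmap_def
    by (simp, intro continuous_on_c2r continuous_on_sum continuous_on_mult continuous_on_const continuous_on_ylin)
   show "(%i. (1 - t) * c2r c (f x) i + t * c2r c (lmap c D (?y x)) i) : Es (2 * c)" for t x
    unfolding c2r_line by (rule c2r_in_Es)
   show "?P (%x i. (1 - t) * c2r c (f x) i + t * c2r c (lmap c D (?y x)) i)" if t: "0 <= t" "t <= 1" for t
   proof
    fix x assume x: "x : topspace (Dtop (2 * c)) Int ?bd"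
    let ?L = "lmap c D (?y x)"
    have pos: "(\<Sum>t<c. cmod (?y x t)) > 0"
    proof -
     obtain s where "s < c" "?y x s ~= 0" using nz[OF x] by blast
     then show ?thesis by (intro sum_pos2[of _ s]) auto
    qed
    have "~ (\<forall>s<c. of_real (1 - t) * f x s + of_real t * ?L s = 0)"
    proof
     assume z: "\<forall>s<c. of_real (1 - t) * f x s + of_real t * ?L s = 0"
     have "?L s = of_real (1 - t) * (?L s - f x s)" if "s < c" for s
      using z that by (auto simp: algebra_simps)
     then have "cmod (?L s) <= cmod (f x s - ?L s)" if "s < c" for s
     proof -
      have "cmod (?L s) = (1 - t) * cmod (?L s - f x s)"
       using \<open>\<And>s. s < c \<Longrightarrow> ?L s = of_real (1 - t) * (?L s - f x s)\<close>[OF that] t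
       by (metis abs_of_nonneg diff_ge_0_iff_ge norm_mult norm_of_real)
      also have "... <= 1 * cmod (?L s - f x s)" using t by (intro mult_right_mono) auto
      finally show ?thesis by (simp add: norm_minus_commute)
     qed
     then have "(\<Sum>s<c. cmod (?L s)) <= (\<Sum>s<c. cmod (f x s - ?L s))" by (intro sum_mono) auto
     also have "... <= \<mu> / 2 * (\<Sum>t<c. cmod (?y x t))" using fb x by simp
     finally have "\<mu> * (\<Sum>t<c. cmod (?y x t)) <= \<mu> / 2 * (\<Sum>t<c. cmod (?y x t))"
      using \<mu>(2)[of "?y x"] by linarith
     then show False using pos \<mu>(1) by simp
    qed
    then show "(%i. (1 - t) * c2r c (f x) i + t * c2r c ?L i) : -{0}"
     unfolding c2r_line by (simp only: Compl_iff singleton_iff c2r_eq_0_iff) simp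
   qed
  qed
  have h2: "homotopic_with ?P (Dtop (2 * c)) ?E (%x. c2r c (lmap c D (?y x))) (%x. c2r c (?y x))"
   unfolding homotopic_with_def
  proof (intro exI conjI ballI allI)
   let ?h = "%(\<tau>, x). c2r c (lmap c (\<gamma> \<tau>) (?y x))"
   have "continuous_on ({0..1} \<times> ?\<Delta>) (%z. c2r c (lmap c (\<gamma> (fst z)) (?y (snd z))))"
    unfolding lmap_def
   proof (intro continuous_on_c2r continuous_on_sum continuous_on_mult)
    show "continuous_on ({0..1} \<times> ?\<Delta>) (%z. \<gamma> (fst z) s t)" for s t
     by (rule continuous_on_compose2[OF \<gamma>(1)]) (auto intro: continuous_intros)
    show "continuous_on ({0..1} \<times> ?\<Delta>) (%z. ylin r (snd z) t)" for t
     by (rule continuous_on_compose2[OF continuous_on_ylin[of UNIV]]) (auto intro: continuous_intros)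
   qed
   then show "continuous_map (cyl (Dtop (2 * c))) ?E ?h"
    unfolding cyl_Dtop Euclidean_space_eq using c2r_in_Es by (auto simp: case_prod_unfold)
   show "?h (0, x) = c2r c (lmap c D (?y x))" for x
   proof -
    have "\<gamma> 0 = D" using \<gamma>(2) by auto
    then show ?thesis by simp
   qed
   show "?h (1, x) = c2r c (?y x)" for x
   proof -
    have "lmap c (\<gamma> 1) (?y x) s = ?y x s" if "s < c" for s
    proof -
     have "lmap c (\<gamma> 1) (?y x) s = (\<Sum>t<c. if t = s then ?y x s else 0)"
      unfolding lmap_def by (intro sum.cong) (auto simp: \<gamma>(3))
     then show ?thesis using that by simp
    qed
    then show ?thesis by (auto simp: c2r_def fun_eq_iff)
   qed
   show "?P (%x. ?h (\<tau>, x))" if \<tau>: "\<tau> : {0..1}" for \<tau>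
   proof
    fix x assume x: "x : topspace (Dtop (2 * c)) Int ?bd"
    have "~ (\<forall>s<c. lmap c (\<gamma> \<tau>) (?y x) s = 0)"
     using \<gamma>(4)[OF \<tau>] nz[OF x] unfolding linj_def by blast
    then show "?h (\<tau>, x) : -{0}" by (simp only: Compl_iff singleton_iff c2r_eq_0_iff prod.case) simp
   qed
  qed
  have rc: "relcycle (2 * c) (Dtop (2 * c)) ?bd ?i" by (rule iota_relcycle)
  have "homrel (2 * c) ?E (-{0}) (chain_map (2 * c) (%x. c2r c (f x)) ?i) (chain_map (2 * c) (%x. c2r c (lmap c D (?y x))) ?i)"
   using homotopic_pair_homologous[OF h1 rc] by (simp only: E)
  moreover have "homrel (2 * c) ?E (-{0}) (chain_map (2 * c) (%x. c2r c (lmap c D (?y x))) ?i) (chain_map (2 * c) (%x. c2r c (?y x)) ?i)"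
   by (rule homotopic_pair_homologous[OF h2 rc])
  ultimately have hom: "homrel (2 * c) ?E (-{0}) (frag_of (\<lambda>x\<in>?\<Delta>. c2r c (f x))) (frag_of (\<lambda>x\<in>?\<Delta>. c2r c (?y x)))"
   unfolding im using homologous_rel_trans by blast
  have sc: "hfree (2 * c) ?E (-{0}) (frag_of (\<lambda>x\<in>?\<Delta>. c2r c (?y x)))"
   unfolding c2r_ylin using scaled_std_simp_free[OF r, of "2 * c"] .
  then have rcs: "relcycle (2 * c) ?E (-{0}) (frag_of (\<lambda>x\<in>?\<Delta>. c2r c (?y x)))"
   unfolding hfree_def by blast
  have "hdeg (2 * c) (frag_of (\<lambda>x\<in>?\<Delta>. c2r c (f x))) = hdeg (2 * c) (frag_of (\<lambda>x\<in>?\<Delta>. c2r c (?y x)))"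
   by (rule hdeg_cong[OF hom rcs])
  also have "... = 1"
   unfolding c2r_ylin by (rule hdeg_scaled[OF r])
  finally show "relcycle (2 * c) ?E (-{0}) (frag_of (\<lambda>x\<in>?\<Delta>. c2r c (f x))) &
    hdeg (2 * c) (frag_of (\<lambda>x\<in>?\<Delta>. c2r c (f x))) = 1"
   using rcs hom homologous_rel_singular_relcycle by blast
 qed
qed

section \<open>Charts of the Grassmannian\<close>

text \<open>Injectivity on \<open>V\<close> of the projection to the columns
  \<open>e 0, ..., e (k - 1)\<close>; on \<open>Gr k m\<close> it means that the corresponding
  maximal minor of a frame is nonzero.\<close>

definition proj_inj :: "nat => (nat => nat) => (nat => complex) set => bool" where
 "proj_inj k e V \<longleftrightarrow> (\<forall>v\<in>V. (\<forall>l<k. v (e l) = 0) --> v = 0)"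

text \<open>Row \<open>i\<close> of the frame of \<open>V\<close> that is the identity matrix in the
  columns \<open>e\<close>.\<close>

definition usol :: "nat => (nat => nat) => nat => (nat => complex) set => nat => complex" where
 "usol k e i V = (THE u. u : V & (\<forall>l<k. u (e l) = (if l = i then 1 else 0)))"

lemma GrD: "V : Gr k m ==> csubspace V" "V : Gr k m ==> V <= cspace m" "V : Gr k m ==> cdim V = k"
 by (auto simp: Gr_def)

lemma proj_inj_iff:
 assumes "W : frames k m"
 shows "proj_inj k e (row_space k W) \<longleftrightarrow> cdet k (%i l. W i (e l)) ~= 0"
proof -
 have z: "comb {..<k} g W = 0 \<longleftrightarrow> (\<forall>j<k. g j = 0)" for g
  using assms findepD[of "{..<k}" W g] unfolding frames_iff by (auto simp: comb_def fun_eq_iff)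
 have "proj_inj k e (row_space k W) \<longleftrightarrow> (\<forall>g. (\<forall>l<k. comb {..<k} g W (e l) = 0) --> comb {..<k} g W = 0)"
  unfolding proj_inj_def row_space_def[symmetric] Ball_def row_space_iff by blast
 then show ?thesis unfolding cdet_nonzero_iff z by (simp add: comb_def)
qed

lemma frame_of_cdet:
 assumes "!!i. i < k ==> W i : cspace m" "!!i. i >= k ==> W i = 0" "cdet k (%i l. W i (e l)) ~= 0"
 shows "W : frames k m"
 unfolding frames_iff findep_def
proof (intro conjI allI impI ballI)
 fix c l assume c: "comb {..<k} c W = 0" and l: "l : {..<k}"
 have "(\<Sum>j<k. c j * W j (e l)) = 0" for l
  using fun_cong[OF c, of "e l"] by (simp add: comb_def)
 then show "c l = 0" using assms(3) l unfolding cdet_nonzero_iff by blast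
qed (use assms in auto)

lemma usol_unique:
 assumes "proj_inj k e V" "csubspace V" "u : V" "!!l. l < k ==> u (e l) = (if l = i then 1 else 0)"
 shows "usol k e i V = u"
 unfolding usol_def
proof (rule the_equality)
 fix v assume v: "v : V & (\<forall>l<k. v (e l) = (if l = i then 1 else 0))"
 then have "v - u : V" using assms cvec.subspace_diff by blast
 moreover have "\<forall>l<k. (v - u) (e l) = 0" using v assms by simp
 ultimately have "v - u = 0" using assms(1) unfolding proj_inj_def by blast
 then show "v = u" by simp
qed (use assms in auto)

text \<open>Cramer's rule: the frame is normalised by the inverse of its minor in the columns
  \<open>e\<close>.\<close>

lemma usol_formula:
 fixes W :: "nat => nat => complex"
 assumes W: "W : frames k m" and T: "cdet k (%i l. W i (e l)) ~= 0" and i: "i < k"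
 shows "usol k e i (row_space k W) = comb {..<k} (%j. cadj k (%i l. W i (e l)) i j / cdet k (%i l. W i (e l))) W" (is "_ = ?u")
  and "usol k e i (row_space k W) : row_space k W"
  and "l < k ==> usol k e i (row_space k W) (e l) = (if l = i then 1 else 0)"
proof -
 let ?T = "%i l. W i (e l)"
 have V: "row_space k W : Gr k m" by (rule row_space_in_Gr[OF W])
 have u: "?u : row_space k W" unfolding row_space_iff by blast
 have d: "?u (e l) = (if l = i then 1 else 0)" if l: "l < k" for l
 proof -
  have "?u (e l) = (\<Sum>j<k. cadj k ?T i j * ?T j l) / cdet k ?T"
   by (simp add: comb_def sum_divide_distrib)
  then show ?thesis using cadj_mult(1)[OF i l, of ?T] T by simp
 qed
 show eq: "usol k e i (row_space k W) = ?u"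
  by (rule usol_unique) (use W T V u d in \<open>auto simp: proj_inj_iff GrD\<close>)
 show "usol k e i (row_space k W) : row_space k W" using u eq by simp
 show "l < k ==> usol k e i (row_space k W) (e l) = (if l = i then 1 else 0)" using d eq by simp
qed

lemma usol_props:
 assumes V: "V : Gr k m" and p: "proj_inj k e V" and i: "i < k"
 shows "usol k e i V : V" "l < k ==> usol k e i V (e l) = (if l = i then 1 else 0)"
proof -
 obtain W where W: "W : frames k m" "row_space k W = V" using Gr_frame[OF V] .
 show "usol k e i V : V" "l < k ==> usol k e i V (e l) = (if l = i then 1 else 0)"
  using usol_formula(2,3)[OF W(1) _ i, of e] p W proj_inj_iff[OF W(1), of e] by auto
qed

lemma continuous_on_entry: "continuous_on S (%A :: nat => nat => 'a :: topological_space. A i j)"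
proof -
 have "continuous_on UNIV (%A :: nat => nat => 'a. A i j)"
  by (rule continuous_on_compose2[where f = "%A. A i" and g = "%x. x j" and t = UNIV]) (auto intro: continuous_on_product_coordinates)
 then show ?thesis by (rule continuous_on_subset) simp
qed

lemma row_space_continuous: "continuous_map (top_of_set (frames k m)) (Gr_top k m) (row_space k)"
 unfolding continuous_map_def topspace_Gr_top openin_Gr_top
 using row_space_in_Gr by (auto simp: Pi_def)

lemma openin_Gr_of_continuous:
 assumes U: "openin (Gr_top k m) U" and f: "continuous_on {A : frames k m. row_space k A : U} (%A. f (row_space k A))" and T: "open T"
 shows "openin (Gr_top k m) {V : U. f V : T}"
 unfolding openin_Gr_top
proof
 let ?P = "{A : frames k m. row_space k A : U}"
 have U': "U <= Gr k m" "openin (top_of_set (frames k m)) ?P" using U unfolding openin_Gr_top by auto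
 show "{V : U. f V : T} <= Gr k m" using U' by auto
 have "openin (top_of_set ?P) (?P Int (%A. f (row_space k A)) -` T)"
  by (rule continuous_openin_preimage_gen[OF f T])
 then have "openin (top_of_set (frames k m)) (?P Int (%A. f (row_space k A)) -` T)"
  using U'(2) openin_trans by blast
 moreover have "{A : frames k m. row_space k A : {V : U. f V : T}} = ?P Int (%A. f (row_space k A)) -` T" by auto
 ultimately show "openin (top_of_set (frames k m)) {A : frames k m. row_space k A : {V : U. f V : T}}" by simp
qed

lemma continuous_map_from_Gr:
 assumes U: "openin (Gr_top k m) U" and f: "continuous_on {A : frames k m. row_space k A : U} (%A. f (row_space k A))"
  and T: "!!V. V : U ==> f V : T"
 shows "continuous_map (sub (Gr_top k m) U) (top_of_set T) f"
proof -
 have top: "topspace (sub (Gr_top k m) U) = U" using openin_subset[OF U] by auto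
 have "openin (sub (Gr_top k m) U) {V : U. f V : S}" if "open S" for S
  using openin_Gr_of_continuous[OF U f that] U openin_open_subtopology by blast
 then have "continuous_map (sub (Gr_top k m) U) euclidean f"
  unfolding continuous_map_def top by auto
 then show ?thesis using T top by (auto simp: continuous_map_in_subtopology)
qed

lemma openin_proj_inj: "openin (Gr_top k m) {V : Gr k m. proj_inj k e V}"
proof -
 have "{A : frames k m. row_space k A : {V : Gr k m. proj_inj k e V}} = {A : frames k m. cdet k (%i l. A i (e l)) : -{0}}"
  using row_space_in_Gr proj_inj_iff by auto
 moreover have "openin (top_of_set (frames k m)) (frames k m Int (%A. cdet k (%i l. A i (e l))) -` (-{0}))"
  by (intro continuous_openin_preimage_gen continuous_on_cdet continuous_on_entry) auto
 ultimately show ?thesis unfolding openin_Gr_top by (auto simp: Int_def vimage_def)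
qed

lemma continuous_on_usol:
 assumes U: "!!V. V : U ==> proj_inj k e V" and i: "i < k"
 shows "continuous_on {A : frames k m. row_space k A : U} (%A. usol k e i (row_space k A) p)"
proof -
 let ?P = "{A : frames k m. row_space k A : U}"
 have d: "cdet k (%i l. A i (e l)) ~= 0" if "A : ?P" for A
  using that U[of "row_space k A"] proj_inj_iff[of A k m e] by auto
 have "continuous_on ?P (%A. comb {..<k} (%j. cadj k (%i l. A i (e l)) i j / cdet k (%i l. A i (e l))) A p)"
  unfolding comb_def
  by (intro continuous_on_sum continuous_on_mult continuous_on_divide continuous_on_cadj continuous_on_cdet continuous_on_entry)
   (use i d in auto)
 then show ?thesis
  by (rule continuous_on_cong[THEN iffD1, rotated -1]) (use usol_formula(1) d i in auto)
qed

text \<open>Cramer's rule exhibits the entry as a quotient of polynomials in the matrix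
  entries.\<close>

lemma holomorphic_usol:
 assumes U: "!!V. V : U ==> proj_inj k e V" and i: "i < k"
 shows "Gr_holomorphic_on k m (%V. usol k e i V p) U"
 unfolding Gr_holomorphic_on_def
proof (intro conjI ballI allI impI)
 show "continuous_on {A : frames k m. row_space k A : U} ((%V. usol k e i V p) \<circ> row_space k)"
  unfolding o_def by (rule continuous_on_usol[OF U i])
 fix A i' j assume A: "A : frames k m" "row_space k A : U" and ij: "i' < k" "j : {1..m}"
 let ?A = "%z. A(i' := (A i')(j := z))"
 let ?T = "%z i l. ?A z i (e l)"
 let ?F = "%z. comb {..<k} (%j. cadj k (?T z) i j / cdet k (?T z)) (?A z) p"
 have A': "?A (A i' j) = A" by simp
 have ent: "(%z. ?A z x y) field_differentiable at w" for x y w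
  by (cases "x = i'"; cases "y = j") (auto intro: derivative_intros)
 have dd: "(%z. cdet k (?T z)) field_differentiable at w" for w
  by (intro field_differentiable_cdet ent)
 have nz: "cdet k (?T (A i' j)) ~= 0" using A U[OF A(2)] proj_inj_iff[OF A(1)] A' by simp
 have "isCont (%z. cdet k (?T z)) (A i' j)" using dd field_differentiable_imp_continuous_at by blast
 \<comment> \<open>The formula is valid while the minor is nonzero; there the changed matrix is
   still a frame.\<close>
 then have ev: "eventually (%z. cdet k (?T z) ~= 0) (nhds (A i' j))"
  using nz A' by (intro eventually_nhds_conv_at[THEN iffD2] conjI tendsto_imp_eventually_ne[of _ "cdet k (?T (A i' j))"]) (auto simp: isCont_def simp del: fun_upd_apply)
 have "?A z : frames k m" if "cdet k (?T z) ~= 0" for z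
 proof (rule frame_of_cdet[where e = e])
  show "cdet k (?T z) ~= 0" by (rule that)
  fix i assume "i < k" then show "?A z i : cspace m" using A ij unfolding frames_iff by (auto simp: cspace_def)
 qed (use A ij in \<open>auto simp: frames_iff\<close>)
 then have "usol k e i (row_space k (?A z)) p = ?F z" if "cdet k (?T z) ~= 0" for z
  using usol_formula(1)[of "?A z" k m e i] that i by simp
 then have ev': "eventually (%z. ?F z = usol k e i (row_space k (?A z)) p) (nhds (A i' j))"
  using ev by (auto elim: eventually_mono)
 have "?F field_differentiable at (A i' j)"
  unfolding comb_def
  by (intro field_differentiable_sum field_differentiable_mult field_differentiable_divide field_differentiable_cadj ent dd i)
   (use nz in auto)
 then show "entry_slice ((%V. usol k e i V p) \<circ> row_space k) A i' j field_differentiable at (A i' j)"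
  unfolding field_differentiable_def entry_slice_def o_def using DERIV_cong_ev[OF refl ev' refl] by blast
qed

lemma cdim_coord_span: "finite T ==> cdim (coord_span T) = card T"
proof (rule cdim_eqI)
 assume T: "finite T"
 have c: "comb T c uvec = (%p. if p : T then c p else 0)" for c
 proof
  fix p
  have "comb T c uvec p = (\<Sum>l\<in>T. if l = p then c p else 0)"
   unfolding comb_def Defs.unit_vec_def by (intro sum.cong) auto
  then show "comb T c uvec p = (if p : T then c p else 0)" using T by simp
 qed
 show "findep T uvec" unfolding findep_def c by (auto simp: fun_eq_iff)
 show "uvec ` T <= coord_span T" unfolding coord_span_def by (rule cvec.span_superset)
 show "\<exists>c. w = comb T c uvec" if "w : coord_span T" for w
  using that unfolding c coord_span_eq[OF T] by (intro exI[of _ w]) auto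
qed simp

text \<open>Evaluation in the columns \<open>e l\<close> with \<open>l\<close> in \<open>T\<close>
  embeds \<open>W\<close> into a space of dimension \<open>card T\<close>; when the dimensions
  agree, it is onto.\<close>

lemma evaluation_dimension:
 fixes T :: "nat set"
 assumes W: "csubspace W" "W <= cspace m" and T: "finite T"
  and inj: "!!w. w : W ==> (!!l. l : T ==> w (e l) = 0) ==> w = 0"
 shows "cdim W <= card T" and "card T <= cdim W ==> \<exists>w\<in>W. \<forall>l\<in>T. w (e l) = g l"
proof -
 obtain M where M: "T <= {..<M}" using T finite_nat_iff_bounded by blast
 \<comment> \<open>Indices are shifted by one because the coordinates of \<open>cspace\<close> start
   at 1.\<close>
 define \<Phi> where "\<Phi> = (%w p. if p : Suc ` T then w (e (p - 1)) else (0 :: complex))"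
 let ?C = "coord_span (Suc ` T)"
 have C: "csubspace ?C" "?C <= cspace M" "cdim ?C = card T"
 proof -
  show "csubspace ?C" by (rule csubspace_coord_span)
  show "cdim ?C = card T" using T by (simp add: cdim_coord_span card_image)
  show "?C <= cspace M"
  proof
   fix x assume "x : ?C"
   then have x: "!!i. i ~: Suc ` T ==> x i = 0" using T by (simp add: coord_span_eq)
   have "Suc ` T <= {1..M}" using M by auto
   then show "x : cspace M" unfolding cspace_def using x by blast
  qed
 qed
 obtain v where v: "findep {..<cdim W} v" "!!i. v i : W" "!!w. w : W ==> \<exists>c. w = comb {..<cdim W} c v"
  using subspace_family_basis[OF W] by blast
 have \<Phi>c: "comb {..<cdim W} c (%i. \<Phi> (v i)) = \<Phi> (comb {..<cdim W} c v)" for c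
  unfolding comb_def \<Phi>_def by (auto simp: fun_eq_iff)
 have cW: "comb {..<cdim W} c v : W" for c by (rule comb_in_subspace) (use W v in auto)
 have f: "findep {..<cdim W} (%i. \<Phi> (v i))"
  unfolding findep_def \<Phi>c
 proof (intro allI impI)
  fix c assume z: "\<Phi> (comb {..<cdim W} c v) = 0"
  have "comb {..<cdim W} c v = 0"
  proof (rule inj[OF cW])
   fix l assume "l : T" then show "comb {..<cdim W} c v (e l) = 0"
    using fun_cong[OF z, of "Suc l"] by (auto simp: \<Phi>_def split: if_splits)
  qed
  then show "\<forall>l\<in>{..<cdim W}. c l = 0" using findepD[OF v(1)] by blast
 qed
 have sub: "(%i. \<Phi> (v i)) ` {..<cdim W} <= ?C" using T by (auto simp: \<Phi>_def coord_span_eq)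
 show le: "cdim W <= card T" using findep_card_le[OF _ f sub C(1,2)] C(3) by simp
 show "\<exists>w\<in>W. \<forall>l\<in>T. w (e l) = g l" if ge: "card T <= cdim W"
 proof -
  have "(%p. if p : Suc ` T then g (p - 1) else 0) : ?C" using T by (auto simp: coord_span_eq)
  then obtain c where c: "(%p. if p : Suc ` T then g (p - 1) else 0) = comb {..<cdim W} c (%i. \<Phi> (v i))"
   using findep_spans[OF _ f sub C(1,2)] C(3) le ge by fastforce
  have "comb {..<cdim W} c v (e l) = g l" if "l : T" for l
   using fun_cong[OF c, of "Suc l"] that unfolding \<Phi>c by (auto simp: \<Phi>_def split: if_splits)
  then show ?thesis using cW by blast
 qed
qed

text \<open>Serves to put the normal coordinates first, so that the cell becomes an
  \<open>Lsub\<close>.\<close>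

lemma ex_initial_enumeration:
 assumes "finite F" "A <= F"
 shows "\<exists>e. bij_betw e {..<card F} F & e ` {..<card A} = A"
proof -
 have fA: "finite A" using assms finite_subset by blast
 obtain e1 where e1: "bij_betw e1 {0..<card A} A" using ex_bij_betw_nat_finite[OF fA] by blast
 obtain e2 where e2: "bij_betw e2 {0..<card (F - A)} (F - A)" using ex_bij_betw_nat_finite[of "F - A"] assms by blast
 let ?e = "%s. if s < card A then e1 s else e2 (s - card A)"
 have cF: "card F = card A + card (F - A)" using assms card_Diff_subset[OF fA] card_mono[OF assms] by simp
 have b1: "bij_betw ?e {..<card A} A"
  by (rule bij_betw_cong[THEN iffD1, OF _ e1[unfolded atLeast0LessThan]]) auto
 have sh: "bij_betw (%s. s - card A) {card A..<card F} {0..<card (F - A)}"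
  by (rule bij_betw_byWitness[where f' = "%s. s + card A"]) (auto simp: cF)
 have b2: "bij_betw ?e {card A..<card F} (F - A)"
  by (rule bij_betw_cong[THEN iffD1, OF _ bij_betw_trans[OF sh e2]]) auto
 have "bij_betw ?e ({..<card A} Un {card A..<card F}) (A Un (F - A))"
  by (rule bij_betw_combine[OF b1 b2]) auto
 moreover have "{..<card A} Un {card A..<card F} = {..<card F}" "A Un (F - A) = F" using cF assms by auto
 ultimately show ?thesis using b1 unfolding bij_betw_def by (intro exI[of _ ?e]) auto
qed

section \<open>The chart around a cell\<close>

context spans
begin

text \<open>The projection of a member of the cell to the columns \<open>colf p q l\<close> is bijective. For \<open>[p, q] = [a i, b i]\<close>
 the preimage of the \<open>i\<close>-th basis vector normalises the \<open>i\<close>-th row; its other entries are the chart coordinates.\<close>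

definition colf :: "nat => nat => nat => nat" where
 "colf p q l = (if a l < p then a l else if q < b l then b l else a l)"

abbreviation ci :: "nat => nat => nat" where "ci i \<equiv> colf (a i) (b i)"
abbreviation uv :: "nat => (nat => complex) set => nat => complex" where "uv i \<equiv> usol k (ci i) i"

text \<open>The three branches take values below \<open>p\<close>; at least \<open>p\<close> and
  above \<open>q\<close>; and within \<open>[p, q]\<close>. Equal values therefore come from the
  same branch, where the ends are distinct.\<close>

lemma colf_inj: "inj_on (colf p q) {..<k}"
proof (rule inj_onI)
 fix l l' assume l: "l : {..<k}" "l' : {..<k}" and e: "colf p q l = colf p q l'"
 have "a l <= b l" "a l' <= b l'" using ab l by auto
 then have "a l = a l' | b l = b l'" using e unfolding colf_def by (auto split: if_splits)
 then show "l = l'" using l inj_a inj_b unfolding inj_on_def by blast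
qed

lemma ci_range: "l < k ==> 1 <= colf p q l & colf p q l <= m"
 using ab[of l] unfolding colf_def by auto

lemma ci_self: "ci i i = a i"
 by (simp add: colf_def)

text \<open>Let \<open>j\<close> be the contributing row with least left end and \<open>j'\<close>
  the one with greatest right end; the combination is nonzero at \<open>a j\<close> and at
  \<open>b j'\<close>. If \<open>a j < p\<close>, the column \<open>a j\<close> is chosen.
  Otherwise, if \<open>q < b j'\<close>, the column \<open>b j'\<close> is chosen; and if neither
  holds, all contributing intervals lie in \<open>[p, q]\<close> and \<open>a j\<close> is chosen
  again.\<close>

lemma proj_cell:
 assumes "V : cell" shows "proj_inj k (colf p q) V"
 unfolding proj_inj_def
proof (intro ballI impI)
 fix v assume v: "v : V" and z: "\<forall>l<k. v (colf p q l) = 0"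
 obtain B where B: "spanned B" "V = row_space k B" using assms unfolding cell_def by blast
 obtain c where c: "v = comb {..<k} c B" using v B row_space_iff by blast
 let ?T = "{l. l < k & c l ~= 0}"
 have nzB: "B l (a l) ~= 0" "B l (b l) ~= 0" if "l < k" for l using B that unfolding spanned_def by auto
 have "?T = {}"
 proof (rule ccontr)
  assume ne: "?T ~= {}"
  have fin: "finite ?T" by simp
  obtain j where j: "j : ?T" "!!l. l : ?T ==> a j <= a l"
   using ne fin arg_min_if_finite[of ?T a] by (metis (no_types, lifting) not_less)
  have "Max (b ` ?T) : b ` ?T" using ne by (intro Max_in) auto
  then obtain j' where j'': "j' : ?T" "b j' = Max (b ` ?T)" by auto
  have j': "j' : ?T" "!!l. l : ?T ==> b l <= b j'" unfolding j''(2) using j'' by (auto intro: Max_ge)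
  have va: "v (a j) ~= 0"
   using spanned_leading[OF B(1), of "{..<k}" j c] j nzB[of j] unfolding c by auto
  have vb: "v (b j') ~= 0"
   using spanned_trailing[OF B(1), of "{..<k}" j' c] j' nzB[of j'] unfolding c by auto
  have zj: "v (colf p q j) = 0" "v (colf p q j') = 0" using z j j' by auto
  have "a j <= a j'" "b j <= b j'" using j j' by auto
  then show False using zj va vb unfolding colf_def by (auto split: if_splits)
 qed
 then show "v = 0" unfolding c comb_def by (auto simp: fun_eq_iff intro!: sum.neutral)
qed

text \<open>For an interval that is not inside \<open>[p, q]\<close> the chosen column lies outside
  \<open>[p, q]\<close>, where \<open>v\<close> is 0 by its support.\<close>

lemma proj_interval:
 assumes "proj_inj k (colf p q) V" "v : V Int coord_span {p..q}"
  "!!l. l : {l. l < k & p <= a l & b l <= q} ==> v (colf p q l) = 0"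
 shows "v = 0"
proof -
 have v: "\<forall>i. v i ~= 0 --> p <= i & i <= q" using assms(2) unfolding in_coord_span_interval[symmetric] by blast
 have "v (colf p q l) = 0" if "l < k" for l
 proof (cases "p <= a l & b l <= q")
  case True then show ?thesis using assms(3) that by auto
 next
  case False
  have "colf p q l < p | q < colf p q l" using False by (auto simp: colf_def)
  then show ?thesis using v by (meson not_less)
 qed
 then show ?thesis using assms unfolding proj_inj_def by blast
qed

text \<open>Semicontinuity of ranks: injectivity of the projection is an open condition, and under
  it the intersection with \<open>[p, q]\<close> embeds into the columns of the intervals inside
  \<open>[p, q]\<close>.\<close>

lemma rk_proj_le:
 assumes V: "V : Gr k m" and p: "proj_inj k (colf p q) V"
 shows "rkV V p q <= rk rset p q"
 unfolding rkV_def rk_rset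
 by (rule evaluation_dimension(1)[where e = "colf p q" and m = m])
  (use proj_interval[OF p] GrD[OF V] in \<open>auto intro: cvec.subspace_inter csubspace_coord_span\<close>)

text \<open>When the rank on \<open>[a i, b i]\<close> is attained, the intersection already
  contains a vector with the normalising values, and by uniqueness this vector is
  \<open>uv i V\<close>.\<close>

lemma uv_supported:
 assumes V: "V : Gr k m" and i: "i < k" and p: "proj_inj k (ci i) V" and r: "rk rset (a i) (b i) <= rkV V (a i) (b i)"
 shows "uv i V : coord_span {a i..b i}"
proof -
 let ?T = "{l. l < k & a i <= a l & b l <= b i}"
 let ?W = "V Int coord_span {a i..b i}"
 have "\<exists>w\<in>?W. \<forall>l\<in>?T. w (ci i l) = (if l = i then 1 else 0)"
  by (rule evaluation_dimension(2)[where m = m])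
   (use proj_interval[OF p] GrD[OF V] r in \<open>auto simp: rkV_def rk_rset intro: cvec.subspace_inter csubspace_coord_span\<close>)
 then obtain w where w: "w : ?W" "\<forall>l\<in>?T. w (ci i l) = (if l = i then 1 else 0)" by blast
 have ws: "\<forall>x. w x ~= 0 --> a i <= x & x <= b i" using w(1) unfolding in_coord_span_interval[symmetric] by blast
 have "w (ci i l) = (if l = i then 1 else 0)" if "l < k" for l
 proof (cases "l : ?T")
  case False
  then have "ci i l < a i | b i < ci i l" "l ~= i" using that by (auto simp: colf_def)
  then show ?thesis using ws by (metis not_less)
 qed (use w in blast)
 then have "uv i V = w" by (intro usol_unique) (use p w GrD[OF V] in auto)
 then show ?thesis using w by blast
qed

lemma uv_spanned:
 assumes V: "V : cell"
 shows "spanned (%i. if i < k then uv i V else 0)"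
 unfolding spanned_def
proof (intro conjI allI impI)
 have G: "V : Gr k m" using V cell_Gr by blast
 obtain B where B: "spanned B" "V = row_space k B" using V unfolding cell_def by blast
 fix i assume i: "i < k"
 have sup: "uv i V : coord_span {a i..b i}"
  by (rule uv_supported[OF G i proj_cell[OF V]]) (simp add: rkV_cell[OF V])
 have p: "uv i V : V" "uv i V (a i) = 1"
  using usol_props(1)[OF G proj_cell[OF V] i, of "a i" "b i"] usol_props(2)[OF G proj_cell[OF V] i i, of "a i" "b i"] ci_self[of i] by auto
 obtain c where c: "uv i V = comb {..<k} c B" using p(1) B row_space_iff by blast
 have cs: "a i <= a l & b l <= b i" if "l < k" "c l ~= 0" for l
 proof (rule spanned_support[where B = B and c = c])
  show "spanned B" "l < k" "c l ~= 0" using B(1) that by auto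
  show "!!x. comb {..<k} c B x ~= 0 ==> a i <= x & x <= b i" using sup unfolding in_coord_span_interval c[symmetric] by blast
 qed
 have "c i * B i (a i) = 1"
  using spanned_leading[OF B(1), of "{..<k}" i c] cs i p(2) unfolding c by auto
 then have "c i ~= 0" by auto
 moreover have "B i (b i) ~= 0" using B i unfolding spanned_def by auto
 ultimately show "(if i < k then uv i V else 0) (b i) ~= 0"
  using spanned_trailing[OF B(1), of "{..<k}" i c] cs i unfolding c by auto
 show "(if i < k then uv i V else 0) (a i) ~= 0" using p i by simp
 show "a i <= q" "q <= b i" if "(if i < k then uv i V else 0) q ~= 0" for q
  using sup that i unfolding in_coord_span_interval by auto
qed auto

text \<open>Each row is normalised in its own set of columns, so independence of the rows
  \<open>uv i V\<close> is a condition of its own, ensured by the minor in the columns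
  \<open>b\<close>. The entries at the right ends have to be nonzero in the cell.\<close>

definition domn :: "(nat => complex) set set" where
 "domn = {V : Gr k m. (\<forall>i<k. proj_inj k (ci i) V) & (\<forall>i<k. uv i V (b i) ~= 0) & cdet k (%i l. uv i V (b l)) ~= 0}"

lemma cdet_cong: "(!!i j. i < k ==> j < k ==> T i j = T' i j) ==> cdet k T = cdet k T'"
 unfolding cdet_def cmat_def by (rule arg_cong[where f = Determinant.det], rule eq_matI) auto

lemma cell_domn: "cell <= domn"
proof
 fix V assume V: "V : cell"
 let ?A = "%i. if i < k then uv i V else 0"
 have G: "V : Gr k m" using V cell_Gr by blast
 note s = uv_spanned[OF V]
 have fr: "?A : frames k m" by (rule spanned_frame[OF s])
 have rs: "row_space k ?A = V"
  by (rule frame_in_subspace[OF _ _ G]) (use spanned_findep[OF s] usol_props(1)[OF G proj_cell[OF V]] in auto)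
 \<comment> \<open>For \<open>p = q = 0\<close> the chosen columns are the right ends, as these are
   positive.\<close>
 have "proj_inj k (colf 0 0) V" by (rule proj_cell[OF V])
 then have "cdet k (%i l. ?A i (colf 0 0 l)) ~= 0" using proj_inj_iff[OF fr, of "colf 0 0"] rs by simp
 moreover have "cdet k (%i l. ?A i (colf 0 0 l)) = cdet k (%i l. uv i V (b l))"
  by (rule cdet_cong) (use ab in \<open>auto simp: colf_def\<close>, fastforce+)
 moreover have "\<forall>i<k. uv i V (b i) ~= 0" using s unfolding spanned_def by auto
 ultimately show "V : domn" unfolding domn_def using G proj_cell[OF V] by auto
qed

lemma domn_frame:
 assumes V: "V : domn"
 shows "(%i. if i < k then uv i V else 0) : frames k m" "row_space k (%i. if i < k then uv i V else 0) = V"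
proof -
 let ?A = "%i. if i < k then uv i V else 0"
 have G: "V : Gr k m" and p: "!!i. i < k ==> proj_inj k (ci i) V" and d: "cdet k (%i l. uv i V (b l)) ~= 0"
  using V unfolding domn_def by auto
 have inV: "uv i V : V" if "i < k" for i using usol_props(1)[OF G p[OF that] that] .
 have "cdet k (%i l. ?A i (b l)) = cdet k (%i l. uv i V (b l))" by (rule cdet_cong) auto
 then show fr: "?A : frames k m"
  by (intro frame_of_cdet[where e = b]) (use d inV GrD(2)[OF G] in auto)
 show "row_space k ?A = V"
  by (rule frame_in_subspace[OF _ _ G]) (use fr inV in \<open>auto simp: frames_iff\<close>)
qed

lemma domn_cell:
 assumes V: "V : domn" and r: "!!i. i < k ==> uv i V : coord_span {a i..b i}"
 shows "V : cell"
proof -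
 let ?A = "%i. if i < k then uv i V else 0"
 have G: "V : Gr k m" and p: "!!i. i < k ==> proj_inj k (ci i) V" and b: "!!i. i < k ==> uv i V (b i) ~= 0"
  using V unfolding domn_def by auto
 have "uv i V (a i) = 1" if "i < k" for i using usol_props(2)[OF G p[OF that] that that] ci_self[of i] by simp
 then have "spanned ?A" unfolding spanned_def using r b unfolding in_coord_span_interval by auto
 then show ?thesis using domn_frame(2)[OF V] unfolding cell_def by (intro image_eqI[of _ _ ?A]) auto
qed

lemma domn_rank_cell:
 assumes V: "V : domn" and r: "!!i. i < k ==> rk rset (a i) (b i) <= rkV V (a i) (b i)"
 shows "V : cell"
 by (rule domn_cell[OF V]) (use uv_supported V r in \<open>auto simp: domn_def\<close>)

lemma openin_domn: "openin (Gr_top k m) domn"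
proof -
 let ?U = "{V : Gr k m. \<forall>i<k. proj_inj k (ci i) V}"
 have "?U = Gr k m Int (\<Inter>i\<in>{..<k}. {V : Gr k m. proj_inj k (ci i) V})" by auto
 moreover have "openin (Gr_top k m) (topspace (Gr_top k m) Int (\<Inter>i\<in>{..<k}. {V : Gr k m. proj_inj k (ci i) V}))"
  by (intro openin_Int_Inter) (auto intro: openin_proj_inj)
 ultimately have U: "openin (Gr_top k m) ?U" by (simp add: topspace_Gr_top)
 have cu: "continuous_on {A : frames k m. row_space k A : ?U} (%A. uv i (row_space k A) p)" if "i < k" for i p
  by (rule continuous_on_usol) (use that in auto)
 let ?g = "%V. (\<Prod>i<k. uv i V (b i)) * cdet k (%i l. uv i V (b l))"
 have "openin (Gr_top k m) {V : ?U. ?g V : -{0}}"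
  by (intro openin_Gr_of_continuous U continuous_on_mult continuous_on_prod continuous_on_cdet cu) auto
 moreover have "{V : ?U. ?g V : -{0}} = domn" unfolding domn_def by auto
 ultimately show ?thesis by simp
qed

text \<open>The entries of the normalised rows that are not prescribed serve as coordinates. Those
  in \<open>nrm\<close> lie outside the interval of their row; they are the normal ones.\<close>

definition free :: "(nat \<times> nat) set" where
 "free = {(i, p). i < k & 1 <= p & p <= m & p ~: ci i ` {..<k}}"
definition nrm :: "(nat \<times> nat) set" where
 "nrm = {(i, p) : free. p < a i | b i < p}"
definition cod :: nat where "cod = card nrm"
definition enum :: "nat => nat \<times> nat" where
 "enum = (SOME e. bij_betw e {..<card free} free & e ` {..<cod} = nrm)"
definition chi :: "nat => (nat => complex) set => complex" where
 "chi s V = uv (fst (enum s)) V (snd (enum s))"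
definition theta :: "(nat => complex) set => nat => real" where
 "theta V = c2r (card free) (%s. chi s V)"
text \<open>\<open>a i\<close> is the column \<open>ci i i\<close>, so a 1 there and 0 in the other
  normalising columns is the normalisation of row \<open>i\<close>.\<close>

definition mato :: "(nat => real) => nat => nat => complex" where
 "mato y i p = (if (i, p) : free then Complex (y (2 * inv_into {..<card free} enum (i, p))) (y (2 * inv_into {..<card free} enum (i, p) + 1))
  else if i < k & p = a i then 1 else 0)"
text \<open>The conditions of \<open>domn\<close>, written for the matrix of normalised
  rows.\<close>

definition imag :: "(nat => real) set" where
 "imag = {y : Es (2 * card free). (\<Prod>i<k. cdet k (%i' l. mato y i' (ci i l)) * mato y i (b i)) * cdet k (%i l. mato y i (b l)) ~= 0}"

lemma finite_free: "finite free"
 by (rule finite_subset[of _ "{..<k} \<times> {1..m}"]) (auto simp: free_def)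

lemma nrm_free: "nrm <= free" by (auto simp: nrm_def)

lemma cod_le: "cod <= card free"
 unfolding cod_def using finite_free nrm_free card_mono by blast

lemma enum: "bij_betw enum {..<card free} free" "enum ` {..<cod} = nrm"
proof -
 have "\<exists>e. bij_betw e {..<card free} free & e ` {..<cod} = nrm"
  unfolding cod_def by (rule ex_initial_enumeration[OF finite_free nrm_free])
 from someI_ex[OF this] show "bij_betw enum {..<card free} free" "enum ` {..<cod} = nrm"
  unfolding enum_def by auto
qed

lemma enum_free: "s < card free ==> enum s : free" "s < cod ==> enum s : nrm"
 using enum by (auto simp: bij_betw_def)

lemma mato_theta:
 assumes V: "V : domn"
 shows "mato (theta V) = (%i. if i < k then uv i V else 0)"
proof (intro ext)
 fix i p
 have G: "V : Gr k m" and pr: "!!i. i < k ==> proj_inj k (ci i) V" using V unfolding domn_def by auto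
 show "mato (theta V) i p = (if i < k then uv i V else 0) p"
 proof (cases "(i, p) : free")
  case True
  let ?s = "inv_into {..<card free} enum (i, p)"
  have s: "?s < card free" "enum ?s = (i, p)"
   using True enum(1) inv_into_into[of "(i, p)" enum "{..<card free}"] f_inv_into_f[of "(i, p)" enum "{..<card free}"] by (auto simp: bij_betw_def)
  then have "chi ?s V = uv i V p" by (simp add: chi_def)
  moreover have "mato (theta V) i p = chi ?s V"
   using True s(1) by (simp add: mato_def theta_def c2r_def)
  ultimately show ?thesis using True by (auto simp: free_def)
 next
  case False
  show ?thesis
  proof (cases "i < k")
   case i: True
   have u: "uv i V : cspace m" using usol_props(1)[OF G pr[OF i] i] GrD(2)[OF G] by blast
   show ?thesis
   proof (cases "p : ci i ` {..<k}")
    case True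
    then obtain l where l: "l < k" "p = ci i l" by auto
    have "uv i V p = (if l = i then 1 else 0)" using usol_props(2)[OF G pr[OF i] i l(1)] l by simp
    moreover have "p = a i \<longleftrightarrow> l = i"
     using inj_on_eq_iff[OF colf_inj, of l i "a i" "b i"] l i ci_self[of i] by auto
    ultimately show ?thesis using False i by (simp add: mato_def)
   next
    case nc: False
    then have "p ~: {1..m}" using False i by (auto simp: free_def)
    moreover have "p ~= a i" using nc ci_self[of i] i by (metis imageI lessThan_iff)
    ultimately show ?thesis using u False i unfolding cspace_def by (auto simp: mato_def)
   qed
  qed (use False in \<open>auto simp: mato_def free_def\<close>)
 qed
qed

lemma mato_frame:
 assumes y: "y : imag"
 shows "mato y : frames k m" "!!i. i < k ==> uv i (row_space k (mato y)) = mato y i" "row_space k (mato y) : domn" "theta (row_space k (mato y)) = y"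
proof -
 let ?V = "row_space k (mato y)"
 have pn: "(\<Prod>i<k. cdet k (%i' l. mato y i' (ci i l)) * mato y i (b i)) ~= 0" "cdet k (%i l. mato y i (b l)) ~= 0" "y : Es (2 * card free)"
  using y unfolding imag_def by auto
 have c: "cdet k (%i' l. mato y i' (ci i l)) ~= 0" "mato y i (b i) ~= 0" if "i < k" for i
  using pn(1) that by (auto simp: prod_zero_iff)
 show fr: "mato y : frames k m"
 proof (rule frame_of_cdet[where e = b])
  show "cdet k (%i l. mato y i (b l)) ~= 0" by (rule pn(2))
  fix i assume "i < k" then show "mato y i : cspace m" using ab[of i] by (auto simp: cspace_def mato_def free_def)
 qed (auto simp: mato_def free_def)
 have G: "?V : Gr k m" by (rule row_space_in_Gr[OF fr])
 have pr: "proj_inj k (ci i) ?V" if "i < k" for i using c(1)[OF that] proj_inj_iff[OF fr] by blast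
 show u: "uv i ?V = mato y i" if i: "i < k" for i
 proof (rule usol_unique[OF pr[OF i]])
  fix l assume l: "l < k"
  have "ci i l = a i \<longleftrightarrow> l = i"
   using inj_on_eq_iff[OF colf_inj, of l i "a i" "b i"] l i ci_self[of i] by auto
  then show "mato y i (ci i l) = (if l = i then 1 else 0)" using l i by (auto simp: mato_def free_def)
 qed (use G i in \<open>auto simp: GrD row_in_row_space\<close>)
 have "cdet k (%i l. uv i ?V (b l)) = cdet k (%i l. mato y i (b l))" by (rule cdet_cong) (simp add: u)
 then show "?V : domn" unfolding domn_def using G pr u c pn by auto
 have "Complex (y (2 * s)) (y (2 * s + 1)) = chi s ?V" if s: "s < card free" for s
 proof -
  have e: "enum s : free" using enum_free s by blast
  have "inv_into {..<card free} enum (enum s) = s"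
   using enum(1) s by (intro inv_into_f_f) (auto simp: bij_betw_def)
  then have "mato y (fst (enum s)) (snd (enum s)) = Complex (y (2 * s)) (y (2 * s + 1))" using e by (simp add: mato_def)
  moreover have "fst (enum s) < k" using e by (auto simp: free_def)
  ultimately show ?thesis unfolding chi_def by (simp add: u)
 qed
 then have cs: "y (2 * s) = Re (chi s ?V)" "y (2 * s + 1) = Im (chi s ?V)" if "s < card free" for s
  using that by (metis complex.sel(1), metis complex.sel(2))
 show "theta ?V = y"
 proof
  fix j
  show "theta ?V j = y j"
  proof (cases "j < 2 * card free")
   case True
   then have h: "j div 2 < card free" by simp
   show ?thesis using cs[OF h] True by (cases "even j") (auto simp: theta_def c2r_def elim: oddE)
  qed (use pn(3) in \<open>auto simp: theta_def c2r_def Es_def\<close>)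
 qed
qed

lemma theta_imag:
 assumes V: "V : domn" shows "theta V : imag"
proof -
 let ?A = "%i. if i < k then uv i V else 0"
 have p: "!!i. i < k ==> proj_inj k (ci i) V" and b: "!!i. i < k ==> uv i V (b i) ~= 0" and d: "cdet k (%i l. uv i V (b l)) ~= 0"
  using V unfolding domn_def by auto
 have "cdet k (%i l. ?A i (b l)) = cdet k (%i l. uv i V (b l))" by (rule cdet_cong) auto
 moreover have "cdet k (%i' l. ?A i' (ci i l)) ~= 0" if "i < k" for i
  using p[OF that] proj_inj_iff[OF domn_frame(1)[OF V], of "ci i"] domn_frame(2)[OF V] by simp
 moreover have "theta V : Es (2 * card free)" by (simp add: theta_def c2r_in_Es)
 ultimately show ?thesis unfolding imag_def mem_Collect_eq mato_theta[OF V] using b d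
  by (auto simp: prod_zero_iff)
qed

lemma continuous_on_mato: "continuous_on S (%y. mato y i p)"
proof (cases "(i, p) : free")
 case True
 have c: "continuous_on S (%y :: nat => real. y j)" for j
  by (rule continuous_on_subset[OF continuous_on_product_coordinates]) auto
 show ?thesis using True unfolding mato_def by (simp add: Complex_eq, intro continuous_intros c)
qed (simp add: mato_def)

lemma continuous_on_mato': "continuous_on S mato"
 by (intro continuous_on_coordinatewise_then_product continuous_on_mato)

text \<open>A normalised row lies in its interval exactly when its entries in \<open>nrm\<close>
  vanish: in the normalising columns it is already 0 except at \<open>a i\<close>.\<close>

lemma theta_Lsub:
 assumes V: "V : domn" shows "V : cell \<longleftrightarrow> theta V : Lsub (2 * cod)"
proof -
 have "theta V : Lsub (2 * cod) \<longleftrightarrow> c2r cod (%s. chi s V) = 0"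
  using cod_le by (auto simp: Lsub_def theta_def c2r_def fun_eq_iff)
 also have "... \<longleftrightarrow> (\<forall>s<cod. chi s V = 0)" by (rule c2r_eq_0_iff)
 also have "... \<longleftrightarrow> (\<forall>e\<in>nrm. uv (fst e) V (snd e) = 0)" unfolding enum(2)[symmetric] chi_def by auto
 also have "... \<longleftrightarrow> V : cell"
 proof
  assume h: "\<forall>e\<in>nrm. uv (fst e) V (snd e) = 0"
  have G: "V : Gr k m" and pr: "!!i. i < k ==> proj_inj k (ci i) V" using V unfolding domn_def by auto
  show "V : cell"
  proof (rule domn_cell[OF V])
   fix i assume i: "i < k"
   show "uv i V : coord_span {a i..b i}"
    unfolding in_coord_span_interval
   proof (intro allI impI)
    fix p assume nz: "uv i V p ~= 0"
    have "uv i V : cspace m" using usol_props(1)[OF G pr[OF i] i] GrD(2)[OF G] by blast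
    then have p: "1 <= p" "p <= m" using nz unfolding cspace_def by auto
    show "a i <= p & p <= b i"
    proof (cases "p : ci i ` {..<k}")
     case True
     then obtain l where l: "l < k" "p = ci i l" by auto
     then have "l = i" using nz usol_props(2)[OF G pr[OF i] i l(1)] by (auto split: if_splits)
     then show ?thesis using l ci_self[of i] ab[OF i] by simp
    next
     case False
     then have "(i, p) : free" using p i by (simp add: free_def)
     moreover have "(i, p) ~: nrm" using h nz by force
     ultimately show ?thesis by (auto simp: nrm_def)
    qed
   qed
  qed
 next
  assume c: "V : cell"
  have "uv i V p = 0" if "(i, p) : nrm" for i p
  proof (rule ccontr)
   assume "uv i V p ~= 0"
   moreover have "i < k" using that by (auto simp: nrm_def free_def)
   ultimately have "a i <= p & p <= b i" using uv_spanned[OF c] unfolding spanned_def by auto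
   then show False using that by (auto simp: nrm_def)
  qed
  then show "\<forall>e\<in>nrm. uv (fst e) V (snd e) = 0" by auto
 qed
 finally show ?thesis by blast
qed

theorem chart_domn: "chart (Gr_top k m) (2 * card free) (2 * cod) domn imag theta (%y. row_space k (mato y))"
proof
 show "2 * cod <= 2 * card free" using cod_le by simp
 show "openin (Gr_top k m) domn" by (rule openin_domn)
 have "openin (top_of_set (Es (2 * card free))) (Es (2 * card free) Int (%y. (\<Prod>i<k. cdet k (%i' l. mato y i' (ci i l)) * mato y i (b i)) * cdet k (%i l. mato y i (b l))) -` (-{0}))"
  by (intro continuous_openin_preimage_gen continuous_on_mult continuous_on_prod continuous_on_cdet continuous_on_mato) auto
 moreover have "Es (2 * card free) Int (%y. (\<Prod>i<k. cdet k (%i' l. mato y i' (ci i l)) * mato y i (b i)) * cdet k (%i l. mato y i (b l))) -` (-{0}) = imag"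
  unfolding imag_def by blast
 ultimately show "openin (Euc (2 * card free)) imag" unfolding Euclidean_space_eq by (simp only:)
 show "homeomorphic_maps (sub (Gr_top k m) domn) (top_of_set imag) theta (%y. row_space k (mato y))"
  unfolding homeomorphic_maps_def
 proof (intro conjI ballI)
  have ec: "continuous_on {A : frames k m. row_space k A : domn} (%A. chi s (row_space k A))" if "s < card free" for s
   unfolding chi_def by (rule continuous_on_usol) (use enum_free(1)[OF that] in \<open>auto simp: domn_def free_def\<close>)
  show "continuous_map (sub (Gr_top k m) domn) (top_of_set imag) theta"
   by (rule continuous_map_from_Gr[OF openin_domn _ theta_imag])
    (unfold theta_def, intro continuous_on_c2r ec)
  have "continuous_map (top_of_set imag) (top_of_set (frames k m)) mato"
   using mato_frame(1) continuous_on_mato' by (auto simp: continuous_map_in_subtopology)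
  from continuous_map_compose[OF this row_space_continuous]
  show "continuous_map (top_of_set imag) (sub (Gr_top k m) domn) (%y. row_space k (mato y))"
   using mato_frame(3) by (auto simp: continuous_map_in_subtopology o_def)
  show "row_space k (mato (theta V)) = V" if "V : topspace (sub (Gr_top k m) domn)" for V
   using that mato_theta domn_frame(2) by simp
  show "theta (row_space k (mato y)) = y" if "y : topspace (top_of_set imag)" for y
   using that mato_frame(4) by simp
 qed
qed

text \<open>The columns outside the interval of row \<open>i\<close> are counted without the
  normalising ones among them, which belong to the rows whose intervals are not inside it.\<close>

lemma card_nrm_row:
 assumes i: "i < k"
 shows "int (card {p. (i, p) : nrm}) = int m - int (Suc (b i) - a i) - (int k - int (rk rset (a i) (b i)))"
proof -
 let ?I = "{a i..b i}" and ?C = "ci i ` {..<k}" and ?T = "{l. l < k & a i <= a l & b l <= b i}"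
 have in_iff: "ci i l : ?I \<longleftrightarrow> l : ?T" if "l < k" for l
  using ab[OF that] ab[OF i] that by (auto simp: colf_def)
 have "{p. (i, p) : nrm} = ({1..m} - ?I) - (?C - ?I)"
  using i by (auto simp: nrm_def free_def)
 moreover have sub: "?C - ?I <= {1..m} - ?I" using ci_range by auto
 moreover have "?C - ?I = ci i ` ({..<k} - ?T)" using in_iff by auto
 moreover have "card (ci i ` ({..<k} - ?T)) = k - rk rset (a i) (b i)"
 proof -
  have "card (ci i ` ({..<k} - ?T)) = card ({..<k} - ?T)"
   by (rule card_image) (rule inj_on_subset[OF colf_inj], auto)
  also have "... = k - card ?T" using card_Diff_subset[of ?T "{..<k}"] by auto
  finally show ?thesis unfolding rk_rset .
 qed
 moreover have "card ({1..m} - ?I) = m - (Suc (b i) - a i)"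
  using card_Diff_subset[of ?I "{1..m}"] ab[OF i] by auto
 ultimately have "card {p. (i, p) : nrm} = (m - (Suc (b i) - a i)) - (k - rk rset (a i) (b i))"
  and "k - rk rset (a i) (b i) <= m - (Suc (b i) - a i)"
  using card_Diff_subset[of "?C - ?I" "{1..m} - ?I"] card_mono[OF _ sub] by simp_all
 moreover have "rk rset (a i) (b i) <= k" unfolding rk_rset using card_mono[of "{..<k}" ?T] by auto
 moreover have "Suc (b i) - a i <= m" using ab[OF i] by auto
 ultimately show ?thesis by linarith
qed

lemma cod_eq: "int cod = int k * (int m - int k) - rdim rset"
proof -
 have "nrm = Sigma {..<k} (%i. {p. (i, p) : nrm})" by (auto simp: nrm_def free_def)
 then have "cod = card (Sigma {..<k} (%i. {p. (i, p) : nrm}))" unfolding cod_def by simp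
 also have "... = (\<Sum>i<k. card {p. (i, p) : nrm})"
  by (intro card_SigmaI) (auto intro: finite_subset[of _ "{1..m}"] simp: nrm_def free_def)
 finally have "int cod = (\<Sum>i<k. int (card {p. (i, p) : nrm}))" by simp
 also have "... = (\<Sum>i<k. (int m - int k) - (int (Suc (b i) - a i) - int (rk rset (a i) (b i))))"
  by (intro sum.cong refl) (simp add: card_nrm_row)
 also have "... = int k * (int m - int k) - (\<Sum>i<k. int (Suc (b i) - a i) - int (rk rset (a i) (b i)))"
  unfolding sum_subtractf[of "%_. int m - int k"] by simp
 also have "(\<Sum>i<k. int (Suc (b i) - a i) - int (rk rset (a i) (b i))) = rdim rset"
  unfolding rdim_def by (subst (3) rset_def, subst sum.reindex[OF inj_pair]) simp
 finally show ?thesis .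
qed

end

section \<open>The stratification of the Grassmannian by rank sets\<close>

definition rsets :: "nat => nat => (nat \<times> nat) set set" where
 "rsets k m = {N. rank_set N & card N = k & (\<forall>x\<in>N. snd x <= m)}"

definition stratum :: "nat => nat => (nat \<times> nat) set => (nat => complex) set set" where
 "stratum k m N = {V : Gr k m. \<forall>p q. rkV V p q = rk N p q}"

lemma finite_rsets: "finite (rsets k m)"
proof (rule finite_subset)
 show "rsets k m <= Pow ({..m} \<times> {..m})"
  unfolding rsets_def rank_set_def by fastforce
qed simp

lemma rsets_spans:
 assumes "N : rsets k m"
 obtains a b where "spans k m a b" "spans.rset k a b = N"
proof -
 have N: "rank_set N" "card N = k" "!!x. x : N ==> snd x <= m" using assms unfolding rsets_def by auto
 have fin: "finite N" and le: "!!x. x : N ==> 1 <= fst x & fst x <= snd x" and inj: "inj_on fst N" "inj_on snd N"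
  using N(1) unfolding rank_set_def by auto
 obtain e where e: "bij_betw e {0..<k} N" using ex_bij_betw_nat_finite[OF fin] N(2) by blast
 have eN: "e i : N" if "i < k" for i using e that by (auto simp: bij_betw_def)
 have ei: "inj_on e {..<k}" "e ` {..<k} = N" using e by (auto simp: bij_betw_def atLeast0LessThan)
 have s: "spans k m (%i. fst (e i)) (%i. snd (e i))"
 proof
  show "inj_on (%i. fst (e i)) {..<k}"
   using comp_inj_on[OF ei(1), of fst] inj(1) ei(2) by (simp add: o_def)
  show "inj_on (%i. snd (e i)) {..<k}"
   using comp_inj_on[OF ei(1), of snd] inj(2) ei(2) by (simp add: o_def)
  show "1 <= fst (e i) & fst (e i) <= snd (e i) & snd (e i) <= m" if "i < k" for i
   using eN[OF that] le N(3) by blast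
 qed
 moreover have "spans.rset k (%i. fst (e i)) (%i. snd (e i)) = N"
  unfolding spans.rset_def[OF s] using ei(2) by simp
 ultimately show ?thesis by (rule that)
qed

context spans
begin

lemma rset_rsets: "rset : rsets k m"
 unfolding rsets_def using rank_set_rset card_rset ab by (auto simp: rset_def)

text \<open>Every \<open>V\<close> lies in some cell, and its rank function determines the rank set.
  That cell may list the intervals in another order, which \<open>\<pi>\<close> undoes.\<close>

lemma cell_eq_stratum: "cell = stratum k m rset"
proof
 show "cell <= stratum k m rset" unfolding stratum_def using cell_Gr rkV_cell by auto
 show "stratum k m rset <= cell"
 proof
  fix V assume V: "V : stratum k m rset"
  then have G: "V : Gr k m" and r: "!!p q. rkV V p q = rk rset p q" unfolding stratum_def by auto
  obtain a' b' where s': "spans k m a' b'" and c': "V : spans.cell k a' b'" using cell_exists[OF G] .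
  have "spans.rset k a' b' = rset"
   by (rule rk_determines)
    (use spans.rank_set_rset[OF s'] rank_set_rset spans.card_rset[OF s'] card_rset spans.rkV_cell[OF s' c'] r in auto)
  then have sub: "\<exists>j<k. a' j = a i & b' j = b i" if "i < k" for i
  proof -
   have "(a i, b i) : spans.rset k a' b'" using \<open>spans.rset k a' b' = rset\<close> that by (simp add: rset_def)
   then show ?thesis unfolding spans.rset_def[OF s'] by auto
  qed
  obtain \<pi> where \<pi>: "!!i. i < k ==> \<pi> i < k & a' (\<pi> i) = a i & b' (\<pi> i) = b i" using sub by metis
  obtain B' where B': "spans.spanned k a' b' B'" "V = row_space k B'" using c' unfolding spans.cell_def[OF s'] by blast
  let ?B = "%i. if i < k then B' (\<pi> i) else 0"
  have B: "spanned ?B" using B'(1) \<pi> unfolding spanned_def spans.spanned_def[OF s'] by auto metis+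
  have "row_space k ?B = V"
   by (rule frame_in_subspace[OF spanned_findep[OF B] _ G]) (use \<pi> B'(2) row_in_row_space in auto)
  then show "V : cell" unfolding cell_def using B by (intro image_eqI[of _ _ ?B]) auto
 qed
qed

text \<open>Leaves finitely many pairs of \<open>p\<close> and \<open>q\<close>, so that the
  intersection of the corresponding open conditions is open.\<close>

lemma colf_min:
 assumes "l < k" shows "colf (min p (Suc m)) (min q m) l = colf p q l"
 using ab[OF assms] unfolding colf_def by auto

lemma rank_neighbourhood:
 obtains Q where "openin (Gr_top k m) Q" "cell <= Q" "!!V p q. V : Q ==> rkV V p q <= rk rset p q"
proof -
 define Q where "Q = Gr k m Int (\<Inter>(p, q)\<in>{..Suc m} \<times> {..m}. {V : Gr k m. proj_inj k (colf p q) V})"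
 have "openin (Gr_top k m) (topspace (Gr_top k m) Int (\<Inter>(p, q)\<in>{..Suc m} \<times> {..m}. {V : Gr k m. proj_inj k (colf p q) V}))"
  by (intro openin_Int_Inter) (auto intro: openin_proj_inj)
 then have "openin (Gr_top k m) Q" unfolding Q_def topspace_Gr_top .
 moreover have "cell <= Q" unfolding Q_def using cell_Gr proj_cell by auto
 moreover have "rkV V p q <= rk rset p q" if V: "V : Q" for V p q
 proof (rule rk_proj_le)
  show "V : Gr k m" using V unfolding Q_def by auto
  have "(min p (Suc m), min q m) : {..Suc m} \<times> {..m}" by auto
  then have "proj_inj k (colf (min p (Suc m)) (min q m)) V" using V unfolding Q_def by blast
  then show "proj_inj k (colf p q) V" unfolding proj_inj_def using colf_min by simp
 qed
 ultimately show ?thesis by (rule that)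
qed

end

lemma stratum_exists:
 assumes "V : Gr k m" obtains N where "N : rsets k m" "V : stratum k m N"
proof -
 obtain a b where s: "spans k m a b" and c: "V : spans.cell k a b" using cell_exists[OF assms] .
 show ?thesis using that spans.rset_rsets[OF s] c spans.cell_eq_stratum[OF s] by metis
qed

lemma stratum_unique:
 assumes "N : rsets k m" "N' : rsets k m" "V : stratum k m N" "V : stratum k m N'"
 shows "N = N'"
 by (rule rk_determines) (use assms in \<open>auto simp: rsets_def stratum_def\<close>)

definition strata :: "nat => nat => (nat \<times> nat) set set => (nat => complex) set set" where
 "strata k m \<S> = (\<Union>N\<in>\<S>. stratum k m N)"

text \<open>Near a point ranks can only stay or drop, so a union of strata is closed once it
  contains, with a rank set, all those with larger rank functions.\<close>

definition up_closed :: "nat => nat => (nat \<times> nat) set set => bool" where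
 "up_closed k m \<S> \<longleftrightarrow> \<S> <= rsets k m &
  (\<forall>N\<in>\<S>. \<forall>N'\<in>rsets k m. (\<forall>p q. rk N p q <= rk N' p q) --> N' : \<S>)"

lemma closed_strata:
 assumes "up_closed k m \<S>" shows "closedin (Gr_top k m) (strata k m \<S>)"
proof -
 have sub: "strata k m \<S> <= Gr k m" unfolding strata_def stratum_def by auto
 have "\<exists>Q. openin (Gr_top k m) Q & V : Q & Q <= Gr k m - strata k m \<S>" if V: "V : Gr k m - strata k m \<S>" for V
 proof -
  obtain N where N: "N : rsets k m" "V : stratum k m N" using stratum_exists V by blast
  then have nS: "N ~: \<S>" using V unfolding strata_def by blast
  obtain a b where s: "spans k m a b" and rs: "spans.rset k a b = N" using rsets_spans[OF N(1)] .
  obtain Q where Q: "openin (Gr_top k m) Q" "spans.cell k a b <= Q" "!!V p q. V : Q ==> rkV V p q <= rk N p q"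
   using spans.rank_neighbourhood[OF s] rs by metis
  have VO: "V : Q" using Q(2) N(2) spans.cell_eq_stratum[OF s] rs by auto
  have "V' ~: strata k m \<S>" if V': "V' : Q" for V'
  proof
   assume "V' : strata k m \<S>"
   then obtain N' where N': "N' : \<S>" "V' : stratum k m N'" unfolding strata_def by blast
   have "\<forall>p q. rk N' p q <= rk N p q" using Q(3)[OF V'] N'(2) unfolding stratum_def by auto
   then have "N : \<S>" using assms N'(1) N(1) unfolding up_closed_def by blast
   then show False using nS by simp
  qed
  moreover have "Q <= Gr k m" using openin_subset[OF Q(1)] topspace_Gr_top by auto
  ultimately show ?thesis using Q(1) VO by blast
 qed
 then have "openin (Gr_top k m) (Gr k m - strata k m \<S>)"
  using openin_subopen[of "Gr_top k m" "Gr k m - strata k m \<S>"] by blast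
 then show ?thesis unfolding closedin_def topspace_Gr_top using sub by blast
qed

lemma hvanish_UNIV: "hvanish p X UNIV"
 unfolding hvanish_def singular_relboundary_alt
proof (intro allI impI)
 fix z assume "relcycle p X UNIV z"
 then have "schain p X z" by (simp add: singular_relcycle_def)
 then have "bdry (Suc p) 0 = z + (- z) & schain (Suc p) X 0 & schain p (sub X UNIV) (- z)"
  by (simp add: singular_chain_minus)
 then show "\<exists>c d. schain (Suc p) X c & schain p (sub X UNIV) d & bdry (Suc p) c = z + d"
  by blast
qed

text \<open>Strata are removed one by one, the largest dimension first. By
  \<open>rdim_strict_mono\<close> the others remain \<open>up_closed\<close>, hence closed; the
  removed stratum is closed in their complement, where the chart of its cell applies and its
  codimension is at least \<open>c\<close>.\<close>

lemma strata_vanish: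
 assumes "up_closed k m \<S>" "!!N. N : \<S> ==> int c <= int k * (int m - int k) - rdim N"
  "openin (Gr_top k m) W" "p < 2 * c"
 shows "hvanish p (sub (Gr_top k m) W) (- strata k m \<S>)"
 using assms
proof (induction "card \<S>" arbitrary: \<S> W rule: less_induct)
 case less
 have fin: "finite \<S>" using less.prems(1) finite_rsets finite_subset unfolding up_closed_def by blast
 show ?case
 proof (cases "\<S> = {}")
  case True
  then show ?thesis using hvanish_UNIV by (simp add: strata_def)
 next
  case False
  have "Max (rdim ` \<S>) : rdim ` \<S>" using False fin by (intro Max_in) auto
  then obtain N where N: "N : \<S>" "rdim N = Max (rdim ` \<S>)" by auto
  then have max: "rdim N' <= rdim N" if "N' : \<S>" for N' using that fin by simp
  let ?S = "\<S> - {N}" and ?X = "Gr_top k m"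
  have sub: "\<S> <= rsets k m" and up: "!!N N'. N : \<S> ==> N' : rsets k m ==> (\<forall>p q. rk N p q <= rk N' p q) ==> N' : \<S>"
   using less.prems(1) unfolding up_closed_def by auto
  have upS: "up_closed k m ?S"
   unfolding up_closed_def
  proof (intro conjI ballI impI)
   fix N1 N2 assume N1: "N1 : ?S" and N2: "N2 : rsets k m" and le: "\<forall>p q. rk N1 p q <= rk N2 p q"
   have "N2 ~= N"
   proof
    assume eq: "N2 = N"
    have "rdim N2 < rdim N1"
     by (rule rdim_strict_mono) (use N1 N2 sub le eq in \<open>auto simp: rsets_def\<close>)
    then show False using max[of N1] N1 eq by auto
   qed
   then show "N2 : ?S" using up[of N1 N2] N1 N2 le by blast
  qed (use sub in auto)
  have cl: "closedin ?X (strata k m ?S)" "closedin ?X (strata k m \<S>)"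
   using closed_strata upS less.prems(1) by auto
  have IH: "hvanish p (sub ?X W) (- strata k m ?S)"
   by (rule less.hyps[OF card_Diff1_less[OF fin N(1)] upS]) (use less.prems in auto)
  obtain a b where s: "spans k m a b" and rs: "spans.rset k a b = N" using rsets_spans N(1) sub by blast
  interpret spans k m a b by (rule s)
  interpret chart ?X "2 * card free" "2 * cod" domn imag theta "%y. row_space k (mato y)" by (rule chart_domn)
  have cN: "cell = stratum k m N" using cell_eq_stratum rs by simp
  have "int c <= int cod" using less.prems(2)[OF N(1)] cod_eq rs by simp
  then have pc: "p < 2 * cod" using less.prems(4) by linarith
  let ?W = "W Int - strata k m ?S"
  have W': "?W = W - strata k m ?S" by auto
  have oW: "openin ?X ?W" unfolding W' by (rule openin_diff[OF less.prems(3) cl(1)])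
  have inter: "?W Int strata k m \<S> = ?W Int cell" unfolding cN strata_def using N(1) by auto
  have WX: "W <= topspace ?X" using openin_subset[OF less.prems(3)] .
  have v1: "hvanish p (sub ?X (?W Int domn)) (- cell)"
   by (rule chart_open(1)[OF _ _ theta_Lsub pc]) (use oW openU in auto)
  have v2: "hvanish p (sub ?X ?W) (- (?W Int cell))"
  proof -
   let ?Y = "sub ?X ?W"
   have "hvanish p (sub ?Y (?W Int domn)) (- (?W Int cell)) = hvanish p ?Y (- (?W Int cell))"
   proof (rule hvanish_excision)
    show "openin ?Y (?W Int domn)" using openU oW by (simp add: openin_subtopology_Int2)
    show "closedin ?Y (?W Int cell)"
     unfolding inter[symmetric] using cl(2) by (simp add: closedin_subtopology_Int_closed)
    show "?W Int cell <= ?W Int domn" using cell_domn by auto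
   qed
   moreover have "sub ?Y (?W Int domn) = sub ?X (?W Int domn)"
    unfolding subtopology_subtopology by (rule arg_cong[where f = "sub ?X"]) blast
   moreover have "hvanish p (sub ?X (?W Int domn)) (- (?W Int cell)) = hvanish p (sub ?X (?W Int domn)) (- cell)"
   proof -
    have "topspace (sub ?X (?W Int domn)) Int - (?W Int cell) = topspace (sub ?X (?W Int domn)) Int - cell" by auto
    then show ?thesis by (metis hvanish_restrict)
   qed
   ultimately show ?thesis using v1 by simp
  qed
  have v3: "hvanish p (sub ?X ?W) (- strata k m \<S>)"
  proof -
   have "topspace (sub ?X ?W) Int - (?W Int cell) = topspace (sub ?X ?W) Int - strata k m \<S>"
    using inter by auto
   then show ?thesis using v2 by (metis hvanish_restrict)
  qed
  show ?thesis
  proof (rule hvanish_triple)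
   show "- strata k m \<S> <= - strata k m ?S" unfolding strata_def by auto
   show "hvanish p (sub (sub ?X W) (- strata k m ?S)) (- strata k m \<S>)"
    using v3 by (simp add: subtopology_subtopology)
  qed (rule IH)
 qed
qed

section \<open>Closed sets between the cell and the locus of larger ranks\<close>

context spans
begin

definition Rvar :: "(nat => complex) set set" where
 "Rvar = {V : Gr k m. \<forall>p q. rk rset p q <= rkV V p q}"

lemma Rvar_strata: "Rvar = strata k m {N : rsets k m. \<forall>p q. rk rset p q <= rk N p q}"
proof
 show "Rvar <= strata k m {N : rsets k m. \<forall>p q. rk rset p q <= rk N p q}"
 proof
  fix V assume V: "V : Rvar"
  then have "V : Gr k m" by (simp add: Rvar_def)
  then obtain N where N: "N : rsets k m" "V : stratum k m N" by (rule stratum_exists)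
  then show "V : strata k m {N : rsets k m. \<forall>p q. rk rset p q <= rk N p q}"
   using V unfolding strata_def Rvar_def stratum_def by auto
 qed
qed (auto simp: strata_def Rvar_def stratum_def)

lemma closed_Rvar: "closedin (Gr_top k m) Rvar"
 unfolding Rvar_strata
proof (rule closed_strata, unfold up_closed_def, intro conjI ballI impI)
 fix N N' assume N: "N : {N : rsets k m. \<forall>p q. rk rset p q <= rk N p q}" "N' : rsets k m" "\<forall>p q. rk N p q <= rk N' p q"
 have "rk rset p q <= rk N' p q" for p q using N order.trans[of "rk rset p q" "rk N p q" "rk N' p q"] by auto
 then show "N' : {N : rsets k m. \<forall>p q. rk rset p q <= rk N p q}" using N by simp
qed auto

lemma cell_Rvar: "cell <= Rvar"
 using cell_Gr rkV_cell by (auto simp: Rvar_def)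

lemma Rvar_domn: "Rvar Int domn <= cell"
 using domn_rank_cell by (auto simp: Rvar_def)

lemma Rvar_minus_cell:
 "Rvar - cell = strata k m {N : rsets k m. N ~= rset & (\<forall>p q. rk rset p q <= rk N p q)}"
proof -
 let ?S = "{N : rsets k m. N ~= rset & (\<forall>p q. rk rset p q <= rk N p q)}"
 have "{N : rsets k m. \<forall>p q. rk rset p q <= rk N p q} = insert rset ?S" using rset_rsets by auto
 then have "Rvar = cell Un strata k m ?S" unfolding Rvar_strata cell_eq_stratum by (simp add: strata_def)
 moreover have "cell Int strata k m ?S = {}"
  unfolding cell_eq_stratum strata_def using stratum_unique[OF rset_rsets] by blast
 ultimately show ?thesis by blast
qed

text \<open>By \<open>rdim_strict_mono\<close> these strata have complex codimension at least
  \<open>cod + 1\<close>, so nothing appears below degree \<open>2 * cod + 2\<close>.\<close>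

lemma small_vanish:
 assumes W: "openin (Gr_top k m) W" and p: "p <= Suc (2 * cod)"
 shows "hvanish p (sub (Gr_top k m) W) (- (Rvar - cell))"
 unfolding Rvar_minus_cell
proof (rule strata_vanish[OF _ _ W])
 let ?S = "{N : rsets k m. N ~= rset & (\<forall>p q. rk rset p q <= rk N p q)}"
 have less: "rdim N < rdim rset" if "N : ?S" for N
  by (rule rdim_strict_mono) (use that rset_rsets in \<open>auto simp: rsets_def\<close>)
 show "up_closed k m ?S"
  unfolding up_closed_def
 proof (intro conjI ballI impI)
  fix N N' assume N: "N : ?S" and N': "N' : rsets k m" and le: "\<forall>p q. rk N p q <= rk N' p q"
  have "N' ~= rset"
  proof
   assume eq: "N' = rset"
   have "rk N p q = rk rset p q" for p q
    by (rule order_antisym) (use N le eq in auto)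
   then have "N = rset" by (intro rk_determines) (use N rset_rsets in \<open>auto simp: rsets_def\<close>)
   then show False using N by simp
  qed
  moreover have "rk rset p q <= rk N' p q" for p q
   using N le by (blast intro: order_trans)
  ultimately show "N' : ?S" using N' by simp
 qed auto
 show "int (Suc cod) <= int k * (int m - int k) - rdim N" if "N : ?S" for N
  using less[OF that] cod_eq by simp
 show "p < 2 * Suc cod" using p by simp
qed

text \<open>\<open>Z\<close> may fail to be a union of strata. But \<open>Z - cell\<close> is closed
  and contained in \<open>Rvar - cell\<close>, and vanishing for the larger set in degrees
  \<open>p\<close> and \<open>p - 1\<close>, on all open sets, gives vanishing for the smaller
  one.\<close>

theorem pair_between:
 assumes Z: "closedin (Gr_top k m) Z" "cell <= Z" "Z <= Rvar"
 shows "chart_pair (Gr_top k m) (2 * card free) (2 * cod) domn imag theta (%y. row_space k (mato y)) Z (Z - cell)"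
proof -
 interpret chart "Gr_top k m" "2 * card free" "2 * cod" domn imag theta "%y. row_space k (mato y)" by (rule chart_domn)
 have Zd: "Z Int domn = cell" using Z Rvar_domn cell_domn by blast
 have S: "Z - cell = Z - domn" using Zd cell_domn by blast
 have clS: "closedin (Gr_top k m) (Z - cell)" unfolding S by (rule closedin_diff[OF Z(1) openin_domn])
 show ?thesis
 proof
  show "closedin (Gr_top k m) Z" by fact
  show "closedin (Gr_top k m) (Z - cell)" by (rule clS)
  show "Z - cell <= Z" by blast
  show "domn Int (Z - cell) = {}" using S by blast
  show "Z - (Z - cell) <= domn" using cell_domn by blast
  show "V : Z \<longleftrightarrow> theta V : Lsub (2 * cod)" if "V : domn" for V
   using theta_Lsub[OF that] Zd that by blast
  show "hvanish p (sub (Gr_top k m) W) (- (Z - cell))" if p: "p <= Suc (2 * cod)" and W: "openin (Gr_top k m) W" for p W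
  proof (rule hvanish_triple')
   show "- (Rvar - cell) <= - (Z - cell)" using Z(3) by blast
   show "hvanish p (sub (Gr_top k m) W) (- (Rvar - cell))" by (rule small_vanish[OF W p])
   have W': "W Int - (Z - cell) = W - (Z - cell)" by auto
   have "hvanish (p - 1) (sub (Gr_top k m) (W Int - (Z - cell))) (- (Rvar - cell))"
    unfolding W' by (rule small_vanish[OF openin_diff[OF W clS]]) (use p in simp)
   then show "p = 0 | hvanish (p - 1) (sub (sub (Gr_top k m) W) (- (Z - cell))) (- (Rvar - cell))"
    by (simp add: subtopology_subtopology)
  qed
 qed
qed

text \<open>The basis from \<open>intersection_basis\<close> is supported on the intervals. Adding
  \<open>z\<close> at both ends of every row makes it \<open>spanned\<close> for all but finitely
  many \<open>z\<close>, so for arbitrarily small ones.\<close>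

lemma locus_subset_closure:
 assumes V: "V : Gr k m"
  and dims: "!!i l. [|i < k; l < k|] ==> cdim (V Int coord_span ({a i..b i} Int {a l..b l})) = card (intervals_in ({a i..b i} Int {a l..b l}) rset)"
 shows "V : Gr_top k m closure_of cell"
proof -
 obtain A where A: "A : frames k m" "row_space k A = V" "!!i. i < k ==> A i : coord_span {a i..b i}"
  using intersection_basis[OF V dims] by blast
 \<comment> \<open>For \<open>a i = b i\<close> the two summands give \<open>2 z\<close>, which is
   nonzero for nonzero \<open>z\<close> as well.\<close>
 define E where "E = (%z :: complex. %i p. A i p + z * (if i < k then (if p = a i then 1 else 0) + (if p = b i then 1 else 0) else 0))"
 have Ec: "continuous_on UNIV E"
  unfolding E_def by (intro continuous_on_coordinatewise_then_product continuous_intros)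
 have E0: "E 0 = A" by (simp add: E_def fun_eq_iff)
 have fin1: "finite {z :: complex. x + z * w = 0}" if "w ~= 0" for x w
  by (rule finite_subset[of _ "{- x / w}"]) (use that in \<open>auto simp: field_simps eq_neg_iff_add_eq_0\<close>)
 let ?bad = "\<Union>i\<in>{..<k}. {z. E z i (a i) = 0} Un {z. E z i (b i) = 0}"
 have "finite ?bad"
  unfolding E_def by (intro finite_UN_I finite_UnI fin1) (auto split: if_splits)
 have good: "row_space k (E z) : cell & E z : frames k m" if z: "z ~: ?bad" for z
 proof -
  have "spanned (E z)"
   unfolding spanned_def
  proof (intro conjI allI impI)
   fix i assume i: "i < k"
   show "E z i (a i) ~= 0" "E z i (b i) ~= 0" using z i by auto
   have sup: "\<forall>x. A i x ~= 0 --> a i <= x & x <= b i" using A(3)[OF i] unfolding in_coord_span_interval .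
   fix p assume "E z i p ~= 0"
   then have "A i p ~= 0 | p = a i | p = b i" by (auto simp: E_def split: if_splits)
   then show "a i <= p" "p <= b i" using sup ab[OF i] by auto
  next
   fix i assume "i >= k"
   then show "E z i = 0" using A(1) by (auto simp: E_def frames_iff fun_eq_iff)
  qed
  then show ?thesis using spanned_frame unfolding cell_def by blast
 qed
 show ?thesis
  unfolding in_closure_of topspace_Gr_top
 proof (intro conjI allI impI)
  fix Q assume Q: "V : Q & openin (Gr_top k m) Q"
  then obtain T where T: "open T" "{A : frames k m. row_space k A : Q} = frames k m Int T"
   unfolding openin_Gr_top openin_open by blast
  have "E 0 : T" using A Q T(2) E0 by blast
  have op: "open (E -` T)" using Ec T(1) by (simp add: continuous_on_open_vimage)
  have "~ E -` T <= ?bad"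
  proof
   assume "E -` T <= ?bad"
   then have "finite (E -` T)" using \<open>finite ?bad\<close> finite_subset by blast
   then show False using finite_imp_not_open[of "E -` T"] op \<open>E 0 \<in> T\<close> by blast
  qed
  then obtain z where z: "E z : T" "z ~: ?bad" by blast
  then have "row_space k (E z) : Q" using good[OF z(2)] T(2) by blast
  then show "\<exists>y. y : cell & y : Q" using good[OF z(2)] by blast
 qed (use V in auto)
qed

lemma inter_interval: "{a i..b i} Int {a l..b l} = {max (a i) (a l)..min (b i) (b l)}"
 by auto

lemma rank_variety_eq: "rank_variety m rset = Gr_top k m closure_of cell"
proof -
 let ?L = "{V : Gr k m. \<forall>(a, b)\<in>rset. \<forall>(c, d)\<in>rset.
    cdim (V Int coord_span ({a..b} Int {c..d})) = card (intervals_in ({a..b} Int {c..d}) rset)}"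
 have "cell <= ?L"
 proof
  fix V assume V: "V : cell"
  have "cdim (V Int coord_span ({a i..b i} Int {a l..b l})) = card (intervals_in ({a i..b i} Int {a l..b l}) rset)" for i l
   unfolding inter_interval intervals_in_rk[OF rank_set_rset] using rkV_cell[OF V] unfolding rkV_def .
  then show "V : ?L" using V cell_Gr unfolding rset_def[of] by auto
 qed
 moreover have "?L <= Gr_top k m closure_of cell"
 proof
  fix V assume V: "V : ?L"
  show "V : Gr_top k m closure_of cell"
  proof (rule locus_subset_closure)
   fix i l assume "i < k" "l < k"
   then have "(a i, b i) : rset" "(a l, b l) : rset" by (auto simp: rset_def)
   then show "cdim (V Int coord_span ({a i..b i} Int {a l..b l})) = card (intervals_in ({a i..b i} Int {a l..b l}) rset)"
    using V by blast
  qed (use V in auto)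
 qed
 ultimately have "Gr_top k m closure_of ?L = Gr_top k m closure_of cell"
  by (intro subset_antisym closure_of_mono closure_of_minimal closedin_closure_of)
 then show ?thesis unfolding rank_variety_def card_rset .
qed

lemma rank_variety_props:
 "closedin (Gr_top k m) (rank_variety m rset)" "cell <= rank_variety m rset" "rank_variety m rset <= Rvar"
 unfolding rank_variety_eq
 using closure_of_subset[of cell "Gr_top k m"] cell_Gr closure_of_minimal[OF cell_Rvar closed_Rvar]
 by (auto simp: topspace_Gr_top)

end

section \<open>First-order expansions along frames\<close>

definition Mat :: "nat => nat => (nat => nat => complex) set" where
 "Mat k m = {E. (\<forall>i<k. E i : cspace m) & (\<forall>i\<ge>k. E i = 0)}"

text \<open>The derivative at \<open>B\<close> in direction \<open>E\<close>, as a formula in the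
  partial derivatives; that it is the first-order term is the content of
  \<open>Gr_first_order\<close>.\<close>

definition dirD :: "nat => nat => ((nat => complex) set => complex) => (nat => nat => complex) => (nat => nat => complex) => complex" where
 "dirD k m f B E = (\<Sum>i<k. \<Sum>p\<in>{1..m}. E i p * Gr_partial k f B i p)"

definition msize :: "nat => nat => (nat => nat => complex) => real" where
 "msize k m E = (\<Sum>i<k. \<Sum>p\<in>{1..m}. cmod (E i p))"

definition mline :: "(nat => nat => complex) => complex => (nat => nat => complex) => nat => nat => complex" where
 "mline B z E = (%i p. B i p + z * E i p)"

definition affm :: "nat => (nat => nat => complex) => (nat => nat => nat => complex) => (nat => complex) => nat => nat => complex" where
 "affm c B R y = (%i p. B i p + (\<Sum>t<c. y t * R t i p))"

text \<open>The row space lies in some cell, and the projection to the right ends of the intervals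
  of that cell is injective.\<close>

lemma frame_cols:
 assumes "B : frames k m"
 obtains e where "cdet k (%i l. B i (e l)) ~= 0" "!!l. l < k ==> e l : {1..m}"
proof -
 obtain a b where s: "spans k m a b" and c: "row_space k B : spans.cell k a b"
  using cell_exists[OF row_space_in_Gr[OF assms]] .
 have "cdet k (%i l. B i (spans.colf a b 0 0 l)) ~= 0"
  using spans.proj_cell[OF s c, of 0 0] proj_inj_iff[OF assms, of "spans.colf a b 0 0"] by simp
 then show ?thesis using that[of "spans.colf a b 0 0"] spans.ci_range[OF s, of _ 0 0] by simp
qed

lemma coord_neighbourhood:
 fixes T :: "(nat => complex) set"
 assumes "open T" "(%_. 0) : T"
 obtains \<delta> where "\<delta> > 0" "!!x. (!!i. i < n ==> cmod (x i) < \<delta>) ==> (!!i. i >= n ==> x i = 0) ==> x : T"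
proof -
 obtain e where e: "e > 0" "ball (%_. 0) e <= T" using assms open_contains_ball by blast
 let ?P = "{x :: nat => complex. \<forall>i\<ge>n. x i = 0}"
 show ?thesis
 proof (rule continuous_on_coordinates_bound[of ?P "%x. x" "%_. 0" e n])
  show "continuous_on ?P (%x. x)" by (rule continuous_on_id)
  fix d assume d: "0 < d" "!!y. y : ?P ==> (!!i. i < n ==> dist (y i) 0 < d) ==> dist y (%_. 0) < e"
  show ?thesis
  proof (rule that[OF d(1)])
   fix x :: "nat => complex" assume x: "!!i. i < n ==> cmod (x i) < d" "!!i. i >= n ==> x i = 0"
   have "dist x (%_. 0) < e" by (rule d(2)) (use x in auto)
   then show "x : T" using e(2) by (auto simp: dist_commute)
  qed
 qed (use e in auto)
qed

context
 fixes k m :: nat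
begin

abbreviation (input) idx :: "nat => nat => nat" where "idx i p \<equiv> i * m + (p - 1)"

text \<open>The \<open>k * m\<close> entries are flattened to one list of variables, the form that
  \<open>osgood\<close> handles; columns start at 1.\<close>

definition pert :: "(nat => nat => complex) => (nat => complex) => nat => nat => complex" where
 "pert B x = (%i p. B i p + (if i < k & p : {1..m} then x (idx i p) else 0))"

lemma idx_lt: "i < k ==> p : {1..m} ==> idx i p < k * m"
proof -
 assume "i < k" "p : {1..m}"
 then have "idx i p < i * m + m" by auto
 also have "... = Suc i * m" by simp
 also have "... <= k * m" using \<open>i < k\<close> by (intro mult_le_mono1) simp
 finally show ?thesis .
qed

lemma idx_inv:
 assumes "p : {1..m}" shows "idx i p div m = i" "Suc (idx i p mod m) = p"
proof -
 obtain q where q: "p = Suc q" "q < m" using assms by (cases p) auto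
 then show "idx i p div m = i" "Suc (idx i p mod m) = p" by auto
qed

lemma idx_entry: "t < k * m ==> t div m < k" "t < k * m ==> Suc (t mod m) : {1..m}" "idx (t div m) (Suc (t mod m)) = t"
proof -
 show "t div m < k" if "t < k * m" using that by (simp add: less_mult_imp_div_less)
 show "Suc (t mod m) : {1..m}" if "t < k * m"
 proof -
  have "m > 0" using that by (cases m) auto
  then show ?thesis using mod_less_divisor[of m t] by (simp add: Suc_leI)
 qed
 show "idx (t div m) (Suc (t mod m)) = t" by simp
qed

lemma sum_idx: "(\<Sum>t<k * m. F (t div m) (Suc (t mod m))) = (\<Sum>i<k. \<Sum>p\<in>{1..m}. F i p :: 'b :: comm_monoid_add)"
proof -
 have "bij_betw (%t. (t div m, Suc (t mod m))) {..<k * m} ({..<k} \<times> {1..m})"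
  by (rule bij_betw_byWitness[where f' = "%(i, p). idx i p"]) (use idx_entry idx_lt idx_inv in \<open>auto simp del: One_nat_def\<close>)
 from sum.reindex_bij_betw[OF this, of "%(i, p). F i p"]
 show ?thesis by (simp add: sum.cartesian_product)
qed

lemma pert_upd:
 assumes t: "t < k * m"
 shows "pert B (x(t := z)) = (pert B x)(t div m := (pert B x (t div m))(Suc (t mod m) := B (t div m) (Suc (t mod m)) + z))"
proof (intro ext)
 fix i p
 have "i < k & p : {1..m} & idx i p = t \<longleftrightarrow> i = t div m & p = Suc (t mod m)"
  using idx_inv[of p i] idx_entry(1,2)[OF t] idx_entry(3)[of t] by metis
 note iff = this
 show "pert B (x(t := z)) i p = ((pert B x)(t div m := (pert B x (t div m))(Suc (t mod m) := B (t div m) (Suc (t mod m)) + z))) i p"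
 proof (cases "i = t div m & p = Suc (t mod m)")
  case True
  then have h: "i < k" "p : {1..m}" "idx i p = t" using iff by auto
  have "pert B (x(t := z)) i p = B i p + z" unfolding pert_def using h by simp
  then show ?thesis using True by simp
 next
  case False
  then have "pert B (x(t := z)) i p = pert B x i p" unfolding pert_def using iff by auto
  then show ?thesis using False by auto
 qed
qed

lemma pert_Mat:
 assumes "E : Mat k m"
 shows "pert B (%t. if t < k * m then E (t div m) (Suc (t mod m)) else 0) = mline B 1 E"
proof (intro ext)
 fix i p
 show "pert B (%t. if t < k * m then E (t div m) (Suc (t mod m)) else 0) i p = mline B 1 E i p"
 proof (cases "i < k & p : {1..m}")
  case True
  then show ?thesis using idx_lt[of i p] idx_inv[of p i] by (simp only: pert_def mline_def) simp
 next
  case False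
  then have "E i p = 0" using assms unfolding Mat_def cspace_def by (cases "i < k") auto
  then show ?thesis using False by (auto simp: pert_def mline_def)
 qed
qed

lemma continuous_on_pert: "continuous_on S (pert B)"
proof -
 have c: "continuous_on S (%x :: nat => complex. x j)" for j
  by (rule continuous_on_subset[OF continuous_on_product_coordinates]) auto
 have "continuous_on S (%x. pert B x i p)" for i p
  by (cases "i < k & p : {1..m}") (auto simp: pert_def intro!: continuous_intros c)
 then show ?thesis by (intro continuous_on_coordinatewise_then_product)
qed

lemma pert_frames_shape:
 assumes "B : frames k m"
 shows "i < k ==> pert B x i : cspace m" "i >= k ==> pert B x i = 0"
 using assms unfolding frames_iff cspace_def pert_def by (auto simp: fun_eq_iff)

lemma frames_neighbourhood:
 assumes B: "B : frames k m" and U: "openin (Gr_top k m) U" "row_space k B : U"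
 obtains \<delta> where "\<delta> > 0" "!!x. (!!t. t < k * m ==> cmod (x t) < \<delta>) ==> (!!t. t >= k * m ==> x t = 0) ==>
  pert B x : frames k m & row_space k (pert B x) : U"
proof -
 obtain e where e: "cdet k (%i l. B i (e l)) ~= 0" using frame_cols[OF B] .
 obtain T where T: "open T" "{A : frames k m. row_space k A : U} = frames k m Int T"
  using U unfolding openin_Gr_top openin_open by blast
 let ?d = "%x. cdet k (%i l. pert B x i (e l))"
 have "continuous_on UNIV ?d"
 proof (rule continuous_on_cdet)
  fix i j show "continuous_on UNIV (%x. pert B x i (e j))"
   by (rule continuous_on_compose2[OF continuous_on_entry[of UNIV i "e j"] continuous_on_pert]) auto
 qed
 then have o1: "open (?d -` (-{0}))" by (intro open_vimage) auto
 have o2: "open (pert B -` T)" by (intro open_vimage continuous_on_pert T)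
 have B0: "pert B (%_. 0) = B" by (auto simp: pert_def fun_eq_iff)
 have "(%_. 0) : ?d -` (-{0}) Int pert B -` T" using e B U(2) T(2) B0 by auto
 then obtain \<delta> where d: "\<delta> > 0" "!!x. (!!i. i < k * m ==> cmod (x i) < \<delta>) ==> (!!i. i >= k * m ==> x i = 0) ==> x : ?d -` (-{0}) Int pert B -` T"
  using coord_neighbourhood[OF open_Int[OF o1 o2], of "k * m"] by blast
 show ?thesis
 proof (rule that[OF d(1)])
  fix x :: "nat => complex" assume "!!t. t < k * m ==> cmod (x t) < \<delta>" "!!t. t >= k * m ==> x t = 0"
  then have x: "?d x ~= 0" "pert B x : T" using d(2)[of x] by auto
  have "pert B x : frames k m"
   by (rule frame_of_cdet[where e = e]) (use pert_frames_shape[OF B] x in auto)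
  then show "pert B x : frames k m & row_space k (pert B x) : U" using T(2) x(2) by blast
 qed
qed

text \<open>\<open>osgood\<close> for \<open>f\<close> as a function of the perturbation
  \<open>x\<close>, on a closed polydisc of half the admissible radius.\<close>

lemma Gr_first_order:
 assumes f: "Gr_holomorphic_on k m f U" and B: "B : frames k m" and U: "openin (Gr_top k m) U" "row_space k B : U" and e: "e > 0"
 obtains \<delta> where "\<delta> > 0" "!!E. E : Mat k m ==> msize k m E < \<delta> ==>
  mline B 1 E : frames k m & row_space k (mline B 1 E) : U &
  cmod (f (row_space k (mline B 1 E)) - f (row_space k B) - dirD k m f B E) <= e * msize k m E"
proof -
 obtain \<delta> where d: "\<delta> > 0" "!!x. (!!t. t < k * m ==> cmod (x t) < \<delta>) ==> (!!t. t >= k * m ==> x t = 0) ==>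
  pert B x : frames k m & row_space k (pert B x) : U"
  using frames_neighbourhood[OF B U] by blast
 let ?\<rho> = "\<delta> / 2" and ?n = "k * m" and ?P = "{A : frames k m. row_space k A : U}"
 define g where "g = (%x. f (row_space k (pert B x)))"
 have inP: "pert B x : ?P" if "x : polydisc ?n ?\<rho>" for x
 proof -
  have "cmod (x t) < \<delta>" if "t < ?n" for t
  proof -
   have "cmod (x t) <= \<delta> / 2" using \<open>x \<in> polydisc ?n ?\<rho>\<close> that by (simp add: polydisc_def)
   then show ?thesis using d(1) by simp
  qed
  then show ?thesis using d(2)[of x] that by (auto simp: polydisc_def)
 qed
 have fc: "continuous_on ?P (%A. f (row_space k A))"
  and fd: "!!A i j. A : ?P ==> i < k ==> j : {1..m} ==> entry_slice (f \<circ> row_space k) A i j field_differentiable at (A i j)"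
  using f unfolding Gr_holomorphic_on_def o_def by auto
 have gc: "continuous_on (polydisc ?n ?\<rho>) g"
  unfolding g_def by (rule continuous_on_compose2[OF fc continuous_on_pert]) (use inP in blast)
 have slice: "(%z. g (x(t := z))) = (%z. entry_slice (f \<circ> row_space k) (pert B x) (t div m) (Suc (t mod m)) (z + B (t div m) (Suc (t mod m))))"
  if "t < ?n" for x t
  unfolding g_def entry_slice_def pert_upd[OF that] by (simp add: add.commute)
 have pe: "pert B x (t div m) (Suc (t mod m)) = x t + B (t div m) (Suc (t mod m))" if "t < ?n" for x t
  using idx_entry(1,2)[OF that] unfolding pert_def idx_entry(3) by auto
 have sep: "(%z. g (x(i := z))) field_differentiable at (x i)" if x: "x : polydisc ?n ?\<rho>" and i: "i < ?n" and "cmod (x i) < ?\<rho>" for x i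
  using fd[OF inP[OF x] idx_entry(1,2)[OF i]] unfolding slice[OF i] pe[OF i] field_differentiable_def DERIV_shift .
 have P0: "pert B (%_. 0) = B" by (auto simp: pert_def fun_eq_iff)
 have z0: "(%_. 0) : polydisc ?n ?\<rho>" using d(1) by (auto simp: polydisc_def)
 have dg: "deriv (%z. g ((%_. 0)(t := z))) 0 = Gr_partial k f B (t div m) (Suc (t mod m))" if t: "t < ?n" for t
 proof -
  let ?h = "entry_slice (f \<circ> row_space k) B (t div m) (Suc (t mod m))" and ?c = "B (t div m) (Suc (t mod m))"
  have "?h field_differentiable at ?c"
   using fd[OF _ idx_entry(1,2)[OF t], of B] B U(2) by auto
  then have "(?h has_field_derivative deriv ?h ?c) (at (0 + ?c))" by (simp add: DERIV_deriv_iff_field_differentiable)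
  then have "((%z. ?h (z + ?c)) has_field_derivative deriv ?h ?c) (at 0)" unfolding DERIV_shift .
  then show ?thesis unfolding slice[OF t] P0 Gr_partial_def by (rule DERIV_imp_deriv)
 qed
 obtain d' where d': "d' > 0" "d' <= ?\<rho>" "!!x. x : polydisc ?n ?\<rho> ==> (!!j. j < ?n ==> cmod (x j) < d') ==>
  cmod (g x - g (%_. 0) - (\<Sum>i<?n. x i * deriv (%z. g ((%_. 0)(i := z))) 0)) <= e * (\<Sum>i<?n. cmod (x i))"
 proof (rule osgood[OF gc _ sep e])
  show "?\<rho> > 0" using d(1) by simp
  fix d' assume h: "0 < d'" "d' <= ?\<rho>" "!!x. x : polydisc ?n ?\<rho> ==> (!!j. j < ?n ==> cmod (x j) < d') ==>
  cmod (g x - g (%_. 0) - (\<Sum>i<?n. x i * deriv (%z. g ((%_. 0)(i := z))) 0)) <= e * (\<Sum>i<?n. cmod (x i))"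
  show thesis by (rule that[OF h])
 qed
 show ?thesis
 proof (rule that[OF d'(1)])
  fix E assume E: "E : Mat k m" and sm: "msize k m E < d'"
  let ?x = "%t. if t < ?n then E (t div m) (Suc (t mod m)) else 0"
  have le: "cmod (E i p) <= msize k m E" if "i < k" "p : {1..m}" for i p
  proof -
   have "cmod (E i p) <= (\<Sum>p\<in>{1..m}. cmod (E i p))" by (rule member_le_sum) (use that in auto)
   also have "... <= msize k m E" unfolding msize_def
    by (rule member_le_sum[where f = "%i. \<Sum>p\<in>{1..m}. cmod (E i p)"]) (use that in \<open>auto intro: sum_nonneg\<close>)
   finally show ?thesis .
  qed
  have xs: "cmod (?x t) < d'" if "t < ?n" for t using le[OF idx_entry(1,2)[OF that]] sm that by simp
  have xl: "cmod (?x t) <= ?\<rho>" if "t < ?n" for t using xs[OF that] d'(2) by linarith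
  have xP: "?x : polydisc ?n ?\<rho>" unfolding polydisc_def mem_Collect_eq using xl by (intro conjI allI impI) (blast, simp)
  have px: "pert B ?x = mline B 1 E" by (rule pert_Mat[OF E])
  have s1: "(\<Sum>i<?n. ?x i * deriv (%z. g ((%_. 0)(i := z))) 0) = dirD k m f B E"
   unfolding dirD_def sum_idx[symmetric] by (intro sum.cong refl) (simp add: dg)
  have s2: "(\<Sum>i<?n. cmod (?x i)) = msize k m E"
   unfolding msize_def sum_idx[symmetric] by (intro sum.cong refl) simp
  have "cmod (g ?x - g (%_. 0) - dirD k m f B E) <= e * msize k m E"
   using d'(3)[OF xP xs] unfolding s1 s2 .
  then show "mline B 1 E : frames k m & row_space k (mline B 1 E) : U &
    cmod (f (row_space k (mline B 1 E)) - f (row_space k B) - dirD k m f B E) <= e * msize k m E"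
   using inP[OF xP] unfolding g_def px P0 by auto
 qed
qed

end

lemma msize_nonneg: "msize k m E >= 0"
 unfolding msize_def by (intro sum_nonneg) auto

lemma msize_scale: "msize k m (%i p. z * E i p) = cmod z * msize k m E"
 by (simp add: msize_def norm_mult sum_distrib_left)

lemma dirD_scale: "dirD k m f B (%i p. z * E i p) = z * dirD k m f B E"
 by (simp add: dirD_def sum_distrib_left mult.assoc)

lemma Mat_scale: "E : Mat k m ==> (%i p. z * E i p) : Mat k m"
 by (auto simp: Mat_def cspace_def fun_eq_iff)

lemma mline_scale: "mline B 1 (%i p. z * E i p) = mline B z E"
 by (simp add: mline_def)

text \<open>The first-order expansion is known to exist, so the values along one real ray, from one
  side, determine the derivative.\<close>

lemma dirD_eqI:
 assumes f: "Gr_holomorphic_on k m f U" and B: "B : frames k m" and U: "openin (Gr_top k m) U" "row_space k B : U"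
  and E: "E : Mat k m" and \<eta>: "\<eta> > 0"
  and h: "!!z :: real. [|0 < z; z < \<eta>; mline B (of_real z) E : frames k m; row_space k (mline B (of_real z) E) : U|] ==>
    f (row_space k (mline B (of_real z) E)) = f (row_space k B) + of_real z * d"
 shows "dirD k m f B E = d"
proof (rule ccontr)
 assume ne: "dirD k m f B E ~= d"
 define K where "K = msize k m E + 1"
 let ?K = K and ?a = "cmod (d - dirD k m f B E)"
 have K: "?K > 0" using msize_nonneg[of k m E] unfolding K_def by linarith
 have a: "?a > 0" using ne by simp
 define e where "e = ?a / (2 * ?K)"
 have e: "e > 0" using a K by (simp add: e_def)
 obtain \<delta> where d: "\<delta> > 0" "!!E. E : Mat k m ==> msize k m E < \<delta> ==>
  mline B 1 E : frames k m & row_space k (mline B 1 E) : U &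
  cmod (f (row_space k (mline B 1 E)) - f (row_space k B) - dirD k m f B E) <= e * msize k m E"
  using Gr_first_order[OF f B U e] by blast
 define z where "z = min (\<eta> / 2) (\<delta> / (2 * ?K))"
 have "\<delta> / (2 * ?K) > 0" using d(1) K by simp
 then have z: "0 < z" "z < \<eta>" using \<eta> by (auto simp: z_def)
 let ?E = "%i p. of_real z * E i p"
 have "z * msize k m E <= z * ?K" using z by (intro mult_left_mono) (auto simp: K_def)
 also have "... <= \<delta> / (2 * ?K) * ?K" using K by (intro mult_right_mono) (auto simp: z_def)
 also have "... < \<delta>" using K d(1) by (simp add: field_simps)
 finally have "msize k m ?E < \<delta>" using z by (simp add: msize_scale)
 from d(2)[OF Mat_scale[OF E] this] have r: "mline B (of_real z) E : frames k m" "row_space k (mline B (of_real z) E) : U"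
  "cmod (f (row_space k (mline B (of_real z) E)) - f (row_space k B) - of_real z * dirD k m f B E) <= e * (z * msize k m E)"
  unfolding mline_scale dirD_scale msize_scale using z by auto
 have "f (row_space k (mline B (of_real z) E)) - f (row_space k B) - of_real z * dirD k m f B E = of_real z * (d - dirD k m f B E)"
  using h[OF z r(1,2)] by (simp add: algebra_simps)
 then have "z * ?a <= e * (z * msize k m E)" using r(3) z by (simp add: norm_mult)
 then have "?a <= e * msize k m E" using z by (simp add: mult.left_commute)
 also have "... <= e * ?K" using e by (intro mult_left_mono) (auto simp: K_def)
 also have "... = ?a / 2" using K by (simp add: e_def)
 finally show False using a by simp
qed

lemma affm_eq: "affm c B R y = mline B 1 (%i p. \<Sum>t<c. y t * R t i p)"
 by (simp add: affm_def mline_def)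

lemma sum_swap3: "(\<Sum>i\<in>A. \<Sum>p\<in>B. \<Sum>t\<in>C. f i p t) = (\<Sum>t\<in>C. \<Sum>i\<in>A. \<Sum>p\<in>B. f i p t :: 'a :: comm_monoid_add)"
proof -
 have "(\<Sum>i\<in>A. \<Sum>p\<in>B. \<Sum>t\<in>C. f i p t) = (\<Sum>i\<in>A. \<Sum>t\<in>C. \<Sum>p\<in>B. f i p t)"
  by (intro sum.cong refl) (rule sum.swap)
 also have "... = (\<Sum>t\<in>C. \<Sum>i\<in>A. \<Sum>p\<in>B. f i p t)" by (rule sum.swap)
 finally show ?thesis .
qed

lemma cmod_ylin:
 assumes x: "x : stdx (2 * c)" and t: "t < c" and r: "r > 0"
 shows "cmod (ylin r x t) <= 2 * r"
proof -
 have b: "0 <= x i & x i <= 1" for i using x unfolding standard_simplex_def by auto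
 have "cmod (Complex (x (2 * t + 1) - x 0) (x (2 * t + 2) - x 0)) <= \<bar>x (2 * t + 1) - x 0\<bar> + \<bar>x (2 * t + 2) - x 0\<bar>"
  using cmod_le[of "Complex (x (2 * t + 1) - x 0) (x (2 * t + 2) - x 0)"] by simp
 also have "... <= 2" using b[of 0] b[of "2 * t + 1"] b[of "2 * t + 2"] by linarith
 finally have "r * cmod (Complex (x (2 * t + 1) - x 0) (x (2 * t + 2) - x 0)) <= r * 2" using r by (intro mult_left_mono) auto
 then show ?thesis using r by (simp add: ylin_def norm_mult)
qed

text \<open>On a small affine simplex the equations agree with their linear part up to an error
  proportional to the argument, with as small a factor as desired, so
  \<open>degree_perturbed\<close> applies.\<close>

theorem normal_degree:
 assumes U: "openin (Gr_top k m) U" and f: "!!s. s < c ==> Gr_holomorphic_on k m (f s) U"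
  and B: "B : frames k m" "row_space k B : U" and f0: "!!s. s < c ==> f s (row_space k B) = 0"
  and R: "!!t. t < c ==> R t : Mat k m" and D: "linj c (%s t. dirD k m (f s) B (R t))"
 obtains \<delta> where "\<delta> > 0"
  "!!r x. [|0 < r; r < \<delta>; x : stdx (2 * c)|] ==> affm c B R (ylin r x) : frames k m"
  "!!r. [|0 < r; r < \<delta>|] ==>
   ssimp (2 * c) (sub (Gr_top k m) U) (\<lambda>x\<in>stdx (2 * c). row_space k (affm c B R (ylin r x)))"
  "!!r x j. [|0 < r; r < \<delta>; x : stdx (2 * c); j <= 2 * c; x j = 0|] ==> \<exists>s<c. f s (row_space k (affm c B R (ylin r x))) ~= 0"
  "!!r. [|0 < r; r < \<delta>|] ==>
   hdeg (2 * c) (frag_of (\<lambda>x\<in>stdx (2 * c). c2r c (%s. f s (row_space k (affm c B R (ylin r x)))))) = 1"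
proof -
 let ?\<Delta> = "stdx (2 * c)" and ?D = "%s t. dirD k m (f s) B (R t)"
 let ?P = "{A : frames k m. row_space k A : U}"
 obtain \<mu>1 where \<mu>1: "\<mu>1 > 0"
  "!!r f. [|r > 0; !!s. s < c ==> continuous_on ?\<Delta> (%x. f x s);
    !!x. x : ?\<Delta> ==>
     (\<Sum>s<c. cmod (f x s - lmap c ?D (ylin r x) s)) <= \<mu>1 * (\<Sum>t<c. cmod (ylin r x t))|] ==>
   relcycle (2 * c) (Euc (2 * c)) (-{0}) (frag_of (\<lambda>x\<in>?\<Delta>. c2r c (f x))) &
   hdeg (2 * c) (frag_of (\<lambda>x\<in>?\<Delta>. c2r c (f x))) = 1"
 proof (rule degree_perturbed[OF D])
  fix \<mu>1 :: real assume m: "0 < \<mu>1" "!!r f. [|r > 0; !!s. s < c ==> continuous_on ?\<Delta> (%x. f x s);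
    !!x. x : ?\<Delta> ==>
     (\<Sum>s<c. cmod (f x s - lmap c ?D (ylin r x) s)) <= \<mu>1 * (\<Sum>t<c. cmod (ylin r x t))|] ==>
   relcycle (2 * c) (Euc (2 * c)) (-{0}) (frag_of (\<lambda>x\<in>?\<Delta>. c2r c (f x))) &
   hdeg (2 * c) (frag_of (\<lambda>x\<in>?\<Delta>. c2r c (f x))) = 1"
  show thesis by (rule that[OF m])
 qed
 obtain \<mu>2 where \<mu>2: "\<mu>2 > 0" "!!y. (\<Sum>s<c. cmod (lmap c ?D y s)) >= \<mu>2 * (\<Sum>t<c. cmod (y t))"
  using linj_bound[OF D] by blast
 \<comment> \<open>\<open>\<mu>1\<close> is the tolerance for the degree; half of
   \<open>\<mu>2\<close> keeps the equations away from 0 on the boundary.\<close>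
 define \<mu> where "\<mu> = min \<mu>1 (\<mu>2 / 2)"
 have \<mu>: "\<mu> > 0" "\<mu> <= \<mu>1" "\<mu> <= \<mu>2 / 2" using \<mu>1 \<mu>2 by (auto simp: \<mu>_def)
 define K where "K = 1 + (\<Sum>t<c. msize k m (R t))"
 have sR: "msize k m (R t) <= K" if "t < c" for t
  using member_le_sum[of t "{..<c}" "%t. msize k m (R t)"] that msize_nonneg by (auto simp: K_def)
 have K: "K > 0" unfolding K_def by (intro add_pos_nonneg sum_nonneg msize_nonneg) auto
 define e where "e = \<mu> / (K * (real c + 1))"
 have e: "e > 0" using \<mu> K by (simp add: e_def)
 have "\<exists>\<delta>>0. \<forall>E. E : Mat k m --> msize k m E < \<delta> -->
  mline B 1 E : frames k m & row_space k (mline B 1 E) : U &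
  cmod (f s (row_space k (mline B 1 E)) - f s (row_space k B) - dirD k m (f s) B E) <= e * msize k m E" if s: "s < c" for s
 proof (rule Gr_first_order[OF f[OF s] B(1) U B(2) e])
  fix \<delta> assume "0 < \<delta>" "!!E. E : Mat k m ==> msize k m E < \<delta> ==>
  mline B 1 E : frames k m & row_space k (mline B 1 E) : U &
  cmod (f s (row_space k (mline B 1 E)) - f s (row_space k B) - dirD k m (f s) B E) <= e * msize k m E"
  then show ?thesis by (intro exI[of _ \<delta>]) simp
 qed
 then obtain \<Delta> where \<Delta>: "!!s. s < c ==> \<Delta> s > 0" "!!s E. [|s < c; E : Mat k m; msize k m E < \<Delta> s|] ==>
  mline B 1 E : frames k m & row_space k (mline B 1 E) : U &
  cmod (f s (row_space k (mline B 1 E)) - f s (row_space k B) - dirD k m (f s) B E) <= e * msize k m E"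
  by metis
 \<comment> \<open>The zero function supplies a radius for staying in \<open>U\<close> that is
   available for \<open>c = 0\<close>, too.\<close>
 have h0: "Gr_holomorphic_on k m (%_. 0) U"
  unfolding Gr_holomorphic_on_def entry_slice_def o_def by auto
 obtain \<delta>0 where \<delta>0: "\<delta>0 > 0" "!!E. E : Mat k m ==> msize k m E < \<delta>0 ==>
  mline B 1 E : frames k m & row_space k (mline B 1 E) : U"
 proof (rule Gr_first_order[OF h0 B(1) U B(2) e])
  fix \<delta> assume d: "0 < \<delta>" "!!E. E : Mat k m ==> msize k m E < \<delta> ==>
  mline B 1 E : frames k m & row_space k (mline B 1 E) : U &
  cmod (0 - 0 - dirD k m (%_. 0) B E) <= e * msize k m E"
  show thesis by (rule that[OF d(1)]) (use d(2) in simp)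
 qed
 define \<delta>1 where "\<delta>1 = Min (insert \<delta>0 (\<Delta> ` {..<c}))"
 have \<delta>1: "\<delta>1 > 0" "\<delta>1 <= \<delta>0" "!!s. s < c ==> \<delta>1 <= \<Delta> s" using \<Delta>(1) \<delta>0 by (auto simp: \<delta>1_def)
 \<comment> \<open>Each of the \<open>c\<close> values of \<open>ylin\<close> has absolute value at
   most \<open>2 * r\<close>; \<open>real c + 1\<close> avoids division by 0.\<close>
 define \<delta> where "\<delta> = \<delta>1 / (K * (2 * (real c + 1)))"
 have \<delta>: "\<delta> > 0" using \<delta>1 K by (simp add: \<delta>_def)
 let ?E = "%r x i p. \<Sum>t<c. ylin r x t * R t i p"
 have EM: "?E r x : Mat k m" for r x
  using R unfolding Mat_def cspace_def by (auto simp: fun_eq_iff)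
 have Ey: "msize k m (?E r x) <= K * (\<Sum>t<c. cmod (ylin r x t))" for r x
 proof -
  have "msize k m (?E r x) <= (\<Sum>i<k. \<Sum>p\<in>{1..m}. \<Sum>t<c. cmod (ylin r x t) * cmod (R t i p))"
   unfolding msize_def by (intro sum_mono order_trans[OF norm_sum]) (simp add: norm_mult)
  also have "... = (\<Sum>t<c. cmod (ylin r x t) * msize k m (R t))"
   unfolding msize_def sum_distrib_left by (rule sum_swap3)
  also have "... <= (\<Sum>t<c. cmod (ylin r x t) * K)" using sR by (intro sum_mono mult_left_mono) auto
  finally show ?thesis by (simp add: sum_distrib_left mult.commute)
 qed
 have small: "msize k m (?E r x) < \<delta>1" if r: "0 < r" "r < \<delta>" and x: "x : ?\<Delta>" for r x
 proof -
  have "(\<Sum>t<c. cmod (ylin r x t)) <= (\<Sum>t<c. 2 * r)" by (intro sum_mono) (use cmod_ylin[OF x _ r(1)] in auto)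
  also have "... <= 2 * (real c + 1) * r" using r by (simp add: algebra_simps)
  finally have "K * (\<Sum>t<c. cmod (ylin r x t)) <= K * (2 * (real c + 1) * r)" using K by (intro mult_left_mono) auto
  also have "... = K * (2 * (real c + 1)) * r" by simp
  also have "... < K * (2 * (real c + 1)) * \<delta>" using r K by (intro mult_strict_left_mono) auto
  also have "... = \<delta>1" using K by (simp add: \<delta>_def)
  finally show ?thesis using Ey[of r x] by linarith
 qed
 have inP: "affm c B R (ylin r x) : ?P" if "0 < r" "r < \<delta>" "x : ?\<Delta>" for r x
  using \<delta>0(2)[OF EM] small[OF that] \<delta>1(2) unfolding affm_eq by fastforce
 have est: "(\<Sum>s<c. cmod (f s (row_space k (affm c B R (ylin r x))) - lmap c ?D (ylin r x) s)) <= \<mu> * (\<Sum>t<c. cmod (ylin r x t))"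
  if r: "0 < r" "r < \<delta>" and x: "x : ?\<Delta>" for r x
 proof -
  let ?Y = "\<Sum>t<c. cmod (ylin r x t)"
  have dl: "dirD k m (f s) B (?E r x) = lmap c ?D (ylin r x) s" for s
  proof -
   have "dirD k m (f s) B (?E r x) = (\<Sum>i<k. \<Sum>p\<in>{1..m}. \<Sum>t<c. ylin r x t * (R t i p * Gr_partial k (f s) B i p))"
    unfolding dirD_def by (simp add: sum_distrib_right mult.assoc)
   also have "... = (\<Sum>t<c. \<Sum>i<k. \<Sum>p\<in>{1..m}. ylin r x t * (R t i p * Gr_partial k (f s) B i p))"
    by (rule sum_swap3)
   also have "... = lmap c ?D (ylin r x) s" unfolding lmap_def dirD_def by (simp add: sum_distrib_left mult.commute)
   finally show ?thesis .
  qed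
  have "cmod (f s (row_space k (affm c B R (ylin r x))) - lmap c ?D (ylin r x) s) <= e * (K * ?Y)" if s: "s < c" for s
  proof -
   have "cmod (f s (row_space k (affm c B R (ylin r x))) - f s (row_space k B) - dirD k m (f s) B (?E r x)) <= e * msize k m (?E r x)"
    using \<Delta>(2)[OF s EM] small[OF r x] \<delta>1(3)[OF s] unfolding affm_eq by fastforce
   also have "... <= e * (K * ?Y)" using Ey e by (intro mult_left_mono) auto
   finally show ?thesis using f0[OF s] unfolding dl by simp
  qed
  then have "(\<Sum>s<c. cmod (f s (row_space k (affm c B R (ylin r x))) - lmap c ?D (ylin r x) s)) <= (\<Sum>s<c. e * (K * ?Y))"
   by (intro sum_mono) auto
  also have "... = real c * ((e * K) * ?Y)" by simp
  also have "e * K = \<mu> / (real c + 1)" using K by (simp add: e_def)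
  also have "real c * (\<mu> / (real c + 1) * ?Y) = (real c / (real c + 1)) * (\<mu> * ?Y)" by simp
  also have "... <= 1 * (\<mu> * ?Y)" using \<mu> by (intro mult_right_mono mult_nonneg_nonneg sum_nonneg) auto
  finally show ?thesis by simp
 qed
 have ac: "continuous_on ?\<Delta> (%x. affm c B R (ylin r x))" for r
  unfolding affm_def by (intro continuous_on_coordinatewise_then_product continuous_intros continuous_on_ylin)
 show ?thesis
 proof (rule that[OF \<delta>])
  show "affm c B R (ylin r x) : frames k m" if "0 < r" "r < \<delta>" "x : ?\<Delta>" for r x using inP[OF that] by simp
  show "ssimp (2 * c) (sub (Gr_top k m) U) (\<lambda>x\<in>?\<Delta>. row_space k (affm c B R (ylin r x)))" if r: "0 < r" "r < \<delta>" for r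
  proof -
   have "continuous_map (top_of_set ?\<Delta>) (top_of_set (frames k m)) (%x. affm c B R (ylin r x))"
    using ac inP[OF r] by (auto simp: continuous_map_in_subtopology)
   from continuous_map_compose[OF this row_space_continuous]
   have "continuous_map (top_of_set ?\<Delta>) (sub (Gr_top k m) U) (%x. row_space k (affm c B R (ylin r x)))"
    using inP[OF r] by (auto simp: continuous_map_in_subtopology o_def)
   then have "continuous_map (top_of_set ?\<Delta>) (sub (Gr_top k m) U) (\<lambda>x\<in>?\<Delta>. row_space k (affm c B R (ylin r x)))"
    by (rule continuous_map_eq) auto
   then show ?thesis unfolding singular_simplex_def powertop_real_eq by simp
  qed
  show "\<exists>s<c. f s (row_space k (affm c B R (ylin r x))) ~= 0" if r: "0 < r" "r < \<delta>" and x: "x : ?\<Delta>" "j <= 2 * c" "x j = 0" for r x j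
  proof (rule ccontr)
   assume n: "~ ?thesis"
   let ?Y = "\<Sum>t<c. cmod (ylin r x t)"
   have "(\<Sum>s<c. cmod (lmap c ?D (ylin r x) s)) = (\<Sum>s<c. cmod (f s (row_space k (affm c B R (ylin r x))) - lmap c ?D (ylin r x) s))"
    by (intro sum.cong refl) (use n in auto)
   also have "... <= \<mu> * ?Y" by (rule est[OF r x(1)])
   finally have "\<mu>2 * ?Y <= \<mu> * ?Y" using \<mu>2(2)[of "ylin r x"] by linarith
   moreover have "?Y > 0"
   proof -
    obtain s where "s < c" "ylin r x s ~= 0" using ylin_boundary_nonzero[OF x r(1)] by blast
    then show ?thesis by (intro sum_pos2[of _ s]) auto
   qed
   ultimately show False using \<mu> \<mu>2(1) by simp
  qed
  show "hdeg (2 * c) (frag_of (\<lambda>x\<in>?\<Delta>. c2r c (%s. f s (row_space k (affm c B R (ylin r x)))))) = 1" if r: "0 < r" "r < \<delta>" for r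
  proof (rule conjunct2[OF \<mu>1(2)[OF r(1)]])
   show "continuous_on ?\<Delta> (%x. f s (row_space k (affm c B R (ylin r x))))" if s: "s < c" for s
   proof -
    have "continuous_on ?P (%A. f s (row_space k A))" using f[OF s] unfolding Gr_holomorphic_on_def o_def by blast
    then show ?thesis by (rule continuous_on_compose2[OF _ ac]) (use inP[OF r] in blast)
   qed
   fix x assume x: "x : ?\<Delta>"
   have "\<mu> * (\<Sum>t<c. cmod (ylin r x t)) <= \<mu>1 * (\<Sum>t<c. cmod (ylin r x t))" using \<mu> by (intro mult_right_mono sum_nonneg) auto
   then show "(\<Sum>s<c. cmod (f s (row_space k (affm c B R (ylin r x))) - lmap c ?D (ylin r x) s)) <= \<mu>1 * (\<Sum>t<c. cmod (ylin r x t))"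
    using est[OF r x] by linarith
  qed
 qed
qed

section \<open>Derivatives of local equations at points of the cell\<close>

lemma cdet_transpose: "cdet k (%i j. T j i) = cdet k T"
proof -
 have "cmat k (%i j. T j i) = transpose_mat (cmat k T)" by (rule eq_matI) (auto simp: cmat_def)
 then show ?thesis unfolding cdet_def using det_transpose[OF cmat_carrier] by metis
qed

lemma linj_left_kernel:
 assumes "!!g. (!!t. t < c ==> (\<Sum>s<c. g s * D s t) = 0) ==> (!!s. s < c ==> g s = 0)"
 shows "linj c D"
 unfolding linj_iff_cdet cdet_transpose[of c D] cdet_nonzero_iff using assms by blast

definition rowm :: "nat => (nat => complex) => nat => nat => complex" where
 "rowm i w = (%i'. if i' = i then w else 0)"

lemma rowm_Mat: "i < k ==> w : cspace m ==> rowm i w : Mat k m"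
 by (auto simp: rowm_def Mat_def cspace_def)

lemma dirD_rowm: "i < k ==> dirD k m f B (rowm i w) = (\<Sum>p\<in>{1..m}. w p * Gr_partial k f B i p)"
proof -
 assume i: "i < k"
 have "dirD k m f B (rowm i w) = (\<Sum>i'<k. if i' = i then (\<Sum>p\<in>{1..m}. w p * Gr_partial k f B i p) else 0)"
  unfolding dirD_def rowm_def by (intro sum.cong refl) auto
 then show ?thesis using i by simp
qed

lemma unit_vec_cspace: "p : {1..m} ==> uvec p : cspace m"
 by (auto simp: Defs.unit_vec_def cspace_def)

lemma dirD_unit: "i < k ==> p : {1..m} ==> dirD k m f B (rowm i (uvec p)) = Gr_partial k f B i p"
proof -
 assume i: "i < k" and p: "p : {1..m}"
 have "(\<Sum>p'\<in>{1..m}. uvec p p' * Gr_partial k f B i p') = (\<Sum>p'\<in>{1..m}. if p' = p then Gr_partial k f B i p else 0)"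
  by (intro sum.cong refl) (auto simp: Defs.unit_vec_def)
 then show ?thesis using dirD_rowm[OF i] p by simp
qed

text \<open>Adding a vector of the row space to a row of the frame leaves the row space
  unchanged.\<close>

lemma dirD_along_row_space:
 assumes f: "Gr_holomorphic_on k m f U" and B: "B : frames k m" and U: "openin (Gr_top k m) U" "row_space k B : U"
  and i: "i < k" and w: "w : row_space k B"
 shows "(\<Sum>p\<in>{1..m}. w p * Gr_partial k f B i p) = 0"
proof -
 have V: "row_space k B : Gr k m" by (rule row_space_in_Gr[OF B])
 have "dirD k m f B (rowm i w) = 0"
 proof (rule dirD_eqI[OF f B U, where \<eta> = 1])
  show "rowm i w : Mat k m" using rowm_Mat[OF i] w GrD(2)[OF V] by blast
  fix z :: real assume fr: "mline B (of_real z) (rowm i w) : frames k m"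
  have "row_space k (mline B (of_real z) (rowm i w)) = row_space k B"
  proof (rule frame_in_subspace[OF _ _ V])
   show "findep {..<k} (mline B (of_real z) (rowm i w))" using fr by (simp add: frames_iff)
   fix i' assume i': "i' < k"
   have "mline B (of_real z) (rowm i w) i' = B i' + cscale (if i' = i then of_real z else 0) w"
    by (auto simp: mline_def rowm_def cscale_def fun_eq_iff)
   moreover have "B i' + cscale (if i' = i then of_real z else 0) w : row_space k B"
    using GrD(1)[OF V] row_in_row_space[OF i'] w by (intro cvec.subspace_add cvec.subspace_scale)
   ultimately show "mline B (of_real z) (rowm i w) i' : row_space k B" by simp
  qed
  then show "f (row_space k (mline B (of_real z) (rowm i w))) = f (row_space k B) + of_real z * 0" by simp
 qed simp
 then show ?thesis using dirD_rowm[OF i] by simp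
qed

context spans
begin

text \<open>\<open>V\<close> and the free coordinates of row \<open>i\<close> span the whole space:
  the vector \<open>usol k (ci i) l V\<close> is 1 in the column \<open>ci i l\<close> and 0 in the
  other normalising columns.\<close>

lemma functional_zero:
 assumes V: "V : Gr k m" "proj_inj k (ci i) V" and i: "i < k"
  and lam: "!!w. w : V ==> (\<Sum>p\<in>{1..m}. w p * lm p) = 0" "!!p. (i, p) : nrm ==> lm p = 0"
   "!!p. a i <= p ==> p <= b i ==> lm p = 0"
  and p: "p : {1..m}"
 shows "lm p = 0"
proof -
 have fr: "lm p = 0" if "(i, p) : free" for p
 proof (cases "p < a i | b i < p")
  case True then show ?thesis using that lam(2)[of p] by (simp add: nrm_def)
 next
  case False then show ?thesis using lam(3)[of p] by simp
 qed
 show ?thesis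
 proof (cases "(i, p) : free")
  case False
  then obtain l where l: "l < k" "p = ci i l" using p i by (auto simp: free_def)
  let ?w = "usol k (ci i) l V"
  have w: "?w : V" "!!l'. l' < k ==> ?w (ci i l') = (if l' = l then 1 else 0)" using usol_props[OF V l(1)] by auto
  have "?w p' * lm p' = (if p' = p then lm p else 0)" if p': "p' : {1..m}" for p'
  proof (cases "(i, p') : free")
   case True then show ?thesis using fr[OF True] fr[of p] by auto
  next
   case False
   then obtain l' where l': "l' < k" "p' = ci i l'" using p' i by (auto simp: free_def)
   have "p' = p \<longleftrightarrow> l' = l" using inj_on_eq_iff[OF colf_inj, of l' l] l l' by auto
   then show ?thesis using w(2)[OF l'(1)] l' by auto
  qed
  then have "(\<Sum>p'\<in>{1..m}. ?w p' * lm p') = (\<Sum>p'\<in>{1..m}. if p' = p then lm p else 0)" by (intro sum.cong) auto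
  then show ?thesis using lam(1)[OF w(1)] p by simp
 qed (rule fr)
qed

text \<open>Changing an entry inside the interval by less than the absolute values of both end
  entries keeps the row space in the cell, where \<open>f\<close> vanishes. This is the origin of
  \<open>?\<eta>\<close>.\<close>

lemma partial_in_cell:
 assumes f: "Gr_holomorphic_on k m f U" and U: "openin (Gr_top k m) U" "row_space k B : U" and B: "spanned B"
  and van: "!!V. V : cell Int U ==> f V = 0" and i: "i < k" and p: "a i <= p" "p <= b i"
 shows "Gr_partial k f B i p = 0"
proof -
 have nz: "B i (a i) ~= 0" "B i (b i) ~= 0" using B i unfolding spanned_def by auto
 have pm: "p : {1..m}" using p ab[OF i] by auto
 have cB: "row_space k B : cell" unfolding cell_def using B by blast
 let ?\<eta> = "min (cmod (B i (a i))) (cmod (B i (b i)))"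
 have "dirD k m f B (rowm i (uvec p)) = 0"
 proof (rule dirD_eqI[OF f spanned_frame[OF B] U, where \<eta> = ?\<eta>])
  show "rowm i (uvec p) : Mat k m" by (rule rowm_Mat[OF i unit_vec_cspace[OF pm]])
  show "?\<eta> > 0" using nz by simp
  fix z :: real assume z: "0 < z" "z < ?\<eta>" and inU: "row_space k (mline B (of_real z) (rowm i (uvec p))) : U"
  have ne: "B i q + of_real z ~= 0" if "z < cmod (B i q)" for q
  proof
   assume "B i q + of_real z = 0"
   then have "B i q = - of_real z" by (simp add: eq_neg_iff_add_eq_0)
   then have "cmod (B i q) = z" using z by simp
   then show False using that by simp
  qed
  have "spanned (mline B (of_real z) (rowm i (uvec p)))"
   unfolding spanned_def
  proof (intro conjI allI impI)
   fix i' assume i': "i' < k"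
   show "mline B (of_real z) (rowm i (uvec p)) i' (a i') ~= 0"
    using B i' ne[of "a i"] z unfolding spanned_def by (auto simp: mline_def rowm_def Defs.unit_vec_def)
   show "mline B (of_real z) (rowm i (uvec p)) i' (b i') ~= 0"
    using B i' ne[of "b i"] z unfolding spanned_def by (auto simp: mline_def rowm_def Defs.unit_vec_def)
   fix q assume "mline B (of_real z) (rowm i (uvec p)) i' q ~= 0"
   then have "B i' q ~= 0 | (i' = i & q = p)" by (auto simp: mline_def rowm_def Defs.unit_vec_def split: if_splits)
   then show "a i' <= q" "q <= b i'" using B i' p unfolding spanned_def by auto
  next
   fix i' assume "i' >= k"
   then show "mline B (of_real z) (rowm i (uvec p)) i' = 0"
    using B i unfolding spanned_def by (auto simp: mline_def rowm_def fun_eq_iff)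
  qed
  then have "row_space k (mline B (of_real z) (rowm i (uvec p))) : cell" unfolding cell_def by blast
  then show "f (row_space k (mline B (of_real z) (rowm i (uvec p)))) = f (row_space k B) + of_real z * 0"
   using van inU cB U(2) by simp
 qed
 then show ?thesis using dirD_unit[OF i pm] by simp
qed

abbreviation uvm :: "(nat => complex) set => nat => nat => complex" where
 "uvm V \<equiv> (%i. if i < k then uv i V else 0)"

definition ndir :: "nat => nat => nat => complex" where
 "ndir t = rowm (fst (enum t)) (uvec (snd (enum t)))"

lemma ndir_Mat: "t < cod ==> ndir t : Mat k m"
 using enum_free(2)[of t] unfolding ndir_def
 by (intro rowm_Mat unit_vec_cspace) (auto simp: nrm_def free_def)

lemma dirD_ndir: "t < cod ==> dirD k m f B (ndir t) = Gr_partial k f B (fst (enum t)) (snd (enum t))"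
 using enum_free(2)[of t] unfolding ndir_def
 by (intro dirD_unit) (auto simp: nrm_def free_def)

text \<open>A combination of the differentials vanishes along \<open>V\<close> and along the cell,
  so by \<open>functional_zero\<close> it is 0 as soon as its normal components are. The number
  \<open>c\<close> of equations is arbitrary, so that the lemma can serve to determine the
  codimension.\<close>

lemma normal_left_kernel:
 assumes f: "!!s. s < c ==> Gr_holomorphic_on k m (f s) U" and U: "openin (Gr_top k m) U" "V : U" and V: "V : cell"
  and van: "!!s V. s < c ==> V : cell Int U ==> f s V = 0"
  and ind: "!!g. (!!i p. i < k ==> p : {1..m} ==> (\<Sum>s<c. g s * Gr_partial k (f s) (uvm V) i p) = 0) ==> (!!s. s < c ==> g s = 0)"
  and g: "!!t. t < cod ==> (\<Sum>s<c. g s * dirD k m (f s) (uvm V) (ndir t)) = 0" and s: "s < c"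
 shows "g s = 0"
proof (rule ind[OF _ s])
 have G: "V : Gr k m" using V cell_Gr by blast
 have sp: "spanned (uvm V)" by (rule uv_spanned[OF V])
 have rs: "row_space k (uvm V) = V" using domn_frame(2) V cell_domn by blast
 fix i p assume i: "i < k" and p: "p : {1..m}"
 let ?l = "%p. \<Sum>s<c. g s * Gr_partial k (f s) (uvm V) i p"
 show "?l p = 0"
 proof (rule functional_zero[OF G proj_cell[OF V] i _ _ _ p, where lm = ?l])
  fix w assume w: "w : V"
  have "(\<Sum>p\<in>{1..m}. w p * ?l p) = (\<Sum>s<c. g s * (\<Sum>p\<in>{1..m}. w p * Gr_partial k (f s) (uvm V) i p))"
   unfolding sum_distrib_left by (subst sum.swap) (simp add: mult_ac)
  also have "... = 0"
   by (intro sum.neutral ballI) (use dirD_along_row_space[OF f spanned_frame[OF sp] U(1)] rs U(2) i w in auto)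
  finally show "(\<Sum>p\<in>{1..m}. w p * ?l p) = 0" .
 next
  fix p assume "(i, p) : nrm"
  then obtain t where t: "t < cod" "enum t = (i, p)" using enum(2) by (metis imageE lessThan_iff)
  show "?l p = 0" using g[OF t(1)] dirD_ndir[OF t(1)] t(2) by simp
 next
  fix p assume "a i <= p" "p <= b i"
  then show "?l p = 0"
   by (intro sum.neutral ballI) (use partial_in_cell[OF f U(1) _ sp van i] rs U(2) in auto)
 qed
qed

end

section \<open>The fundamental cocycle\<close>

lemma local_equationsD:
 assumes "local_equations k m c Z W f"
 shows "openin (Gr_top k m) W" "!!s. s < c ==> Gr_holomorphic_on k m (f s) W"
  "!!A t s. [|A : frames k m; row_space k A : W; !!i j. i < k ==> j : {1..m} ==> (\<Sum>s<c. t s * Gr_partial k (f s) A i j) = 0; s < c|] ==> t s = 0"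
  "!!V. V : W ==> V : Z \<longleftrightarrow> (\<forall>s<c. f s V = 0)"
 using assms unfolding local_equations_def by blast+

lemma local_map_continuous:
 assumes "openin (Gr_top k m) W" "!!s. s < c ==> Gr_holomorphic_on k m (f s) W"
 shows "continuous_map (sub (Gr_top k m) W) (Euc (2 * c)) (%V. c2r c (%s. f s V))"
 unfolding Euclidean_space_eq
 by (rule continuous_map_from_Gr[OF assms(1) continuous_on_c2r c2r_in_Es])
  (use assms(2) in \<open>simp add: Gr_holomorphic_on_def o_def\<close>)

lemma chain_map_restrict:
 "chain_map n F (frag_of (\<lambda>x\<in>stdx n. g x)) = frag_of (\<lambda>x\<in>stdx n. F (g x))"
 unfolding chain_map_of by (rule arg_cong[where f = frag_of]) (auto simp: simplex_map_def fun_eq_iff restrict_def)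

lemma hdeg_diff:
 assumes "relcycle n (Euc n) (-{0}) z" "relcycle n (Euc n) (-{0}) w"
 shows "hdeg n (z - w) = hdeg n z - hdeg n w"
 using hdeg_add[OF singular_relcycle_diff[OF assms] assms(2)] by simp

lemma singular_relcycle_subtopology:
 assumes "relcycle p (sub X W) S c" shows "relcycle p X S c"
proof -
 have "schain p X c" "schain (p - 1) (sub (sub X W) S) (bdry p c)"
  using assms unfolding singular_relcycle by (auto simp: singular_chain_subtopology)
 then show ?thesis unfolding singular_relcycle by (auto simp: singular_chain_subtopology)
qed

text \<open>Additivity is given on relative cycles only, so the induction also carries that the
  partial chains are relative cycles.\<close>

lemma frag_agree:
 fixes u v :: "'a chain => int"
 assumes "Poly_Mapping.keys c <= G"
  and G: "!!\<tau>. \<tau> : G ==> relcycle p X S (frag_of \<tau>) & u (frag_of \<tau>) = v (frag_of \<tau>)"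
  and u: "!!a b. [|relcycle p X S a; relcycle p X S b|] ==> u (a - b) = u a - u b"
  and v: "!!a b. [|relcycle p X S a; relcycle p X S b|] ==> v (a - b) = v a - v b"
 shows "relcycle p X S c & u c = v c"
 using assms(1)
proof (induction c rule: frag_induction)
 case zero
 have z: "relcycle p X S 0" by simp
 have "u 0 = 0" "v 0 = 0" using u[OF z z] v[OF z z] by simp_all
 then show ?case using z by simp
next
 case (one x)
 then show ?case using G by blast
next
 case (diff a b)
 then show ?case using u v by (simp add: singular_relcycle_diff)
qed

lemma cocycle_diff:
 assumes "\<phi> : cocycles p X" "schain p X a" "schain p X b"
 shows "\<phi> (a - b) = \<phi> a - \<phi> b"
proof -
 have "\<phi> ((a - b) + b) = \<phi> (a - b) + \<phi> b"
  using assms singular_chain_diff[OF assms(2,3)] unfolding cocycles_def cochain_group_carrier_iff by blast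
 then show ?thesis by simp
qed

lemma cocycle_boundary:
 assumes "\<phi> : cocycles p X" "schain (Suc p) X d"
 shows "\<phi> (bdry (Suc p) d) = 0"
proof -
 have "coboundary_map p X \<phi> d = (\<lambda>c\<in>singular_chain_set (Suc p) X. 0) d"
  using assms(1) unfolding cocycles_def cochain_group_one by auto
 then show ?thesis using assms(2) by (simp add: coboundary_map_def)
qed

lemma cocycle_homologous:
 assumes \<phi>: "\<phi> : cocycles p X" and van: "!!d. schain p (sub X S) d ==> \<phi> d = 0"
  and h: "homrel p (sub X W) S a b" and ab: "schain p X a" "schain p X b"
 shows "\<phi> a = \<phi> b"
proof -
 obtain d e where d: "schain (Suc p) (sub X W) d" and e: "schain p (sub (sub X W) S) e"
  and eq: "bdry (Suc p) d = (a - b) + e"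
  using h unfolding homologous_rel_def singular_relboundary_alt by blast
 have d': "schain (Suc p) X d" using d by (simp add: singular_chain_subtopology)
 have e': "schain p (sub X S) e" "schain p X e"
  using e by (auto simp: singular_chain_subtopology)
 have "0 = \<phi> ((a - b) + e)" using cocycle_boundary[OF \<phi> d'] eq by simp
 also have "... = \<phi> (a - b) + \<phi> e"
  using \<phi> singular_chain_diff[OF ab] e'(2) unfolding cocycles_def cochain_group_carrier_iff by auto
 finally show ?thesis using van[OF e'(1)] cocycle_diff[OF \<phi> ab] by simp
qed

context spans
begin

lemma chi_zero: "V : domn ==> V : cell \<longleftrightarrow> (\<forall>s<cod. chi s V = 0)"
proof -
 assume V: "V : domn"
 have "theta V : Lsub (2 * cod) \<longleftrightarrow> c2r cod (%s. chi s V) = 0"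
  using cod_le by (auto simp: Lsub_def theta_def c2r_def fun_eq_iff)
 then show ?thesis using theta_Lsub[OF V] c2r_eq_0_iff by simp
qed

lemma chi_holomorphic: "s < cod ==> Gr_holomorphic_on k m (chi s) domn"
 unfolding chi_def[abs_def] using enum_free(2)[of s]
 by (intro holomorphic_usol) (auto simp: domn_def nrm_def free_def)

lemma cell_nonempty: "cell ~= {}"
proof -
 have "spanned (%i p. if i < k & (p = a i | p = b i) then 1 else 0)"
  unfolding spanned_def using ab by (auto simp: fun_eq_iff split: if_splits)
 then show ?thesis unfolding cell_def by blast
qed

text \<open>Write \<open>A\<close> as the matrix \<open>g\<close> times the normalised rows. Adding
  \<open>z\<close> times column \<open>i0\<close> of \<open>g\<close> to column \<open>p0\<close> of
  \<open>A\<close> adds \<open>z\<close> to the entry \<open>(i0, p0)\<close> of the normalised rows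
  and leaves the others alone; since \<open>p0\<close> is not a normalising column of row
  \<open>i0\<close>, the rows stay normalised.\<close>

lemma chi_derivative:
 assumes A: "A : frames k m" "row_space k A : domn" and s0: "s0 < cod"
 shows "\<exists>E\<in>Mat k m. \<forall>s<cod. dirD k m (chi s) A E = (if s = s0 then 1 else 0)"
proof -
 let ?V = "row_space k A"
 let ?M = "uvm ?V"
 obtain i0 p0 where e0: "enum s0 = (i0, p0)" by (cases "enum s0")
 have n0: "i0 < k" "p0 : {1..m}" "p0 ~: ci i0 ` {..<k}" using enum_free(2)[OF s0] e0 by (auto simp: nrm_def free_def)
 have M: "?M : frames k m" "row_space k ?M = ?V" using domn_frame[OF A(2)] by auto
 have "\<exists>g. A i = comb {..<k} g ?M" if "i < k" for i
  using row_in_row_space[OF that, of A] row_space_iff[of "A i" k ?M] M(2) by simp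
 then have "A i = comb {..<k} (SOME g. A i = comb {..<k} g ?M) ?M" if "i < k" for i by (rule someI_ex[OF _]) (rule that)
 then obtain g where g: "!!i. i < k ==> A i = comb {..<k} (g i) ?M" by (rule that[of "%i. SOME g. A i = comb {..<k} g ?M"])
 define E where "E = (%i. if i < k then cscale (g i i0) (uvec p0) else 0)"
 have EM: "E : Mat k m" unfolding E_def Mat_def using n0 by (auto simp: cspace_def cscale_def Defs.unit_vec_def)
 have "dirD k m (chi s) A E = (if s = s0 then 1 else 0)" if s: "s < cod" for s
 proof (rule dirD_eqI[OF chi_holomorphic[OF s] A(1) openin_domn A(2) EM, where \<eta> = 1])
  fix z :: real
  let ?A = "mline A (of_real z) E" and ?N = "mline ?M (of_real z) (rowm i0 (uvec p0))"
  assume fr: "?A : frames k m" and dm: "row_space k ?A : domn"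
  have rows: "?A i = comb {..<k} (g i) ?N" if i: "i < k" for i
  proof
   fix p
   have "comb {..<k} (g i) ?N p = (\<Sum>l<k. g i l * ?M l p) + (\<Sum>l<k. if l = i0 then of_real z * g i i0 * uvec p0 p else 0)"
    unfolding comb_def mline_def rowm_def sum.distrib[symmetric] by (intro sum.cong refl) (auto simp: algebra_simps)
   then show "?A i p = comb {..<k} (g i) ?N p"
    using fun_cong[OF g[OF i], of p] i n0(1) by (simp add: mline_def E_def cscale_def comb_def)
  qed
  have Nc: "?N i : cspace m" "i >= k ==> ?N i = 0" for i
   using M(1) n0 unfolding frames_iff
   by (cases "i < k"; auto simp: mline_def rowm_def cspace_def Defs.unit_vec_def fun_eq_iff)+
  have Nsub: "row_space k ?N <= cspace m"
  proof
   fix x assume "x : row_space k ?N"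
   then obtain c where "x = comb {..<k} c ?N" using row_space_iff by blast
   moreover have "comb {..<k} c ?N : cspace m" by (rule comb_in_subspace[OF cspace_subspace]) (use Nc(1) in blast)
   ultimately show "x : cspace m" by simp
  qed
  have sN: "csubspace (row_space k ?N)" unfolding row_space_def by (rule cvec.subspace_span)
  have inN: "?A i : row_space k ?N" if "i < k" for i unfolding row_space_iff using rows[OF that] by blast
  \<comment> \<open>The row space of \<open>?N\<close> contains the \<open>k\<close> independent
    rows of \<open>?A\<close>, so the two row spaces coincide.\<close>
  have "k <= cdim (row_space k ?N)"
   using findep_card_le[of "{..<k}" ?A "row_space k ?N" m] fr inN sN Nsub by (auto simp: frames_iff)
  moreover have "cdim (row_space k ?N) <= card (?N ` {..<k})"
   by (rule cvec.dim_le_card) (auto simp: row_space_def)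
  moreover have "card (?N ` {..<k}) <= k" using card_image_le[of "{..<k}" ?N] by simp
  ultimately have cN: "cdim (row_space k ?N) = k" by linarith
  have GN: "row_space k ?N : Gr k m" unfolding Gr_def using sN Nsub cN by simp
  have eq: "row_space k ?A = row_space k ?N"
   by (rule frame_in_subspace[OF _ inN GN]) (use fr in \<open>auto simp: frames_iff\<close>)
  have "uv i (row_space k ?N) = ?N i" if i: "i < k" for i
  proof (rule usol_unique[OF _ sN row_in_row_space[OF i]])
   show "proj_inj k (ci i) (row_space k ?N)" using dm i unfolding eq domn_def by blast
   fix l assume l: "l < k"
   have "uv i ?V (ci i l) = (if l = i then 1 else 0)"
    using A(2) i usol_props(2)[of ?V k m "ci i" i l] l unfolding domn_def by auto
   moreover have "rowm i0 (uvec p0) i (ci i l) = 0" using n0(3) l by (auto simp: rowm_def Defs.unit_vec_def)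
   ultimately show "?N i (ci i l) = (if l = i then 1 else 0)" using i by (simp add: mline_def)
  qed
  moreover have es: "fst (enum s) < k" using enum_free(2)[OF s] by (auto simp: nrm_def free_def)
  ultimately have c1: "chi s (row_space k ?A) = ?N (fst (enum s)) (snd (enum s))" unfolding eq chi_def by simp
  have "enum s = enum s0 \<longleftrightarrow> s = s0"
   using enum(1) s s0 cod_le by (auto simp: bij_betw_def inj_on_def)
  then have "rowm i0 (uvec p0) (fst (enum s)) (snd (enum s)) = (if s = s0 then 1 else 0)"
   unfolding e0 by (auto simp: rowm_def Defs.unit_vec_def prod_eq_iff)
  then show "chi s (row_space k ?A) = chi s ?V + of_real z * (if s = s0 then 1 else 0)"
   unfolding c1 using es by (simp add: mline_def chi_def)
 qed simp
 then show ?thesis using EM by blast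
qed

lemma chi_independent:
 assumes A: "A : frames k m" "row_space k A : domn"
  and t: "!!i j. i < k ==> j : {1..m} ==> (\<Sum>s<cod. t s * Gr_partial k (chi s) A i j) = 0" and s0: "s0 < cod"
 shows "t s0 = 0"
proof -
 obtain E where E: "E : Mat k m" "!!s. s < cod ==> dirD k m (chi s) A E = (if s = s0 then 1 else 0)"
  using chi_derivative[OF A s0] by blast
 have "(\<Sum>s<cod. t s * dirD k m (chi s) A E) = (\<Sum>i<k. \<Sum>p\<in>{1..m}. E i p * (\<Sum>s<cod. t s * Gr_partial k (chi s) A i p))"
 proof -
  have "(\<Sum>s<cod. t s * dirD k m (chi s) A E) = (\<Sum>s<cod. \<Sum>i<k. \<Sum>p\<in>{1..m}. E i p * (t s * Gr_partial k (chi s) A i p))"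
   unfolding dirD_def by (simp add: sum_distrib_left mult_ac)
  also have "... = (\<Sum>i<k. \<Sum>s<cod. \<Sum>p\<in>{1..m}. E i p * (t s * Gr_partial k (chi s) A i p))" by (rule sum.swap)
  also have "... = (\<Sum>i<k. \<Sum>p\<in>{1..m}. \<Sum>s<cod. E i p * (t s * Gr_partial k (chi s) A i p))"
   by (rule sum.cong[OF refl], rule sum.swap)
  finally show ?thesis by (simp add: sum_distrib_left)
 qed
 also have "... = 0" using t by simp
 finally have "(\<Sum>s<cod. if s = s0 then t s0 else 0) = 0"
  using E(2) by (simp add: if_distrib[of "%x. _ * x"] cong: if_cong)
 then show ?thesis using s0 by simp
qed

lemma chi_equations:
 assumes Z: "cell <= Z" "Z <= Rvar"
 shows "local_equations k m cod Z domn chi"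
 unfolding local_equations_def
proof (intro conjI allI impI ballI)
 show "openin (Gr_top k m) domn" by (rule openin_domn)
 show "Gr_holomorphic_on k m (chi s) domn" if "s < cod" for s by (rule chi_holomorphic[OF that])
 show "t s = 0" if "A : frames k m" "row_space k A : domn"
  "\<forall>i<k. \<forall>j\<in>{1..m}. (\<Sum>s<cod. t s * Gr_partial k (chi s) A i j) = 0" "s < cod" for A t s
  using chi_independent[of A t s] that by blast
 have "Z Int domn = cell" using Z Rvar_domn cell_domn by blast
 then show "Z Int domn = {V : domn. \<forall>s<cod. chi s V = 0}" using chi_zero cell_domn by blast
qed

lemma sum_ndir:
 "(\<Sum>t<cod. y t * ndir t i p) = (if (i, p) : nrm then y (inv_into {..<card free} enum (i, p)) else 0)"
proof -
 have nd: "ndir t i p = (if enum t = (i, p) then 1 else 0)" for t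
  by (auto simp: ndir_def rowm_def Defs.unit_vec_def prod_eq_iff)
 show ?thesis
 proof (cases "(i, p) : nrm")
  case True
  then obtain s where s: "s < cod" "enum s = (i, p)" using enum(2) by (metis imageE lessThan_iff)
  have inv: "inv_into {..<card free} enum (i, p) = s"
   using enum(1) s cod_le inv_into_f_f[of enum "{..<card free}" s] by (auto simp: bij_betw_def)
  have "enum t = (i, p) \<longleftrightarrow> t = s" if "t < cod" for t
   using enum(1) s that cod_le by (auto simp: bij_betw_def inj_on_def)
  then have "(\<Sum>t<cod. y t * ndir t i p) = (\<Sum>t<cod. if t = s then y s else 0)"
   unfolding nd by (intro sum.cong) auto
  then show ?thesis using s True inv by simp
 next
  case False
  then have "enum t ~= (i, p)" if "t < cod" for t using enum_free(2)[OF that] by metis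
  then show ?thesis unfolding nd using False by simp
 qed
qed

text \<open>Links the simplices of the chart, which generate homology, with affine families of
  frames, to which \<open>normal_degree\<close> applies.\<close>

lemma normal_simplex_matrix:
 assumes V: "V : cell" and x: "x : stdx (2 * cod)"
 shows "mato (nsm (2 * cod) (theta V) r x) = affm cod (uvm V) ndir (ylin r x)"
proof (intro ext)
 fix i p
 have Vd: "V : domn" using V cell_domn by blast
 have mt: "mato (theta V) i p = uvm V i p" using mato_theta[OF Vd] by simp
 let ?s = "inv_into {..<card free} enum (i, p)" and ?y = "nsm (2 * cod) (theta V) r x"
 show "mato ?y i p = affm cod (uvm V) ndir (ylin r x) i p"
 proof (cases "(i, p) : free")
  case fr: True
  have s: "?s < card free" "enum ?s = (i, p)"
   using fr enum(1) inv_into_into[of "(i, p)" enum "{..<card free}"] f_inv_into_f[of "(i, p)" enum "{..<card free}"] by (auto simp: bij_betw_def)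
  show ?thesis
  proof (cases "(i, p) : nrm")
   case True
   then obtain t where t: "t < cod" "enum t = (i, p)" using enum(2) by (metis imageE lessThan_iff)
   have "?s = t" using enum(1) t cod_le inv_into_f_f[of enum "{..<card free}" t] by (auto simp: bij_betw_def)
   then have sc: "?s < cod" using t by simp
   have "chi ?s V = 0" using chi_zero[OF Vd] V sc by blast
   then have "uvm V i p = 0" using s(2) True by (auto simp: chi_def)
   moreover have "mato ?y i p = ylin r x ?s"
    using fr sc x by (simp add: mato_def nsm_def ylin_def complex_eq_iff)
   ultimately show ?thesis unfolding affm_def sum_ndir using True by simp
  next
   case False
   have "~ ?s < cod" using enum_free(2)[of ?s] s(2) False by auto
   then have "mato ?y i p = mato (theta V) i p" using fr x by (simp add: mato_def nsm_def)
   then show ?thesis unfolding affm_def sum_ndir using False mt by simp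
  qed
 next
  case False
  then have "(i, p) ~: nrm" "mato ?y i p = mato (theta V) i p" using nrm_free by (auto simp: mato_def)
  then show ?thesis unfolding affm_def sum_ndir using mt by simp
 qed
qed

definition nsx :: "(nat => complex) set => real => (nat => real) => (nat => complex) set" where
 "nsx V r = (\<lambda>x\<in>stdx (2 * cod). row_space k (affm cod (uvm V) ndir (ylin r x)))"

lemma chart_normal_simplex:
 assumes V: "V : cell"
 shows "simplex_map (2 * cod) (%y. row_space k (mato y)) (nsm (2 * cod) (theta V) r) = nsx V r"
proof
 fix x
 show "simplex_map (2 * cod) (%y. row_space k (mato y)) (nsm (2 * cod) (theta V) r) x = nsx V r x"
  by (cases "x : stdx (2 * cod)") (simp_all add: simplex_map_def nsx_def normal_simplex_matrix[OF V])
qed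

lemma linj_normal:
 assumes eq: "local_equations k m cod Z W f" and Z: "cell <= Z" and V: "V : cell" "V : W"
 shows "linj cod (%s t. dirD k m (f s) (uvm V) (ndir t))"
proof (rule linj_left_kernel)
 note D = local_equationsD[OF eq]
 have fr: "uvm V : frames k m" "row_space k (uvm V) = V" using domn_frame V cell_domn by auto
 fix g s assume g: "!!t. t < cod ==> (\<Sum>s<cod. g s * dirD k m (f s) (uvm V) (ndir t)) = 0" and s: "s < cod"
 show "g s = 0"
 proof (rule normal_left_kernel[where f = f and U = W and V = V and c = cod and g = g])
  show "Gr_holomorphic_on k m (f s) W" if "s < cod" for s using D(2) that .
  show "openin (Gr_top k m) W" "V : W" "V : cell" "s < cod" using D(1) V s by auto
  show "f s V' = 0" if "s < cod" "V' : cell Int W" for s V' using D(4)[of V'] that Z by blast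
  show "h s = 0" if "!!i p. i < k ==> p : {1..m} ==> (\<Sum>s<cod. h s * Gr_partial k (f s) (uvm V) i p) = 0" "s < cod" for h s
   by (rule D(3)[OF fr(1) _ that(1) that(2)]) (use fr(2) V in auto)
 qed (rule g)
qed

text \<open>The derivatives of any local equations in the normal directions form an invertible
  matrix by \<open>linj_normal\<close>, so their degree on small simplices at points of the cell is
  1.\<close>

lemma normal_degree_equations:
 assumes eq: "local_equations k m cod Z W f" and Z: "cell <= Z" and V: "V : cell" "V : W"
 shows "\<exists>\<delta>>0. \<forall>r. 0 < r --> r < \<delta> -->
  ssimp (2 * cod) (sub (Gr_top k m) W) (nsx V r) &
  relcycle (2 * cod) (sub (Gr_top k m) W) (-Z) (frag_of (nsx V r)) &
  hdeg (2 * cod) (chain_map (2 * cod) (%V. c2r cod (%s. f s V)) (frag_of (nsx V r))) = 1"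
proof -
 note D = local_equationsD[OF eq]
 have fr: "uvm V : frames k m" "row_space k (uvm V) = V" using domn_frame V cell_domn by auto
 have f0: "f s (row_space k (uvm V)) = 0" if "s < cod" for s using D(4)[of V] that Z V fr(2) by auto
 have VW: "row_space k (uvm V) : W" using fr V by simp
 show ?thesis
 proof (rule normal_degree[OF D(1) D(2) fr(1) VW f0 ndir_Mat linj_normal[OF eq Z V]])
  fix \<delta> :: real
  let ?\<sigma> = "%r. \<lambda>x\<in>stdx (2 * cod). row_space k (affm cod (uvm V) ndir (ylin r x))"
  assume d: "0 < \<delta>"
   and ss: "!!r. 0 < r ==> r < \<delta> ==> ssimp (2 * cod) (sub (Gr_top k m) W) (?\<sigma> r)"
   and bd: "!!r x j. 0 < r ==> r < \<delta> ==> x : stdx (2 * cod) ==> j <= 2 * cod ==> x j = 0 ==>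
    \<exists>s<cod. f s (row_space k (affm cod (uvm V) ndir (ylin r x))) ~= 0"
   and dg: "!!r. 0 < r ==> r < \<delta> ==> hdeg (2 * cod) (frag_of (\<lambda>x\<in>stdx (2 * cod).
    c2r cod (%s. f s (row_space k (affm cod (uvm V) ndir (ylin r x)))))) = 1"
  show ?thesis
  proof (intro exI[of _ \<delta>] conjI allI impI d)
   fix r assume r: "0 < r" "r < \<delta>"
   show "ssimp (2 * cod) (sub (Gr_top k m) W) (nsx V r)" unfolding nsx_def by (rule ss[OF r])
   show "hdeg (2 * cod) (chain_map (2 * cod) (%V. c2r cod (%s. f s V)) (frag_of (nsx V r))) = 1"
    unfolding nsx_def chain_map_restrict by (rule dg[OF r])
   show "relcycle (2 * cod) (sub (Gr_top k m) W) (-Z) (frag_of (nsx V r))"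
    unfolding nsx_def
   proof (rule singular_relcycle_of_simplex[OF ss[OF r]])
    fix x j assume x: "x : stdx (2 * cod)" "j <= 2 * cod" "x j = 0"
    have "?\<sigma> r x : W"
     using ss[OF r] x(1) unfolding singular_simplex_def continuous_map_def by (auto simp: Pi_def)
    then show "?\<sigma> r x : -Z" using D(4)[of "?\<sigma> r x"] bd[OF r x] x(1) by auto
   qed
  qed
 qed
qed

section \<open>Cocycles supported on a closed set between the cell and the locus of larger
  ranks\<close>

context
 fixes Z assumes Zc: "closedin (Gr_top k m) Z" and Zs: "cell <= Z" "Z <= Rvar"
begin

interpretation P: chart_pair "Gr_top k m" "2 * card free" "2 * cod" domn imag theta "%y. row_space k (mato y)" Z "Z - cell"
 by (rule pair_between[OF Zc Zs])

lemma coordn_chi: "P.coordn V = c2r cod (%s. chi s V)"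
 unfolding P.coordn_def using cod_le by (auto simp: trunc_def theta_def c2r_def fun_eq_iff)

lemma rich_normal:
 assumes "!!V. V : cell ==> V : W ==> \<exists>\<delta>>0. \<forall>r. 0 < r --> r < \<delta> --> nsx V r : G"
 shows "P.rich W G"
 unfolding P.rich_def
proof (intro ballI impI allI)
 fix V and \<epsilon> :: real assume V: "V : domn Int W" "theta V : Lsub (2 * cod)" and e: "\<epsilon> > 0"
 have c: "V : cell" using theta_Lsub V by blast
 then obtain \<delta> where d: "\<delta> > 0" "!!r. 0 < r ==> r < \<delta> ==> nsx V r : G"
  using assms V by blast
 let ?r = "min \<epsilon> \<delta> / 2"
 have "0 < ?r" "?r < \<epsilon>" "?r < \<delta>" using e d(1) by (auto simp: min_def)
 then show "\<exists>r. 0 < r & r < \<epsilon> & simplex_map (2 * cod) (%y. row_space k (mato y)) (nsm (2 * cod) (theta V) r) : G"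
  unfolding chart_normal_simplex[OF c] using d(2) by blast
qed

lemma total: "openin (Gr_top k m) (Gr k m)" "sub (Gr_top k m) (Gr k m) = Gr_top k m"
proof -
 show "openin (Gr_top k m) (Gr k m)" using openin_topspace[of "Gr_top k m"] by (simp add: topspace_Gr_top)
 show "sub (Gr_top k m) (Gr k m) = Gr_top k m" using subtopology_topspace[of "Gr_top k m"] by (simp add: topspace_Gr_top)
qed

lemma pair_vanish_total: "p < 2 * cod ==> hvanish p (Gr_top k m) (-Z)"
 using P.pair_vanish[OF total(1)] total(2) by simp

lemma hdeg_push_diff:
 assumes eq: "local_equations k m cod Z W f"
  and ab: "relcycle (2 * cod) (sub (Gr_top k m) W) (-Z) y" "relcycle (2 * cod) (sub (Gr_top k m) W) (-Z) z"
 shows "hdeg (2 * cod) (chain_map (2 * cod) (%V. c2r cod (%s. f s V)) (y - z)) =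
  hdeg (2 * cod) (chain_map (2 * cod) (%V. c2r cod (%s. f s V)) y) - hdeg (2 * cod) (chain_map (2 * cod) (%V. c2r cod (%s. f s V)) z)"
proof -
 note D = local_equationsD[OF eq]
 let ?F = "%V. c2r cod (%s. f s V)"
 have off: "?F V ~: {0}" if "V : topspace (sub (Gr_top k m) W)" "V ~: Z" for V
  using D(4)[of V] that unfolding singleton_iff c2r_eq_0_iff by auto
 have push: "relcycle (2 * cod) (Euc (2 * cod)) (-{0}) (chain_map (2 * cod) ?F e)"
  if "relcycle (2 * cod) (sub (Gr_top k m) W) (-Z) e" for e
  by (rule relcycle_push[OF that local_map_continuous[OF D(1,2)] off])
 show ?thesis unfolding chain_map_diff by (rule hdeg_diff[OF push[OF ab(1)] push[OF ab(2)]])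
qed

lemma hdeg_push_homologous:
 assumes eq: "local_equations k m c Z W f"
  and h: "homrel (2 * c) (sub (Gr_top k m) W) (-Z) y z" and z: "relcycle (2 * c) (sub (Gr_top k m) W) (-Z) z"
 shows "hdeg (2 * c) (chain_map (2 * c) (%V. c2r c (%s. f s V)) y) = hdeg (2 * c) (chain_map (2 * c) (%V. c2r c (%s. f s V)) z)"
proof -
 note D = local_equationsD[OF eq]
 let ?F = "%V. c2r c (%s. f s V)"
 have off: "?F V ~: {0}" if "V : topspace (sub (Gr_top k m) W)" "V ~: Z" for V
  using D(4)[of V] that unfolding singleton_iff c2r_eq_0_iff by auto
 show ?thesis
  by (rule hdeg_cong[OF homologous_push[OF h local_map_continuous[OF D(1,2)]] relcycle_push[OF z local_map_continuous[OF D(1,2)]]])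
   (use off in auto)
qed

text \<open>The cocycle comes from the degree in the chart. Its value is to be 1 on normal simplices
  for arbitrary equations on some \<open>W\<close>, possibly away from the cell. Such a simplex is
  homologous within \<open>W\<close> to a combination of small \<open>nsx\<close>, on which
  \<open>\<phi>\<close> and the degree of the equations agree; so they agree on it, and its degree
  is 1.\<close>

theorem fundamental_exists:
 obtains \<phi> where "fundamental_cocycle k m cod Z \<phi>"
  "!!e. relcycle (2 * cod) (sub (Gr_top k m) domn) (-Z) e ==>
   \<phi> e = hdeg (2 * cod) (chain_map (2 * cod) (%V. c2r cod (%s. chi s V)) e)"
proof -
 let ?X = "Gr_top k m" and ?n = "2 * cod"
 obtain h :: "(nat => complex) set chain => int" where h:
  "!!a b. [|relcycle ?n ?X (-Z) a; relcycle ?n ?X (-Z) b|] ==> h (a + b) = h a + h b"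
  "!!a. relboundary ?n ?X (-Z) a ==> h a = 0"
  "!!e. relcycle ?n (sub ?X domn) (-Z) e ==> h e = hdeg ?n (chain_map ?n P.coordn e)"
  using P.pair_hom by blast
 obtain \<phi> where \<phi>: "\<phi> : cocycles ?n ?X" "!!d. schain ?n (sub ?X (-Z)) d ==> \<phi> d = 0"
  "!!z. relcycle ?n ?X (-Z) z ==> \<phi> z = h z"
  using cocycle_of_relative_hom[of ?n ?X "-Z" h, OF pair_vanish_total h(1,2)] by blast
 have cn: "P.coordn = (%V. c2r cod (%s. chi s V))" using coordn_chi by (rule ext)
 have sub: "relcycle ?n ?X (-Z) e" if "relcycle ?n (sub ?X W) (-Z) e" for e W
  using singular_relcycle_subtopology[OF that] .
 have \<phi>d: "\<phi> e = hdeg ?n (chain_map ?n (%V. c2r cod (%s. chi s V)) e)" if "relcycle ?n (sub ?X domn) (-Z) e" for e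
  using \<phi>(3)[OF sub[OF that]] h(3)[OF that] unfolding cn by simp
 have "\<phi> (frag_of \<sigma>) = 1" if n\<sigma>: "normal_simplex k m cod Z \<sigma>" for \<sigma>
 proof -
  obtain W f r where eq: "local_equations k m cod Z W f" and r: "r > 0"
   and ss: "ssimp ?n (sub ?X W) \<sigma>"
   and f\<sigma>: "!!x s. x : stdx ?n ==> s < cod ==> f s (\<sigma> x) = ylin r x s"
   using n\<sigma> unfolding normal_simplex_def ylin_def by blast
  note D = local_equationsD[OF eq]
  let ?F = "%V. c2r cod (%s. f s V)"
  define G where "G = {\<tau>. relcycle ?n (sub ?X W) (-Z) (frag_of \<tau>) &
   hdeg ?n (chain_map ?n ?F (frag_of \<tau>)) = \<phi> (frag_of \<tau>)}"
  have rich: "P.rich W G"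
  proof (rule rich_normal)
   fix V assume V: "V : cell" "V : W"
   have Vd: "V : domn" using V cell_domn by blast
   obtain \<delta>1 where d1: "\<delta>1 > 0" "\<forall>r. 0 < r --> r < \<delta>1 -->
     ssimp ?n (sub ?X W) (nsx V r) &
     relcycle ?n (sub ?X W) (-Z) (frag_of (nsx V r)) & hdeg ?n (chain_map ?n ?F (frag_of (nsx V r))) = 1"
    using normal_degree_equations[OF eq Zs(1) V] by (elim exE conjE)
   obtain \<delta>2 where d2: "\<delta>2 > 0" "\<forall>r. 0 < r --> r < \<delta>2 -->
     ssimp ?n (sub ?X domn) (nsx V r) &
     relcycle ?n (sub ?X domn) (-Z) (frag_of (nsx V r)) &
     hdeg ?n (chain_map ?n (%V. c2r cod (%s. chi s V)) (frag_of (nsx V r))) = 1"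
    using normal_degree_equations[OF chi_equations[OF Zs] Zs(1) V(1) Vd] by (elim exE conjE)
   have "nsx V r : G" if "0 < r" "r < min \<delta>1 \<delta>2" for r
   proof -
    have r: "r < \<delta>1" "r < \<delta>2" using that by auto
    note h1 = d1(2)[rule_format, OF that(1) r(1)] and h2 = d2(2)[rule_format, OF that(1) r(2)]
    have "\<phi> (frag_of (nsx V r)) = 1" using \<phi>d[OF conjunct1[OF conjunct2[OF h2]]] h2 by simp
    then show ?thesis unfolding G_def using h1 by simp
   qed
   then show "\<exists>\<delta>>0. \<forall>r. 0 < r --> r < \<delta> --> nsx V r : G" using d1(1) d2(1) by (intro exI[of _ "min \<delta>1 \<delta>2"]) auto
  qed
  have \<sigma>W: "\<sigma> x : W" if "x : stdx ?n" for x
   using ss that unfolding singular_simplex_def continuous_map_def by (auto simp: Pi_def)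
  have rc: "relcycle ?n (sub ?X W) (-Z) (frag_of \<sigma>)"
  proof (rule singular_relcycle_of_simplex[OF ss])
   fix x j assume x: "x : stdx ?n" "j <= ?n" "x j = 0"
   obtain s where "s < cod" "ylin r x s ~= 0" using ylin_boundary_nonzero[OF x r] by blast
   then show "\<sigma> x : -Z" using D(4)[OF \<sigma>W[OF x(1)]] f\<sigma>[OF x(1)] by auto
  qed
  have "hgen ?n (sub ?X W) (-Z) G" by (rule P.pair_generate[OF D(1) rich])
  then obtain c where c: "Poly_Mapping.keys c <= G" "homrel ?n (sub ?X W) (-Z) (frag_of \<sigma>) c"
   using rc unfolding hgen_def by blast
  have ch: "schain ?n ?X e" if "relcycle ?n (sub ?X W) (-Z) e" for e
   using sub[OF that] by (simp add: singular_relcycle_def)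
  have ag: "relcycle ?n (sub ?X W) (-Z) c & hdeg ?n (chain_map ?n ?F c) = \<phi> c"
  proof (rule frag_agree[OF c(1), where u = "%c. hdeg ?n (chain_map ?n ?F c)" and v = \<phi>])
   show "\<tau> : G ==> relcycle ?n (sub ?X W) (-Z) (frag_of \<tau>) & hdeg ?n (chain_map ?n ?F (frag_of \<tau>)) = \<phi> (frag_of \<tau>)" for \<tau>
    unfolding G_def by blast
  qed (use hdeg_push_diff[OF eq] cocycle_diff[OF \<phi>(1)] ch in auto)
  have "\<phi> (frag_of \<sigma>) = \<phi> c"
   by (rule cocycle_homologous[OF \<phi>(1,2) c(2)]) (use ch rc ag in auto)
  also have "... = hdeg ?n (chain_map ?n ?F (frag_of \<sigma>))"
   using hdeg_push_homologous[OF eq c(2)] ag by simp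
  also have "... = 1"
  proof -
   have "simplex_map ?n ?F \<sigma> = (\<lambda>x\<in>stdx ?n. c2r cod (ylin r x))"
   proof
    fix x
    show "simplex_map ?n ?F \<sigma> x = (\<lambda>x\<in>stdx ?n. c2r cod (ylin r x)) x"
    proof (cases "x : stdx ?n")
     case True
     then show ?thesis using f\<sigma>[OF True] by (auto simp: simplex_map_def c2r_def fun_eq_iff)
    qed (simp add: simplex_map_def)
   qed
   then show ?thesis unfolding chain_map_of c2r_ylin using hdeg_scaled[OF r] by simp
  qed
  finally show ?thesis .
 qed
 then have "fundamental_cocycle k m cod Z \<phi>" unfolding fundamental_cocycle_def using \<phi>(1,2) by blast
 then show ?thesis using that \<phi>d by blast
qed

text \<open>Applied with \<open>Z\<close> the rank variety for the uniqueness of the class, and with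
  \<open>Z = Rvar\<close> for the pullback. The bound on \<open>r\<close> may depend on
  \<open>V\<close>, since generators may be taken arbitrarily small.\<close>

theorem cocycle_determined:
 assumes \<delta>: "\<delta> : cocycles (2 * cod) (Gr_top k m)" and van: "!!d. schain (2 * cod) (sub (Gr_top k m) (-Z)) d ==> \<delta> d = 0"
  and n: "!!V. V : cell ==> \<exists>\<epsilon>>0. \<forall>r. 0 < r --> r < \<epsilon> --> \<delta> (frag_of (nsx V r)) = 0"
 shows "\<delta> : coboundaries (2 * cod) (Gr_top k m)"
proof -
 let ?X = "Gr_top k m" and ?n = "2 * cod"
 define G where "G = {\<tau>. relcycle ?n ?X (-Z) (frag_of \<tau>) & \<delta> (frag_of \<tau>) = 0}"
 have sub: "relcycle ?n ?X (-Z) e" if "relcycle ?n (sub ?X W) (-Z) e" for e W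
  using singular_relcycle_subtopology[OF that] .
 have rich: "P.rich (Gr k m) G"
 proof (rule rich_normal)
  fix V assume V: "V : cell"
  have Vd: "V : domn" using V cell_domn by blast
  obtain \<delta>1 where d1: "\<delta>1 > 0" "\<forall>r. 0 < r --> r < \<delta>1 -->
    ssimp ?n (sub ?X domn) (nsx V r) &
    relcycle ?n (sub ?X domn) (-Z) (frag_of (nsx V r)) &
    hdeg ?n (chain_map ?n (%V. c2r cod (%s. chi s V)) (frag_of (nsx V r))) = 1"
   using normal_degree_equations[OF chi_equations[OF Zs] Zs(1) V Vd] by (elim exE conjE)
  obtain \<delta>2 where d2: "\<delta>2 > 0" "\<forall>r. 0 < r --> r < \<delta>2 --> \<delta> (frag_of (nsx V r)) = 0"
   using n[OF V] by (elim exE conjE)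
  have "nsx V r : G" if "0 < r" "r < min \<delta>1 \<delta>2" for r
  proof -
   have r: "r < \<delta>1" "r < \<delta>2" using that by auto
   have "relcycle ?n (sub ?X domn) (-Z) (frag_of (nsx V r))"
    using d1(2)[rule_format, OF that(1) r(1)] by blast
   then have "relcycle ?n ?X (-Z) (frag_of (nsx V r))" by (rule sub)
   then show ?thesis unfolding G_def using d2(2)[rule_format, OF that(1) r(2)] by simp
  qed
  then show "\<exists>\<delta>>0. \<forall>r. 0 < r --> r < \<delta> --> nsx V r : G" using d1(1) d2(1) by (intro exI[of _ "min \<delta>1 \<delta>2"]) auto
 qed
 show ?thesis
 proof (rule relative_cocycle_coboundary[OF pair_vanish_total \<delta>])
  fix z assume z: "relcycle ?n ?X (-Z) z"
  have "hgen ?n ?X (-Z) G" using P.pair_generate[OF total(1) rich] total(2) by simp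
  then obtain c where c: "Poly_Mapping.keys c <= G" "homrel ?n ?X (-Z) z c"
   using z unfolding hgen_def by blast
  have ch: "schain ?n ?X e" if "relcycle ?n ?X (-Z) e" for e
   using that by (simp add: singular_relcycle_def)
  have ag: "relcycle ?n ?X (-Z) c & \<delta> c = 0"
  proof (rule frag_agree[OF c(1), where u = \<delta> and v = "%_. 0"])
   show "\<tau> : G ==> relcycle ?n ?X (-Z) (frag_of \<tau>) & \<delta> (frag_of \<tau>) = 0" for \<tau>
    unfolding G_def by blast
  qed (use cocycle_diff[OF \<delta>] ch in auto)
  have "\<delta> z = \<delta> c"
   by (rule cocycle_homologous[where W = "Gr k m" and S = "-Z", OF \<delta> van]) (use c(2) total(2) ch z ag in auto)
  then show "\<delta> z = 0" using ag by simp
 qed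
qed

text \<open>At most \<open>cod\<close>: the differentials of independent equations stay independent
  on the \<open>cod\<close> normal directions. At least \<open>cod\<close>: otherwise a simplex of
  dimension \<open>2 * c\<close> on which the equations have degree 1 would bound modulo the
  complement of \<open>Z\<close>, as homology vanishes below degree \<open>2 * cod\<close>.\<close>

lemma codim_unique:
 assumes V: "V : cell" "V : W" and eq: "local_equations k m c Z W f"
 shows "c = cod"
proof (rule antisym)
 note D = local_equationsD[OF eq]
 let ?B = "uvm V" and ?X = "Gr_top k m"
 have fr: "?B : frames k m" "row_space k ?B = V" using domn_frame V cell_domn by auto
 have f0: "f s V = 0" if "s < c" for s using D(4)[OF V(2)] that Zs V by auto
 have ind: "h s = 0" if "!!i p. i < k ==> p : {1..m} ==> (\<Sum>s<c. h s * Gr_partial k (f s) ?B i p) = 0" "s < c" for h s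
  by (rule D(3)[OF fr(1) _ that(1) that(2)]) (use fr(2) V in auto)
 show "c <= cod"
 proof -
  define v where "v = (%s p. if p : {1..cod} then dirD k m (f s) ?B (ndir (p - 1)) else 0)"
  have fv: "findep {..<c} v"
   unfolding findep_def
  proof (intro allI impI ballI)
   fix g s assume z: "comb {..<c} g v = 0" and s: "s : {..<c}"
   show "g s = 0"
   proof (rule normal_left_kernel[where f = f and U = W and V = V and c = c and g = g])
    show "Gr_holomorphic_on k m (f s) W" if "s < c" for s using D(2) that .
    show "openin (Gr_top k m) W" "V : W" "V : cell" "s < c" using D(1) V s by auto
    show "f s V' = 0" if "s < c" "V' : cell Int W" for s V' using D(4)[of V'] that Zs by blast
    show "h s = 0" if "!!i p. i < k ==> p : {1..m} ==> (\<Sum>s<c. h s * Gr_partial k (f s) ?B i p) = 0" "s < c" for h s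
     using ind[OF that] .
    show "(\<Sum>s<c. g s * dirD k m (f s) ?B (ndir t)) = 0" if "t < cod" for t
     using fun_cong[OF z, of "Suc t"] that by (simp add: comb_def v_def)
   qed
  qed
  have sub: "v ` {..<c} <= cspace cod" by (auto simp: v_def cspace_def)
  have "cspace cod = coord_span {1..cod}" by (auto simp: cspace_def coord_span_eq)
  then have "cdim (cspace cod) = cod" using cdim_coord_span[of "{1..cod}"] by simp
  then show ?thesis
   using findep_card_le[OF _ fv sub cspace_subspace subset_refl] by simp
 qed
 show "cod <= c"
 proof (rule ccontr)
  assume "~ cod <= c"
  then have lt: "2 * c < 2 * cod" by simp
  \<comment> \<open>The differentials as rows of length \<open>k * m\<close>;
    \<open>frame_cols\<close> selects \<open>c\<close> entries in which they form an invertible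
    matrix.\<close>
  define v where "v = (%s p. if s < c & p : {1..k * m} then Gr_partial k (f s) ?B ((p - 1) div m) (Suc ((p - 1) mod m)) else 0)"
  have vi: "v s (Suc (i * m + (p - 1))) = Gr_partial k (f s) ?B i p" if "s < c" "i < k" "p : {1..m}" for s i p
   using idx_lt[OF that(2,3)] idx_inv[OF that(3), of i] that(1) unfolding v_def by (simp only: diff_Suc_1) auto
  have vf: "v : frames c (k * m)"
   unfolding frames_iff findep_def
  proof (intro conjI allI impI ballI)
   fix g s assume z: "comb {..<c} g v = 0" and s: "s : {..<c}"
   show "g s = 0"
   proof (rule ind)
    fix i p assume ip: "i < k" "p : {1..m}"
    have "(\<Sum>s<c. g s * Gr_partial k (f s) ?B i p) = comb {..<c} g v (Suc (i * m + (p - 1)))"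
     unfolding comb_def by (intro sum.cong refl) (use vi ip in auto)
    then show "(\<Sum>s<c. g s * Gr_partial k (f s) ?B i p) = 0" using z by simp
   qed (use s in auto)
  qed (auto simp: v_def cspace_def fun_eq_iff)
  obtain e where e: "cdet c (%s l. v s (e l)) ~= 0" "!!l. l < c ==> e l : {1..k * m}"
   using frame_cols[OF vf] by blast
  define R where "R = (%t. rowm ((e t - 1) div m) (uvec (Suc ((e t - 1) mod m))))"
  have et: "(e t - 1) div m < k" "Suc ((e t - 1) mod m) : {1..m}" if "t < c" for t
  proof -
   have "e t - 1 < k * m" using e(2)[OF that] by auto
   then show "(e t - 1) div m < k" "Suc ((e t - 1) mod m) : {1..m}" using idx_entry(1,2) by auto
  qed
  have RM: "R t : Mat k m" if "t < c" for t unfolding R_def by (intro rowm_Mat unit_vec_cspace et that)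
  have DR: "dirD k m (f s) ?B (R t) = v s (e t)" if "s < c" "t < c" for s t
   unfolding R_def using dirD_unit[OF et[OF that(2)]] e(2)[OF that(2)] that(1) by (simp add: v_def)
  have "cdet c (%s t. dirD k m (f s) ?B (R t)) = cdet c (%s l. v s (e l))"
   unfolding cdet_def cmat_def by (rule arg_cong[where f = Determinant.det], rule eq_matI) (auto simp: DR)
  then have lin: "linj c (%s t. dirD k m (f s) ?B (R t))"
   unfolding linj_iff_cdet cdet_transpose[of c "%s t. dirD k m (f s) ?B (R t)"] using e(1) by simp
  have VW: "row_space k ?B : W" and f0': "!!s. s < c ==> f s (row_space k ?B) = 0" using fr V f0 by auto
  show False
  proof (rule normal_degree[OF D(1) D(2) fr(1) VW f0' RM lin])
   fix \<delta> :: real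
   let ?\<sigma> = "%r. \<lambda>x\<in>stdx (2 * c). row_space k (affm c ?B R (ylin r x))"
   assume d: "0 < \<delta>"
    and ss: "!!r. 0 < r ==> r < \<delta> ==> ssimp (2 * c) (sub ?X W) (?\<sigma> r)"
    and bd: "!!r x j. 0 < r ==> r < \<delta> ==> x : stdx (2 * c) ==> j <= 2 * c ==> x j = 0 ==>
     \<exists>s<c. f s (row_space k (affm c ?B R (ylin r x))) ~= 0"
    and dg: "!!r. 0 < r ==> r < \<delta> ==> hdeg (2 * c) (frag_of (\<lambda>x\<in>stdx (2 * c).
     c2r c (%s. f s (row_space k (affm c ?B R (ylin r x)))))) = 1"
   define r where "r = \<delta> / 2"
   have r: "0 < r" "r < \<delta>" using d by (auto simp: r_def)
   have rc: "relcycle (2 * c) (sub ?X W) (-Z) (frag_of (?\<sigma> r))"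
   proof (rule singular_relcycle_of_simplex[OF ss[OF r]])
    fix x j assume x: "x : stdx (2 * c)" "j <= 2 * c" "x j = 0"
    have "?\<sigma> r x : W"
     using ss[OF r] x(1) unfolding singular_simplex_def continuous_map_def by (auto simp: Pi_def)
    then show "?\<sigma> r x : -Z" using D(4)[of "?\<sigma> r x"] bd[OF r x] x(1) by auto
   qed
   have "relboundary (2 * c) (sub ?X W) (-Z) (frag_of (?\<sigma> r))"
    using P.pair_vanish[OF D(1) lt] rc unfolding hvanish_def by blast
   then have "homrel (2 * c) (sub ?X W) (-Z) (frag_of (?\<sigma> r)) 0" by (simp add: homologous_rel_def)
   then have "hdeg (2 * c) (chain_map (2 * c) (%V. c2r c (%s. f s V)) (frag_of (?\<sigma> r))) = hdeg (2 * c) (chain_map (2 * c) (%V. c2r c (%s. f s V)) 0)"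
    by (rule hdeg_push_homologous[OF eq]) simp
   also have "... = 0" using hdeg_relboundary[of "2 * c" 0] by simp
   finally show False unfolding chain_map_restrict using dg[OF r] by simp
  qed
 qed
qed

text \<open>In the coordinates \<open>chi\<close> the simplex \<open>nsx V r\<close> is exactly
  \<open>ylin r\<close>, so it satisfies \<open>normal_simplex\<close> with \<open>chi\<close> as
  local equations.\<close>

lemma normal_value:
 assumes \<phi>: "fundamental_cocycle k m cod Z \<phi>" and V: "V : cell"
 shows "\<exists>\<epsilon>>0. \<forall>r. 0 < r --> r < \<epsilon> --> schain (2 * cod) (Gr_top k m) (frag_of (nsx V r)) & \<phi> (frag_of (nsx V r)) = 1"
proof -
 let ?n = "2 * cod" and ?X = "Gr_top k m"
 have Vd: "V : domn" using V cell_domn by blast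
 note eq = chi_equations[OF Zs]
 obtain \<delta> where d: "\<delta> > 0" "\<forall>r. 0 < r --> r < \<delta> -->
    ssimp ?n (sub ?X domn) (nsx V r) &
    relcycle ?n (sub ?X domn) (-Z) (frag_of (nsx V r)) &
    hdeg ?n (chain_map ?n (%V. c2r cod (%s. chi s V)) (frag_of (nsx V r))) = 1"
  using normal_degree_equations[OF eq Zs(1) V Vd] by (elim exE conjE)
 show ?thesis
 proof (intro exI[of _ \<delta>] conjI allI impI d(1))
  fix r assume r: "0 < r" "r < \<delta>"
  have ss: "ssimp ?n (sub ?X domn) (nsx V r)" using d(2)[rule_format, OF r] by blast
  then show "schain ?n ?X (frag_of (nsx V r))" by (simp add: singular_chain_of singular_simplex_subtopology)
  have "chi s (nsx V r x) = ylin r x s" if x: "x : stdx ?n" and s: "s < cod" for x s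
  proof -
   let ?A = "affm cod (uvm V) ndir (ylin r x)"
   have inD: "row_space k ?A : domn"
    using ss x unfolding singular_simplex_def continuous_map_def nsx_def by (auto simp: Pi_def)
   obtain i p where ip: "enum s = (i, p)" by (cases "enum s")
   have n: "(i, p) : nrm" using enum_free(2)[OF s] ip by simp
   then have i: "i < k" by (auto simp: nrm_def free_def)
   have sub: "csubspace (row_space k ?A)" unfolding row_space_def by (rule cvec.subspace_span)
   have "uv i (row_space k ?A) = ?A i"
   proof (rule usol_unique[OF _ sub row_in_row_space[OF i]])
    show "proj_inj k (ci i) (row_space k ?A)" using inD i unfolding domn_def by blast
    fix l assume l: "l < k"
    have "uv i V (ci i l) = (if l = i then 1 else 0)"
     using Vd i usol_props(2)[of V k m "ci i" i l] l unfolding domn_def by auto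
    moreover have "(i, ci i l) ~: nrm" using l by (auto simp: nrm_def free_def)
    ultimately show "?A i (ci i l) = (if l = i then 1 else 0)" using i unfolding affm_def sum_ndir by simp
   qed
   then have "chi s (row_space k ?A) = ?A i p" unfolding chi_def ip by simp
   also have "... = uvm V i p + ylin r x (inv_into {..<card free} enum (i, p))" unfolding affm_def sum_ndir using n by simp
   also have "inv_into {..<card free} enum (i, p) = s"
    unfolding ip[symmetric] using enum(1) s cod_le by (intro inv_into_f_f) (auto simp: bij_betw_def)
   also have "uvm V i p = 0" using chi_zero[OF Vd] V s i ip by (auto simp: chi_def)
   finally show ?thesis using x by (simp add: nsx_def)
  qed
  then have "normal_simplex k m cod Z (nsx V r)"
   unfolding normal_simplex_def ylin_def[symmetric] using eq r(1) ss
   by (intro exI[of _ domn] exI[of _ chi] exI[of _ r]) blast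
  then show "\<phi> (frag_of (nsx V r)) = 1" using \<phi> unfolding fundamental_cocycle_def by blast
 qed
qed

end

theorem Gr_codim_rank_variety: "Gr_codim k m (rank_variety m rset) = cod"
 unfolding Gr_codim_def
proof (rule the_equality)
 let ?Z = "rank_variety m rset"
 note Z = rank_variety_props
 have "cell <= regular_points k m cod ?Z"
  unfolding regular_points_def using chi_equations[OF Z(2,3)] Z(2) cell_domn by blast
 then show "?Z <= Gr_top k m closure_of regular_points k m cod ?Z"
  unfolding rank_variety_eq by (rule closure_of_mono)
 fix c assume c: "?Z <= Gr_top k m closure_of regular_points k m c ?Z"
 obtain V where V: "V : cell" using cell_nonempty by blast
 then have "V : Gr_top k m closure_of regular_points k m c ?Z" "V : domn" using c Z(2) cell_domn by auto
 \<comment> \<open>The regular points of codimension \<open>c\<close> are dense in the rank variety,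
   so one of them lies in \<open>domn\<close>, where the variety is just the cell.\<close>
 then obtain V' where V': "V' : regular_points k m c ?Z" "V' : domn"
  using openin_domn unfolding in_closure_of by blast
 have "V' : cell" using V' Z(3) Rvar_domn unfolding regular_points_def by blast
 then show "c = cod" using V'(1) codim_unique[OF Z] unfolding regular_points_def by blast
qed

end

section \<open>Pullback of cohomology classes\<close>

lemma coboundaries_pullback:
 assumes f: "continuous_map X Y f" and h: "h : coboundaries p Y"
 shows "cochain_pullback p X f h : coboundaries p X"
proof (cases p)
 case 0
 then have "h = (\<lambda>c\<in>singular_chain_set 0 Y. 0)" using h by (simp add: coboundaries_def cochain_group_one)
 then have "cochain_pullback p X f h = (\<lambda>c\<in>singular_chain_set 0 X. 0)"
  using 0 singular_chain_chain_map[OF _ f] by (auto simp: cochain_pullback_def fun_eq_iff)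
 then show ?thesis using 0 by (simp add: coboundaries_def cochain_group_one)
next
 case (Suc q)
 then obtain g where g: "g : carrier (cochain_group q Y)" "h = coboundary_map q Y g" using h by (auto simp: coboundaries_def)
 have gp: "cochain_pullback q X f g : carrier (cochain_group q X)"
  using g(1) singular_chain_chain_map[OF _ f] unfolding cochain_group_carrier_iff cochain_pullback_def
  by (auto simp: chain_map_add singular_chain_add)
 have "cochain_pullback p X f h = coboundary_map q X (cochain_pullback q X f g)"
 proof
  fix c
  show "cochain_pullback p X f h c = coboundary_map q X (cochain_pullback q X f g) c"
  proof (cases "schain (Suc q) X c")
   case True
   then show ?thesis
    using singular_chain_chain_map[OF True f] singular_chain_boundary_alt[OF True] chain_boundary_chain_map[OF True, of f] Suc
    by (simp add: cochain_pullback_def coboundary_map_def g(2))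
  qed (simp add: cochain_pullback_def coboundary_map_def Suc)
 qed
 then show ?thesis using gp Suc by (auto simp: coboundaries_def)
qed

lemma cocycles_pullback:
 assumes f: "continuous_map X Y f" and h: "\<phi> : cocycles p Y"
 shows "cochain_pullback p X f \<phi> : cocycles p X"
 unfolding cocycles_def
proof (intro CollectI conjI)
 show "cochain_pullback p X f \<phi> : carrier (cochain_group p X)"
  using h singular_chain_chain_map[OF _ f] unfolding cocycles_def cochain_group_carrier_iff cochain_pullback_def
  by (auto simp: chain_map_add singular_chain_add)
 show "coboundary_map p X (cochain_pullback p X f \<phi>) = \<one>\<^bsub>cochain_group (Suc p) X\<^esub>"
 proof
  fix c
  show "coboundary_map p X (cochain_pullback p X f \<phi>) c = \<one>\<^bsub>cochain_group (Suc p) X\<^esub> c"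
  proof (cases "schain (Suc p) X c")
   case True
   then show ?thesis
    using cocycle_boundary[OF h singular_chain_chain_map[OF True f]] singular_chain_boundary_alt[OF True] chain_boundary_chain_map[OF True, of f]
    by (simp add: cochain_pullback_def coboundary_map_def cochain_group_one)
  qed (simp add: coboundary_map_def cochain_group_one)
 qed
qed

lemma cocycle_sub:
 assumes "\<phi> : cocycles p X" "\<psi> : cocycles p X"
 shows "(\<lambda>c\<in>singular_chain_set p X. \<phi> c - \<psi> c) : cocycles p X"
 unfolding cocycles_def
proof (intro CollectI conjI)
 show "(\<lambda>c\<in>singular_chain_set p X. \<phi> c - \<psi> c) : carrier (cochain_group p X)"
  using assms unfolding cocycles_def cochain_group_carrier_iff by (auto simp: singular_chain_add)
 show "coboundary_map p X (\<lambda>c\<in>singular_chain_set p X. \<phi> c - \<psi> c) = \<one>\<^bsub>cochain_group (Suc p) X\<^esub>"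
 proof
  fix c
  show "coboundary_map p X (\<lambda>c\<in>singular_chain_set p X. \<phi> c - \<psi> c) c = \<one>\<^bsub>cochain_group (Suc p) X\<^esub> c"
  proof (cases "schain (Suc p) X c")
   case True
   then show ?thesis
    using cocycle_boundary[OF assms(1) True] cocycle_boundary[OF assms(2) True] singular_chain_boundary_alt[OF True]
    by (simp add: coboundary_map_def cochain_group_one)
  qed (simp add: coboundary_map_def cochain_group_one)
 qed
qed

lemma chain_map_comp: "chain_map p g (chain_map p f c) = chain_map p (%x. g (f x)) c"
 using fun_cong[OF chain_map_compose[of p g f], of c] by (simp add: o_def)

text \<open>The pair consisting of a cylinder and its bottom has trivial homology.\<close>

lemma homotopic_pullback_coboundary:
 assumes h: "homotopic_with (%x. True) X Y f g" and \<phi>: "\<phi> : cocycles p Y"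
 shows "(\<lambda>c\<in>singular_chain_set p X. \<phi> (chain_map p g c) - \<phi> (chain_map p f c)) : coboundaries p X"
proof -
 obtain H where H: "continuous_map (cyl X) Y H" "!!x. H (0, x) = f x" "!!x. H (1, x) = g x"
  using h unfolding homotopic_with_def by blast
 let ?C = "cyl X" and ?S = "{z :: real \<times> 'a. fst z = 0}" and ?r = "%z :: real \<times> 'a. (0 :: real, snd z)"
 have r: "continuous_map ?C ?C ?r"
  by (simp add: continuous_map_pairwise o_def continuous_map_snd)
 have van: "hvanish i ?C ?S" for i
  unfolding hvanish_iff_trivial_group
 proof (rule trivial_relative_homology_group_gen[where f = ?r])
  show "continuous_map ?C (sub ?C ?S) ?r" using r by (auto intro: continuous_map_into_subtopology)
  show "homotopic_with (%h. True) (sub ?C ?S) (sub ?C ?S) ?r id"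
   by (rule homotopic_with_equal) (auto simp: prod_eq_iff intro!: continuous_map_into_subtopology continuous_map_from_subtopology[OF r])
  show "homotopic_with (%h. True) ?C ?C ?r id"
   unfolding homotopic_with_def
  proof (intro exI conjI)
   let ?k = "%w :: real \<times> real \<times> 'a. (fst w * fst (snd w), snd (snd w))"
   have "continuous_map (cyl ?C) (top_of_set {0..1}) (%w. fst w * fst (snd w))"
   proof (rule continuous_map_into_subtopology)
    have "continuous_map (cyl ?C) euclideanreal fst"
     using continuous_map_fst[of "top_of_set {0..1 :: real}" ?C] by (simp add: continuous_map_in_subtopology)
    moreover have "continuous_map (cyl ?C) euclideanreal (%w. fst (snd w))"
     using continuous_map_compose[OF continuous_map_snd continuous_map_fst, of "top_of_set {0..1 :: real}" "top_of_set {0..1 :: real}" X]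
     by (simp add: continuous_map_in_subtopology o_def)
    ultimately show "continuous_map (cyl ?C) euclideanreal (%w. fst w * fst (snd w))" by (intro continuous_map_real_mult)
   qed (auto simp: mult_le_one)
   moreover have "continuous_map (cyl ?C) X (%w. snd (snd w))"
    using continuous_map_compose[OF continuous_map_snd continuous_map_snd, of "top_of_set {0..1 :: real}" "top_of_set {0..1 :: real}" X] by (simp add: o_def)
   ultimately show "continuous_map (cyl ?C) ?C ?k" by (simp add: continuous_map_pairwise o_def)
  qed auto
 qed
 have Hr: "continuous_map ?C Y (%z. H (?r z))" using continuous_map_compose[OF r H(1)] by (simp add: o_def)
 \<comment> \<open>The pullback along \<open>H\<close> minus the pullback along \<open>H\<close>
   after collapsing to the bottom. It vanishes on the bottom, and its restriction to the top is the
   cochain of the claim.\<close>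
 let ?P = "\<lambda>c\<in>singular_chain_set p ?C. cochain_pullback p ?C H \<phi> c - cochain_pullback p ?C (%z. H (?r z)) \<phi> c"
 have Pc: "?P : cocycles p ?C" by (rule cocycle_sub[OF cocycles_pullback[OF H(1) \<phi>] cocycles_pullback[OF Hr \<phi>]])
 have P0: "?P d = 0" if d: "schain p (sub ?C ?S) d" for d
 proof -
  have "chain_map p (%z. H (?r z)) d = chain_map p H d"
   by (rule chain_map_eq[OF d]) (auto simp: prod_eq_iff intro!: arg_cong[where f = H])
  moreover have "schain p ?C d" using d by (simp add: singular_chain_subtopology)
  ultimately show ?thesis by (simp add: cochain_pullback_def)
 qed
 have "?P : coboundaries p ?C"
 proof (rule relative_cocycle_coboundary[OF van Pc])
  fix z assume z: "relcycle p ?C ?S z"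
  then have zc: "schain p ?C z" by (simp add: singular_relcycle_def)
  have "relboundary p ?C ?S z" using van z unfolding hvanish_def by blast
  then have hr: "homrel p (sub ?C (topspace ?C)) ?S z 0" by (simp only: subtopology_topspace homologous_rel_def diff_zero)
  have "?P z = ?P 0"
  proof (rule cocycle_homologous[OF Pc _ hr zc])
   show "?P d = 0" if "schain p (sub ?C ?S) d" for d by (rule P0[OF that])
  qed simp
  also have "?P 0 = 0" by (rule P0) simp
  finally show "?P z = 0" .
 qed
 moreover have i1: "continuous_map X ?C (Pair 1)" by (simp add: continuous_map_pairwise o_def)
 ultimately have "cochain_pullback p X (Pair 1) ?P : coboundaries p X" by (intro coboundaries_pullback)
 also have "cochain_pullback p X (Pair 1) ?P = (\<lambda>c\<in>singular_chain_set p X. \<phi> (chain_map p g c) - \<phi> (chain_map p f c))"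
  using singular_chain_chain_map[OF _ i1] by (auto simp: cochain_pullback_def chain_map_comp H fun_eq_iff)
 finally show ?thesis .
qed

lemma cocycle_group_mult: "x \<otimes>\<^bsub>cocycle_group p X\<^esub> y = (\<lambda>c\<in>singular_chain_set p X. x c + y c)"
 unfolding cocycle_group_def by (simp add: cochain_group_mult)

lemma cocycle_ext: "\<phi> : cocycles p X ==> ~ schain p X c ==> \<phi> c = undefined"
 unfolding cocycles_def cochain_group_carrier_iff extensional_def by auto

lemma subgroup_coboundaries': "subgroup (coboundaries p X) (cocycle_group p X)"
 unfolding cocycle_group_def
 by (intro group.subgroup_of_subgroup_generated coboundaries_subset_cocycles subgroup_coboundaries
   comm_group.axioms(2)[OF comm_group_cochain_group])

lemma group_cocycle_group: "group (cocycle_group p X)"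
 unfolding cocycle_group_def by (intro group.group_subgroup_generated comm_group.axioms(2)[OF comm_group_cochain_group])

lemma cohom_class_eqI:
 assumes \<phi>: "\<phi> : cocycles p X" "\<psi> : cocycles p X" and d: "(\<lambda>c\<in>singular_chain_set p X. \<phi> c - \<psi> c) : coboundaries p X"
 shows "cohom_class p X \<phi> = cohom_class p X \<psi>"
proof -
 have "\<phi> = (\<lambda>c\<in>singular_chain_set p X. \<phi> c - \<psi> c) \<otimes>\<^bsub>cocycle_group p X\<^esub> \<psi>"
  unfolding cocycle_group_mult using cocycle_ext[OF \<phi>(1)] by (auto simp: fun_eq_iff)
 then have "\<phi> : coboundaries p X #>\<^bsub>cocycle_group p X\<^esub> \<psi>" unfolding r_coset_def using d by blast
 then show ?thesis
  unfolding cohom_class_def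
  using group.repr_independence[OF group_cocycle_group _ _ subgroup_coboundaries'] \<phi>(2) carrier_cocycle_group by metis
qed

lemma cochain_pullback_mult:
 assumes f: "continuous_map X Y f"
 shows "cochain_pullback p X f (x \<otimes>\<^bsub>cocycle_group p Y\<^esub> y) = cochain_pullback p X f x \<otimes>\<^bsub>cocycle_group p X\<^esub> cochain_pullback p X f y"
 unfolding cocycle_group_mult cochain_pullback_def using singular_chain_chain_map[OF _ f] by (auto simp: fun_eq_iff)

text \<open>The coboundaries of \<open>X\<close> absorb the pullbacks of those of \<open>Y\<close>,
  so the product of sets is a single coset.\<close>

lemma pullback_class:
 assumes f: "continuous_map X Y f" and \<phi>: "\<phi> : cocycles p Y"
 shows "coboundaries p X <#>\<^bsub>cocycle_group p X\<^esub> (cochain_pullback p X f ` cohom_class p Y \<phi>) = cohom_class p X (cochain_pullback p X f \<phi>)"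
proof
 interpret G: group "cocycle_group p X" by (rule group_cocycle_group)
 interpret H: group "cocycle_group p Y" by (rule group_cocycle_group)
 have cl: "!!h. h : coboundaries p X ==> h : carrier (cocycle_group p X)"
  unfolding carrier_cocycle_group using coboundaries_subset_cocycles by blast
 have pc: "cochain_pullback p X f \<phi> : carrier (cocycle_group p X)" unfolding carrier_cocycle_group by (rule cocycles_pullback[OF f \<phi>])
 show "coboundaries p X <#>\<^bsub>cocycle_group p X\<^esub> (cochain_pullback p X f ` cohom_class p Y \<phi>) <= cohom_class p X (cochain_pullback p X f \<phi>)"
 proof
  fix x assume "x : coboundaries p X <#>\<^bsub>cocycle_group p X\<^esub> (cochain_pullback p X f ` cohom_class p Y \<phi>)"
  then obtain h h' where h: "h : coboundaries p X" "h' : coboundaries p Y"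
   "x = h \<otimes>\<^bsub>cocycle_group p X\<^esub> cochain_pullback p X f (h' \<otimes>\<^bsub>cocycle_group p Y\<^esub> \<phi>)"
   unfolding set_mult_def cohom_class_def r_coset_def by auto
  note ph = coboundaries_pullback[OF f h(2)]
  have "x = (h \<otimes>\<^bsub>cocycle_group p X\<^esub> cochain_pullback p X f h') \<otimes>\<^bsub>cocycle_group p X\<^esub> cochain_pullback p X f \<phi>"
   unfolding h(3) cochain_pullback_mult[OF f] using cl[OF h(1)] cl[OF ph] pc by (simp add: G.m_assoc)
  moreover have "h \<otimes>\<^bsub>cocycle_group p X\<^esub> cochain_pullback p X f h' : coboundaries p X"
   by (rule subgroup.m_closed[OF subgroup_coboundaries' h(1) ph])
  ultimately show "x : cohom_class p X (cochain_pullback p X f \<phi>)" unfolding cohom_class_def r_coset_def by blast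
 qed
 show "cohom_class p X (cochain_pullback p X f \<phi>) <= coboundaries p X <#>\<^bsub>cocycle_group p X\<^esub> (cochain_pullback p X f ` cohom_class p Y \<phi>)"
 proof
  fix x assume "x : cohom_class p X (cochain_pullback p X f \<phi>)"
  then obtain h where h: "h : coboundaries p X" "x = h \<otimes>\<^bsub>cocycle_group p X\<^esub> cochain_pullback p X f \<phi>"
   unfolding cohom_class_def r_coset_def by auto
  have "\<phi> : carrier (cocycle_group p Y)" unfolding carrier_cocycle_group by (rule \<phi>)
  then have "\<one>\<^bsub>cocycle_group p Y\<^esub> \<otimes>\<^bsub>cocycle_group p Y\<^esub> \<phi> = \<phi>" by simp
  moreover have "\<one>\<^bsub>cocycle_group p Y\<^esub> : coboundaries p Y" by (rule subgroup.one_closed[OF subgroup_coboundaries'])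
  ultimately have "\<phi> : cohom_class p Y \<phi>" unfolding cohom_class_def r_coset_def by force
  then show "x : coboundaries p X <#>\<^bsub>cocycle_group p X\<^esub> (cochain_pullback p X f ` cohom_class p Y \<phi>)"
   unfolding set_mult_def h(2) using h(1) by blast
 qed
qed

lemma one_cohomology_group: "\<one>\<^bsub>cohomology_group p X\<^esub> = cohom_class p X \<one>\<^bsub>cocycle_group p X\<^esub>"
proof -
 have "coboundaries p X <= carrier (cocycle_group p X)"
  unfolding carrier_cocycle_group by (rule coboundaries_subset_cocycles)
 then show ?thesis
  unfolding cohomology_group_def cohom_class_def FactGroup_def
  by (simp add: group.coset_mult_one[OF group_cocycle_group])
qed

lemma pullback_one:
 assumes f: "continuous_map X Y f"
 shows "coboundaries p X <#>\<^bsub>cocycle_group p X\<^esub> (cochain_pullback p X f ` \<one>\<^bsub>cohomology_group p Y\<^esub>) = \<one>\<^bsub>cohomology_group p X\<^esub>"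
proof -
 have one: "\<one>\<^bsub>cocycle_group p Z\<^esub> = (\<lambda>c\<in>singular_chain_set p Z. 0)" for Z :: "'c topology"
  unfolding cocycle_group_def by (simp add: cochain_group_one)
 have oneX: "\<one>\<^bsub>cocycle_group p X\<^esub> = (\<lambda>c\<in>singular_chain_set p X. 0)"
  unfolding cocycle_group_def by (simp add: cochain_group_one)
 have oneY: "\<one>\<^bsub>cocycle_group p Y\<^esub> = (\<lambda>c\<in>singular_chain_set p Y. 0)"
  unfolding cocycle_group_def by (simp add: cochain_group_one)
 have "\<one>\<^bsub>cocycle_group p Y\<^esub> : cocycles p Y"
  using group.is_monoid[OF group_cocycle_group, THEN monoid.one_closed] carrier_cocycle_group by blast
 moreover have "cochain_pullback p X f \<one>\<^bsub>cocycle_group p Y\<^esub> = \<one>\<^bsub>cocycle_group p X\<^esub>"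
  unfolding oneX oneY cochain_pullback_def using singular_chain_chain_map[OF _ f] by (auto simp: fun_eq_iff)
 ultimately show ?thesis unfolding one_cohomology_group using pullback_class[OF f] by metis
qed

section \<open>Linear inclusions\<close>

definition lin :: "nat => nat => (nat => nat => complex) => (nat => complex) => nat => complex" where
 "lin m m' T v = (%q. if q : {1..m'} then \<Sum>p\<in>{1..m}. T q p * v p else 0)"

lemma lin_comb: "lin m m' T (comb S c v) = comb S c (%i. lin m m' T (v i))"
proof
 fix q
 have "(\<Sum>p\<in>{1..m}. T q p * (\<Sum>l\<in>S. c l * v l p)) = (\<Sum>l\<in>S. c l * (\<Sum>p\<in>{1..m}. T q p * v l p))"
  unfolding sum_distrib_left by (subst sum.swap) (simp add: mult_ac)
 then show "lin m m' T (comb S c v) q = comb S c (%i. lin m m' T (v i)) q"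
  by (auto simp: lin_def comb_def)
qed

lemma image_row_space:
 assumes "!!c. h (comb {..<k} c A) = comb {..<k} c (%i. h (A i))"
 shows "h ` row_space k A = row_space k (%i. h (A i))"
proof (rule equalityI; rule subsetI)
 fix x assume "x : h ` row_space k A"
 then obtain w where w: "w : row_space k A" "x = h w" by blast
 then obtain c where "x = h (comb {..<k} c A)" using row_space_iff[of w k A] by blast
 then show "x : row_space k (%i. h (A i))" unfolding row_space_iff assms by blast
next
 fix x assume "x : row_space k (%i. h (A i))"
 then obtain c where c: "x = h (comb {..<k} c A)" unfolding row_space_iff assms[symmetric] by blast
 have "comb {..<k} c A : row_space k A" unfolding row_space_iff by blast
 then show "x : h ` row_space k A" using c by blast
qed

lemma lin_row_space: "lin m m' T ` row_space k A = row_space k (%i. lin m m' T (A i))"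
 by (rule image_row_space[OF lin_comb])

lemma lin_cspace: "lin m m' T v : cspace m'"
 by (auto simp: lin_def cspace_def)

lemma lin_frames:
 assumes A: "A : frames k m" and inj: "!!v. v : cspace m ==> lin m m' T v = 0 ==> v = 0"
 shows "(%i. lin m m' T (A i)) : frames k m'"
 unfolding frames_iff findep_def
proof (intro conjI allI impI ballI)
 have A': "!!i. i < k ==> A i : cspace m" "!!i. i >= k ==> A i = 0" "findep {..<k} A" using A frames_iff by auto
 show "lin m m' T (A i) = 0" if "i >= k" for i using A'(2)[OF that] by (auto simp: lin_def fun_eq_iff)
 fix c l assume z: "comb {..<k} c (%i. lin m m' T (A i)) = 0" and l: "l : {..<k}"
 have "comb {..<k} c A : cspace m" by (rule comb_in_subspace[OF cspace_subspace]) (use A' in auto)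
 then have "comb {..<k} c A = 0" using inj z unfolding lin_comb[symmetric] by blast
 then show "c l = 0" using findepD[OF A'(3)] l by blast
qed (rule lin_cspace)

text \<open>Joint continuity in \<open>\<tau>\<close> and \<open>V\<close> is checked on the chart
  domains, which cover the Grassmannian and on which the frame \<open>mato (theta V)\<close> depends
  continuously on \<open>V\<close>.\<close>

lemma homotopic_lin:
 fixes T :: "real => nat => nat => complex"
 assumes Tc: "!!q p. continuous_on {0..1} (%\<tau>. T \<tau> q p)"
  and inj: "!!\<tau> v. \<tau> : {0..1} ==> v : cspace m ==> lin m m' (T \<tau>) v = 0 ==> v = 0"
 shows "homotopic_with (%_. True) (Gr_top k m) (Gr_top k m') (%V. lin m m' (T 0) ` V) (%V. lin m m' (T 1) ` V)"
proof -
 let ?H = "%z. lin m m' (T (fst z)) ` snd z"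
 let ?X = "Gr_top k m" and ?I = "{0..1 :: real}"
 let ?J = "{(a, b). spans k m a b}" and ?D = "%(a, b). spans.domn k m a b"
 have "continuous_map (prod_topology (top_of_set ?I) ?X) (Gr_top k m') ?H"
 proof (rule pasting_lemma[where I = ?J and T = "%j. ?I \<times> ?D j" and f = "%_. ?H"])
  show "openin (prod_topology (top_of_set ?I) ?X) (?I \<times> ?D j)" if "j : ?J" for j
   using that spans.openin_domn by (auto simp: openin_prod_Times_iff)
  show "\<exists>j. j : ?J & z : ?I \<times> ?D j & ?H z = ?H z" if z: "z : topspace (prod_topology (top_of_set ?I) ?X)" for z
  proof -
   have "snd z : Gr k m" "fst z : ?I" using z by (auto simp: topspace_Gr_top)
   moreover obtain a b where s: "spans k m a b" "snd z : spans.cell k a b" using cell_exists[OF \<open>snd z \<in> Gr k m\<close>] .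
   moreover have "snd z : spans.domn k m a b" using spans.cell_domn[OF s(1)] s(2) by blast
   ultimately show ?thesis by (intro exI[of _ "(a, b)"]) (auto simp: mem_Times_iff)
  qed
  show "continuous_map (sub (prod_topology (top_of_set ?I) ?X) (?I \<times> ?D j)) (Gr_top k m') ?H" if jJ: "j : ?J" for j
  proof -
   obtain a b where j: "j = (a, b)" and s: "spans k m a b" using jJ by auto
   interpret spans k m a b by (rule s)
   have hom: "homeomorphic_maps (sub ?X domn) (top_of_set imag) theta (%y. row_space k (mato y))"
    using chart_domn unfolding chart_def by blast
   then have tc: "continuous_map (sub ?X domn) (top_of_set imag) theta" by (simp add: homeomorphic_maps_def)
   let ?P = "prod_topology (top_of_set ?I) (sub ?X domn)"
   have sub: "sub (prod_topology (top_of_set ?I) ?X) (?I \<times> ?D j) = ?P"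
    unfolding j by (simp add: subtopology_Times subtopology_subtopology)
   have c1: "continuous_map ?P (top_of_set (?I \<times> imag)) (%z. (fst z, theta (snd z)))"
   proof -
    have "continuous_map ?P (prod_topology (top_of_set ?I) (top_of_set imag)) (%z. (fst z, theta (snd z)))"
    proof -
     have f1: "continuous_map ?P (top_of_set ?I) (%z. fst z)" by (rule continuous_map_fst)
     have f2: "continuous_map ?P (top_of_set imag) (%z. theta (snd z))"
      using continuous_map_compose[OF continuous_map_snd tc, of "top_of_set ?I"] unfolding o_def .
     show ?thesis by (simp only: continuous_map_pairwise o_def fst_conv snd_conv) (intro conjI f1 f2)
    qed
    then show ?thesis by (simp add: prod_topology_subtopology subtopology_subtopology Times_Int_Times flip: prod_topology_euclidean)
   qed
   let ?\<Phi> = "%z i. lin m m' (T (fst z)) (mato (snd z) i)"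
   have c2: "continuous_map (top_of_set (?I \<times> imag)) (top_of_set (frames k m')) ?\<Phi>"
   proof -
    have "continuous_on (?I \<times> imag) (%z. ?\<Phi> z i q)" for i q
    proof (cases "q : {1..m'}")
     case True
     have t: "continuous_on (?I \<times> imag) (%z. T (fst z) q p)" for p
      by (rule continuous_on_compose2[OF Tc]) (auto intro: continuous_intros)
     have u: "continuous_on (?I \<times> imag) (%z. mato (snd z) i p)" for p
      by (rule continuous_on_compose2[OF continuous_on_mato[of UNIV]]) (auto intro: continuous_intros)
     show ?thesis using True unfolding lin_def by (simp, intro continuous_intros t u)
    next
     case False
     then have "?\<Phi> z i q = 0" for z by (auto simp: lin_def)
     then show ?thesis by (simp only: continuous_on_const)
    qed
    then have "continuous_on (?I \<times> imag) ?\<Phi>" by (intro continuous_on_coordinatewise_then_product)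
    moreover have "?\<Phi> z : frames k m'" if "z : ?I \<times> imag" for z
     by (rule lin_frames[OF mato_frame(1) inj]) (use that in auto)
    ultimately show ?thesis by (auto simp: continuous_map_in_subtopology)
   qed
   have c3: "continuous_map ?P (Gr_top k m') (%z. row_space k (?\<Phi> (fst z, theta (snd z))))"
    using continuous_map_compose[OF c1 continuous_map_compose[OF c2 row_space_continuous]] by (simp add: o_def)
   have "row_space k (?\<Phi> (fst z, theta (snd z))) = ?H z" if z: "z : topspace ?P" for z
   proof -
    have d: "snd z : domn" using z by auto
    have "row_space k (mato (theta (snd z))) = snd z" using domn_frame(2)[OF d] mato_theta[OF d] by simp
    then show ?thesis unfolding fst_conv snd_conv lin_row_space[symmetric] by simp
   qed
   then show ?thesis unfolding sub by (rule continuous_map_eq[OF c3])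
  qed
 qed auto
 then show ?thesis unfolding homotopic_with_def by (intro exI[of _ ?H]) auto
qed

lemma linear_inclusion_sum:
 assumes j: "linear_inclusion n m j" and v: "v : cspace n"
 shows "j v = comb {1..n} v (%p. j (uvec p))"
proof -
 have add: "!!v w. v : cspace n ==> w : cspace n ==> j (v + w) = j v + j w"
  and sc: "!!c v. v : cspace n ==> j (cscale c v) = cscale c (j v)"
  using j unfolding linear_inclusion_def by auto
 have u: "uvec p : cspace n" if "p : {1..n}" for p by (rule unit_vec_cspace[OF that])
 have z: "j 0 = 0"
  using sc[of 0 0] cvec.subspace_0[OF cspace_subspace] by (auto simp: cscale_def fun_eq_iff zero_fun_def)
 have gen: "j (comb S v uvec) = comb S v (%p. j (uvec p)) & comb S v uvec : cspace n"
  if "finite S" "S <= {1..n}" for S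
  using that
 proof (induction S)
  case empty
  have c0: "comb {} v u = 0" for u by (simp only: comb_eq_sum sum.empty)
  show ?case unfolding c0 by (intro conjI z cvec.subspace_0[OF cspace_subspace])
 next
  case (insert x S)
  have x: "uvec x : cspace n" using u insert by auto
  then have sx: "cscale (v x) (uvec x) : cspace n" using cvec.subspace_scale[OF cspace_subspace] by blast
  have ci: "comb (insert x S) v u = cscale (v x) (u x) + comb S v u" for u
   by (simp only: comb_eq_sum sum.insert[OF insert.hyps])
  have IH: "j (comb S v uvec) = comb S v (%p. j (uvec p))" "comb S v uvec : cspace n" using insert by auto
  show ?case
   unfolding ci add[OF sx IH(2)] sc[OF x] IH(1)
   by (intro conjI refl cvec.subspace_add[OF cspace_subspace] sx IH(2))
 qed
 have "comb {1..n} v uvec = v"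
 proof
  fix p
  have "comb {1..n} v uvec p = (\<Sum>l\<in>{1..n}. if l = p then v p else 0)"
   unfolding comb_def Defs.unit_vec_def by (intro sum.cong) auto
  then show "comb {1..n} v uvec p = v p" using v by (auto simp: cspace_def)
 qed
 then show ?thesis using gen[of "{1..n}"] by auto
qed

text \<open>The images of the unit vectors are completed to a basis by a unit vector outside their
  span. A path of invertible matrices from this basis to the standard one, restricted to the first
  \<open>n\<close> columns, gives the homotopy.\<close>

theorem inclusion_homotopic_standard:
 assumes j: "linear_inclusion n (Suc n) j"
 shows "homotopic_with (%_. True) (Gr_top k n) (Gr_top k (Suc n)) (%V. j ` V) (%V. V)"
proof -
 let ?m = "Suc n"
 have jc: "!!v. v : cspace n ==> j v : cspace ?m" and ji: "inj_on j (cspace n)"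
  using j unfolding linear_inclusion_def by auto
 let ?u = "%p. j (uvec p)"
 have u: "?u p : cspace ?m" if "p : {1..n}" for p by (rule jc[OF unit_vec_cspace[OF that]])
 have j0: "j 0 = 0" using linear_inclusion_sum[OF j, of 0] cvec.subspace_0[OF cspace_subspace] by (auto simp: comb_def fun_eq_iff)
 let ?S = "cspan (?u ` {1..n})"
 obtain q0 where q0: "q0 : {1..?m}" "uvec q0 ~: ?S"
 proof (rule ccontr)
  assume "~ thesis"
  then have "uvec ` {1..?m} <= ?S" using that by blast
  then have "coord_span {1..?m} <= ?S" unfolding coord_span_def by (rule cvec.span_minimal[OF _ cvec.subspace_span])
  then have "cdim (coord_span {1..?m}) <= card (?u ` {1..n})" by (rule cvec.dim_le_card) simp
  also have "... <= n" using card_image_le[of "{1..n}" ?u] by simp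
  finally show False by (simp add: cdim_coord_span)
 qed
 \<comment> \<open>Arrays for \<open>linj\<close> are indexed from 0, coordinates of vectors from 1;
   the last column is the added vector.\<close>
 define D where "D = (%s t. if t < n then ?u (Suc t) (Suc s) else uvec q0 (Suc s))"
 have lD: "linj ?m D"
  unfolding linj_def
 proof (intro allI impI)
  fix y t assume z: "\<forall>s<?m. lmap ?m D y s = 0" and t: "t < ?m"
  let ?v = "%p. if p : {1..n} then y (p - 1) else 0"
  have vc: "?v : cspace n" by (auto simp: cspace_def)
  have eq: "comb {1..n} ?v ?u q + y n * uvec q0 q = 0" for q
  proof (cases "q : {1..?m}")
   case True
   then obtain s where s: "q = Suc s" "s < ?m" by (cases q) auto
   have "comb {1..n} ?v ?u q = (\<Sum>t<n. y t * ?u (Suc t) q)"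
    unfolding comb_def by (rule sum.reindex_bij_witness[of _ Suc "%p. p - 1"]) auto
   moreover have "lmap ?m D y s = (\<Sum>t<n. y t * ?u (Suc t) q) + y n * uvec q0 q"
    unfolding lmap_def D_def s by (simp add: mult.commute)
   ultimately show ?thesis using z s by simp
  next
   case False
   have "comb {1..n} ?v ?u : cspace ?m" by (rule comb_in_subspace[OF cspace_subspace]) (use u in auto)
   then show ?thesis using False q0 by (auto simp: cspace_def Defs.unit_vec_def)
  qed
  have yn: "y n = 0"
  proof (rule ccontr)
   assume ne: "y n ~= 0"
   have "uvec q0 = cscale (- 1 / y n) (comb {1..n} ?v ?u)"
    using eq ne by (auto simp: cscale_def fun_eq_iff field_simps eq_neg_iff_add_eq_0)
   then have "uvec q0 : ?S" using comb_in_span[of "{1..n}" ?v ?u] cvec.span_scale by metis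
   then show False using q0 by blast
  qed
  then have "comb {1..n} ?v ?u = 0" using eq by (auto simp: fun_eq_iff)
  then have "j ?v = j 0" using linear_inclusion_sum[OF j vc] j0 by simp
  then have "?v = 0" by (rule inj_onD[OF ji _ vc cvec.subspace_0[OF cspace_subspace]])
  then have "?v (Suc t) = 0 (Suc t)" by (rule fun_cong)
  then show "y t = 0" using t yn by (cases "t = n") auto
 qed
 obtain \<gamma> :: "real => nat => nat => complex" where \<gamma>:
  "!!s t. continuous_on {0..1} (%\<tau>. \<gamma> \<tau> s t)" "!!s t. \<gamma> 0 s t = D s t" "!!s t. \<gamma> 1 s t = (if s = t then 1 else 0)"
  "!!\<tau>. \<tau> : {0..1} ==> linj ?m (\<gamma> \<tau>)"
  using linj_path[OF lD] by blast
 let ?T = "%\<tau> q p. \<gamma> \<tau> (q - 1) (p - 1)"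
 have lt: "lin n ?m (?T \<tau>) v (Suc s) = lmap ?m (\<gamma> \<tau>) (%t. if t < n then v (Suc t) else 0) s" if "s < ?m" for \<tau> v s
 proof -
  have "lin n ?m (?T \<tau>) v (Suc s) = (\<Sum>p\<in>{1..n}. \<gamma> \<tau> s (p - 1) * v p)" using that by (simp add: lin_def)
  also have "... = (\<Sum>t<n. \<gamma> \<tau> s t * v (Suc t))" by (rule sum.reindex_bij_witness[of _ Suc "%p. p - 1"]) auto
  finally show ?thesis by (simp add: lmap_def)
 qed
 have hom: "homotopic_with (%_. True) (Gr_top k n) (Gr_top k ?m) (%V. lin n ?m (?T 0) ` V) (%V. lin n ?m (?T 1) ` V)"
 proof (rule homotopic_lin)
  show "continuous_on {0..1} (%\<tau>. ?T \<tau> q p)" for q p by (rule \<gamma>(1))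
  fix \<tau> :: real and v assume \<tau>: "\<tau> : {0..1}" and v: "v : cspace n" and z: "lin n ?m (?T \<tau>) v = 0"
  have "\<forall>s<?m. lmap ?m (\<gamma> \<tau>) (%t. if t < n then v (Suc t) else 0) s = 0"
  proof (intro allI impI)
   fix s assume s: "s < ?m"
   have "lin n ?m (?T \<tau>) v (Suc s) = 0" using fun_cong[OF z, of "Suc s"] by simp
   then show "lmap ?m (\<gamma> \<tau>) (%t. if t < n then v (Suc t) else 0) s = 0" unfolding lt[OF s] .
  qed
  then have "\<forall>t<?m. (if t < n then v (Suc t) else 0) = 0" using \<gamma>(4)[OF \<tau>] unfolding linj_def by blast
  then have vz: "v (Suc t) = 0" if "t < n" for t using that by (metis less_SucI)
  show "v = 0"
  proof
   fix p
   show "v p = 0 p"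
   proof (cases "p : {1..n}")
    case True
    then obtain t where "p = Suc t" "t < n" by (cases p) auto
    then show ?thesis using vz by simp
   qed (use v in \<open>auto simp: cspace_def\<close>)
  qed
 qed
 have e0: "lin n ?m (?T 0) v = j v" if v: "v : cspace n" for v
 proof
  fix q
  show "lin n ?m (?T 0) v q = j v q"
  proof (cases "q : {1..?m}")
   case True
   have "lin n ?m (?T 0) v q = (\<Sum>p\<in>{1..n}. v p * ?u p q)"
    using True unfolding lin_def by (auto simp: \<gamma>(2) D_def mult.commute intro!: sum.cong)
   then show ?thesis using linear_inclusion_sum[OF j v] by (simp add: comb_def)
  next
   case False
   then show ?thesis using jc[OF v] by (auto simp: lin_def cspace_def)
  qed
 qed
 have e1: "lin n ?m (?T 1) v = v" if v: "v : cspace n" for v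
 proof
  fix q
  show "lin n ?m (?T 1) v q = v q"
  proof (cases "q : {1..?m}")
   case True
   have "lin n ?m (?T 1) v q = (\<Sum>p\<in>{1..n}. ?T 1 q p * v p)" using True by (simp add: lin_def)
   also have "... = (\<Sum>p\<in>{1..n}. if p = q then v q else 0)"
   proof (intro sum.cong refl)
    fix p assume "p : {1..n}"
    then have "q - 1 = p - 1 \<longleftrightarrow> p = q" using True by (cases p; cases q) auto
    then show "?T 1 q p * v p = (if p = q then v q else 0)" unfolding \<gamma>(3) by simp
   qed
   finally have "lin n ?m (?T 1) v q = (\<Sum>p\<in>{1..n}. if p = q then v q else 0)" .
   then show ?thesis using v by (auto simp: cspace_def)
  next
   case False
   then have "q ~: {1..n}" by auto
   then show ?thesis using False v by (auto simp: lin_def cspace_def)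
  qed
 qed
 show ?thesis
 proof (rule homotopic_with_eq[OF hom])
  fix V assume "V : topspace (Gr_top k n)"
  then have V: "V <= cspace n" using GrD(2) topspace_Gr_top by blast
  show "j ` V = lin n ?m (?T 0) ` V" by (rule image_cong[OF refl]) (use e0 V in auto)
  show "V = lin n ?m (?T 1) ` V" using e1 V by (auto simp: image_iff subset_iff)
 qed auto
qed

text \<open>The inclusion \<open>e\<^sub>p \<mapsto> e\<^sub>p - e\<^sub>p\<^sub>+\<^sub>1\<close>.\<close>

definition sh :: "(nat => complex) => nat => complex" where
 "sh v = (%p. v p - v (p - 1))"

lemma sh_comb: "sh (comb S c v) = comb S c (%i. sh (v i))"
 by (simp add: sh_def comb_def fun_eq_iff right_diff_distrib sum_subtractf)

lemma sh_row_space: "sh ` row_space k A = row_space k (%i. sh (A i))"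
 by (rule image_row_space[OF sh_comb])

lemma sh_cspace: "v : cspace m ==> sh v : cspace (Suc m)"
proof -
 assume v: "v : cspace m"
 have "sh v i = 0" if "i ~: {1..Suc m}" for i
 proof -
  have "v i = 0 & v (i - 1) = 0" using v that by (cases i) (auto simp: cspace_def)
  then show ?thesis by (simp add: sh_def)
 qed
 then show ?thesis by (simp add: cspace_def)
qed

text \<open>\<open>v\<close> is the sequence of partial sums of \<open>sh v\<close>: it is 0 before
  \<open>p\<close>, and constant after \<open>q\<close>, hence 0 there because it is 0 beyond
  \<open>m\<close>.\<close>

lemma sh_support:
 assumes v: "v : cspace m" and s: "sh v : coord_span {p..Suc q}"
 shows "v : coord_span {p..q}"
 unfolding in_coord_span_interval
proof (intro allI impI)
 have z: "v i = v (i - 1)" if "i < p | Suc q < i" for i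
 proof -
  have "sh v i = 0" using s that unfolding in_coord_span_interval by (meson not_less)
  then show ?thesis by (simp add: sh_def)
 qed
 have lo: "v i = 0" if "i < p" for i
  using that
 proof (induction i)
  case 0 then show ?case using v by (auto simp: cspace_def)
 next
  case (Suc i) then show ?case using z[of "Suc i"] by simp
 qed
 have hi: "v (i + d) = v i" if "q < i" for i d
  using that
 proof (induction d)
  case (Suc d) then show ?case using z[of "Suc (i + d)"] by simp
 qed simp
 fix i assume nz: "v i ~= 0"
 have "i <= q"
 proof (rule ccontr)
  assume "~ i <= q"
  then have "v (i + Suc m) = v i" by (intro hi) simp
  moreover have "v (i + Suc m) = 0" using v by (simp add: cspace_def)
  ultimately show False using nz by simp
 qed
 moreover have "p <= i" using lo[of i] nz by (meson not_less)
 ultimately show "p <= i & i <= q" by simp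
qed

lemma sh_inj: "v : cspace m ==> sh v = 0 ==> v = 0"
proof -
 assume v: "v : cspace m" and z: "sh v = 0"
 have "v : coord_span {1..0}" by (rule sh_support[OF v]) (unfold z in_coord_span_interval, simp)
 then show "v = 0" unfolding in_coord_span_interval by (auto simp: fun_eq_iff)
qed

lemma sh_inclusion: "linear_inclusion n (Suc n) sh"
 unfolding linear_inclusion_def
proof (intro conjI ballI allI)
 show "sh : cspace n \<rightarrow> cspace (Suc n)" using sh_cspace by auto
 show "inj_on sh (cspace n)"
 proof (rule inj_onI)
  fix v w assume vw: "v : cspace n" "w : cspace n" "sh v = sh w"
  have "sh (v - w) = sh v - sh w" by (simp add: sh_def fun_eq_iff)
  then have "sh (v - w) = 0" using vw(3) by simp
  then have "v - w = 0" using sh_inj cvec.subspace_diff[OF cspace_subspace vw(1,2)] by blast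
  then show "v = w" by simp
 qed
qed (auto simp: sh_def cscale_def fun_eq_iff algebra_simps)

lemma sh_affm: "(%i. sh (affm c B R y i)) = affm c (%i. sh (B i)) (%t i. sh (R t i)) y"
 by (simp add: sh_def affm_def fun_eq_iff algebra_simps sum_subtractf)

text \<open>Computes the transpose of \<open>sh\<close>, which turns a functional \<open>l\<close>
  into its sequence of differences.\<close>

lemma sh_summation_by_parts:
 assumes w: "w : cspace m"
 shows "(\<Sum>q\<in>{1..Suc m}. sh w q * l q) = (\<Sum>p\<in>{1..m}. w p * (l p - l (Suc p)))"
proof -
 have w0: "w 0 = 0" "w (Suc m) = 0" using w by (auto simp: cspace_def)
 have "(\<Sum>q\<in>{1..Suc m}. sh w q * l q) = (\<Sum>q\<in>{1..Suc m}. w q * l q) - (\<Sum>q\<in>{1..Suc m}. w (q - 1) * l q)"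
  by (simp add: sh_def left_diff_distrib sum_subtractf)
 also have "(\<Sum>q\<in>{1..Suc m}. w q * l q) = (\<Sum>q\<in>{1..m}. w q * l q)" using w0 by simp
 also have "(\<Sum>q\<in>{1..Suc m}. w (q - 1) * l q) = (\<Sum>p\<in>{0..m}. w p * l (Suc p))"
  by (rule sum.reindex_bij_witness[of _ Suc "%q. q - 1"]) auto
 also have "... = (\<Sum>p\<in>{1..m}. w p * l (Suc p))"
  using w0 by (simp add: sum.atLeast_Suc_atMost)
 finally show ?thesis by (simp add: right_diff_distrib sum_subtractf)
qed

section \<open>The theorem\<close>

lemma subvariety_classI:
 assumes "Gr_codim k m Z = c" "fundamental_cocycle k m c Z \<phi>"
  "!!\<psi>. fundamental_cocycle k m c Z \<psi> ==> cohom_class (2 * c) (Gr_top k m) \<psi> = cohom_class (2 * c) (Gr_top k m) \<phi>"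
 shows "subvariety_class k m Z = (%p. \<one>\<^bsub>cohomology_group p (Gr_top k m)\<^esub>)(2 * c := cohom_class (2 * c) (Gr_top k m) \<phi>)"
proof -
 have "(THE \<xi>. \<exists>\<phi>. fundamental_cocycle k m c Z \<phi> & \<xi> = cohom_class (2 * c) (Gr_top k m) \<phi>) = cohom_class (2 * c) (Gr_top k m) \<phi>"
 proof (rule the_equality)
  show "\<exists>\<psi>. fundamental_cocycle k m c Z \<psi> & cohom_class (2 * c) (Gr_top k m) \<phi> = cohom_class (2 * c) (Gr_top k m) \<psi>"
   using assms(2) by blast
 qed (use assms(3) in blast)
 then show ?thesis unfolding subvariety_class_def assms(1) Let_def by simp
qed

section \<open>Raising all right ends by one\<close>

context spans
begin

lemma fundamental_unique:
 assumes \<phi>: "fundamental_cocycle k m cod (rank_variety m rset) \<phi>" and \<psi>: "fundamental_cocycle k m cod (rank_variety m rset) \<psi>"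
 shows "cohom_class (2 * cod) (Gr_top k m) \<phi> = cohom_class (2 * cod) (Gr_top k m) \<psi>"
proof (rule cohom_class_eqI)
 let ?X = "Gr_top k m" and ?n = "2 * cod"
 have c: "\<phi> : cocycles ?n ?X" "\<psi> : cocycles ?n ?X" using \<phi> \<psi> by (auto simp: fundamental_cocycle_def)
 then show "\<phi> : cocycles ?n ?X" "\<psi> : cocycles ?n ?X" by auto
 let ?d = "\<lambda>c\<in>singular_chain_set ?n ?X. \<phi> c - \<psi> c"
 show "?d : coboundaries ?n ?X"
 proof (rule cocycle_determined[OF rank_variety_props])
  show "?d : cocycles ?n ?X" by (rule cocycle_sub[OF c])
  show "?d d = 0" if "schain ?n (sub ?X (- rank_variety m rset)) d" for d
   using that \<phi> \<psi> unfolding fundamental_cocycle_def by (auto simp: singular_chain_subtopology)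
  fix V assume V: "V : cell"
  obtain e1 where e1: "e1 > 0" "\<forall>r. 0 < r --> r < e1 --> schain ?n ?X (frag_of (nsx V r)) & \<phi> (frag_of (nsx V r)) = 1"
   using normal_value[OF rank_variety_props \<phi> V] by (elim exE conjE)
  obtain e2 where e2: "e2 > 0" "\<forall>r. 0 < r --> r < e2 --> schain ?n ?X (frag_of (nsx V r)) & \<psi> (frag_of (nsx V r)) = 1"
   using normal_value[OF rank_variety_props \<psi> V] by (elim exE conjE)
  have "?d (frag_of (nsx V r)) = 0" if "0 < r" "r < min e1 e2" for r
  proof -
   have r: "r < e1" "r < e2" using that(2) by auto
   show ?thesis using e1(2)[rule_format, OF that(1) r(1)] e2(2)[rule_format, OF that(1) r(2)] by simp
  qed
  then show "\<exists>\<epsilon>>0. \<forall>r. 0 < r --> r < \<epsilon> --> ?d (frag_of (nsx V r)) = 0"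
   using e1(1) e2(1) by (intro exI[of _ "min e1 e2"]) auto
 qed
qed

lemma rdim_rset: "rdim rset = (\<Sum>i<k. int (Suc (b i) - a i) - int (rk rset (a i) (b i)))"
 unfolding rdim_def by (subst (2) rset_def, subst sum.reindex[OF inj_pair]) simp

lemma spans_kappa: "spans k (Suc m) a (%i. Suc (b i))"
proof
 show "inj_on (%i. Suc (b i)) {..<k}" using inj_b by (simp add: inj_on_def)
 show "1 <= a i & a i <= Suc (b i) & Suc (b i) <= Suc m" if "i < k" for i using ab[OF that] by auto
qed (rule inj_a)

interpretation K: spans k "Suc m" a "%i. Suc (b i)"
 by (rule spans_kappa)

lemma K_rset: "K.rset = kappa rset"
 unfolding K.rset_def kappa_def rset_def by auto

lemma K_rk: "rk K.rset p (Suc q) = rk rset p q"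
 unfolding rk_rset K.rk_rset by simp

text \<open>Each interval grows by one and nesting is unchanged, so \<open>rdim\<close> grows by
  \<open>k\<close>, exactly as the dimension of the Grassmannian does.\<close>

lemma K_cod: "K.cod = cod"
proof -
 have "rdim K.rset = (\<Sum>i<k. (int (Suc (b i) - a i) - int (rk rset (a i) (b i))) + 1)"
  unfolding K.rdim_rset K_rk by (intro sum.cong refl) (use ab in \<open>auto simp: Suc_diff_le le_Suc_eq\<close>)
 also have "... = rdim rset + int k" unfolding rdim_rset sum.distrib by simp
 finally have "int K.cod = int cod" using cod_eq K.cod_eq by (simp add: algebra_simps)
 then show ?thesis by simp
qed

lemma sh_Rvar:
 assumes V: "V : Gr k m" and sV: "sh ` V : K.Rvar"
 shows "V : Rvar"
 unfolding Rvar_def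
proof (intro CollectI conjI allI V)
 fix p q
 let ?W = "V Int coord_span {p..q}"
 have W: "csubspace ?W" "?W <= cspace m" using GrD[OF V] by (auto intro: cvec.subspace_inter csubspace_coord_span)
 obtain v where v: "!!w. w : ?W ==> \<exists>c. w = comb {..<cdim ?W} c v" using subspace_family_basis[OF W] by metis
 have "sh ` V Int coord_span {p..Suc q} <= cspan ((%i. sh (v i)) ` {..<cdim ?W})"
 proof
  fix x assume "x : sh ` V Int coord_span {p..Suc q}"
  then obtain w where w: "w : V" "x = sh w" "sh w : coord_span {p..Suc q}" by auto
  then have "w : ?W" using sh_support GrD(2)[OF V] by blast
  then obtain c where "w = comb {..<cdim ?W} c v" using v by blast
  then have "x = comb {..<cdim ?W} c (%i. sh (v i))" using w sh_comb by simp
  then show "x : cspan ((%i. sh (v i)) ` {..<cdim ?W})" using comb_in_span[of "{..<cdim ?W}" c "%i. sh (v i)"] by simp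
 qed
 then have "rkV (sh ` V) p (Suc q) <= card ((%i. sh (v i)) ` {..<cdim ?W})"
  unfolding rkV_def by (rule cvec.dim_le_card) simp
 also have "... <= cdim ?W" using card_image_le[of "{..<cdim ?W}" "%i. sh (v i)"] by simp
 finally have "rkV (sh ` V) p (Suc q) <= rkV V p q" by (simp add: rkV_def)
 moreover have "rk K.rset p (Suc q) <= rkV (sh ` V) p (Suc q)" using sV unfolding K.Rvar_def by blast
 ultimately show "rk rset p q <= rkV V p q" using K_rk by simp
qed

text \<open>At the left end \<open>sh\<close> keeps the entry, and one place after the right end it
  gives the negative of the end entry, so both new ends are nonzero.\<close>

lemma sh_spanned:
 assumes B: "spanned B" shows "K.spanned (%i. sh (B i))"
 unfolding K.spanned_def
proof (intro conjI allI impI)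
 fix i assume i: "i < k"
 have s: "B i p = 0" if "p < a i | b i < p" for p using B i that unfolding spanned_def by (meson not_less)
 have nz: "B i (a i) ~= 0" "B i (b i) ~= 0" using B i unfolding spanned_def by auto
 have "a i - 1 < a i" using ab[OF i] by auto
 then show "sh (B i) (a i) ~= 0" using s[of "a i - 1"] nz by (simp add: sh_def)
 show "sh (B i) (Suc (b i)) ~= 0" using s[of "Suc (b i)"] nz by (simp add: sh_def)
 fix p assume "sh (B i) p ~= 0"
 then have "B i p ~= 0 | B i (p - 1) ~= 0" by (auto simp: sh_def)
 then have "(a i <= p & p <= b i) | (a i <= p - 1 & p - 1 <= b i)" using s by (meson not_less)
 then show "a i <= p" "p <= Suc (b i)" by auto
next
 fix i assume "i >= k"
 then show "sh (B i) = 0" using B by (auto simp: spanned_def sh_def fun_eq_iff)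
qed

text \<open>Transversality of the inclusion to the cell of the raised rank set. Let
  \<open>?l i\<close> be the combination of the differentials in row \<open>i\<close>. Summation by
  parts carries its differences back to the smaller space, where \<open>functional_zero\<close>
  makes them vanish; so \<open>?l i\<close> is constant. On \<open>[a i, Suc (b i)]\<close> it is 0
  because the equations vanish on the cell, hence it is 0 everywhere.\<close>

lemma sh_linj:
 assumes V: "V : cell"
 shows "linj cod (%s t. dirD k (Suc m) (K.chi s) (%i. sh (uvm V i)) (%i. sh (ndir t i)))"
proof (rule linj_left_kernel)
 let ?B = "%i. sh (uvm V i)"
 have Vd: "V : domn" and G: "V : Gr k m" using V cell_domn cell_Gr by auto
 have sp: "K.spanned ?B" by (rule sh_spanned[OF uv_spanned[OF V]])
 have rsV: "row_space k (uvm V) = V" by (rule domn_frame(2)[OF Vd])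
 have rs: "row_space k ?B = sh ` V" using sh_row_space[of k "uvm V"] rsV by simp
 have Bc: "row_space k ?B : K.cell" unfolding K.cell_def using sp by blast
 have Bd: "row_space k ?B : K.domn" using Bc K.cell_domn by blast
 have hol: "Gr_holomorphic_on k (Suc m) (K.chi s) K.domn" if "s < cod" for s using K.chi_holomorphic that K_cod by simp
 fix g s
 assume g: "!!t. t < cod ==> (\<Sum>s<cod. g s * dirD k (Suc m) (K.chi s) ?B (%i. sh (ndir t i))) = 0" and s: "s < cod"
 let ?l = "%i q. \<Sum>s<cod. g s * Gr_partial k (K.chi s) ?B i q"
 have swap: "(\<Sum>s<cod. g s * (\<Sum>q\<in>{1..Suc m}. w q * Gr_partial k (K.chi s) ?B i q)) = (\<Sum>q\<in>{1..Suc m}. w q * ?l i q)" for w i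
  unfolding sum_distrib_left by (subst sum.swap) (simp add: mult_ac)
 have zero: "?l i q = 0" if i: "i < k" and q: "q : {1..Suc m}" for i q
 proof -
  have inI: "?l i q = 0" if "a i <= q" "q <= Suc (b i)" for q
  proof (intro sum.neutral ballI)
   fix s assume "s : {..<cod}"
   then have s: "s < cod" by simp
   have "Gr_partial k (K.chi s) ?B i q = 0"
   proof (rule K.partial_in_cell[OF hol[OF s] K.openin_domn Bd sp _ i])
    show "K.chi s V' = 0" if "V' : K.cell Int K.domn" for V' using K.chi_zero[of V'] that s K_cod by auto
   qed (use that in auto)
   then show "g s * Gr_partial k (K.chi s) ?B i q = 0" by simp
  qed
  have step: "?l i p - ?l i (Suc p) = 0" if p: "p : {1..m}" for p
  proof (rule functional_zero[OF G proj_cell[OF V] i _ _ _ p, where lm = "%p. ?l i p - ?l i (Suc p)"])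
   fix w assume w: "w : V"
   then have wc: "w : cspace m" using GrD(2)[OF G] by blast
   have "sh w : row_space k ?B" unfolding rs using w by blast
   then have "(\<Sum>q\<in>{1..Suc m}. sh w q * Gr_partial k (K.chi s) ?B i q) = 0" if "s < cod" for s
    using dirD_along_row_space[OF hol[OF that] K.spanned_frame[OF sp] K.openin_domn Bd i] by blast
   then have "(\<Sum>q\<in>{1..Suc m}. sh w q * ?l i q) = 0" unfolding swap[symmetric] by simp
   then show "(\<Sum>p\<in>{1..m}. w p * (?l i p - ?l i (Suc p))) = 0" unfolding sh_summation_by_parts[OF wc] .
  next
   fix p assume n: "(i, p) : nrm"
   then obtain t where t: "t < cod" "enum t = (i, p)" using enum(2) by (metis imageE lessThan_iff)
   have pm: "p : {1..m}" using n by (auto simp: nrm_def free_def)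
   have sn: "(%i. sh (ndir t i)) = rowm i (sh (uvec p))"
    unfolding ndir_def t(2) rowm_def by (auto simp: sh_def fun_eq_iff)
   have "(\<Sum>q\<in>{1..Suc m}. sh (uvec p) q * ?l i q) = 0"
    using g[OF t(1)] unfolding sn dirD_rowm[OF i] swap .
   then have "(\<Sum>p'\<in>{1..m}. uvec p p' * (?l i p' - ?l i (Suc p'))) = 0"
    unfolding sh_summation_by_parts[OF unit_vec_cspace[OF pm]] .
   moreover have "(\<Sum>p'\<in>{1..m}. uvec p p' * (?l i p' - ?l i (Suc p'))) = (\<Sum>p'\<in>{1..m}. if p' = p then ?l i p - ?l i (Suc p) else 0)"
    by (intro sum.cong refl) (auto simp: Defs.unit_vec_def)
   ultimately show "?l i p - ?l i (Suc p) = 0" using pm by simp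
  next
   fix p assume "a i <= p" "p <= b i"
   then show "?l i p - ?l i (Suc p) = 0" using inI[of p] inI[of "Suc p"] by simp
  qed
  have const: "?l i (Suc p) = ?l i 1" if "p <= m" for p
   using that
  proof (induction p)
   case (Suc p)
   have "?l i (Suc p) - ?l i (Suc (Suc p)) = 0" by (rule step) (use Suc in auto)
   then show ?case using Suc by simp
  qed simp
  have "?l i (Suc (a i - 1)) = ?l i 1" by (rule const) (use ab[OF i] in auto)
  then have "?l i 1 = 0" using inI[of "a i"] ab[OF i] by auto
  moreover obtain p where p: "q = Suc p" "p <= m" using q by (cases q) auto
  moreover have "?l i q = ?l i 1" unfolding p(1) by (rule const[OF p(2)])
  ultimately show ?thesis by (simp only:)
 qed
 show "g s = 0"
  by (rule K.chi_independent[OF K.spanned_frame[OF sp] Bd, of g]) (use zero s K_cod in auto)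
qed

text \<open>The pullback of \<open>\<phi>\<close> is known to vanish off \<open>Rvar\<close>, so the
  comparison takes place with \<open>Z = Rvar\<close>. On the image of \<open>nsx V r\<close> the
  functions \<open>K.chi\<close> are controlled only to first order, so this image is not treated as
  a normal simplex; the value of \<open>\<phi>\<close> on it is read off from the degree formula on
  \<open>K.domn\<close>.\<close>

theorem pullback_fundamental:
 assumes \<phi>: "fundamental_cocycle k (Suc m) K.cod (rank_variety (Suc m) K.rset) \<phi>"
   "!!e. relcycle (2 * K.cod) (sub (Gr_top k (Suc m)) K.domn) (- rank_variety (Suc m) K.rset) e ==>
   \<phi> e = hdeg (2 * K.cod) (chain_map (2 * K.cod) (%V. c2r K.cod (%s. K.chi s V)) e)"
  and \<psi>: "fundamental_cocycle k m cod (rank_variety m rset) \<psi>"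
  and cont: "continuous_map (Gr_top k m) (Gr_top k (Suc m)) (%V. sh ` V)"
 shows "(\<lambda>c\<in>singular_chain_set (2 * cod) (Gr_top k m). \<phi> (chain_map (2 * cod) (%V. sh ` V) c) - \<psi> c) : coboundaries (2 * cod) (Gr_top k m)"
  (is "?d : _")
proof -
 let ?X = "Gr_top k m" and ?Y = "Gr_top k (Suc m)" and ?n = "2 * cod" and ?S = "%V. sh ` V"
 let ?ZK = "rank_variety (Suc m) K.rset" and ?ZM = "rank_variety m rset"
 have \<phi>c: "\<phi> : cocycles ?n ?Y" and \<phi>0: "!!d. schain ?n (sub ?Y (- ?ZK)) d ==> \<phi> d = 0"
  using \<phi>(1) unfolding fundamental_cocycle_def K_cod by auto
 have \<psi>c: "\<psi> : cocycles ?n ?X" and \<psi>0: "!!d. schain ?n (sub ?X (- ?ZM)) d ==> \<psi> d = 0"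
  using \<psi> unfolding fundamental_cocycle_def by auto
 note \<phi>deg = \<phi>(2)[unfolded K_cod]
 have dp: "?d = (\<lambda>c\<in>singular_chain_set ?n ?X. cochain_pullback ?n ?X ?S \<phi> c - \<psi> c)"
  by (auto simp: cochain_pullback_def fun_eq_iff)
 show ?thesis
 proof (rule cocycle_determined[OF closed_Rvar cell_Rvar subset_refl])
  show "?d : cocycles ?n ?X" unfolding dp by (rule cocycle_sub[OF cocycles_pullback[OF cont \<phi>c] \<psi>c])
  fix d assume d: "schain ?n (sub ?X (- Rvar)) d"
  have "continuous_map (sub ?X (- Rvar)) (sub ?Y (- ?ZK)) ?S"
  proof (rule continuous_map_into_subtopology)
   show "continuous_map (sub ?X (- Rvar)) ?Y ?S" by (rule continuous_map_from_subtopology[OF cont])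
   show "?S : topspace (sub ?X (- Rvar)) \<rightarrow> - ?ZK"
    using sh_Rvar K.rank_variety_props(3) by (auto simp: topspace_Gr_top)
  qed
  then have "\<phi> (chain_map ?n ?S d) = 0" by (intro \<phi>0 singular_chain_chain_map[OF d])
  moreover have "\<psi> d = 0"
   by (rule \<psi>0) (use d rank_variety_props(3) in \<open>auto simp: singular_chain_subtopology\<close>)
  moreover have "schain ?n ?X d" using d by (simp add: singular_chain_subtopology)
  ultimately show "?d d = 0" by simp
 next
  fix V assume V: "V : cell"
  let ?B = "%i. sh (uvm V i)" and ?R = "%t i. sh (ndir t i)"
  have sp: "K.spanned ?B" by (rule sh_spanned[OF uv_spanned[OF V]])
  have Bc: "row_space k ?B : K.cell" unfolding K.cell_def using sp by blast
  have Bd: "row_space k ?B : K.domn" using Bc K.cell_domn by blast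
  have hol: "Gr_holomorphic_on k (Suc m) (K.chi s) K.domn" if "s < cod" for s using K.chi_holomorphic that K_cod by simp
  have f0: "K.chi s (row_space k ?B) = 0" if "s < cod" for s using K.chi_zero[OF Bd] Bc that K_cod by simp
  have RM: "?R t : Mat k (Suc m)" if "t < cod" for t
   using ndir_Mat[OF that] sh_cspace unfolding Mat_def by (auto simp: sh_def fun_eq_iff)
  have push: "chain_map ?n ?S (frag_of (nsx V r)) = frag_of (\<lambda>x\<in>stdx ?n. row_space k (affm cod ?B ?R (ylin r x)))" for r
   unfolding nsx_def chain_map_restrict sh_row_space sh_affm ..
  obtain e1 where e1: "e1 > 0" "\<forall>r. 0 < r --> r < e1 --> schain ?n ?X (frag_of (nsx V r)) & \<psi> (frag_of (nsx V r)) = 1"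
   using normal_value[OF rank_variety_props \<psi> V] by (elim exE conjE)
  show "\<exists>\<epsilon>>0. \<forall>r. 0 < r --> r < \<epsilon> --> ?d (frag_of (nsx V r)) = 0"
  proof (rule normal_degree[OF K.openin_domn hol K.spanned_frame[OF sp] Bd f0 RM sh_linj[OF V]])
   fix e2 :: real
   let ?\<tau> = "%r. \<lambda>x\<in>stdx ?n. row_space k (affm cod ?B ?R (ylin r x))"
   assume d: "0 < e2"
    and ss: "!!r. 0 < r ==> r < e2 ==> ssimp ?n (sub ?Y K.domn) (?\<tau> r)"
    and bd: "!!r x j. 0 < r ==> r < e2 ==> x : stdx ?n ==> j <= ?n ==> x j = 0 ==>
     \<exists>s<cod. K.chi s (row_space k (affm cod ?B ?R (ylin r x))) ~= 0"
    and dg: "!!r. 0 < r ==> r < e2 ==> hdeg ?n (frag_of (\<lambda>x\<in>stdx ?n.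
     c2r cod (%s. K.chi s (row_space k (affm cod ?B ?R (ylin r x)))))) = 1"
   have "?d (frag_of (nsx V r)) = 0" if r0: "0 < r" and rm: "r < min e1 e2" for r
   proof -
    have r: "r < e1" "r < e2" using rm by auto
    note h1 = e1(2)[rule_format, OF r0 r(1)]
    have "relcycle ?n (sub ?Y K.domn) (- ?ZK) (frag_of (?\<tau> r))"
    proof (rule singular_relcycle_of_simplex[OF ss[OF r0 r(2)]])
     fix x j assume x: "x : stdx ?n" "j <= ?n" "x j = 0"
     have "?\<tau> r x : K.domn"
      using ss[OF r0 r(2)] x(1) unfolding singular_simplex_def continuous_map_def by (auto simp: Pi_def)
     moreover obtain s where "s < cod" "K.chi s (?\<tau> r x) ~= 0" using bd[OF r0 r(2) x] x(1) by auto
     ultimately have "?\<tau> r x ~: K.cell" using K.chi_zero[of "?\<tau> r x"] K_cod by auto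
     then show "?\<tau> r x : - ?ZK" using \<open>?\<tau> r x \<in> K.domn\<close> K.Rvar_domn K.rank_variety_props(3) by blast
    qed
    then have "\<phi> (frag_of (?\<tau> r)) = hdeg ?n (chain_map ?n (%V. c2r cod (%s. K.chi s V)) (frag_of (?\<tau> r)))" by (rule \<phi>deg)
    also have "... = 1" unfolding chain_map_restrict by (rule dg[OF r0 r(2)])
    finally show ?thesis using h1 push[of r] by simp
   qed
   then show ?thesis using e1(1) d by (intro exI[of _ "min e1 e2"]) auto
  qed
 qed
qed

end

lemma homotopic_inclusions:
 assumes "linear_inclusion n (Suc n) i" "linear_inclusion n (Suc n) j"
 shows "homotopic_with (%_. True) (Gr_top k n) (Gr_top k (Suc n)) (%V. i ` V) (%V. j ` V)"
 using homotopic_with_trans[OF inclusion_homotopic_standard[OF assms(1)] homotopic_with_symD[OF inclusion_homotopic_standard[OF assms(2)]]] .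

theorem theorem4p4:
 fixes M :: "(nat \<times> nat) set" and k n :: nat
  and j :: "(nat \<Rightarrow> complex) \<Rightarrow> (nat \<Rightarrow> complex)"
 assumes "rank_set M"
  and "card M = k"
  and "\<forall>(a, b)\<in>M. {a..b} \<subseteq> {1..n}"
  and "linear_inclusion n (n + 1) j"
 shows "cohom_pullback (Gr_top k n) (\<lambda>V. j ` V)
     (subvariety_class k (n + 1) (rank_variety (n + 1) (kappa M)))
    = subvariety_class k n (rank_variety n M)"
proof -
 have "snd x <= n" if x: "x : M" for x
 proof -
  obtain a b where ab: "x = (a, b)" by (cases x)
  have "a <= b" using assms(1) x ab unfolding rank_set_def by auto
  then have "b : {a..b}" by simp
  moreover have "{a..b} <= {1..n}" using assms(3) x ab by blast
  ultimately show ?thesis using ab by auto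
 qed
 then have "M : rsets k n" using assms(1,2) by (simp add: rsets_def)
 then obtain a b where s: "spans k n a b" and M: "spans.rset k a b = M" by (rule rsets_spans)
 interpret spans k n a b by (rule s)
 interpret K: spans k "Suc n" a "%i. Suc (b i)" by (rule spans_kappa)
 let ?X = "Gr_top k n" and ?Y = "Gr_top k (Suc n)" and ?p = "2 * cod"
 have j: "linear_inclusion n (Suc n) j" using assms(4) by simp
 have jc: "continuous_map ?X ?Y (%V. j ` V)" and shc: "continuous_map ?X ?Y (%V. sh ` V)"
  using homotopic_with_imp_continuous_maps[OF homotopic_inclusions[OF j sh_inclusion]] by auto
 obtain \<phi> where \<phi>: "fundamental_cocycle k (Suc n) K.cod (rank_variety (Suc n) K.rset) \<phi>"
  "!!e. relcycle (2 * K.cod) (sub (Gr_top k (Suc n)) K.domn) (- rank_variety (Suc n) K.rset) e ==>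
   \<phi> e = hdeg (2 * K.cod) (chain_map (2 * K.cod) (%V. c2r K.cod (%s. K.chi s V)) e)"
  using K.fundamental_exists[OF K.rank_variety_props] by blast
 obtain \<psi> where \<psi>: "fundamental_cocycle k n cod (rank_variety n rset) \<psi>"
  using fundamental_exists[OF rank_variety_props] by blast
 have \<phi>c: "\<phi> : cocycles ?p ?Y" and \<psi>c: "\<psi> : cocycles ?p ?X" using \<phi>(1) \<psi> unfolding fundamental_cocycle_def K_cod by auto
 have clY: "subvariety_class k (Suc n) (rank_variety (Suc n) (kappa M)) = (%p. \<one>\<^bsub>cohomology_group p ?Y\<^esub>)(?p := cohom_class ?p ?Y \<phi>)"
  using subvariety_classI[OF K.Gr_codim_rank_variety \<phi>(1) K.fundamental_unique[OF _ \<phi>(1)]] unfolding K_rset M K_cod .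
 have clX: "subvariety_class k n (rank_variety n M) = (%p. \<one>\<^bsub>cohomology_group p ?X\<^esub>)(?p := cohom_class ?p ?X \<psi>)"
  using subvariety_classI[OF Gr_codim_rank_variety \<psi> fundamental_unique[OF _ \<psi>]] unfolding M .
 have d1: "(\<lambda>c\<in>singular_chain_set ?p ?X. \<phi> (chain_map ?p (%V. sh ` V) c) - \<psi> c) : coboundaries ?p ?X"
  by (rule pullback_fundamental[OF \<phi> \<psi> shc])
 \<comment> \<open>Up to a coboundary the given inclusion \<open>j\<close> may be replaced by
   \<open>sh\<close>.\<close>
 have d2: "(\<lambda>c\<in>singular_chain_set ?p ?X. \<phi> (chain_map ?p (%V. j ` V) c) - \<phi> (chain_map ?p (%V. sh ` V) c)) : coboundaries ?p ?X"
  by (rule homotopic_pullback_coboundary[OF homotopic_inclusions[OF sh_inclusion j] \<phi>c])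
 have "(\<lambda>c\<in>singular_chain_set ?p ?X. cochain_pullback ?p ?X (%V. j ` V) \<phi> c - \<psi> c) : coboundaries ?p ?X"
 proof -
  have "(\<lambda>c\<in>singular_chain_set ?p ?X. cochain_pullback ?p ?X (%V. j ` V) \<phi> c - \<psi> c)
   = (\<lambda>c\<in>singular_chain_set ?p ?X. \<phi> (chain_map ?p (%V. j ` V) c) - \<phi> (chain_map ?p (%V. sh ` V) c))
    \<otimes>\<^bsub>cocycle_group ?p ?X\<^esub> (\<lambda>c\<in>singular_chain_set ?p ?X. \<phi> (chain_map ?p (%V. sh ` V) c) - \<psi> c)"
   unfolding cocycle_group_mult by (auto simp: cochain_pullback_def fun_eq_iff)
  then show ?thesis using subgroup.m_closed[OF subgroup_coboundaries' d2 d1] by simp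
 qed
 then have key: "cohom_class ?p ?X (cochain_pullback ?p ?X (%V. j ` V) \<phi>) = cohom_class ?p ?X \<psi>"
  by (rule cohom_class_eqI[OF cocycles_pullback[OF jc \<phi>c] \<psi>c])
 show ?thesis
  unfolding Suc_eq_plus1[symmetric] clX clY
 proof
  fix p
  show "cohom_pullback ?X (%V. j ` V) ((%p. \<one>\<^bsub>cohomology_group p ?Y\<^esub>)(?p := cohom_class ?p ?Y \<phi>)) p
   = ((%p. \<one>\<^bsub>cohomology_group p ?X\<^esub>)(?p := cohom_class ?p ?X \<psi>)) p"
  \<comment> \<open>In degrees other than \<open>2 * cod\<close> both sides are the trivial
    class.\<close>
  proof (cases "p = ?p")
   case True
   then show ?thesis unfolding cohom_pullback_def using pullback_class[OF jc \<phi>c] key by simp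
  next
   case False
   then show ?thesis unfolding cohom_pullback_def using pullback_one[OF jc] by simp
  qed
 qed
qed

end
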